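(* Let $A,B\in\mathcal B_0$ with $\mathsf d(A,B)<\infty$. Suppose Assumption (A) holds, together with: (B.1) there exists $\kappa>0$ such that $\left|\int_E (b-c,Df)_H\, f\,d\mu\right|\le \kappa\,\mathcal E^0_1(f)$ for all $f\in\bigcup_{k}\mathbb D_{E_k,b}$; (B.2)$_{A,B}$ there exist $\gamma\ge 0$ and nonnegative numbers $\{\lambda_\varepsilon\}_{\varepsilon>0}$ with $\lim_{\varepsilon\to 0}\varepsilon\lambda_\varepsilon=0$ such that for every $\varepsilon>0$ and every $f\in\bigcup_k\mathbb D_{E_k,b}$ with $\|f\|_2=1$, $$\int_{\{0<\mathsf d_B<\mathsf d(A,B)\}}(b-c,D\mathsf d_B)_H\, f^2\,d\mu\le \varepsilon\,\mathcal E^0(f)+\lambda_\varepsilon+\gamma\Big(\int_E f^2\log^+ f^2\,d\mu\Big)^{1/2}.$$ Then $\displaystyle\limsup_{t\to 0} t\log P_t(A,B)\le -\frac{\mathsf d(A,B)^2}{2}.$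
   Context: Framework. $(E,\mathcal B,\mu)$ is a $\sigma$-finite measure space, $H$ a real separable Hilbert space with inner product $(\cdot,\cdot)_H$ and norm $|\cdot|_H$; $L^p(\mu)$ is the real $L^p$-space with norm $\|\cdot\|_p$, $L^0(\mu)$ the real measurable functions modulo $\mu$-a.e. equality, $L^2(\mu;H)$ the square-integrable $H$-valued functions. $\mathbb D$ is a dense subspace of $L^2(\mu)$ and $D:\mathbb D\to L^2(\mu;H)$ is a closed linear operator with the derivation property: for $f_1,\dots,f_m\in\mathbb D$ and $F\in C^1(\mathbb R^m)$ with bounded first derivatives and $F(0)=0$, $F(f_1,\dots,f_m)\in\mathbb D$ and $D F(f_1,\dots,f_m)=\sum_j\partial_jF(f_1,\dots,f_m)Df_j$. Put $\mathcal E^0(f,g)=\frac12\int_E(Df,Dg)_H\,d\mu$, $\mathcal E^0(f)=\mathcal E^0(f,f)$, $\mathcal E^0_l(f,g)=\mathcal E^0(f,g)+l\int_E fg\,d\mu$, $\mathcal E^0_l(f)=\mathcal E^0_l(f,f)$; $\mathbb D$ is a Hilbert space under $\mathcal E^0_1$. For $A\in\mathcal B$: $\mathbb D_A=\{f\in\mathbb D: f=0\ \mu\text{-a.e. on }E\setminus A\}$, $\mathbb D_{A,b}=\mathbb D_A\cap L^\infty(\mu)$, $\mathbb D_{A,b,+}=\{f\in\mathbb D_{A,b}:f\ge0\}$. A measurable nest is an increasing sequence $\{E_k\}$ in $\mathcal B$ such that (i) for each $k$ there is $h_k\in\mathbb D$ with $h_k\ge 1$ a.e. on $E_k$, and (ii)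 $\bigcup_k\mathbb D_{E_k}$ is dense in $\mathbb D$. For a nest: $L^p_{\rm loc}(\mu,\{E_k\})=\{f\in L^0(\mu): f\mathbf 1_{E_k}\in L^p(\mu)\ \forall k\}$; $\mathbb D_{\rm loc}(\{E_k\})=\{f\in L^0(\mu):\exists f_k\in\mathbb D,\ f=f_k \text{ a.e. on }E_k\ \forall k\}$, with $Df:=Df_k$ on $E_k$; $\mathbb D_0=\{f\in\mathbb D_{\rm loc}(\{E_k\})\cap L^\infty(\mu): |Df|_H\le1\text{ a.e.}\}$ (independent of the nest). For $A,B$ of positive measure, $\mathsf d(A,B)=\sup_{f\in\mathbb D_0}\{\operatorname{ess\,inf}_A f-\operatorname{ess\,sup}_B f\}\in[0,\infty]$. For $B\in\mathcal B$, $\mathsf d_B$ is the a.e.-unique $[0,\infty]$-valued measurable function such that for every $N>0$, $\mathsf d_B\wedge N\in\mathbb D_0$, $\mathsf d_B\wedge N=0$ on $B$, and $f\le\mathsf d_B\wedge N$ a.e. for every $f\in\mathbb D_0$ with $f=0$ on $B$, $0\le f\le N$; one has $\mathsf d(A,B)=\operatorname{ess\,inf}_A\mathsf d_B$. $D\mathsf d_B:=D(\mathsf d_B\wedge N)$ on $\{\mathsf d_B\le N\}$ and $:=0$ on $\{\mathsf d_B=\infty\}$. $\log^\pm x=0\vee(\pm\log x)$. Assumption (A): $b,c$ are $H$-valued measurable functions and $V$ a real measurable function on $E$ such that (A.1) there is a measurable nest $\{E_k\}$ with $|b|_H,|c|_H\in L^2_{\rm loc}(\mu,\{E_k\})$,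 $V\in L^1_{\rm loc}(\mu,\{E_k\})$; (A.2) there are $\eta\in[0,1)$, $\theta,\omega,l\ge0$ with, for all $f,g\in\bigcup_k\mathbb D_{E_k,b}$, $-\int_E\{(b+c,Df)_Hf+Vf^2\}d\mu\le\eta\mathcal E^0(f)+\theta\|f\|_2^2$ and $|\int_E\{(b,Df)_Hg+(c,Dg)_Hf+Vfg\}d\mu|\le\omega\mathcal E^0_l(f)^{1/2}\mathcal E^0_l(g)^{1/2}$. Then $\mathcal E(f,g)=\mathcal E^0(f,g)+\int_E\{(b,Df)_Hg+(c,Dg)_Hf+Vfg\}d\mu$ extends continuously to $\mathbb D\times\mathbb D$, $\mathcal E+\theta(\cdot,\cdot)_{L^2}$ is a coercive closed form, and $\{T_t\}_{t>0}$ is the associated strongly continuous (positivity preserving) semigroup on $L^2(\mu)$, with generator $\mathcal L$ satisfying $\mathcal E(f,g)=-\int_E(\mathcal Lf)g\,d\mu$; $\hat T_t$ is the $L^2$-adjoint of $T_t$. Throughout, $\{E_k\}$ is the nest of (A.1). $\mathcal B_0=\{A\in\mathcal B:0<\mu(A)<\infty\}$ and $P_t(A,B)=\int_AT_t\mathbf 1_B\,d\mu$. *)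

theory Defs
  imports "HOL-Analysis.Analysis"
begin

definition L2 :: "'a measure \<Rightarrow> ('a \<Rightarrow> real) \<Rightarrow> bool" where
  "L2 M f \<longleftrightarrow> f \<in> borel_measurable M \<and> integrable M (\<lambda>x. (f x)\<^sup>2)"

definition L2H :: "'a measure \<Rightarrow> ('a \<Rightarrow> 'h::{real_inner,banach,second_countable_topology}) \<Rightarrow> bool" where
  "L2H M G \<longleftrightarrow> G \<in> borel_measurable M \<and> integrable M (\<lambda>x. (norm (G x))\<^sup>2)"

definition norm2 :: "'a measure \<Rightarrow> ('a \<Rightarrow> real) \<Rightarrow> real" where
  "norm2 M f = sqrt (\<integral>x. (f x)\<^sup>2 \<partial>M)"

definition norm2H :: "'a measure \<Rightarrow> ('a \<Rightarrow> 'h::{real_inner,banach,second_countable_topology}) \<Rightarrow> real" where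
  "norm2H M G = sqrt (\<integral>x. (norm (G x))\<^sup>2 \<partial>M)"

definition Linfty :: "'a measure \<Rightarrow> ('a \<Rightarrow> real) \<Rightarrow> bool" where
  "Linfty M f \<longleftrightarrow> f \<in> borel_measurable M \<and> (\<exists>C. AE x in M. \<bar>f x\<bar> \<le> C)"

definition E0 :: "'a measure \<Rightarrow> (('a \<Rightarrow> real) \<Rightarrow> 'a \<Rightarrow> 'h::{real_inner,banach,second_countable_topology})
    \<Rightarrow> ('a \<Rightarrow> real) \<Rightarrow> ('a \<Rightarrow> real) \<Rightarrow> real" where
  "E0 M D f g = (1/2) * (\<integral>x. inner (D f x) (D g x) \<partial>M)"

definition E0l :: "'a measure \<Rightarrow> (('a \<Rightarrow> real) \<Rightarrow> 'a \<Rightarrow> 'h::{real_inner,banach,second_countable_topology})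
    \<Rightarrow> real \<Rightarrow> ('a \<Rightarrow> real) \<Rightarrow> ('a \<Rightarrow> real) \<Rightarrow> real" where
  "E0l M D l f g = E0 M D f g + l * (\<integral>x. f x * g x \<partial>M)"

text \<open>R^m is represented by the functions nat => real vanishing at indices >= m.\<close>

definition Rvec :: "nat \<Rightarrow> (nat \<Rightarrow> real) set" where
  "Rvec m = {x. \<forall>j\<ge>m. x j = 0}"

definition C1_bdd :: "nat \<Rightarrow> ((nat \<Rightarrow> real) \<Rightarrow> real) \<Rightarrow> (nat \<Rightarrow> (nat \<Rightarrow> real) \<Rightarrow> real) \<Rightarrow> bool" where
  "C1_bdd m F dF \<longleftrightarrow> F (\<lambda>_. 0) = 0 \<and>
     (\<forall>j<m. (\<forall>x\<in>Rvec m. ((\<lambda>t. F (x(j := t))) has_real_derivative dF j x) (at (x j)))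
            \<and> continuous_on (Rvec m) (dF j) \<and> bounded (dF j ` Rvec m))"

definition compose_vec :: "nat \<Rightarrow> (nat \<Rightarrow> 'a \<Rightarrow> real) \<Rightarrow> 'a \<Rightarrow> nat \<Rightarrow> real" where
  "compose_vec m fs x = (\<lambda>j. if j < m then fs j x else 0)"

definition dirichlet_framework ::
  "'a measure \<Rightarrow> ('a \<Rightarrow> real) set \<Rightarrow> (('a \<Rightarrow> real) \<Rightarrow> 'a \<Rightarrow> 'h::{real_inner,banach,second_countable_topology}) \<Rightarrow> bool" where
  "dirichlet_framework M Dom D \<longleftrightarrow>
     sigma_finite_measure M
   \<comment> \<open>Dom is a linear subspace of L^2, D is linear\<close>
   \<and> (\<forall>f\<in>Dom. L2 M f \<and> L2H M (D f))
   \<and> (\<lambda>_. 0) \<in> Dom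
   \<and> (\<forall>f\<in>Dom. \<forall>g\<in>Dom. (\<lambda>x. f x + g x) \<in> Dom \<and>
          (AE x in M. D (\<lambda>y. f y + g y) x = D f x + D g x))
   \<and> (\<forall>f\<in>Dom. \<forall>a::real. (\<lambda>x. a * f x) \<in> Dom \<and> (AE x in M. D (\<lambda>y. a * f y) x = a *\<^sub>R D f x))
   \<comment> \<open>Dom is dense in L^2\<close>
   \<and> (\<forall>f. L2 M f \<longrightarrow> (\<forall>e>0. \<exists>g\<in>Dom. norm2 M (\<lambda>x. f x - g x) < e))
   \<comment> \<open>D is closed (in particular D respects a.e. equality)\<close>
   \<and> (\<forall>fs f G. (\<forall>n. fs n \<in> Dom) \<longrightarrow> L2 M f \<longrightarrow> L2H M G
          \<longrightarrow> (\<lambda>n. norm2 M (\<lambda>x. fs n x - f x)) \<longlonglongrightarrow> 0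
          \<longrightarrow> (\<lambda>n. norm2H M (\<lambda>x. D (fs n) x - G x)) \<longlonglongrightarrow> 0
          \<longrightarrow> f \<in> Dom \<and> (AE x in M. D f x = G x))
   \<comment> \<open>derivation property\<close>
   \<and> (\<forall>m fs F dF. (\<forall>j<m. fs j \<in> Dom) \<longrightarrow> C1_bdd m F dF \<longrightarrow>
          (\<lambda>x. F (compose_vec m fs x)) \<in> Dom \<and>
          (AE x in M. D (\<lambda>y. F (compose_vec m fs y)) x
                      = (\<Sum>j<m. dF j (compose_vec m fs x) *\<^sub>R D (fs j) x)))"

definition DomA :: "'a measure \<Rightarrow> ('a \<Rightarrow> real) set \<Rightarrow> 'a set \<Rightarrow> ('a \<Rightarrow> real) set" where
  "DomA M Dom A = {f\<in>Dom. AE x in M. x \<notin> A \<longrightarrow> f x = 0}"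

definition DomAb :: "'a measure \<Rightarrow> ('a \<Rightarrow> real) set \<Rightarrow> 'a set \<Rightarrow> ('a \<Rightarrow> real) set" where
  "DomAb M Dom A = {f\<in>DomA M Dom A. Linfty M f}"

definition core :: "'a measure \<Rightarrow> ('a \<Rightarrow> real) set \<Rightarrow> (nat \<Rightarrow> 'a set) \<Rightarrow> ('a \<Rightarrow> real) set" where
  "core M Dom Ek = (\<Union>k. DomAb M Dom (Ek k))"

definition measurable_nest ::
  "'a measure \<Rightarrow> ('a \<Rightarrow> real) set \<Rightarrow> (('a \<Rightarrow> real) \<Rightarrow> 'a \<Rightarrow> 'h::{real_inner,banach,second_countable_topology})
     \<Rightarrow> (nat \<Rightarrow> 'a set) \<Rightarrow> bool" where
  "measurable_nest M Dom D Ek \<longleftrightarrow>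
     (\<forall>k. Ek k \<in> sets M) \<and> incseq Ek
   \<and> (\<forall>k. \<exists>h\<in>Dom. AE x in M. x \<in> Ek k \<longrightarrow> 1 \<le> h x)
   \<and> (\<forall>f\<in>Dom. \<forall>e>0. \<exists>k. \<exists>g\<in>DomA M Dom (Ek k).
          E0l M D 1 (\<lambda>x. f x - g x) (\<lambda>x. f x - g x) < e)"

definition Lp_loc :: "'a measure \<Rightarrow> real \<Rightarrow> (nat \<Rightarrow> 'a set) \<Rightarrow> ('a \<Rightarrow> real) \<Rightarrow> bool" where
  "Lp_loc M p Ek f \<longleftrightarrow> f \<in> borel_measurable M \<and>
     (\<forall>k. integrable M (\<lambda>x. indicator (Ek k) x * \<bar>f x\<bar> powr p))"

definition Dloc :: "'a measure \<Rightarrow> ('a \<Rightarrow> real) set \<Rightarrow> (nat \<Rightarrow> 'a set) \<Rightarrow> ('a \<Rightarrow> real) set" where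
  "Dloc M Dom Ek = {f. f \<in> borel_measurable M \<and>
       (\<forall>k. \<exists>g\<in>Dom. AE x in M. x \<in> Ek k \<longrightarrow> f x = g x)}"

text \<open>Df := D f_k on E_k (chosen representative; well defined a.e.).\<close>
definition Dloc_grad ::
  "'a measure \<Rightarrow> ('a \<Rightarrow> real) set \<Rightarrow> (('a \<Rightarrow> real) \<Rightarrow> 'a \<Rightarrow> 'h::{real_inner,banach,second_countable_topology})
     \<Rightarrow> (nat \<Rightarrow> 'a set) \<Rightarrow> ('a \<Rightarrow> real) \<Rightarrow> 'a \<Rightarrow> 'h" where
  "Dloc_grad M Dom D Ek f x =
     (if x \<in> (\<Union>k. Ek k) then
        (let k = (LEAST k. x \<in> Ek k) in
           D (SOME g. g \<in> Dom \<and> (AE y in M. y \<in> Ek k \<longrightarrow> f y = g y)) x)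
      else 0)"

definition D0 ::
  "'a measure \<Rightarrow> ('a \<Rightarrow> real) set \<Rightarrow> (('a \<Rightarrow> real) \<Rightarrow> 'a \<Rightarrow> 'h::{real_inner,banach,second_countable_topology})
     \<Rightarrow> (nat \<Rightarrow> 'a set) \<Rightarrow> ('a \<Rightarrow> real) set" where
  "D0 M Dom D Ek = {f\<in>Dloc M Dom Ek. Linfty M f \<and>
       (AE x in M. norm (Dloc_grad M Dom D Ek f x) \<le> 1)}"

definition ess_inf_on :: "'a measure \<Rightarrow> 'a set \<Rightarrow> ('a \<Rightarrow> real) \<Rightarrow> ereal" where
  "ess_inf_on M A f = Sup {c::ereal. AE x in M. x \<in> A \<longrightarrow> c \<le> ereal (f x)}"

definition ess_sup_on :: "'a measure \<Rightarrow> 'a set \<Rightarrow> ('a \<Rightarrow> real) \<Rightarrow> ereal" where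
  "ess_sup_on M A f = Inf {c::ereal. AE x in M. x \<in> A \<longrightarrow> ereal (f x) \<le> c}"

definition dist_sets ::
  "'a measure \<Rightarrow> ('a \<Rightarrow> real) set \<Rightarrow> (('a \<Rightarrow> real) \<Rightarrow> 'a \<Rightarrow> 'h::{real_inner,banach,second_countable_topology})
     \<Rightarrow> (nat \<Rightarrow> 'a set) \<Rightarrow> 'a set \<Rightarrow> 'a set \<Rightarrow> ereal" where
  "dist_sets M Dom D Ek A B =
     Sup {ess_inf_on M A f - ess_sup_on M B f | f. f \<in> D0 M Dom D Ek}"

definition is_dist_fun ::
  "'a measure \<Rightarrow> ('a \<Rightarrow> real) set \<Rightarrow> (('a \<Rightarrow> real) \<Rightarrow> 'a \<Rightarrow> 'h::{real_inner,banach,second_countable_topology})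
     \<Rightarrow> (nat \<Rightarrow> 'a set) \<Rightarrow> 'a set \<Rightarrow> ('a \<Rightarrow> ereal) \<Rightarrow> bool" where
  "is_dist_fun M Dom D Ek B d \<longleftrightarrow>
     d \<in> borel_measurable M \<and> (\<forall>x. 0 \<le> d x) \<and>
     (\<forall>N::real. N > 0 \<longrightarrow>
        (\<lambda>x. real_of_ereal (min (d x) (ereal N))) \<in> D0 M Dom D Ek
      \<and> (AE x in M. x \<in> B \<longrightarrow> min (d x) (ereal N) = 0)
      \<and> (\<forall>f\<in>D0 M Dom D Ek. (AE x in M. x \<in> B \<longrightarrow> f x = 0) \<longrightarrow>
            (AE x in M. 0 \<le> f x \<and> f x \<le> N) \<longrightarrow>
            (AE x in M. ereal (f x) \<le> min (d x) (ereal N))))"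

definition dist_fun ::
  "'a measure \<Rightarrow> ('a \<Rightarrow> real) set \<Rightarrow> (('a \<Rightarrow> real) \<Rightarrow> 'a \<Rightarrow> 'h::{real_inner,banach,second_countable_topology})
     \<Rightarrow> (nat \<Rightarrow> 'a set) \<Rightarrow> 'a set \<Rightarrow> 'a \<Rightarrow> ereal" where
  "dist_fun M Dom D Ek B = (SOME d. is_dist_fun M Dom D Ek B d)"

text \<open>D d_B := D(d_B \<and> N) on {d_B \<le> N} (N natural), and 0 on {d_B = \<infinity>}.\<close>
definition dist_fun_grad ::
  "'a measure \<Rightarrow> ('a \<Rightarrow> real) set \<Rightarrow> (('a \<Rightarrow> real) \<Rightarrow> 'a \<Rightarrow> 'h::{real_inner,banach,second_countable_topology})
     \<Rightarrow> (nat \<Rightarrow> 'a set) \<Rightarrow> 'a set \<Rightarrow> 'a \<Rightarrow> 'h" where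
  "dist_fun_grad M Dom D Ek B x =
     (let d = dist_fun M Dom D Ek B in
      if d x = \<infinity> then 0
      else (let N = real (nat \<lceil>real_of_ereal (d x)\<rceil> + 1) in
            Dloc_grad M Dom D Ek (\<lambda>y. real_of_ereal (min (d y) (ereal N))) x))"

definition pform ::
  "'a measure \<Rightarrow> (('a \<Rightarrow> real) \<Rightarrow> 'a \<Rightarrow> 'h::{real_inner,banach,second_countable_topology})
     \<Rightarrow> ('a \<Rightarrow> 'h) \<Rightarrow> ('a \<Rightarrow> 'h) \<Rightarrow> ('a \<Rightarrow> real) \<Rightarrow> ('a \<Rightarrow> real) \<Rightarrow> ('a \<Rightarrow> real) \<Rightarrow> real" where
  "pform M D b c V f g = E0 M D f g +
     (\<integral>x. inner (b x) (D f x) * g x + inner (c x) (D g x) * f x + V x * f x * g x \<partial>M)"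

definition pform_ext ::
  "'a measure \<Rightarrow> ('a \<Rightarrow> real) set \<Rightarrow> (('a \<Rightarrow> real) \<Rightarrow> 'a \<Rightarrow> 'h::{real_inner,banach,second_countable_topology})
     \<Rightarrow> (nat \<Rightarrow> 'a set) \<Rightarrow> ('a \<Rightarrow> 'h) \<Rightarrow> ('a \<Rightarrow> 'h) \<Rightarrow> ('a \<Rightarrow> real)
     \<Rightarrow> ('a \<Rightarrow> real) \<Rightarrow> ('a \<Rightarrow> real) \<Rightarrow> real" where
  "pform_ext M Dom D Ek b c V f g =
     (THE e. \<forall>fs gs. (\<forall>n. fs n \<in> core M Dom Ek \<and> gs n \<in> core M Dom Ek)
        \<longrightarrow> (\<lambda>n. E0l M D 1 (\<lambda>x. fs n x - f x) (\<lambda>x. fs n x - f x)) \<longlonglongrightarrow> 0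
        \<longrightarrow> (\<lambda>n. E0l M D 1 (\<lambda>x. gs n x - g x) (\<lambda>x. gs n x - g x)) \<longlonglongrightarrow> 0
        \<longrightarrow> (\<lambda>n. pform M D b c V (fs n) (gs n)) \<longlonglongrightarrow> e)"

text \<open>T is the semigroup associated with the form: for every f in L^2, u(t) = T t f
  lies in Dom for t>0, is L^2-differentiable on (0,\<infinity>) with derivative w = L u(t)
  characterised by (w,g) = - E(u(t),g) for all g in Dom, and u(t) -> f in L^2 as t -> 0+.\<close>
definition associated_semigroup ::
  "'a measure \<Rightarrow> ('a \<Rightarrow> real) set \<Rightarrow> (('a \<Rightarrow> real) \<Rightarrow> 'a \<Rightarrow> 'h::{real_inner,banach,second_countable_topology})
     \<Rightarrow> (nat \<Rightarrow> 'a set) \<Rightarrow> ('a \<Rightarrow> 'h) \<Rightarrow> ('a \<Rightarrow> 'h) \<Rightarrow> ('a \<Rightarrow> real)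
     \<Rightarrow> (real \<Rightarrow> ('a \<Rightarrow> real) \<Rightarrow> 'a \<Rightarrow> real) \<Rightarrow> bool" where
  "associated_semigroup M Dom D Ek b c V T \<longleftrightarrow>
     (\<forall>f. L2 M f \<longrightarrow>
        (\<forall>t>0. T t f \<in> Dom \<and>
           (\<exists>w. L2 M w
              \<and> ((\<lambda>s. norm2 M (\<lambda>x. (T s f x - T t f x) / (s - t) - w x)) \<longlongrightarrow> 0) (at t)
              \<and> (\<forall>g\<in>Dom. (\<integral>x. w x * g x \<partial>M) = - pform_ext M Dom D Ek b c V (T t f) g)))
      \<and> ((\<lambda>t. norm2 M (\<lambda>x. T t f x - f x)) \<longlongrightarrow> 0) (at_right 0))"

definition assumption_A ::
  "'a measure \<Rightarrow> ('a \<Rightarrow> real) set \<Rightarrow> (('a \<Rightarrow> real) \<Rightarrow> 'a \<Rightarrow> 'h::{real_inner,banach,second_countable_topology})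
     \<Rightarrow> (nat \<Rightarrow> 'a set) \<Rightarrow> ('a \<Rightarrow> 'h) \<Rightarrow> ('a \<Rightarrow> 'h) \<Rightarrow> ('a \<Rightarrow> real) \<Rightarrow> bool" where
  "assumption_A M Dom D Ek b c V \<longleftrightarrow>
     b \<in> borel_measurable M \<and> c \<in> borel_measurable M \<and> V \<in> borel_measurable M
   \<comment> \<open>(A.1)\<close>
   \<and> measurable_nest M Dom D Ek
   \<and> Lp_loc M 2 Ek (\<lambda>x. norm (b x)) \<and> Lp_loc M 2 Ek (\<lambda>x. norm (c x)) \<and> Lp_loc M 1 Ek V
   \<comment> \<open>(A.2)\<close>
   \<and> (\<exists>\<eta> \<theta> \<omega> l::real. 0 \<le> \<eta> \<and> \<eta> < 1 \<and> 0 \<le> \<theta> \<and> 0 \<le> \<omega> \<and> 0 \<le> l \<and>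
        (\<forall>f\<in>core M Dom Ek.
           - (\<integral>x. inner (b x + c x) (D f x) * f x + V x * (f x)\<^sup>2 \<partial>M)
             \<le> \<eta> * E0 M D f f + \<theta> * (norm2 M f)\<^sup>2) \<and>
        (\<forall>f\<in>core M Dom Ek. \<forall>g\<in>core M Dom Ek.
           \<bar>\<integral>x. inner (b x) (D f x) * g x + inner (c x) (D g x) * f x + V x * f x * g x \<partial>M\<bar>
             \<le> \<omega> * sqrt (E0l M D l f f) * sqrt (E0l M D l g g)))"

definition Pt :: "'a measure \<Rightarrow> (real \<Rightarrow> ('a \<Rightarrow> real) \<Rightarrow> 'a \<Rightarrow> real) \<Rightarrow> real \<Rightarrow> 'a set \<Rightarrow> 'a set \<Rightarrow> real" where
  "Pt M T t A B = (\<integral>x. indicator A x * T t (indicator B) x \<partial>M)"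

definition tlog :: "real \<Rightarrow> real \<Rightarrow> ereal" where
  "tlog t p = (if p \<le> 0 then -\<infinity> else ereal (t * ln p))"

definition logplus :: "real \<Rightarrow> real" where
  "logplus x = max 0 (ln x)"

end

theory Submission
  imports Defs
begin

text \<open>
  A nonlinear version of Davies' method. Let \<open>u\<^sub>t = T\<^sub>t 1\<^sub>B\<close>, \<open>\<psi> = d\<^sub>B \<and> d(A,B)\<close> and
  \<open>v\<^sub>t = exp (\<alpha> \<psi>) u\<^sub>t\<close>. Instead of the \<open>L\<^sup>2\<close>-norm of \<open>v\<^sub>t\<close> one follows
  \<open>K t = \<integral> v\<^sub>t\<^sup>2 (1 + v\<^sub>t\<^sup>2) powr (- s)\<close> with a slowly increasing exponent \<open>s = \<beta> t\<close>: the motion of \<open>s\<close>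
  contributes the negative term \<open>- \<beta> \<integral> v\<^sub>t\<^sup>2 (1 + v\<^sub>t\<^sup>2) powr (- s) ln (1 + v\<^sub>t\<^sup>2)\<close>, which absorbs the entropy term of (B.2),
  while (B.1) controls the deviation from the quadratic case, which is of size \<open>s\<close>. The result is
  \<open>K t \<le> C exp ((1 + o(1)) \<alpha>\<^sup>2 t)\<close>. Since \<open>\<psi> = d(A,B)\<close> on \<open>A\<close>, taking \<open>\<alpha> = d(A,B) / t\<close>, then \<open>t \<rightarrow> 0\<close> and
  finally the range of \<open>s\<close> to zero gives the bound. The growth of the integrand is
  subquadratic, so that its derivative maps the form domain into itself without any truncation of \<open>u\<^sub>t\<close>.

  The function \<open>d\<^sub>B\<close> exists because the set of competitors is a lattice that is closed under
  bounded almost everywhere convergence; the latter uses the weak closedness of \<open>D\<close>.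
\<close>

section \<open>Square-integrable functions\<close>

text \<open>The obstacle is the entropy under the square root in (B.2): no logarithmic Sobolev
  inequality is at hand, so the energy alone does not control it. Young's inequality splits the root
  with a parameter \<open>\<rho>\<close> such that
  \<open>\<alpha> * \<gamma> * \<rho> = \<beta>\<close>; the entropy is then paid for exactly by the
  moving exponent, and what remains is \<open>\<alpha> * \<gamma> / \<rho>\<close>, of order
  \<open>1 / t\<close>. Integrated over a time \<open>t\<close> and multiplied by \<open>t\<close>,
  as in \<open>t log P_t\<close>, such terms vanish; only \<open>\<alpha>\<^sup>2\<close>, of order
  \<open>1 / t^2\<close>, survives. Likewise \<open>\<epsilon>\<close> is proportional to
  \<open>t\<close>, so that \<open>\<alpha> * \<epsilon>\<close> is a fixed part of the coercivity
  gap \<open>1 - \<eta>\<close>; its cost \<open>\<alpha> * lam \<epsilon>\<close> enters the limit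
  as a multiple of \<open>\<epsilon> * lam \<epsilon>\<close>, which is the product assumed to tend
  to zero. The price of the altered power is that the final bound on \<open>A\<close> comes from a
  pointwise comparison of \<open>\<bar>x\<bar>\<close> with \<open>Phi s x\<close> instead of
  Cauchy-Schwarz, with an error in the exponent proportional to the final \<open>s\<close>.\<close>

lemma L2_iff_L2H: "L2 M f \<longleftrightarrow> L2H M f" for f :: "'a \<Rightarrow> real"
  by (simp add: L2_def L2H_def)

lemma norm2_eq_norm2H: "norm2 M f = norm2H M f" for f :: "'a \<Rightarrow> real"
  by (simp add: norm2_def norm2H_def)

lemma norm2H_tendsto_0_iff:
  "((\<lambda>n. norm2H M (Gs n)) \<longlongrightarrow> 0) F \<longleftrightarrow> ((\<lambda>n. \<integral>x. (norm (Gs n x))\<^sup>2 \<partial>M) \<longlongrightarrow> 0) F"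
proof
  assume "((\<lambda>n. norm2H M (Gs n)) \<longlongrightarrow> 0) F"
  then have "((\<lambda>n. (norm2H M (Gs n))\<^sup>2) \<longlongrightarrow> 0\<^sup>2) F"
    by (intro tendsto_intros)
  then show "((\<lambda>n. \<integral>x. (norm (Gs n x))\<^sup>2 \<partial>M) \<longlongrightarrow> 0) F"
    by (simp add: norm2H_def)
next
  assume "((\<lambda>n. \<integral>x. (norm (Gs n x))\<^sup>2 \<partial>M) \<longlongrightarrow> 0) F"
  then have "((\<lambda>n. sqrt (\<integral>x. (norm (Gs n x))\<^sup>2 \<partial>M)) \<longlongrightarrow> sqrt 0) F"
    by (intro tendsto_intros)
  then show "((\<lambda>n. norm2H M (Gs n)) \<longlongrightarrow> 0) F"
    by (simp add: norm2H_def)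
qed

lemma L2H_measurable [measurable_dest]: "L2H M G \<Longrightarrow> G \<in> borel_measurable M"
  by (simp add: L2H_def)

lemma L2H_integrable: "L2H M G \<Longrightarrow> integrable M (\<lambda>x. (norm (G x))\<^sup>2)"
  by (simp add: L2H_def)

lemma L2_integrable: "L2H M G \<Longrightarrow> integrable M (\<lambda>x. (G x)\<^sup>2)" for G :: "'a \<Rightarrow> real"
  by (simp add: L2H_def)

lemma L2H_bound:
  assumes "L2H M F" "G \<in> borel_measurable M" "AE x in M. norm (G x) \<le> C * norm (F x)"
  shows "L2H M G"
  unfolding L2H_def
proof
  show "G \<in> borel_measurable M" by fact
  have i: "integrable M (\<lambda>x. C\<^sup>2 * (norm (F x))\<^sup>2)"
    using assms(1) by (simp add: L2H_def)
  show "integrable M (\<lambda>x. (norm (G x))\<^sup>2)"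
  proof (rule Bochner_Integration.integrable_bound[OF i])
    show "(\<lambda>x. (norm (G x))\<^sup>2) \<in> borel_measurable M" using assms(2) by measurable
    show "AE x in M. norm ((norm (G x))\<^sup>2) \<le> norm (C\<^sup>2 * (norm (F x))\<^sup>2)"
      using assms(3)
    proof eventually_elim
      case (elim x)
      have "(norm (G x))\<^sup>2 \<le> (C * norm (F x))\<^sup>2" using elim by (intro power_mono) auto
      then show ?case by (simp add: power_mult_distrib)
    qed
  qed
qed

lemma norm_add_square_le: "(norm (a + b))\<^sup>2 \<le> 2 * (norm a)\<^sup>2 + 2 * (norm b)\<^sup>2"
  for a b :: "'a::real_normed_vector"
proof -
  have "(norm (a + b))\<^sup>2 \<le> (norm a + norm b)\<^sup>2"
    by (intro power_mono norm_triangle_ineq) auto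
  also have "\<dots> \<le> 2 * (norm a)\<^sup>2 + 2 * (norm b)\<^sup>2"
    using sum_squares_bound[of "norm a" "norm b"] by (simp add: power2_sum)
  finally show ?thesis .
qed

lemma L2H_add:
  assumes "L2H M F" "L2H M G"
  shows "L2H M (\<lambda>x. F x + G x)"
  unfolding L2H_def
proof
  have [measurable]: "F \<in> borel_measurable M" "G \<in> borel_measurable M"
    using assms by (auto simp: L2H_def)
  show "(\<lambda>x. F x + G x) \<in> borel_measurable M" by measurable
  have i: "integrable M (\<lambda>x. 2 * (norm (F x))\<^sup>2 + 2 * (norm (G x))\<^sup>2)"
    using assms by (simp add: L2H_def)
  show "integrable M (\<lambda>x. (norm (F x + G x))\<^sup>2)"
    by (rule Bochner_Integration.integrable_bound[OF i]) (auto simp: norm_add_square_le)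
qed

lemma L2H_scaleR: "L2H M G \<Longrightarrow> L2H M (\<lambda>x. a *\<^sub>R G x)"
  by (rule L2H_bound[where F = G and C = "\<bar>a\<bar>"]) (auto simp: L2H_def)

lemma L2_cmult: "L2H M G \<Longrightarrow> L2H M (\<lambda>x. a * G x)" for G :: "'a \<Rightarrow> real"
  using L2H_scaleR[of M G a] by simp

lemma L2H_diff: "L2H M F \<Longrightarrow> L2H M G \<Longrightarrow> L2H M (\<lambda>x. F x - G x)"
  using L2H_add[of M F "\<lambda>x. (-1) *\<^sub>R G x"] L2H_scaleR[of M G "-1"] by simp

lemma L2H_mult_bounded:
  assumes "L2H M G" "m \<in> borel_measurable M" "AE x in M. \<bar>m x\<bar> \<le> C"
  shows "L2H M (\<lambda>x. m x *\<^sub>R G x)"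
proof (rule L2H_bound[OF assms(1)])
  show "(\<lambda>x. m x *\<^sub>R G x) \<in> borel_measurable M" using assms(2) L2H_measurable[OF assms(1)] by measurable
  show "AE x in M. norm (m x *\<^sub>R G x) \<le> C * norm (G x)"
    using assms(3) by eventually_elim (auto intro: mult_right_mono)
qed

lemma L2H_bounded_scaleR:
  fixes u :: "'a \<Rightarrow> real"
  assumes "L2H M u" "G \<in> borel_measurable M" "AE x in M. norm (G x) \<le> C"
  shows "L2H M (\<lambda>x. u x *\<^sub>R G x)"
proof (rule L2H_bound[OF assms(1)])
  show "(\<lambda>x. u x *\<^sub>R G x) \<in> borel_measurable M" using assms(2) L2H_measurable[OF assms(1)] by measurable
  show "AE x in M. norm (u x *\<^sub>R G x) \<le> C * norm (u x)"
    using assms(3) by eventually_elim (simp add: mult.commute[of C] mult_left_mono)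
qed

lemma L2H_norm_mult_integrable:
  assumes "L2H M F" "L2H M G"
  shows "integrable M (\<lambda>x. norm (F x) * norm (G x))"
proof -
  have [measurable]: "F \<in> borel_measurable M" "G \<in> borel_measurable M"
    using assms by (auto simp: L2H_def)
  have i: "integrable M (\<lambda>x. (norm (F x))\<^sup>2 + (norm (G x))\<^sup>2)"
    using assms by (simp add: L2H_def)
  show ?thesis
  proof (rule Bochner_Integration.integrable_bound[OF i])
    show "AE x in M. norm (norm (F x) * norm (G x)) \<le> norm ((norm (F x))\<^sup>2 + (norm (G x))\<^sup>2)"
    proof (rule AE_I2)
      fix x
      have "2 * (norm (F x) * norm (G x)) \<le> (norm (F x))\<^sup>2 + (norm (G x))\<^sup>2"
        using sum_squares_bound[of "norm (F x)" "norm (G x)"] by simp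
      moreover have "0 \<le> norm (F x) * norm (G x)" by simp
      ultimately have "norm (F x) * norm (G x) \<le> (norm (F x))\<^sup>2 + (norm (G x))\<^sup>2" by linarith
      then show "norm (norm (F x) * norm (G x)) \<le> norm ((norm (F x))\<^sup>2 + (norm (G x))\<^sup>2)" by simp
    qed
  qed measurable
qed

lemma L2H_inner_integrable:
  assumes "L2H M F" "L2H M G"
  shows "integrable M (\<lambda>x. inner (F x) (G x))"
proof (rule Bochner_Integration.integrable_bound[OF L2H_norm_mult_integrable[OF assms]])
  show "(\<lambda>x. inner (F x) (G x)) \<in> borel_measurable M"
    using assms[THEN L2H_measurable] by measurable
qed (auto simp: Cauchy_Schwarz_ineq2)

lemma L2_mult_integrable:
  "L2H M F \<Longrightarrow> L2H M G \<Longrightarrow> integrable M (\<lambda>x. F x * G x)" for F G :: "'a \<Rightarrow> real"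
  using L2H_inner_integrable[of M F G] by simp

lemma integral_norm_add_square_le:
  assumes "L2H M F" "L2H M G"
  shows "(\<integral>x. (norm (F x + G x))\<^sup>2 \<partial>M)
      \<le> 2 * (\<integral>x. (norm (F x))\<^sup>2 \<partial>M) + 2 * (\<integral>x. (norm (G x))\<^sup>2 \<partial>M)"
proof -
  have "(\<integral>x. (norm (F x + G x))\<^sup>2 \<partial>M) \<le> (\<integral>x. 2 * (norm (F x))\<^sup>2 + 2 * (norm (G x))\<^sup>2 \<partial>M)"
    using L2H_integrable[OF L2H_add[OF assms]] assms[THEN L2H_integrable]
    by (intro integral_mono) (auto simp: norm_add_square_le)
  also have "\<dots> = 2 * (\<integral>x. (norm (F x))\<^sup>2 \<partial>M) + 2 * (\<integral>x. (norm (G x))\<^sup>2 \<partial>M)"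
    using assms[THEN L2H_integrable] by simp
  finally show ?thesis .
qed

text \<open>The squared norm of \<open>s F + t G\<close> is a nonnegative quadratic form in
  \<open>(s, t)\<close>; evaluating it at well-chosen points gives Cauchy-Schwarz.\<close>

lemma integral_inner_le:
  assumes "L2H M F" "L2H M G"
  shows "\<bar>\<integral>x. inner (F x) (G x) \<partial>M\<bar> \<le> norm2H M F * norm2H M G"
proof -
  define a where "a = (\<integral>x. (norm (F x))\<^sup>2 \<partial>M)"
  define b where "b = (\<integral>x. (norm (G x))\<^sup>2 \<partial>M)"
  define c where "c = (\<integral>x. inner (F x) (G x) \<partial>M)"
  have iF: "integrable M (\<lambda>x. (norm (F x))\<^sup>2)" and iG: "integrable M (\<lambda>x. (norm (G x))\<^sup>2)"
    and ic: "integrable M (\<lambda>x. inner (F x) (G x))"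
    using assms by (auto simp: L2H_integrable L2H_inner_integrable)
  have q: "0 \<le> s\<^sup>2 * a + 2 * s * t * c + t\<^sup>2 * b" for s t :: real
  proof -
    have "0 \<le> (\<integral>x. (norm (s *\<^sub>R F x + t *\<^sub>R G x))\<^sup>2 \<partial>M)" by simp
    also have "\<dots> = (\<integral>x. s\<^sup>2 * (norm (F x))\<^sup>2 + 2 * s * t * inner (F x) (G x) + t\<^sup>2 * (norm (G x))\<^sup>2 \<partial>M)"
      by (intro Bochner_Integration.integral_cong refl)
        (simp only: power2_norm_eq_inner,
         simp add: inner_add_left inner_add_right inner_commute power2_eq_square algebra_simps)
    also have "\<dots> = s\<^sup>2 * a + 2 * s * t * c + t\<^sup>2 * b"
      using iF iG ic by (simp add: a_def b_def c_def)
    finally show ?thesis .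
  qed
  have ab: "0 \<le> a" "0 \<le> b" by (simp_all add: a_def b_def)
  have "c\<^sup>2 \<le> a * b"
  proof (cases "b = 0")
    case True
    have "c = 0"
    proof (rule ccontr)
      assume "c \<noteq> 0"
      \<comment> \<open>With \<open>b = 0\<close> the form is affine in its second argument, and
        this point gives it the value \<open>-1\<close>.\<close>
      from q[of 1 "- (a + 1) / (2 * c)"] True \<open>c \<noteq> 0\<close> show False by (simp add: field_simps)
    qed
    then show ?thesis using True by simp
  next
    case False
    then have "b > 0" using ab by simp
    from q[of b "-c"] have "0 \<le> b * (a * b - c\<^sup>2)" by (simp add: power2_eq_square algebra_simps)
    with \<open>b > 0\<close> show ?thesis by (simp add: zero_le_mult_iff)
  qed
  then have "\<bar>c\<bar> \<le> sqrt (a * b)" by (metis real_sqrt_abs real_sqrt_le_mono)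
  then show ?thesis by (simp add: norm2H_def a_def b_def c_def real_sqrt_mult)
qed

lemma L2H_tendsto_AE_subseq:
  assumes "\<And>n. L2H M (\<lambda>x. Gs n x - G x)"
    and "(\<lambda>n. \<integral>x. (norm (Gs n x - G x))\<^sup>2 \<partial>M) \<longlonglongrightarrow> 0"
  obtains r :: "nat \<Rightarrow> nat" where "strict_mono r" "AE x in M. (\<lambda>n. Gs (r n) x) \<longlonglongrightarrow> G x"
proof -
  have "\<exists>r::nat\<Rightarrow>nat. strict_mono r \<and> (AE x in M. (\<lambda>n. (norm (Gs (r n) x - G x))\<^sup>2) \<longlonglongrightarrow> 0)"
    using assms by (intro tendsto_L1_AE_subseq) (auto intro: L2H_integrable)
  then obtain r :: "nat \<Rightarrow> nat" where r: "strict_mono r" "AE x in M. (\<lambda>n. (norm (Gs (r n) x - G x))\<^sup>2) \<longlonglongrightarrow> 0"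
    by blast
  from r(2) have "AE x in M. (\<lambda>n. Gs (r n) x) \<longlonglongrightarrow> G x"
  proof eventually_elim
    case (elim x)
    then have "(\<lambda>n. sqrt ((norm (Gs (r n) x - G x))\<^sup>2)) \<longlonglongrightarrow> sqrt 0" by (intro tendsto_intros)
    then have "(\<lambda>n. norm (Gs (r n) x - G x)) \<longlonglongrightarrow> 0" by simp
    then show ?case by (simp add: tendsto_norm_zero_iff LIM_zero_iff)
  qed
  with r(1) show thesis by (rule that)
qed

lemma L2H_dominated_convergence:
  assumes "\<And>n. Gs n \<in> borel_measurable M" "G \<in> borel_measurable M"
    and lim: "AE x in M. (\<lambda>n. Gs n x) \<longlonglongrightarrow> G x"
    and dom: "\<And>n. AE x in M. norm (Gs n x) \<le> h x" and h: "L2H M h"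
  shows "L2H M G" "(\<lambda>n. \<integral>x. (norm (Gs n x - G x))\<^sup>2 \<partial>M) \<longlonglongrightarrow> 0"
proof -
  have [measurable]: "\<And>n. Gs n \<in> borel_measurable M" "G \<in> borel_measurable M" "h \<in> borel_measurable M"
    using assms by (auto simp: L2H_def)
  have "AE x in M. \<forall>n. norm (Gs n x) \<le> h x" using dom by (simp add: AE_all_countable)
  with lim have b: "AE x in M. norm (G x) \<le> h x \<and> (\<forall>n. norm (Gs n x) \<le> h x)"
  proof eventually_elim
    case (elim x)
    then have "(\<lambda>n. norm (Gs n x)) \<longlonglongrightarrow> norm (G x)" by (intro tendsto_intros)
    then have "norm (G x) \<le> h x" by (rule LIMSEQ_le_const2) (use elim in auto)
    with elim show ?case by auto
  qed
  show "L2H M G"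
    by (rule L2H_bound[OF h, where C = 1]) (use b in auto)
  show "(\<lambda>n. \<integral>x. (norm (Gs n x - G x))\<^sup>2 \<partial>M) \<longlonglongrightarrow> 0"
  proof -
    have "(\<lambda>n. \<integral>x. (norm (Gs n x - G x))\<^sup>2 \<partial>M) \<longlonglongrightarrow> (\<integral>x. 0 \<partial>M)"
    proof (rule integral_dominated_convergence)
      show "integrable M (\<lambda>x. 4 * (h x)\<^sup>2)" using h by (simp add: L2H_def)
      show "AE x in M. (\<lambda>n. (norm (Gs n x - G x))\<^sup>2) \<longlonglongrightarrow> 0"
        using lim
      proof eventually_elim
        case (elim x)
        then have "(\<lambda>n. (norm (Gs n x - G x))\<^sup>2) \<longlonglongrightarrow> (norm (G x - G x))\<^sup>2" by (intro tendsto_intros)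
        then show ?case by simp
      qed
      show "AE x in M. norm ((norm (Gs n x - G x))\<^sup>2) \<le> 4 * (h x)\<^sup>2" for n
        using b
      proof eventually_elim
        case (elim x)
        then have "norm (Gs n x - G x) \<le> 2 * h x"
          using norm_triangle_ineq4[of "Gs n x" "G x"] by (smt (verit, best))
        then have "(norm (Gs n x - G x))\<^sup>2 \<le> (2 * h x)\<^sup>2" by (intro power_mono) auto
        then show ?case by (simp add: power_mult_distrib)
      qed
    qed auto
    then show ?thesis by simp
  qed
qed

text \<open>Stated for a general filter and with eventual hypotheses because the semigroup limits
  run along \<open>at t\<close> and \<open>at_right 0\<close>, where square-integrability is known
  for positive times only.\<close>

lemma L2H_null_mono:
  fixes Gs :: "'i \<Rightarrow> 'a \<Rightarrow> 'g::{real_inner,banach,second_countable_topology}"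
  assumes ev: "\<forall>\<^sub>F n in F. L2H M (Fs n) \<and> Gs n \<in> borel_measurable M \<and> (AE x in M. norm (Gs n x) \<le> C * norm (Fs n x))"
    and lim: "((\<lambda>n. \<integral>x. (norm (Fs n x))\<^sup>2 \<partial>M) \<longlongrightarrow> 0) F"
  shows "((\<lambda>n. \<integral>x. (norm (Gs n x))\<^sup>2 \<partial>M) \<longlongrightarrow> 0) F"
proof (rule Lim_null_comparison)
  show "((\<lambda>n. C\<^sup>2 * (\<integral>x. (norm (Fs n x))\<^sup>2 \<partial>M)) \<longlongrightarrow> 0) F"
    using tendsto_mult_right_zero[OF lim] .
  show "\<forall>\<^sub>F n in F. norm (\<integral>x. (norm (Gs n x))\<^sup>2 \<partial>M) \<le> C\<^sup>2 * (\<integral>x. (norm (Fs n x))\<^sup>2 \<partial>M)"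
    using ev
  proof eventually_elim
    case (elim n)
    then have e: "L2H M (Fs n)" "Gs n \<in> borel_measurable M" "AE x in M. norm (Gs n x) \<le> C * norm (Fs n x)" by auto
    have "(\<integral>x. (norm (Gs n x))\<^sup>2 \<partial>M) \<le> (\<integral>x. C\<^sup>2 * (norm (Fs n x))\<^sup>2 \<partial>M)"
    proof (rule integral_mono_AE)
      show "integrable M (\<lambda>x. (norm (Gs n x))\<^sup>2)" by (rule L2H_integrable[OF L2H_bound[OF e]])
      show "integrable M (\<lambda>x. C\<^sup>2 * (norm (Fs n x))\<^sup>2)" using L2H_integrable[OF e(1)] by simp
      show "AE x in M. (norm (Gs n x))\<^sup>2 \<le> C\<^sup>2 * (norm (Fs n x))\<^sup>2"
        using e(3)
      proof eventually_elim
        case (elim x)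
        have "(norm (Gs n x))\<^sup>2 \<le> (C * norm (Fs n x))\<^sup>2" using elim by (intro power_mono) auto
        then show ?case by (simp add: power_mult_distrib)
      qed
    qed
    then show ?case by simp
  qed
qed

lemmas L2H_null_mono_sequentially =
  L2H_null_mono[OF always_eventually[OF allI[OF conjI[OF _ conjI]]], where F = sequentially]

lemma L2H_null_add:
  assumes L: "\<And>n. L2H M (Fs n)" "\<And>n. L2H M (Gs n)"
    and lim: "(\<lambda>n. \<integral>x. (norm (Fs n x))\<^sup>2 \<partial>M) \<longlonglongrightarrow> 0" "(\<lambda>n. \<integral>x. (norm (Gs n x))\<^sup>2 \<partial>M) \<longlonglongrightarrow> 0"
    and H: "\<And>n. Hs n \<in> borel_measurable M" "\<And>n. AE x in M. Hs n x = Fs n x + Gs n x"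
  shows "(\<lambda>n. \<integral>x. (norm (Hs n x))\<^sup>2 \<partial>M) \<longlonglongrightarrow> 0"
proof (rule Lim_null_comparison)
  show "(\<lambda>n. 2 * (\<integral>x. (norm (Fs n x))\<^sup>2 \<partial>M) + 2 * (\<integral>x. (norm (Gs n x))\<^sup>2 \<partial>M)) \<longlonglongrightarrow> 0"
    using tendsto_add[OF tendsto_mult_right_zero[OF lim(1)] tendsto_mult_right_zero[OF lim(2)]] by simp
  have "(\<integral>x. (norm (Hs n x))\<^sup>2 \<partial>M) = (\<integral>x. (norm (Fs n x + Gs n x))\<^sup>2 \<partial>M)" for n
  proof (rule integral_cong_AE)
    show "AE x in M. (norm (Hs n x))\<^sup>2 = (norm (Fs n x + Gs n x))\<^sup>2" using H(2)[of n] by eventually_elim simp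
  qed (use H(1) L2H_measurable[OF L2H_add[OF L]] in measurable)
  then show "\<forall>\<^sub>F n in sequentially. norm (\<integral>x. (norm (Hs n x))\<^sup>2 \<partial>M)
      \<le> 2 * (\<integral>x. (norm (Fs n x))\<^sup>2 \<partial>M) + 2 * (\<integral>x. (norm (Gs n x))\<^sup>2 \<partial>M)"
    using integral_norm_add_square_le[OF L] by simp
qed

text \<open>\<open>Hs\<close> stands for the gradient of \<open>m * us\<close>: multiplication by a
  bounded function with bounded gradient is continuous in the graph norm. This serves both for known
  multipliers and for proving that functions in \<open>D0\<close> are multipliers.\<close>

lemma L2H_product_null:
  fixes us :: "nat \<Rightarrow> 'a \<Rightarrow> real"
  assumes m: "m \<in> borel_measurable M" "AE x in M. \<bar>m x\<bar> \<le> C" and G: "G \<in> borel_measurable M" "AE x in M. norm (G x) \<le> C'"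
    and L: "\<And>n. L2H M (us n)" "\<And>n. L2H M (Us n)"
    and lim: "(\<lambda>n. \<integral>x. (us n x)\<^sup>2 \<partial>M) \<longlonglongrightarrow> 0" "(\<lambda>n. \<integral>x. (norm (Us n x))\<^sup>2 \<partial>M) \<longlonglongrightarrow> 0"
    and H: "\<And>n. Hs n \<in> borel_measurable M" "\<And>n. AE x in M. Hs n x = m x *\<^sub>R Us n x + us n x *\<^sub>R G x"
  shows "(\<lambda>n. \<integral>x. (m x * us n x)\<^sup>2 \<partial>M) \<longlonglongrightarrow> 0" "(\<lambda>n. \<integral>x. (norm (Hs n x))\<^sup>2 \<partial>M) \<longlonglongrightarrow> 0"
proof -
  note LL = L2H_mult_bounded[OF L(1) m] L2H_mult_bounded[OF L(2) m] L2H_bounded_scaleR[OF L(1) G]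
  have l: "(\<lambda>n. \<integral>x. (norm (us n x))\<^sup>2 \<partial>M) \<longlonglongrightarrow> 0" using lim(1) by simp
  have "AE x in M. norm (m x *\<^sub>R us n x) \<le> C * norm (us n x)" for n
    using m(2) by eventually_elim (auto simp: abs_mult intro: mult_right_mono)
  then have "(\<lambda>n. \<integral>x. (norm (m x *\<^sub>R us n x))\<^sup>2 \<partial>M) \<longlonglongrightarrow> 0"
    by (rule L2H_null_mono_sequentially[OF L(1) L2H_measurable[OF LL(1)] _ l])
  then show "(\<lambda>n. \<integral>x. (m x * us n x)\<^sup>2 \<partial>M) \<longlonglongrightarrow> 0" by simp
  have "AE x in M. norm (m x *\<^sub>R Us n x) \<le> C * norm (Us n x)" for n
    using m(2) by eventually_elim (auto intro: mult_right_mono)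
  then have 1: "(\<lambda>n. \<integral>x. (norm (m x *\<^sub>R Us n x))\<^sup>2 \<partial>M) \<longlonglongrightarrow> 0"
    by (rule L2H_null_mono_sequentially[OF L(2) L2H_measurable[OF LL(2)] _ lim(2)])
  have "AE x in M. norm (us n x *\<^sub>R G x) \<le> C' * norm (us n x)" for n
    using G(2) by eventually_elim (simp add: mult.commute[of C'] mult_left_mono)
  then have 2: "(\<lambda>n. \<integral>x. (norm (us n x *\<^sub>R G x))\<^sup>2 \<partial>M) \<longlonglongrightarrow> 0"
    by (rule L2H_null_mono_sequentially[OF L(1) L2H_measurable[OF LL(3)] _ l])
  show "(\<lambda>n. \<integral>x. (norm (Hs n x))\<^sup>2 \<partial>M) \<longlonglongrightarrow> 0"
    by (rule L2H_null_add[OF LL(2,3) 1 2 H])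
qed

text \<open>Riesz-Fischer for Hilbert-valued functions. A subsequence with geometrically small
  increments converges pointwise, and Fatou's lemma transfers the Cauchy estimate to the pointwise
  limit.\<close>

lemma L2H_complete:
  fixes Gs :: "nat \<Rightarrow> 'a \<Rightarrow> 'h::{real_inner,banach,second_countable_topology}"
  assumes L2: "\<And>n. L2H M (Gs n)"
    and Cauchy: "\<And>e. e > 0 \<Longrightarrow> \<exists>N. \<forall>m\<ge>N. \<forall>n\<ge>N. (\<integral>x. (norm (Gs m x - Gs n x))\<^sup>2 \<partial>M) < e"
  obtains G where "L2H M G" "(\<lambda>n. \<integral>x. (norm (Gs n x - G x))\<^sup>2 \<partial>M) \<longlonglongrightarrow> 0"
proof -
  have [measurable]: "\<And>n. Gs n \<in> borel_measurable M" using L2 by (auto simp: L2H_def)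
  define Q where "Q m n = (\<integral>x. (norm (Gs m x - Gs n x))\<^sup>2 \<partial>M)" for m n
  have iQ: "integrable M (\<lambda>x. (norm (Gs m x - Gs n x))\<^sup>2)" for m n
    by (intro L2H_integrable L2H_diff L2)
  have "\<forall>j. \<exists>N. \<forall>m\<ge>N. \<forall>n\<ge>N. Q m n < (1/4)^j"
    using Cauchy unfolding Q_def by simp
  then obtain N0 where N0: "\<And>j m n. m \<ge> N0 j \<Longrightarrow> n \<ge> N0 j \<Longrightarrow> Q m n < (1/4)^j" by metis
  \<comment> \<open>Summing the earlier thresholds makes \<open>N\<close> monotone, and the summand
    \<open>j\<close> makes it unbounded.\<close>
  define N where "N j = (\<Sum>i\<le>j. N0 i) + j" for j
  have NN0: "N0 j \<le> N j" for j
    unfolding N_def by (simp add: sum.remove[of "{..j}" j] trans_le_add1)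
  have Nmono: "N j \<le> N (Suc j)" for j by (simp add: N_def)
  have Nge: "j \<le> N j" for j by (simp add: N_def)
  define \<Delta> where "\<Delta> j x = Gs (N (Suc j)) x - Gs (N j) x" for j x
  have [measurable]: "\<Delta> j \<in> borel_measurable M" for j by (simp add: \<Delta>_def[abs_def])
  have \<Delta>i: "(\<integral>x. (norm (\<Delta> j x))\<^sup>2 \<partial>M) \<le> (1/4)^j" for j
    using N0[of j "N (Suc j)" "N j"] NN0[of j] Nmono[of j] by (simp add: Q_def \<Delta>_def)
  have i\<Delta>: "integrable M (\<lambda>x. (norm (\<Delta> j x))\<^sup>2)" for j
    unfolding \<Delta>_def by (rule iQ)
  \<comment> \<open>The weight \<open>2 ^ j\<close> lies between 1 and \<open>4 ^ j\<close>: the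
    weighted series still has a finite integral, and boundedness of its terms already makes the
    increments summable, like powers of \<open>sqrt (1/2)\<close>.\<close>
  have "(\<integral>\<^sup>+x. (\<Sum>j. ennreal (2^j * (norm (\<Delta> j x))\<^sup>2)) \<partial>M) = (\<Sum>j. \<integral>\<^sup>+x. ennreal (2^j * (norm (\<Delta> j x))\<^sup>2) \<partial>M)"
    by (intro nn_integral_suminf) measurable
  also have "\<dots> \<le> (\<Sum>j. ennreal ((1/2)^j))"
  proof (intro suminf_le)
    fix j
    have "(\<integral>\<^sup>+x. ennreal (2^j * (norm (\<Delta> j x))\<^sup>2) \<partial>M) = ennreal (\<integral>x. 2^j * (norm (\<Delta> j x))\<^sup>2 \<partial>M)"
      by (intro nn_integral_eq_integral) (auto intro: i\<Delta>)
    also have "\<dots> \<le> ennreal ((1/2)^j)"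
    proof (rule ennreal_leI)
      have "(\<integral>x. 2^j * (norm (\<Delta> j x))\<^sup>2 \<partial>M) = 2^j * (\<integral>x. (norm (\<Delta> j x))\<^sup>2 \<partial>M)" by simp
      also have "\<dots> \<le> 2^j * (1/4)^j" using \<Delta>i[of j] by (intro mult_left_mono) auto
      also have "\<dots> = (1/2)^j" by (simp add: power_mult_distrib[symmetric])
      finally show "(\<integral>x. 2^j * (norm (\<Delta> j x))\<^sup>2 \<partial>M) \<le> (1/2)^j" .
    qed
    finally show "(\<integral>\<^sup>+x. ennreal (2^j * (norm (\<Delta> j x))\<^sup>2) \<partial>M) \<le> ennreal ((1/2)^j)" .
  qed auto
  also have "\<dots> = ennreal (\<Sum>j. (1/2)^j)"
    by (intro suminf_ennreal2) (auto intro: summable_geometric)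
  finally have "(\<integral>\<^sup>+x. (\<Sum>j. ennreal (2^j * (norm (\<Delta> j x))\<^sup>2)) \<partial>M) \<noteq> \<infinity>"
    by (metis ennreal_neq_top infinity_ennreal_def top.extremum_uniqueI)
  then have "AE x in M. (\<Sum>j. ennreal (2^j * (norm (\<Delta> j x))\<^sup>2)) \<noteq> \<infinity>"
    by (intro nn_integral_PInf_AE) measurable
  then have conv: "AE x in M. convergent (\<lambda>j. Gs (N j) x)"
  proof eventually_elim
    case (elim x)
    have "summable (\<lambda>j. 2^j * (norm (\<Delta> j x))\<^sup>2)"
      using elim by (intro summable_suminf_not_top) auto
    then have "Bseq (\<lambda>j. 2^j * (norm (\<Delta> j x))\<^sup>2)"
      by (intro convergent_imp_Bseq) (auto simp: convergent_def intro: summable_LIMSEQ_zero)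
    then obtain C where C: "C > 0" "\<And>j. 2^j * (norm (\<Delta> j x))\<^sup>2 \<le> C"
      by (auto simp: Bseq_def)
    have bd: "norm (\<Delta> j x) \<le> sqrt C * (sqrt (1/2))^j" for j
    proof -
      have "(norm (\<Delta> j x))\<^sup>2 \<le> C * (1/2)^j" using C(2)[of j] by (simp add: field_simps power_divide)
      then have "norm (\<Delta> j x) \<le> sqrt (C * (1/2)^j)" by (simp add: real_le_rsqrt)
      also have "\<dots> = sqrt C * (sqrt (1/2))^j" by (simp add: real_sqrt_mult real_sqrt_power)
      finally show ?thesis .
    qed
    have "summable (\<lambda>j. sqrt C * (sqrt (1/2))^j)"
      by (intro summable_mult summable_geometric) (simp add: real_sqrt_lt_1_iff)
    then have "summable (\<lambda>j. \<Delta> j x)"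
      by (rule summable_comparison_test[rotated]) (use bd in auto)
    then have "convergent (\<lambda>n. \<Sum>j<n. \<Delta> j x)" by (simp add: summable_iff_convergent)
    moreover have "(\<Sum>j<n. \<Delta> j x) = Gs (N n) x - Gs (N 0) x" for n
      unfolding \<Delta>_def by (rule sum_lessThan_telescope)
    ultimately have "convergent (\<lambda>n. Gs (N n) x - Gs (N 0) x)" by simp
    then have "convergent (\<lambda>n. (Gs (N n) x - Gs (N 0) x) + Gs (N 0) x)"
      by (intro convergent_add convergent_const)
    then show ?case by simp
  qed
  define G where "G x = lim (\<lambda>j. Gs (N j) x)" for x
  have [measurable]: "G \<in> borel_measurable M"
    unfolding G_def[abs_def] by (rule borel_measurable_lim_metric) measurable
  have Glim: "AE x in M. (\<lambda>j. Gs (N j) x) \<longlonglongrightarrow> G x"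
    using conv by eventually_elim (simp add: G_def convergent_LIMSEQ_iff)
  have est: "(\<integral>\<^sup>+x. ennreal ((norm (Gs m x - G x))\<^sup>2) \<partial>M) \<le> ennreal ((1/4)^j)" if "m \<ge> N j" for m j
  proof -
    have "(\<integral>\<^sup>+x. ennreal ((norm (Gs m x - G x))\<^sup>2) \<partial>M)
        = (\<integral>\<^sup>+x. liminf (\<lambda>i. ennreal ((norm (Gs m x - Gs (N i) x))\<^sup>2)) \<partial>M)"
    proof (rule nn_integral_cong_AE)
      show "AE x in M. ennreal ((norm (Gs m x - G x))\<^sup>2) = liminf (\<lambda>i. ennreal ((norm (Gs m x - Gs (N i) x))\<^sup>2))"
        using Glim
      proof eventually_elim
        case (elim x)
        have "(\<lambda>i. ennreal ((norm (Gs m x - Gs (N i) x))\<^sup>2)) \<longlonglongrightarrow> ennreal ((norm (Gs m x - G x))\<^sup>2)"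
          by (intro tendsto_ennrealI tendsto_intros elim)
        from lim_imp_Liminf[OF sequentially_bot this] show ?case by (rule sym)
      qed
    qed
    also have "\<dots> \<le> liminf (\<lambda>i. \<integral>\<^sup>+x. ennreal ((norm (Gs m x - Gs (N i) x))\<^sup>2) \<partial>M)"
      by (rule nn_integral_liminf) measurable
    also have "\<dots> \<le> liminf (\<lambda>i::nat. ennreal ((1/4)^j))"
    proof (rule Liminf_mono)
      show "\<forall>\<^sub>F i in sequentially. (\<integral>\<^sup>+x. ennreal ((norm (Gs m x - Gs (N i) x))\<^sup>2) \<partial>M) \<le> ennreal ((1/4)^j)"
      proof (rule eventually_sequentiallyI)
        fix i assume "N j \<le> i"
        then have "N0 j \<le> N i" using NN0[of j] Nge[of i] by linarith
        moreover have "N0 j \<le> m" using that NN0[of j] by linarith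
        ultimately have "Q m (N i) < (1/4)^j" by (rule N0[rotated])
        moreover have "(\<integral>\<^sup>+x. ennreal ((norm (Gs m x - Gs (N i) x))\<^sup>2) \<partial>M) = ennreal (Q m (N i))"
          unfolding Q_def by (intro nn_integral_eq_integral iQ) auto
        ultimately show "(\<integral>\<^sup>+x. ennreal ((norm (Gs m x - Gs (N i) x))\<^sup>2) \<partial>M) \<le> ennreal ((1/4)^j)"
          by (simp add: ennreal_leI)
      qed
    qed
    also have "\<dots> = ennreal ((1/4)^j)" by (simp add: Liminf_const)
    finally show ?thesis .
  qed
  have L2d: "L2H M (\<lambda>x. Gs m x - G x)" if "m \<ge> N j" for m j
    unfolding L2H_def
  proof
    show "(\<lambda>x. Gs m x - G x) \<in> borel_measurable M" by measurable
    show "integrable M (\<lambda>x. (norm (Gs m x - G x))\<^sup>2)"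
    proof (rule integrableI_bounded)
      have "(\<integral>\<^sup>+ x. ennreal (norm ((norm (Gs m x - G x))\<^sup>2)) \<partial>M) \<le> ennreal ((1/4)^j)"
        using est[OF that] by simp
      then show "(\<integral>\<^sup>+ x. ennreal (norm ((norm (Gs m x - G x))\<^sup>2)) \<partial>M) < \<infinity>"
        using ennreal_less_top le_less_trans unfolding infinity_ennreal_def by blast
    qed measurable
  qed
  have G: "L2H M G"
    using L2H_diff[OF L2[of "N 0"] L2d[of 0 "N 0"]] by simp
  have bound: "(\<integral>x. (norm (Gs m x - G x))\<^sup>2 \<partial>M) \<le> (1/4)^j" if "m \<ge> N j" for m j
  proof -
    have "ennreal (\<integral>x. (norm (Gs m x - G x))\<^sup>2 \<partial>M) = (\<integral>\<^sup>+x. ennreal ((norm (Gs m x - G x))\<^sup>2) \<partial>M)"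
      using L2H_integrable[OF L2d[OF that]] by (intro nn_integral_eq_integral[symmetric]) auto
    also have "\<dots> \<le> ennreal ((1/4)^j)" by (rule est[OF that])
    finally show ?thesis by simp
  qed
  have "(\<lambda>n. \<integral>x. (norm (Gs n x - G x))\<^sup>2 \<partial>M) \<longlonglongrightarrow> 0"
  proof (rule LIMSEQ_I)
    fix e :: real assume "e > 0"
    then obtain j where j: "(1/4::real)^j < e" using real_arch_pow_inv[of e "1/4"] by auto
    show "\<exists>no. \<forall>n\<ge>no. norm ((\<integral>x. (norm (Gs n x - G x))\<^sup>2 \<partial>M) - 0) < e"
    proof (intro exI allI impI)
      fix n assume "N j \<le> n"
      with bound[OF this] j show "norm ((\<integral>x. (norm (Gs n x - G x))\<^sup>2 \<partial>M) - 0) < e" by simp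
    qed
  qed
  with G show thesis by (rule that)
qed

section \<open>Closed derivations\<close>

locale dirichlet =
  fixes M :: "'a measure" and Dom :: "('a \<Rightarrow> real) set"
    and D :: "('a \<Rightarrow> real) \<Rightarrow> 'a \<Rightarrow> 'h::{real_inner,banach,second_countable_topology}"
  assumes frame: "dirichlet_framework M Dom D"
begin

lemmas frame_conjs = frame[unfolded dirichlet_framework_def]

lemma sigma_finite: "sigma_finite_measure M"
  by (rule frame_conjs[THEN conjunct1])

lemma dom_L2: "f \<in> Dom \<Longrightarrow> L2H M f"
  and D_L2: "f \<in> Dom \<Longrightarrow> L2H M (D f)"
  using frame_conjs[THEN conjunct2, THEN conjunct1] unfolding L2_iff_L2H by blast+

lemma dom_measurable [measurable_dest]: "f \<in> Dom \<Longrightarrow> f \<in> borel_measurable M"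
  by (rule L2H_measurable[OF dom_L2])

lemma D_measurable [measurable_dest]: "f \<in> Dom \<Longrightarrow> D f \<in> borel_measurable M"
  by (rule L2H_measurable[OF D_L2])

lemma dom_zero: "(\<lambda>_. 0) \<in> Dom"
  by (rule frame_conjs[THEN conjunct2, THEN conjunct2, THEN conjunct1])

lemma dom_add:
  assumes "f \<in> Dom" "g \<in> Dom"
  shows "(\<lambda>x. f x + g x) \<in> Dom" "AE x in M. D (\<lambda>y. f y + g y) x = D f x + D g x"
  using frame_conjs[THEN conjunct2, THEN conjunct2, THEN conjunct2, THEN conjunct1] assms by blast+

lemma dom_cmult:
  assumes "f \<in> Dom"
  shows "(\<lambda>x. a * f x) \<in> Dom" "AE x in M. D (\<lambda>y. a * f y) x = a *\<^sub>R D f x"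
  using frame_conjs[THEN conjunct2, THEN conjunct2, THEN conjunct2, THEN conjunct2, THEN conjunct1] assms
  by blast+

lemma D_zero: "AE x in M. D (\<lambda>_. 0) x = 0"
  using dom_cmult(2)[OF dom_zero, of 0] by simp

lemma dom_diff:
  assumes "f \<in> Dom" "g \<in> Dom"
  shows "(\<lambda>x. f x - g x) \<in> Dom" "AE x in M. D (\<lambda>y. f y - g y) x = D f x - D g x"
proof -
  have m: "(\<lambda>x. (-1) * g x) \<in> Dom" "AE x in M. D (\<lambda>y. (-1) * g y) x = (-1) *\<^sub>R D g x"
    using dom_cmult[OF assms(2), of "-1"] by auto
  show "(\<lambda>x. f x - g x) \<in> Dom" using dom_add(1)[OF assms(1) m(1)] by simp
  have "AE x in M. D (\<lambda>y. f y + (-1) * g y) x = D f x + D (\<lambda>y. (-1) * g y) x"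
    by (rule dom_add(2)[OF assms(1) m(1)])
  with m(2) have "AE x in M. D (\<lambda>y. f y + (-1) * g y) x = D f x - D g x"
    by eventually_elim simp
  then show "AE x in M. D (\<lambda>y. f y - g y) x = D f x - D g x" by simp
qed

lemma dom_closed:
  assumes "\<And>n. fs n \<in> Dom" "L2H M f" "L2H M G"
    and "(\<lambda>n. \<integral>x. (fs n x - f x)\<^sup>2 \<partial>M) \<longlonglongrightarrow> 0"
    and "(\<lambda>n. \<integral>x. (norm (D (fs n) x - G x))\<^sup>2 \<partial>M) \<longlonglongrightarrow> 0"
  shows "f \<in> Dom" "AE x in M. D f x = G x"
proof -
  have "(\<lambda>n. norm2 M (\<lambda>x. fs n x - f x)) \<longlonglongrightarrow> 0"
    using assms(4) by (simp add: norm2_eq_norm2H norm2H_tendsto_0_iff)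
  moreover have "(\<lambda>n. norm2H M (\<lambda>x. D (fs n) x - G x)) \<longlonglongrightarrow> 0"
    using assms(5) by (simp add: norm2H_tendsto_0_iff)
  moreover have "L2 M f" using assms(2) by (simp add: L2_iff_L2H)
  ultimately show "f \<in> Dom" "AE x in M. D f x = G x"
    using frame_conjs[THEN conjunct2, THEN conjunct2, THEN conjunct2, THEN conjunct2, THEN conjunct2,
        THEN conjunct2, THEN conjunct1, rule_format, of fs f G] assms(1,3)
    by blast+
qed

text \<open>The form in which closedness is mostly used: pointwise limits with square-integrable
  majorants for functions and gradients. \<open>Gs\<close> is kept apart from
  \<open>D (fs n)\<close> because the chain and product rules give gradients only almost
  everywhere.\<close>

lemma dom_dominated:
  assumes fs: "\<And>n. fs n \<in> Dom" and D: "\<And>n. AE x in M. D (fs n) x = Gs n x"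
    and m: "f \<in> borel_measurable M" "G \<in> borel_measurable M"
    and "AE x in M. (\<lambda>n. fs n x) \<longlonglongrightarrow> f x" "\<And>n. AE x in M. \<bar>fs n x\<bar> \<le> h x" "L2H M h"
    and "AE x in M. (\<lambda>n. Gs n x) \<longlonglongrightarrow> G x" "\<And>n. AE x in M. norm (Gs n x) \<le> h' x" "L2H M h'"
  shows "f \<in> Dom" "AE x in M. D f x = G x"
proof -
  have 1: "L2H M f" "(\<lambda>n. \<integral>x. (norm (fs n x - f x))\<^sup>2 \<partial>M) \<longlonglongrightarrow> 0"
    using L2H_dominated_convergence[of fs M f h] dom_measurable[OF fs] m assms(5,6,7) by (auto simp del: real_norm_def simp: real_norm_def[symmetric])
  have all: "AE x in M. \<forall>n. D (fs n) x = Gs n x" using D by (simp add: AE_all_countable)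
  have 2: "L2H M G" "(\<lambda>n. \<integral>x. (norm (D (fs n) x - G x))\<^sup>2 \<partial>M) \<longlonglongrightarrow> 0"
  proof -
    have "AE x in M. (\<lambda>n. D (fs n) x) \<longlonglongrightarrow> G x" using all assms(8) by eventually_elim simp
    moreover have "AE x in M. norm (D (fs n) x) \<le> h' x" for n
      using all assms(9)[of n] by eventually_elim simp
    ultimately show "L2H M G" "(\<lambda>n. \<integral>x. (norm (D (fs n) x - G x))\<^sup>2 \<partial>M) \<longlonglongrightarrow> 0"
      using L2H_dominated_convergence[of "\<lambda>n. D (fs n)" M G h'] D_measurable[OF fs] m assms(10) by blast+
  qed
  show "f \<in> Dom" "AE x in M. D f x = G x"
    using dom_closed[of fs f G] fs 1 2 by simp_all
qed

text \<open>The derivation property enters only here, and only for a single function; products are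
  recovered from squares by polarisation.\<close>

lemma chain_rule:
  assumes f: "f \<in> Dom" and der: "\<And>x. (F has_real_derivative F' x) (at x)"
    and cont: "continuous_on UNIV F'" and bdd: "\<And>x. \<bar>F' x\<bar> \<le> C" and F0: "F 0 = 0"
  shows "(\<lambda>x. F (f x)) \<in> Dom" "AE x in M. D (\<lambda>y. F (f y)) x = F' (f x) *\<^sub>R D f x"
proof -
  have C1: "C1_bdd 1 (\<lambda>v. F (v 0)) (\<lambda>j v. F' (v 0))"
    unfolding C1_bdd_def
  proof (intro conjI allI impI ballI)
    show "F 0 = 0" by fact
  next
    fix j :: nat and x assume "j < 1" "x \<in> Rvec 1"
    then show "((\<lambda>t. F ((x(j := t)) 0)) has_real_derivative F' (x 0)) (at (x j))"
      using der by simp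
  next
    have "continuous_on (Rvec 1) (\<lambda>v::nat \<Rightarrow> real. v 0)"
      by (rule continuous_on_subset[OF continuous_on_product_coordinates]) auto
    then show "continuous_on (Rvec 1) (\<lambda>v. F' (v 0))"
      by (rule continuous_on_compose2[OF cont]) auto
  next
    show "bounded ((\<lambda>v. F' (v 0)) ` Rvec 1)"
      using bdd by (auto simp: bounded_iff)
  qed
  have eq: "(\<lambda>x. F (compose_vec 1 (\<lambda>_. f) x 0)) = (\<lambda>x. F (f x))"
    by (simp add: compose_vec_def)
  from frame_conjs[THEN conjunct2, THEN conjunct2, THEN conjunct2, THEN conjunct2, THEN conjunct2,
      THEN conjunct2, THEN conjunct2, rule_format, of 1 "\<lambda>_. f", OF f C1]
  show "(\<lambda>x. F (f x)) \<in> Dom" "AE x in M. D (\<lambda>y. F (f y)) x = F' (f x) *\<^sub>R D f x"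
    by (simp_all add: compose_vec_def)
qed

end

text \<open>As \<open>a \<rightarrow> 0\<close> these functions truncate, and as \<open>a \<rightarrow> \<infinity>\<close> their derivatives tend to
  the indicator function of \<open>{0}\<close>, which gives the locality of \<open>D\<close>.\<close>

definition cutoff :: "real \<Rightarrow> real \<Rightarrow> real" where
  "cutoff a x = x / (1 + a * x\<^sup>2)"

definition cutoff' :: "real \<Rightarrow> real \<Rightarrow> real" where
  "cutoff' a x = (1 - a * x\<^sup>2) / (1 + a * x\<^sup>2)\<^sup>2"

lemma cutoff_derivative:
  assumes "a \<ge> 0" shows "(cutoff a has_real_derivative cutoff' a x) (at x)"
proof -
  have p: "1 + a * x\<^sup>2 \<noteq> 0" using assms by (smt (verit) mult_nonneg_nonneg zero_le_power2)
  then have "(cutoff a has_real_derivative (1 * (1 + a * x\<^sup>2) - x * (a * (2 * x))) / ((1 + a * x\<^sup>2) * (1 + a * x\<^sup>2))) (at x)"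
    unfolding cutoff_def[abs_def] by (auto intro!: derivative_eq_intros)
  moreover have "1 * (1 + a * x\<^sup>2) - x * (a * (2 * x)) = 1 - a * x\<^sup>2"
    by (simp add: power2_eq_square)
  ultimately show ?thesis by (simp add: cutoff'_def power2_eq_square)
qed

lemma abs_cutoff: "a \<ge> 0 \<Longrightarrow> \<bar>cutoff a x\<bar> = \<bar>x\<bar> / (1 + a * x\<^sup>2)"
  by (simp add: cutoff_def abs_divide)

lemma abs_cutoff_le: "a \<ge> 0 \<Longrightarrow> \<bar>cutoff a x\<bar> \<le> \<bar>x\<bar>"
proof -
  assume a: "a \<ge> 0"
  have "1 + a * x\<^sup>2 \<ge> 1" using a by simp
  then have "\<bar>x\<bar> / (1 + a * x\<^sup>2) \<le> \<bar>x\<bar> / 1" by (intro divide_left_mono) auto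
  then show ?thesis using a by (simp add: abs_cutoff)
qed

lemma abs_cutoff'_le_inverse: 
  assumes "a \<ge> 0" shows "\<bar>cutoff' a x\<bar> \<le> 1 / (1 + a * x\<^sup>2)"
proof -
  have p: "0 \<le> a * x\<^sup>2" using assms by simp
  then have "\<bar>1 - a * x\<^sup>2\<bar> / (1 + a * x\<^sup>2)\<^sup>2 \<le> (1 + a * x\<^sup>2) / (1 + a * x\<^sup>2)\<^sup>2"
    by (intro divide_right_mono) auto
  also have "\<dots> = 1 / (1 + a * x\<^sup>2)" using p by (simp add: power2_eq_square)
  finally show ?thesis by (simp add: cutoff'_def)
qed

lemma abs_cutoff'_le: "a \<ge> 0 \<Longrightarrow> \<bar>cutoff' a x\<bar> \<le> 1"
proof -
  assume a: "a \<ge> 0"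
  have "1 / (1 + a * x\<^sup>2) \<le> 1" using a by (simp add: add_pos_nonneg)
  then show ?thesis using abs_cutoff'_le_inverse[OF a, of x] by linarith
qed

lemma continuous_cutoff':
  assumes "a \<ge> 0" shows "continuous_on UNIV (cutoff' a)"
proof -
  have "1 + a * x\<^sup>2 \<noteq> 0" for x
    using assms by (smt (verit) mult_nonneg_nonneg zero_le_power2)
  then show ?thesis unfolding cutoff'_def[abs_def] by (intro continuous_intros) auto
qed

lemma cutoff_bounded:
  assumes "a > 0" shows "\<bar>cutoff a x\<bar> \<le> 1 / sqrt a"
proof -
  have "2 * (sqrt a * \<bar>x\<bar>) \<le> 1 + a * x\<^sup>2"
    using sum_squares_bound[of 1 "sqrt a * \<bar>x\<bar>"] assms by (simp add: power_mult_distrib)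
  moreover have "0 \<le> sqrt a * \<bar>x\<bar>" using assms by simp
  ultimately have "sqrt a * \<bar>x\<bar> \<le> 1 + a * x\<^sup>2" by linarith
  moreover have "1 + a * x\<^sup>2 > 0" using assms by (simp add: add_pos_nonneg)
  ultimately show ?thesis using assms by (simp add: abs_cutoff pos_divide_le_eq pos_le_divide_eq mult.commute)
qed

lemma cutoff_tendsto_id: "(\<lambda>n. cutoff (inverse (real (Suc n))) x) \<longlonglongrightarrow> x"
proof -
  have "(\<lambda>n. x / (1 + inverse (real (Suc n)) * x\<^sup>2)) \<longlonglongrightarrow> x / (1 + 0 * x\<^sup>2)"
    by (intro tendsto_intros LIMSEQ_inverse_real_of_nat) auto
  then show ?thesis by (simp add: cutoff_def)
qed

lemma cutoff'_tendsto_1: "(\<lambda>n. cutoff' (inverse (real (Suc n))) x) \<longlonglongrightarrow> 1"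
proof -
  have "(\<lambda>n. (1 - inverse (real (Suc n)) * x\<^sup>2) / (1 + inverse (real (Suc n)) * x\<^sup>2)\<^sup>2)
      \<longlonglongrightarrow> (1 - 0 * x\<^sup>2) / (1 + 0 * x\<^sup>2)\<^sup>2"
    by (intro tendsto_intros LIMSEQ_inverse_real_of_nat) auto
  then show ?thesis by (simp add: cutoff'_def)
qed

lemma inverse_quadratic_tendsto_0:
  assumes "x \<noteq> 0" shows "(\<lambda>n. 1 / (1 + real n * x\<^sup>2)) \<longlonglongrightarrow> 0"
proof (rule Lim_null_comparison)
  have "(\<lambda>n. (1 / x\<^sup>2) * (1 / real n)) \<longlonglongrightarrow> (1 / x\<^sup>2) * 0"
    by (intro tendsto_intros lim_1_over_n)
  then show "(\<lambda>n. (1 / x\<^sup>2) * (1 / real n)) \<longlonglongrightarrow> 0" by simp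
  show "\<forall>\<^sub>F n in sequentially. norm (1 / (1 + real n * x\<^sup>2)) \<le> (1 / x\<^sup>2) * (1 / real n)"
  proof (rule eventually_sequentiallyI[of 1])
    fix n :: nat assume "1 \<le> n"
    then have "0 < real n * x\<^sup>2" using assms by simp
    then have "1 / (1 + real n * x\<^sup>2) \<le> 1 / (real n * x\<^sup>2)" by (intro divide_left_mono) auto
    with \<open>0 < real n * x\<^sup>2\<close> show "norm (1 / (1 + real n * x\<^sup>2)) \<le> (1 / x\<^sup>2) * (1 / real n)"
      by (simp add: mult.commute)
  qed
qed

lemma cutoff'_tendsto_indicator: "(\<lambda>n. cutoff' (real n) x) \<longlonglongrightarrow> (if x = 0 then 1 else 0)"
proof (cases "x = 0")
  case True then show ?thesis by (simp add: cutoff'_def)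
next
  case False
  have "(\<lambda>n. cutoff' (real n) x) \<longlonglongrightarrow> 0"
    by (rule Lim_null_comparison[OF _ inverse_quadratic_tendsto_0[OF False]])
      (simp add: abs_cutoff'_le_inverse)
  with False show ?thesis by simp
qed

lemma cutoff_tendsto_0: "(\<lambda>n. cutoff (real n) x) \<longlonglongrightarrow> 0"
proof (cases "x = 0")
  case True then show ?thesis by (simp add: cutoff_def)
next
  case False
  have "(\<lambda>n. x * (1 / (1 + real n * x\<^sup>2))) \<longlonglongrightarrow> x * 0"
    by (intro tendsto_intros inverse_quadratic_tendsto_0 False)
  then show ?thesis by (simp add: cutoff_def)
qed

section \<open>Locality, product rule and weak closedness\<close>

context dirichlet
begin

lemma cutoff_dom:
  assumes "f \<in> Dom" "a \<ge> 0"
  shows "(\<lambda>x. cutoff a (f x)) \<in> Dom" "AE x in M. D (\<lambda>y. cutoff a (f y)) x = cutoff' a (f x) *\<^sub>R D f x"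
  using chain_rule[OF assms(1) cutoff_derivative[OF assms(2)] continuous_cutoff'[OF assms(2)]
      abs_cutoff'_le[OF assms(2)]]
  by (auto simp: cutoff_def)

lemma measurable_cutoff [measurable]:
  "cutoff a \<in> borel_measurable borel" "cutoff' a \<in> borel_measurable borel"
  unfolding cutoff_def[abs_def] cutoff'_def[abs_def] by measurable

text \<open>The functions \<open>cutoff n (f x)\<close> tend to 0, while their gradients tend to
  \<open>D f\<close> on the zero set of \<open>f\<close> and to 0 elsewhere. Closedness identifies
  this limit with the gradient of the zero function.\<close>

lemma D_eq_0_on_zero_set:
  assumes f: "f \<in> Dom" shows "AE x in M. f x = 0 \<longrightarrow> D f x = 0"
proof -
  have [measurable]: "f \<in> borel_measurable M" "D f \<in> borel_measurable M"
    using f by (auto intro: dom_measurable D_measurable)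
  have "AE x in M. D (\<lambda>_. 0) x = (if f x = 0 then 1 else 0) *\<^sub>R D f x"
  proof (rule dom_dominated(2))
    show "(\<lambda>x. cutoff (real n) (f x)) \<in> Dom" for n by (rule cutoff_dom) (use f in auto)
    show "AE x in M. D (\<lambda>x. cutoff (real n) (f x)) x = cutoff' (real n) (f x) *\<^sub>R D f x" for n
      by (rule cutoff_dom) (use f in auto)
    show "AE x in M. (\<lambda>n. cutoff (real n) (f x)) \<longlonglongrightarrow> 0" by (simp add: cutoff_tendsto_0)
    show "AE x in M. \<bar>cutoff (real n) (f x)\<bar> \<le> norm (f x)" for n by (simp add: abs_cutoff_le)
    show "L2H M (\<lambda>x. norm (f x))" by (rule L2H_bound[OF dom_L2[OF f], where C = 1]) auto
    show "AE x in M. (\<lambda>n. cutoff' (real n) (f x) *\<^sub>R D f x) \<longlonglongrightarrow> (if f x = 0 then 1 else 0) *\<^sub>R D f x"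
      by (intro AE_I2 tendsto_intros cutoff'_tendsto_indicator)
    show "AE x in M. norm (cutoff' (real n) (f x) *\<^sub>R D f x) \<le> norm (D f x)" for n
      using abs_cutoff'_le[of "real n"] by (auto intro!: mult_left_le_one_le)
    show "L2H M (\<lambda>x. norm (D f x))" by (rule L2H_bound[OF D_L2[OF f], where C = 1]) auto
  qed measurable
  with D_zero show ?thesis by eventually_elim auto
qed

lemma D_eq_on_equal_set:
  assumes "f \<in> Dom" "g \<in> Dom" shows "AE x in M. f x = g x \<longrightarrow> D f x = D g x"
  using D_eq_0_on_zero_set[OF dom_diff(1)[OF assms]] dom_diff(2)[OF assms]
  by eventually_elim auto

text \<open>The derivative of the square is unbounded, so the chain rule is applied to
  \<open>x^2 / (1 + a x^2)\<close> with \<open>a\<close> tending to 0. The bound on \<open>f\<close>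
  supplies majorants that do not depend on \<open>a\<close>.\<close>

lemma dom_square:
  assumes f: "f \<in> Dom" and bdd: "AE x in M. \<bar>f x\<bar> \<le> C"
  shows "(\<lambda>x. (f x)\<^sup>2) \<in> Dom" "AE x in M. D (\<lambda>x. (f x)\<^sup>2) x = (2 * f x) *\<^sub>R D f x"
proof -
  have [measurable]: "f \<in> borel_measurable M" "D f \<in> borel_measurable M"
    using f by (auto intro: dom_measurable D_measurable)
  define a where "a n = inverse (real (Suc n))" for n
  have a: "a n > 0" for n by (simp add: a_def)
  have a0: "a \<longlonglongrightarrow> 0" unfolding a_def[abs_def] by (rule LIMSEQ_inverse_real_of_nat)
  define F where "F n x = x\<^sup>2 / (1 + a n * x\<^sup>2)" for n x
  define F' where "F' n x = 2 * x / (1 + a n * x\<^sup>2)\<^sup>2" for n x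
  have p: "1 + a n * x\<^sup>2 \<ge> 1" for n x using a[of n] by simp
  have p': "1 + a n * x\<^sup>2 \<noteq> 0" for n x using p[of n x] by linarith
  have der: "(F n has_real_derivative F' n x) (at x)" for n x
  proof -
    have "(F n has_real_derivative (2 * x * (1 + a n * x\<^sup>2) - x\<^sup>2 * (a n * (2 * x))) / ((1 + a n * x\<^sup>2) * (1 + a n * x\<^sup>2))) (at x)"
      unfolding F_def[abs_def] using p'[of n x] by (auto intro!: derivative_eq_intros)
    moreover have "2 * x * (1 + a n * x\<^sup>2) - x\<^sup>2 * (a n * (2 * x)) = 2 * x"
      by (simp add: power2_eq_square algebra_simps)
    ultimately show ?thesis by (simp add: F'_def power2_eq_square)
  qed
  have cont: "continuous_on UNIV (F' n)" for n
    unfolding F'_def[abs_def] by (intro continuous_intros) (simp add: p')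
  have sq: "1 + a n * x\<^sup>2 \<le> (1 + a n * x\<^sup>2)\<^sup>2" for n x
    using p[of n x] by (simp add: self_le_power)
  have bF': "\<bar>F' n x\<bar> \<le> 2 / sqrt (a n)" for n x
  proof -
    have "\<bar>F' n x\<bar> = 2 * \<bar>x\<bar> / (1 + a n * x\<^sup>2)\<^sup>2" by (simp add: F'_def abs_mult)
    also have "\<dots> \<le> 2 * \<bar>x\<bar> / (1 + a n * x\<^sup>2)"
      using p[of n x] sq[of n x] by (intro divide_left_mono mult_pos_pos) auto
    also have "\<dots> = 2 * \<bar>cutoff (a n) x\<bar>" using a[of n] by (simp add: abs_cutoff)
    also have "\<dots> \<le> 2 / sqrt (a n)" using cutoff_bounded[OF a[of n], of x] by simp
    finally show ?thesis .
  qed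
  have F'2: "\<bar>F' n x\<bar> \<le> 2 * \<bar>x\<bar>" for n x
  proof -
    have "\<bar>F' n x\<bar> = 2 * \<bar>x\<bar> / (1 + a n * x\<^sup>2)\<^sup>2" by (simp add: F'_def abs_mult)
    also have "\<dots> \<le> 2 * \<bar>x\<bar> / 1"
      using p[of n x] sq[of n x] by (intro divide_left_mono) auto
    finally show ?thesis by simp
  qed
  have [measurable]: "F n \<in> borel_measurable borel" "F' n \<in> borel_measurable borel" for n
    unfolding F_def[abs_def] F'_def[abs_def] by measurable
  note ch = chain_rule[OF f der cont bF']
  have le: "\<bar>F n x\<bar> \<le> x\<^sup>2" for n x
  proof -
    have "x\<^sup>2 / (1 + a n * x\<^sup>2) \<le> x\<^sup>2 / 1" using p[of n x] by (intro divide_left_mono) auto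
    then show ?thesis using p[of n x] by (simp add: F_def)
  qed
  have fsD: "(\<lambda>x. F n (f x)) \<in> Dom" "AE x in M. D (\<lambda>x. F n (f x)) x = F' n (f x) *\<^sub>R D f x" for n
    using ch[of n] by (auto simp: F_def)
  have lim: "AE x in M. (\<lambda>n. F n (f x)) \<longlonglongrightarrow> (f x)\<^sup>2"
  proof (rule AE_I2)
    fix x
    have "(\<lambda>n. F n (f x)) \<longlonglongrightarrow> (f x)\<^sup>2 / (1 + 0 * (f x)\<^sup>2)"
      unfolding F_def by (intro tendsto_intros a0) auto
    then show "(\<lambda>n. F n (f x)) \<longlonglongrightarrow> (f x)\<^sup>2" by simp
  qed
  have lim': "AE x in M. (\<lambda>n. F' n (f x) *\<^sub>R D f x) \<longlonglongrightarrow> (2 * f x) *\<^sub>R D f x"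
  proof (rule AE_I2)
    fix x
    have "(\<lambda>n. F' n (f x) *\<^sub>R D f x) \<longlonglongrightarrow> (2 * f x / (1 + 0 * (f x)\<^sup>2)\<^sup>2) *\<^sub>R D f x"
      unfolding F'_def by (intro tendsto_intros a0) auto
    then show "(\<lambda>n. F' n (f x) *\<^sub>R D f x) \<longlonglongrightarrow> (2 * f x) *\<^sub>R D f x" by simp
  qed
  have b1: "AE x in M. \<bar>F n (f x)\<bar> \<le> C * norm (f x)" for n
    using bdd
  proof eventually_elim
    case (elim x)
    have "(f x)\<^sup>2 \<le> C * \<bar>f x\<bar>"
      using mult_right_mono[OF elim, of "\<bar>f x\<bar>"] by (simp add: power2_eq_square)
    then show ?case using le[of n "f x"] by simp
  qed
  have b2: "AE x in M. norm (F' n (f x) *\<^sub>R D f x) \<le> (2 * C) * norm (D f x)" for n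
    using bdd
  proof eventually_elim
    case (elim x)
    then have "\<bar>F' n (f x)\<bar> \<le> 2 * C" using F'2[of n "f x"] by linarith
    then show ?case by (simp add: mult_right_mono)
  qed
  have L: "L2H M (\<lambda>x. C * norm (f x))" "L2H M (\<lambda>x. (2 * C) * norm (D f x))"
    using L2H_bound[OF dom_L2[OF f], of "\<lambda>x. C * norm (f x)" "\<bar>C\<bar>"]
      L2H_bound[OF D_L2[OF f], of "\<lambda>x. (2 * C) * norm (D f x)" "\<bar>2 * C\<bar>"]
    by (auto simp: abs_mult)
  show "(\<lambda>x. (f x)\<^sup>2) \<in> Dom" "AE x in M. D (\<lambda>x. (f x)\<^sup>2) x = (2 * f x) *\<^sub>R D f x"
    using dom_dominated[OF fsD _ _ lim b1 L(1) lim' b2 L(2)] by auto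
qed

lemma dom_mult:
  assumes f: "f \<in> Dom" and g: "g \<in> Dom"
    and bf: "AE x in M. \<bar>f x\<bar> \<le> C" and bg: "AE x in M. \<bar>g x\<bar> \<le> C'"
  shows "(\<lambda>x. f x * g x) \<in> Dom" "AE x in M. D (\<lambda>x. f x * g x) x = f x *\<^sub>R D g x + g x *\<^sub>R D f x"
proof -
  have bp: "AE x in M. \<bar>f x + g x\<bar> \<le> C + C'" and bm: "AE x in M. \<bar>f x - g x\<bar> \<le> C + C'"
    using bf bg by (eventually_elim, linarith)+
  note p = dom_add[OF f g] and m = dom_diff[OF f g]
  note p2 = dom_square[OF p(1) bp] and m2 = dom_square[OF m(1) bm]
  note d = dom_diff[OF p2(1) m2(1)]
  note e = dom_cmult[OF d(1), of "1/4"]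
  have eq: "(\<lambda>x. 1 / 4 * ((f x + g x)\<^sup>2 - (f x - g x)\<^sup>2)) = (\<lambda>x. f x * g x)"
    by (auto simp: power2_eq_square algebra_simps)
  show "(\<lambda>x. f x * g x) \<in> Dom" using e(1) unfolding eq .
  have "AE x in M. D (\<lambda>x. 1 / 4 * ((f x + g x)\<^sup>2 - (f x - g x)\<^sup>2)) x = f x *\<^sub>R D g x + g x *\<^sub>R D f x"
    using e(2) d(2) p2(2) m2(2) p(2) m(2)
  proof eventually_elim
    case (elim x)
    have "(2 * (a + b)) *\<^sub>R (X + Y) - (2 * (a - b)) *\<^sub>R (X - Y) = 4 *\<^sub>R (a *\<^sub>R Y + b *\<^sub>R X)"
      for a b :: real and X Y :: 'h
    proof -
      have t: "(2 * c) *\<^sub>R Z = c *\<^sub>R Z + c *\<^sub>R Z" for c :: real and Z :: 'h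
        by (simp only: mult_2 scaleR_add_left)
      have f: "4 *\<^sub>R Z = Z + Z + (Z + Z)" for Z :: 'h
        by (simp flip: scaleR_2)
      show ?thesis unfolding t f by (simp add: algebra_simps)
    qed
    from this[of "f x" "g x" "D f x" "D g x"] elim show ?case by simp
  qed
  then show "AE x in M. D (\<lambda>x. f x * g x) x = f x *\<^sub>R D g x + g x *\<^sub>R D f x" unfolding eq .
qed

text \<open>Weak closedness without weak topologies: near-minimisers of the energy over the convex sets
  of admissible functions that are \<open>L\<^sup>2\<close>-close to \<open>f\<close> are Cauchy by the parallelogram law.\<close>

lemma dom_weak_limit:
  assumes fs: "\<And>n. fs n \<in> Dom" and L: "L2H M f"
    and lim: "(\<lambda>n. \<integral>x. (fs n x - f x)\<^sup>2 \<partial>M) \<longlonglongrightarrow> 0"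
    and bdd: "\<And>n. (\<integral>x. (norm (D (fs n) x))\<^sup>2 \<partial>M) \<le> C"
    and one: "\<And>n. AE x in M. x \<in> S \<longrightarrow> norm (D (fs n) x) \<le> 1"
  shows "f \<in> Dom" "AE x in M. x \<in> S \<longrightarrow> norm (D f x) \<le> 1"
proof -
  define q where "q g = (\<integral>x. (norm (D g x))\<^sup>2 \<partial>M)" for g
  \<comment> \<open>Both constraints are convex, so midpoints stay inside; keeping the pointwise
    gradient bound in the set is what carries it to the limit.\<close>
  define A where "A \<delta> = {g \<in> Dom. norm2 M (\<lambda>x. g x - f x) \<le> \<delta> \<and> (AE x in M. x \<in> S \<longrightarrow> norm (D g x) \<le> 1)}" for \<delta>
  define I where "I \<delta> = Inf (q ` A \<delta>)" for \<delta>
  have q0: "0 \<le> q g" for g by (simp add: q_def)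
  have bb: "bdd_below (q ` A \<delta>)" for \<delta> using q0 by (auto intro: bdd_belowI[of _ 0])
  have lim2: "(\<lambda>n. norm2 M (\<lambda>x. fs n x - f x)) \<longlonglongrightarrow> 0"
    using lim by (simp add: norm2_eq_norm2H norm2H_tendsto_0_iff)
  have ex: "\<exists>g\<in>A \<delta>. q g \<le> C" if d: "\<delta> > 0" for \<delta>
  proof -
    obtain n where "norm2 M (\<lambda>x. fs n x - f x) < \<delta>"
      using order_tendstoD(2)[OF lim2 d] by (auto dest: eventually_happens)
    then have "fs n \<in> A \<delta>" using fs one by (simp add: A_def)
    then show ?thesis using bdd by (auto simp: q_def)
  qed
  have Amono: "A \<delta> \<subseteq> A \<delta>'" if "\<delta> \<le> \<delta>'" for \<delta> \<delta>' using that by (auto simp: A_def)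
  have Imono: "I \<delta>' \<le> I \<delta>" if "0 < \<delta>" "\<delta> \<le> \<delta>'" for \<delta> \<delta>'
    unfolding I_def using ex[OF that(1)] Amono[OF that(2)] bb by (intro cInf_superset_mono) auto
  have IC: "I \<delta> \<le> C" if "\<delta> > 0" for \<delta>
    using ex[OF that] cInf_lower[OF _ bb] unfolding I_def by (meson imageI order_trans)
  define a where "a n = inverse (real (Suc n))" for n
  have a: "a n > 0" for n by (simp add: a_def)
  have a0: "a \<longlonglongrightarrow> 0" unfolding a_def[abs_def] by (rule LIMSEQ_inverse_real_of_nat)
  have amono: "a m \<le> a n" if "n \<le> m" for m n using that by (simp add: a_def)
  have "\<exists>g\<in>A (a n). q g < I (a n) + a n" for n
  proof -
    have "Inf (q ` A (a n)) < I (a n) + a n" using a by (simp add: I_def)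
    moreover have "q ` A (a n) \<noteq> {}" using ex[OF a[of n]] by auto
    ultimately have "\<exists>y\<in>q ` A (a n). y < I (a n) + a n" by (rule cInf_lessD[rotated])
    then show ?thesis by auto
  qed
  then obtain g where g: "\<And>n. g n \<in> A (a n)" "\<And>n. q (g n) < I (a n) + a n" by metis
  have gD: "g n \<in> Dom" for n using g(1) by (simp add: A_def)
  have n2sub: "norm2 M (\<lambda>x. (1/2) * (g n x + g m x) - f x) \<le> a n" if nm: "n \<le> m" for n m
  proof -
    have "(\<lambda>x. (1/2) * (g n x + g m x) - f x) = (\<lambda>x. (1/2) * ((g n x - f x) + (g m x - f x)))"
      by (auto simp: field_simps)
    moreover have "norm2 M (\<lambda>x. (1/2) * ((g n x - f x) + (g m x - f x))) \<le> a n"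
    proof -
      have L1: "L2H M (\<lambda>x. g n x - f x)" "L2H M (\<lambda>x. g m x - f x)"
        using gD dom_L2 L by (auto intro: L2H_diff)
      have i: "(\<integral>x. (g n x - f x)\<^sup>2 \<partial>M) \<le> (a n)\<^sup>2" if "g n \<in> A d" "d \<le> a n'" "n' = n" for n d n'
      proof -
        have "sqrt (\<integral>x. (g n x - f x)\<^sup>2 \<partial>M) \<le> a n"
          using that by (simp add: A_def norm2_def)
        then show ?thesis using real_sqrt_le_iff by (simp add: sqrt_le_D)
      qed
      have i1: "(\<integral>x. (g n x - f x)\<^sup>2 \<partial>M) \<le> (a n)\<^sup>2" using i[OF g(1)] by simp
      have "(\<integral>x. (g m x - f x)\<^sup>2 \<partial>M) \<le> (a m)\<^sup>2" using i[OF g(1)] by simp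
      also have "\<dots> \<le> (a n)\<^sup>2" using amono[OF nm] a[of m] by (intro power_mono) auto
      finally have i2: "(\<integral>x. (g m x - f x)\<^sup>2 \<partial>M) \<le> (a n)\<^sup>2" .
      have "(\<integral>x. ((1/2) * ((g n x - f x) + (g m x - f x)))\<^sup>2 \<partial>M)
          = (1/4) * (\<integral>x. (norm ((g n x - f x) + (g m x - f x)))\<^sup>2 \<partial>M)"
        by (simp add: power_divide)
      also have "\<dots> \<le> (1/4) * (2 * (a n)\<^sup>2 + 2 * (a n)\<^sup>2)"
        using integral_norm_add_square_le[OF L1] i1 i2 by simp
      finally have "(\<integral>x. ((1/2) * ((g n x - f x) + (g m x - f x)))\<^sup>2 \<partial>M) \<le> (a n)\<^sup>2" by simp
      then show ?thesis unfolding norm2_def using a[of n] by (intro real_le_lsqrt) auto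
    qed
    ultimately show ?thesis by simp
  qed
  have mid: "(\<lambda>x. (1/2) * (g n x + g m x)) \<in> A (a n)" and
    midq: "4 * q (\<lambda>x. (1/2) * (g n x + g m x)) = (\<integral>x. (norm (D (g n) x + D (g m) x))\<^sup>2 \<partial>M)"
    if "n \<le> m" for n m
  proof -
    note s = dom_add[OF gD gD, of n m]
    note h = dom_cmult[OF s(1), of "1/2"]
    have D: "AE x in M. D (\<lambda>x. (1/2) * (g n x + g m x)) x = (1/2) *\<^sub>R (D (g n) x + D (g m) x)"
      using s(2) h(2) by eventually_elim simp
    have "AE x in M. x \<in> S \<longrightarrow> norm (D (g n) x) \<le> 1" "AE x in M. x \<in> S \<longrightarrow> norm (D (g m) x) \<le> 1"
      using g(1) by (auto simp: A_def)
    with D have "AE x in M. x \<in> S \<longrightarrow> norm (D (\<lambda>x. (1/2) * (g n x + g m x)) x) \<le> 1"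
    proof eventually_elim
      case (elim x)
      show ?case
        using norm_triangle_ineq[of "D (g n) x" "D (g m) x"] elim by auto
    qed
    then show "(\<lambda>x. (1/2) * (g n x + g m x)) \<in> A (a n)"
      using h(1) n2sub[OF that] by (simp add: A_def)
    have "q (\<lambda>x. (1/2) * (g n x + g m x)) = (\<integral>x. (1/4) * (norm (D (g n) x + D (g m) x))\<^sup>2 \<partial>M)"
      unfolding q_def
    proof (rule integral_cong_AE)
      show "AE x in M. (norm (D (\<lambda>x. (1/2) * (g n x + g m x)) x))\<^sup>2 = (1/4) * (norm (D (g n) x + D (g m) x))\<^sup>2"
        using D by eventually_elim (simp add: power_divide)
    qed (use D_measurable[OF h(1)] D_measurable[OF gD] in measurable)
    then show "4 * q (\<lambda>x. (1/2) * (g n x + g m x)) = (\<integral>x. (norm (D (g n) x + D (g m) x))\<^sup>2 \<partial>M)" by simp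
  qed
  \<comment> \<open>For \<open>n \<le> m\<close> the midpoint competes in the larger set
    \<open>A (a n)\<close>, so its energy is at least \<open>I (a n)\<close>; the parallelogram law
    turns this into closeness of the two gradients.\<close>
  have est: "(\<integral>x. (norm (D (g n) x - D (g m) x))\<^sup>2 \<partial>M) \<le> 2 * (I (a m) - I (a n)) + 4 * a n" if "n \<le> m" for n m
  proof -
    have i: "integrable M (\<lambda>x. (norm (D (g n) x))\<^sup>2)" "integrable M (\<lambda>x. (norm (D (g m) x))\<^sup>2)"
      "integrable M (\<lambda>x. (norm (D (g n) x + D (g m) x))\<^sup>2)" "integrable M (\<lambda>x. (norm (D (g n) x - D (g m) x))\<^sup>2)"
      using D_L2[OF gD] by (auto intro!: L2H_integrable L2H_add L2H_diff)
    have "(\<integral>x. (norm (D (g n) x - D (g m) x))\<^sup>2 \<partial>M)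
       = (\<integral>x. 2 * (norm (D (g n) x))\<^sup>2 + 2 * (norm (D (g m) x))\<^sup>2 - (norm (D (g n) x + D (g m) x))\<^sup>2 \<partial>M)"
      by (intro Bochner_Integration.integral_cong refl)
        (simp only: power2_norm_eq_inner, simp add: inner_add_left inner_add_right inner_diff_left
          inner_diff_right inner_commute algebra_simps)
    also have "\<dots> = 2 * q (g n) + 2 * q (g m) - 4 * q (\<lambda>x. (1/2) * (g n x + g m x))"
      unfolding midq[OF that] using i by (simp add: q_def)
    also have "\<dots> \<le> 2 * (I (a n) + a n) + 2 * (I (a m) + a m) - 4 * I (a n)"
    proof -
      have "I (a n) \<le> q (\<lambda>x. (1/2) * (g n x + g m x))"
        unfolding I_def using mid[OF that] by (intro cInf_lower bb) auto
      then show ?thesis using g(2)[of n] g(2)[of m] by argo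
    qed
    also have "\<dots> \<le> 2 * (I (a m) - I (a n)) + 4 * a n" using amono[OF that] by argo
    finally show ?thesis .
  qed
  \<comment> \<open>Tightening the constraint raises the infimum, and the given sequence keeps it
    below \<open>C\<close>; hence the infima converge.\<close>
  have "incseq (\<lambda>n. I (a n))" by (rule monoI) (auto intro: Imono a amono)
  then have "convergent (\<lambda>n. I (a n))"
    using IC[OF a] incseq_convergent[of "\<lambda>n. I (a n)" C] convergentI by metis
  then have "Cauchy (\<lambda>n. I (a n))" by (rule convergent_Cauchy)
  have "\<exists>N. \<forall>m\<ge>N. \<forall>n\<ge>N. (\<integral>x. (norm (D (g m) x - D (g n) x))\<^sup>2 \<partial>M) < e" if e: "e > 0" for e
  proof -
    obtain N1 where N1: "\<forall>m\<ge>N1. \<forall>n\<ge>N1. norm (I (a m) - I (a n)) < e / 8"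
      using CauchyD[OF \<open>Cauchy (\<lambda>n. I (a n))\<close>, of "e/8"] e by auto
    obtain N2 where N2: "\<forall>n\<ge>N2. a n < e / 8"
      using order_tendstoD(2)[OF a0, of "e/8"] e by (auto simp: eventually_sequentially)
    have main: "(\<integral>x. (norm (D (g m) x - D (g n) x))\<^sup>2 \<partial>M) < e" if "m \<ge> max N1 N2" "n \<ge> m" for m n
    proof -
      have "norm (I (a n) - I (a m)) < e / 8" "a m < e / 8" using N1 N2 that by auto
      then show ?thesis using est[OF that(2)] by (simp add: abs_if split: if_splits)
    qed
    have "(\<integral>x. (norm (D (g m) x - D (g n) x))\<^sup>2 \<partial>M) < e" if "m \<ge> max N1 N2" "n \<ge> max N1 N2" for m n
      using main[of m n] main[of n m] that by (cases "m \<le> n") (auto simp: norm_minus_commute)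
    then show ?thesis by blast
  qed
  then obtain G where G: "L2H M G" "(\<lambda>n. \<integral>x. (norm (D (g n) x - G x))\<^sup>2 \<partial>M) \<longlonglongrightarrow> 0"
    using L2H_complete[of M "\<lambda>n. D (g n)"] D_L2[OF gD] by blast
  have "(\<lambda>n. norm2 M (\<lambda>x. g n x - f x)) \<longlonglongrightarrow> 0"
  proof (rule Lim_null_comparison[OF _ a0])
    show "\<forall>\<^sub>F n in sequentially. norm (norm2 M (\<lambda>x. g n x - f x)) \<le> a n"
      using g(1) by (auto simp: A_def norm2_def)
  qed
  then have gf: "(\<lambda>n. \<integral>x. (g n x - f x)\<^sup>2 \<partial>M) \<longlonglongrightarrow> 0"
    by (simp add: norm2_eq_norm2H norm2H_tendsto_0_iff)
  note fin = dom_closed[OF gD L G(1) gf G(2)]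
  show "f \<in> Dom" by (rule fin(1))
  obtain r where r: "strict_mono r" "AE x in M. (\<lambda>n. D (g (r n)) x) \<longlonglongrightarrow> G x"
    using L2H_tendsto_AE_subseq[of M "\<lambda>n. D (g n)" G] L2H_diff[OF D_L2[OF gD] G(1)] G(2) by blast
  have "AE x in M. \<forall>n. x \<in> S \<longrightarrow> norm (D (g n) x) \<le> 1"
    unfolding AE_all_countable using g(1) by (simp add: A_def)
  with r(2) fin(2) show "AE x in M. x \<in> S \<longrightarrow> norm (D f x) \<le> 1"
  proof eventually_elim
    case (elim x)
    show ?case
    proof
      assume "x \<in> S"
      have "(\<lambda>n. norm (D (g (r n)) x)) \<longlonglongrightarrow> norm (G x)" by (intro tendsto_intros elim)
      then have "norm (G x) \<le> 1" by (rule LIMSEQ_le_const2) (use elim \<open>x \<in> S\<close> in auto)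
      then show "norm (D f x) \<le> 1" using elim by simp
    qed
  qed
qed

end

section \<open>Convergence in the form norm\<close>

context dirichlet
begin

text \<open>Convergence in the form norm, split into the two square integrals in which closedness
  and dominated convergence are phrased. Membership in \<open>Dom\<close> is part of it because
  \<open>D\<close> is a total function whose values outside \<open>Dom\<close> mean nothing.\<close>

definition conv1 :: "(nat \<Rightarrow> 'a \<Rightarrow> real) \<Rightarrow> ('a \<Rightarrow> real) \<Rightarrow> bool" where
  "conv1 fs f \<longleftrightarrow> (\<forall>n. fs n \<in> Dom) \<and> f \<in> Dom
     \<and> (\<lambda>n. \<integral>x. (fs n x - f x)\<^sup>2 \<partial>M) \<longlonglongrightarrow> 0
     \<and> (\<lambda>n. \<integral>x. (norm (D (fs n) x - D f x))\<^sup>2 \<partial>M) \<longlonglongrightarrow> 0"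

lemma E0_self: "E0 M D f f = (1/2) * (\<integral>x. (norm (D f x))\<^sup>2 \<partial>M)"
  by (simp add: E0_def power2_norm_eq_inner)

lemma E0l_self: "E0l M D l f f = (1/2) * (\<integral>x. (norm (D f x))\<^sup>2 \<partial>M) + l * (\<integral>x. (f x)\<^sup>2 \<partial>M)"
  by (simp add: E0l_def E0_self power2_eq_square)

lemma E0l_nonneg: "0 \<le> l \<Longrightarrow> 0 \<le> E0l M D l f f"
  by (simp add: E0l_self)

lemma integral_norm_D_diff:
  assumes "f \<in> Dom" "g \<in> Dom"
  shows "(\<integral>x. (norm (D (\<lambda>x. f x - g x) x))\<^sup>2 \<partial>M) = (\<integral>x. (norm (D f x - D g x))\<^sup>2 \<partial>M)"
proof (rule integral_cong_AE)
  show "AE x in M. (norm (D (\<lambda>x. f x - g x) x))\<^sup>2 = (norm (D f x - D g x))\<^sup>2"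
    using dom_diff(2)[OF assms] by eventually_elim simp
qed (use D_measurable[OF dom_diff(1)[OF assms]] D_measurable[OF assms(1)] D_measurable[OF assms(2)] in measurable)

lemma conv1_iff_E0l:
  assumes "\<And>n. fs n \<in> Dom" "f \<in> Dom"
  shows "conv1 fs f \<longleftrightarrow> (\<lambda>n. E0l M D 1 (\<lambda>x. fs n x - f x) (\<lambda>x. fs n x - f x)) \<longlonglongrightarrow> 0"
    (is "_ \<longleftrightarrow> ?E \<longlonglongrightarrow> 0")
proof -
  have E: "E0l M D 1 (\<lambda>x. fs n x - f x) (\<lambda>x. fs n x - f x)
      = (1/2) * (\<integral>x. (norm (D (fs n) x - D f x))\<^sup>2 \<partial>M) + (\<integral>x. (fs n x - f x)\<^sup>2 \<partial>M)" for n
    using assms by (simp add: E0l_self integral_norm_D_diff)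
  show ?thesis
  proof
    assume "conv1 fs f"
    then have "?E \<longlonglongrightarrow> (1/2) * 0 + 0"
      unfolding E conv1_def by (intro tendsto_intros) auto
    then show "?E \<longlonglongrightarrow> 0" by simp
  next
    assume 0: "?E \<longlonglongrightarrow> 0"
    have "(\<lambda>n. \<integral>x. (fs n x - f x)\<^sup>2 \<partial>M) \<longlonglongrightarrow> 0"
      by (rule Lim_null_comparison[OF _ 0]) (simp add: E)
    moreover from 0 have "(\<lambda>n. 2 * ?E n) \<longlonglongrightarrow> 2 * 0" by (intro tendsto_intros)
    then have 1: "(\<lambda>n. 2 * ?E n) \<longlonglongrightarrow> 0" by simp
    have "(\<lambda>n. \<integral>x. (norm (D (fs n) x - D f x))\<^sup>2 \<partial>M) \<longlonglongrightarrow> 0"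
      by (rule Lim_null_comparison[OF _ 1]) (simp add: E)
    ultimately show "conv1 fs f" using assms by (simp add: conv1_def)
  qed
qed

lemma E0l_diff_triangle:
  assumes f: "f \<in> Dom" and g: "g \<in> Dom" and h: "h \<in> Dom"
  shows "E0l M D 1 (\<lambda>x. f x - h x) (\<lambda>x. f x - h x)
    \<le> 2 * E0l M D 1 (\<lambda>x. f x - g x) (\<lambda>x. f x - g x) + 2 * E0l M D 1 (\<lambda>x. g x - h x) (\<lambda>x. g x - h x)"
proof -
  have "(\<integral>x. (norm ((D f x - D g x) + (D g x - D h x)))\<^sup>2 \<partial>M)
      \<le> 2 * (\<integral>x. (norm (D f x - D g x))\<^sup>2 \<partial>M) + 2 * (\<integral>x. (norm (D g x - D h x))\<^sup>2 \<partial>M)"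
    using assms by (intro integral_norm_add_square_le L2H_diff D_L2)
  moreover have "(\<integral>x. (norm ((f x - g x) + (g x - h x)))\<^sup>2 \<partial>M)
      \<le> 2 * (\<integral>x. (norm (f x - g x))\<^sup>2 \<partial>M) + 2 * (\<integral>x. (norm (g x - h x))\<^sup>2 \<partial>M)"
    using assms by (intro integral_norm_add_square_le L2H_diff dom_L2)
  ultimately show ?thesis
    using assms by (simp add: E0l_self integral_norm_D_diff)
qed

lemma conv1_dominated:
  assumes fs: "\<And>n. fs n \<in> Dom" and f: "f \<in> Dom"
    and D: "\<And>n. AE x in M. D (fs n) x = Gs n x"
    and "AE x in M. (\<lambda>n. fs n x) \<longlonglongrightarrow> f x" "\<And>n. AE x in M. \<bar>fs n x\<bar> \<le> h x" "L2H M h"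
    and "AE x in M. (\<lambda>n. Gs n x) \<longlonglongrightarrow> D f x" "\<And>n. AE x in M. norm (Gs n x) \<le> h' x" "L2H M h'"
  shows "conv1 fs f"
proof -
  have all: "AE x in M. \<forall>n. D (fs n) x = Gs n x" unfolding AE_all_countable using D by blast
  have "AE x in M. (\<lambda>n. D (fs n) x) \<longlonglongrightarrow> D f x" using all assms(7) by eventually_elim simp
  moreover have "AE x in M. norm (D (fs n) x) \<le> h' x" for n
    using all assms(8)[of n] by eventually_elim simp
  ultimately have "(\<lambda>n. \<integral>x. (norm (D (fs n) x - D f x))\<^sup>2 \<partial>M) \<longlonglongrightarrow> 0"
    using L2H_dominated_convergence(2)[of "\<lambda>n. D (fs n)" M "D f" h'] D_measurable[OF fs] D_measurable[OF f] assms(9)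
    by blast
  moreover have "(\<lambda>n. \<integral>x. (fs n x - f x)\<^sup>2 \<partial>M) \<longlonglongrightarrow> 0"
    using L2H_dominated_convergence(2)[of fs M f h] dom_measurable[OF fs] dom_measurable[OF f] assms(4,5,6)
    by simp
  ultimately show ?thesis using fs f by (simp add: conv1_def)
qed

lemma L2_norm: "L2H M f \<Longrightarrow> L2H M (\<lambda>x. norm (f x))"
  by (rule L2H_bound[where F = f and C = 1]) (auto dest: L2H_measurable)

text \<open>Bounded functions are dense in the form norm: the truncations have derivatives bounded
  by 1 and tending to 1, so \<open>f\<close> and \<open>D f\<close> themselves provide the
  majorants.\<close>

lemma cutoff_conv1:
  assumes f: "f \<in> Dom"
  shows "conv1 (\<lambda>n x. cutoff (inverse (real (Suc n))) (f x)) f"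
proof (rule conv1_dominated)
  show "(\<lambda>x. cutoff (inverse (real (Suc n))) (f x)) \<in> Dom" for n by (rule cutoff_dom) (use f in auto)
  show "AE x in M. D (\<lambda>x. cutoff (inverse (real (Suc n))) (f x)) x
      = cutoff' (inverse (real (Suc n))) (f x) *\<^sub>R D f x" for n
    by (rule cutoff_dom) (use f in auto)
  show "AE x in M. (\<lambda>n. cutoff (inverse (real (Suc n))) (f x)) \<longlonglongrightarrow> f x"
    by (simp only: cutoff_tendsto_id) simp
  show "AE x in M. \<bar>cutoff (inverse (real (Suc n))) (f x)\<bar> \<le> norm (f x)" for n
    by (intro AE_I2) (simp add: abs_cutoff_le)
  have "(\<lambda>n. cutoff' (inverse (real (Suc n))) (f x) *\<^sub>R D f x) \<longlonglongrightarrow> 1 *\<^sub>R D f x" for x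
    by (intro tendsto_intros cutoff'_tendsto_1)
  then show "AE x in M. (\<lambda>n. cutoff' (inverse (real (Suc n))) (f x) *\<^sub>R D f x) \<longlonglongrightarrow> D f x"
    by simp
  show "AE x in M. norm (cutoff' (inverse (real (Suc n))) (f x) *\<^sub>R D f x) \<le> norm (D f x)" for n
    using abs_cutoff'_le[of "inverse (real (Suc n))"] by (auto intro!: mult_left_le_one_le simp del: of_nat_Suc)
  show "L2H M (\<lambda>x. norm (f x))" "L2H M (\<lambda>x. norm (D f x))"
    by (rule L2_norm, rule dom_L2 D_L2, rule f)+
qed (rule f)

lemma conv1_AE_subseq:
  assumes "conv1 fs f"
  obtains r :: "nat \<Rightarrow> nat" where "strict_mono r" "AE x in M. (\<lambda>n. fs (r n) x) \<longlonglongrightarrow> f x"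
    "conv1 (\<lambda>n. fs (r n)) f"
proof -
  have "L2H M (\<lambda>x. fs n x - f x)" for n
    using assms by (auto simp: conv1_def intro: L2H_diff dom_L2)
  moreover have "(\<lambda>n. \<integral>x. (norm (fs n x - f x))\<^sup>2 \<partial>M) \<longlonglongrightarrow> 0" using assms by (simp add: conv1_def)
  ultimately obtain r :: "nat \<Rightarrow> nat" where r: "strict_mono r" "AE x in M. (\<lambda>n. fs (r n) x) \<longlonglongrightarrow> f x"
    by (rule L2H_tendsto_AE_subseq)
  moreover have "conv1 (\<lambda>n. fs (r n)) f"
    using assms LIMSEQ_subseq_LIMSEQ[OF _ r(1)] unfolding conv1_def comp_def by blast
  ultimately show thesis by (rule that)
qed

end

section \<open>Measurable nests and local gradients\<close>

locale dirichlet_nest = dirichlet M Dom D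
  for M :: "'a measure" and Dom :: "('a \<Rightarrow> real) set"
    and D :: "('a \<Rightarrow> real) \<Rightarrow> 'a \<Rightarrow> 'h::{real_inner,banach,second_countable_topology}" +
  fixes Ek :: "nat \<Rightarrow> 'a set"
  assumes nest: "measurable_nest M Dom D Ek"
begin

abbreviation "Core \<equiv> core M Dom Ek"

lemma Ek_sets [measurable]: "Ek k \<in> sets M"
  using nest by (simp add: measurable_nest_def)

lemma coreD: "f \<in> Core \<Longrightarrow> f \<in> Dom"
  by (auto simp: core_def DomAb_def DomA_def)

lemma coreE:
  assumes "f \<in> Core"
  obtains k C where "f \<in> Dom" "AE x in M. x \<notin> Ek k \<longrightarrow> f x = 0" "AE x in M. \<bar>f x\<bar> \<le> C"
  using assms by (auto simp: core_def DomAb_def DomA_def Linfty_def)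

lemma coreI:
  assumes "f \<in> Dom" "AE x in M. x \<notin> Ek k \<longrightarrow> f x = 0" "AE x in M. \<bar>f x\<bar> \<le> C"
  shows "f \<in> Core"
  using assms dom_measurable by (auto simp: core_def DomAb_def DomA_def Linfty_def)

text \<open>The nest gives approximants living on one \<open>Ek\<close>; truncating them by
  \<open>cutoff\<close> makes them bounded without enlarging the support.\<close>

lemma core_dense:
  assumes f: "f \<in> Dom"
  obtains fs where "\<And>n. fs n \<in> Core" "conv1 fs f"
proof -
  have step: "\<exists>g\<in>Core. E0l M D 1 (\<lambda>x. g x - f x) (\<lambda>x. g x - f x) < e" if e: "e > 0" for e
  proof -
    \<comment> \<open>A quarter for each of the two errors, since the triangle inequality for
      squared norms costs a factor 2.\<close>
    obtain k g where g: "g \<in> DomA M Dom (Ek k)" "E0l M D 1 (\<lambda>x. f x - g x) (\<lambda>x. f x - g x) < e / 4"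
      using nest f e unfolding measurable_nest_def by (metis zero_less_divide_iff zero_less_numeral)
    have gD: "g \<in> Dom" using g by (simp add: DomA_def)
    define c where "c n x = cutoff (inverse (real (Suc n))) (g x)" for n x
    have c: "conv1 c g" unfolding c_def by (rule cutoff_conv1[OF gD])
    have cD: "c n \<in> Dom" for n using c by (simp add: conv1_def)
    have "(\<lambda>n. E0l M D 1 (\<lambda>x. c n x - g x) (\<lambda>x. c n x - g x)) \<longlonglongrightarrow> 0"
      using c conv1_iff_E0l[OF cD gD] by simp
    then have "\<forall>\<^sub>F n in sequentially. E0l M D 1 (\<lambda>x. c n x - g x) (\<lambda>x. c n x - g x) < e / 4"
      using e by (intro order_tendstoD) auto
    then obtain n where n: "E0l M D 1 (\<lambda>x. c n x - g x) (\<lambda>x. c n x - g x) < e / 4"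
      by (auto dest: eventually_happens)
    have sym: "E0l M D 1 (\<lambda>x. g x - f x) (\<lambda>x. g x - f x) = E0l M D 1 (\<lambda>x. f x - g x) (\<lambda>x. f x - g x)"
      using f gD by (simp add: E0l_self integral_norm_D_diff power2_commute norm_minus_commute)
    have "E0l M D 1 (\<lambda>x. c n x - f x) (\<lambda>x. c n x - f x) < e"
      using E0l_diff_triangle[OF cD[of n] gD f] n g(2) sym by linarith
    moreover have "c n \<in> Core"
    proof (rule coreI[OF cD])
      have "AE x in M. x \<notin> Ek k \<longrightarrow> g x = 0" using g by (simp add: DomA_def)
      then show "AE x in M. x \<notin> Ek k \<longrightarrow> c n x = 0"
        by eventually_elim (auto simp: c_def cutoff_def)
      show "AE x in M. \<bar>c n x\<bar> \<le> 1 / sqrt (inverse (real (Suc n)))"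
        unfolding c_def by (intro AE_I2 cutoff_bounded) simp
    qed
    ultimately show ?thesis by blast
  qed
  have "\<forall>n. \<exists>g\<in>Core. E0l M D 1 (\<lambda>x. g x - f x) (\<lambda>x. g x - f x) < inverse (real (Suc n))"
    using step by simp
  then obtain fs where fs: "\<And>n. fs n \<in> Core"
    "\<And>n. E0l M D 1 (\<lambda>x. fs n x - f x) (\<lambda>x. fs n x - f x) < inverse (real (Suc n))" by metis
  have "(\<lambda>n. E0l M D 1 (\<lambda>x. fs n x - f x) (\<lambda>x. fs n x - f x)) \<longlonglongrightarrow> 0"
  proof (rule Lim_null_comparison[OF _ LIMSEQ_inverse_real_of_nat])
    show "\<forall>\<^sub>F n in sequentially. norm (E0l M D 1 (\<lambda>x. fs n x - f x) (\<lambda>x. fs n x - f x)) \<le> inverse (real (Suc n))"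
      using fs(2) E0l_nonneg[of 1] by (intro always_eventually allI) (simp add: less_imp_le)
  qed
  then have "conv1 fs f" using conv1_iff_E0l[of fs f] coreD[OF fs(1)] f by simp
  with fs(1) show thesis by (rule that)
qed

text \<open>The form in which sigma-finiteness is used: integrals against one strictly positive
  weight detect null sets.\<close>

lemma positive_integrable_function:
  obtains p :: "'a \<Rightarrow> real" where "integrable M p" "AE x in M. 0 < p x" "\<And>x. 0 \<le> p x"
proof -
  interpret sigma_finite_measure M by (rule sigma_finite)
  obtain h where h: "h \<in> borel_measurable M" "integral\<^sup>N M h \<noteq> \<infinity>" "\<And>x. x \<in> space M \<Longrightarrow> 0 < h x \<and> h x < \<infinity>"
    using Ex_finite_integrable_function by auto
  have [measurable]: "h \<in> borel_measurable M" by fact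
  have "integrable M (\<lambda>x. enn2real (h x))"
  proof (rule integrableI_bounded)
    have "(\<integral>\<^sup>+x. ennreal (norm (enn2real (h x))) \<partial>M) = integral\<^sup>N M h"
      using h(3) by (intro nn_integral_cong) (simp add: ennreal_enn2real_if less_top[symmetric])
    then show "(\<integral>\<^sup>+x. ennreal (norm (enn2real (h x))) \<partial>M) < \<infinity>"
      using h(2) by (simp add: less_top[symmetric])
  qed measurable
  moreover have "AE x in M. 0 < enn2real (h x)"
    using h(3) by (intro AE_I2) (simp add: enn2real_positive_iff)
  ultimately show thesis using that[of "\<lambda>x. enn2real (h x)"] by simp
qed

text \<open>Core functions vanish off the union of the nest, hence so do their limits, that is, all
  of \<open>Dom\<close>. By density of \<open>Dom\<close> in L2 the same holds for the square root
  of a positive integrable weight, which vanishes almost nowhere.\<close>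

lemma AE_in_nest: "AE x in M. x \<in> (\<Union>k. Ek k)"
proof -
  have van: "AE x in M. x \<notin> (\<Union>k. Ek k) \<longrightarrow> f x = 0" if f: "f \<in> Dom" for f
  proof -
    obtain fs where fs: "\<And>n. fs n \<in> Core" "conv1 fs f" using core_dense[OF f] by blast
    obtain r :: "nat \<Rightarrow> nat" where r: "AE x in M. (\<lambda>n. fs (r n) x) \<longlonglongrightarrow> f x"
      using conv1_AE_subseq[OF fs(2)] by blast
    have "AE x in M. x \<notin> (\<Union>k. Ek k) \<longrightarrow> fs n x = 0" for n
    proof -
      obtain k where "AE x in M. x \<notin> Ek k \<longrightarrow> fs n x = 0" using fs(1)[of n] by (rule coreE)
      then show ?thesis by eventually_elim auto
    qed
    then have "AE x in M. \<forall>n. x \<notin> (\<Union>k. Ek k) \<longrightarrow> fs n x = 0" by (simp only: AE_all_countable) blast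
    with r show ?thesis
    proof eventually_elim
      case (elim x)
      show ?case
      proof
        assume "x \<notin> (\<Union>k. Ek k)"
        with elim have "(\<lambda>n. 0) \<longlonglongrightarrow> f x" by simp
        then show "f x = 0" using LIMSEQ_unique tendsto_const by blast
      qed
    qed
  qed
  obtain p :: "'a \<Rightarrow> real" where p: "integrable M p" "AE x in M. 0 < p x" "\<And>x. 0 \<le> p x"
    using positive_integrable_function by blast
  define q where "q x = sqrt (p x)" for x
  have [measurable]: "p \<in> borel_measurable M" using p(1) by auto
  have q: "L2H M q" unfolding L2H_def q_def[abs_def] using p by simp
  have "\<exists>g\<in>Dom. norm2 M (\<lambda>x. q x - g x) < inverse (real (Suc n))" for n
    using frame_conjs[THEN conjunct2, THEN conjunct2, THEN conjunct2, THEN conjunct2, THEN conjunct2, THEN conjunct1]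
      q by (simp add: L2_iff_L2H)
  then obtain gs where gs: "\<And>n. gs n \<in> Dom" "\<And>n. norm2 M (\<lambda>x. q x - gs n x) < inverse (real (Suc n))" by metis
  have "(\<lambda>n. norm2 M (\<lambda>x. q x - gs n x)) \<longlonglongrightarrow> 0"
  proof (rule Lim_null_comparison[OF _ LIMSEQ_inverse_real_of_nat])
    show "\<forall>\<^sub>F n in sequentially. norm (norm2 M (\<lambda>x. q x - gs n x)) \<le> inverse (real (Suc n))"
      using gs(2) by (intro always_eventually allI) (simp add: less_imp_le norm2_def)
  qed
  then have "(\<lambda>n. \<integral>x. (norm (gs n x - q x))\<^sup>2 \<partial>M) \<longlonglongrightarrow> 0"
    by (simp add: norm2_eq_norm2H norm2H_tendsto_0_iff power2_commute[of "q _"])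
  then obtain r :: "nat \<Rightarrow> nat" where r: "AE x in M. (\<lambda>n. gs (r n) x) \<longlonglongrightarrow> q x"
    using L2H_tendsto_AE_subseq[of M gs q] L2H_diff[OF dom_L2[OF gs(1)] q] by blast
  have "AE x in M. \<forall>n. x \<notin> (\<Union>k. Ek k) \<longrightarrow> gs n x = 0"
    using van[OF gs(1)] by (simp only: AE_all_countable) blast
  with r p(2) show ?thesis
  proof eventually_elim
    case (elim x)
    show ?case
    proof (rule ccontr)
      assume "x \<notin> (\<Union>k. Ek k)"
      with elim have "(\<lambda>n. 0) \<longlonglongrightarrow> q x" by simp
      then have "q x = 0" using LIMSEQ_unique tendsto_const by blast
      with elim show False by (simp add: q_def)
    qed
  qed
qed

lemma AE_nestI:
  assumes "\<And>k. AE x in M. x \<in> Ek k \<longrightarrow> P x" shows "AE x in M. P x"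
proof -
  have "AE x in M. \<forall>k. x \<in> Ek k \<longrightarrow> P x" unfolding AE_all_countable using assms by blast
  with AE_in_nest show ?thesis by eventually_elim auto
qed

abbreviation "grad \<equiv> Dloc_grad M Dom D Ek"
abbreviation "D_0 \<equiv> D0 M Dom D Ek"

lemma Dloc_ex: "f \<in> Dloc M Dom Ek \<Longrightarrow> \<exists>g. g \<in> Dom \<and> (AE x in M. x \<in> Ek k \<longrightarrow> f x = g x)"
  unfolding Dloc_def by blast

text \<open>\<open>Dloc_grad\<close> works with arbitrarily chosen representatives on the first
  \<open>Ek\<close> containing the point; locality of \<open>D\<close> makes every other choice
  agree with it almost everywhere.\<close>

lemma grad_eq:
  assumes f: "f \<in> Dloc M Dom Ek" and g: "g \<in> Dom" and eq: "AE x in M. x \<in> Ek k \<longrightarrow> f x = g x"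
  shows "AE x in M. x \<in> Ek k \<longrightarrow> grad f x = D g x"
proof -
  define G where "G j = (SOME g. g \<in> Dom \<and> (AE y in M. y \<in> Ek j \<longrightarrow> f y = g y))" for j
  have G: "G j \<in> Dom \<and> (AE y in M. y \<in> Ek j \<longrightarrow> f y = G j y)" for j
    unfolding G_def by (rule someI_ex[OF Dloc_ex[OF f]])
  \<comment> \<open>The least index depends on \<open>x\<close>, so the exceptional sets of all
    indices are discarded at once.\<close>
  have "AE x in M. \<forall>j. x \<in> Ek j \<longrightarrow> f x = G j x" unfolding AE_all_countable using G by blast
  moreover have "AE x in M. \<forall>j. G j x = g x \<longrightarrow> D (G j) x = D g x"
    unfolding AE_all_countable using D_eq_on_equal_set[OF _ g] G by blast
  ultimately show ?thesis using eq
  proof eventually_elim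
    case (elim x)
    show ?case
    proof
      assume x: "x \<in> Ek k"
      define j where "j = (LEAST k. x \<in> Ek k)"
      have "x \<in> Ek j" unfolding j_def using x by (rule LeastI)
      have "grad f x = D (G j) x"
        using x by (auto simp: Dloc_grad_def Let_def G_def j_def)
      also have "\<dots> = D g x" using elim x \<open>x \<in> Ek j\<close> by metis
      finally show "grad f x = D g x" .
    qed
  qed
qed

lemma grad_eq_on_equal_set:
  assumes "f \<in> Dloc M Dom Ek" "g \<in> Dloc M Dom Ek"
  shows "AE x in M. f x = g x \<longrightarrow> grad f x = grad g x"
proof (rule AE_nestI)
  fix k
  obtain f' g' where "f' \<in> Dom" "AE x in M. x \<in> Ek k \<longrightarrow> f x = f' x" "g' \<in> Dom" "AE x in M. x \<in> Ek k \<longrightarrow> g x = g' x"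
    using Dloc_ex[OF assms(1)] Dloc_ex[OF assms(2)] by blast
  note * = this
  show "AE x in M. x \<in> Ek k \<longrightarrow> f x = g x \<longrightarrow> grad f x = grad g x"
    using *(2,4) D_eq_on_equal_set[OF *(1,3)] grad_eq[OF assms(1) *(1,2)] grad_eq[OF assms(2) *(3,4)]
    by eventually_elim auto
qed

lemma grad_measurable:
  assumes "f \<in> Dloc M Dom Ek" shows "grad f \<in> borel_measurable M"
proof -
  define G where "G j = (SOME g. g \<in> Dom \<and> (AE y in M. y \<in> Ek j \<longrightarrow> f y = g y))" for j
  have G: "G j \<in> Dom \<and> (AE y in M. y \<in> Ek j \<longrightarrow> f y = G j y)" for j
    unfolding G_def by (rule someI_ex[OF Dloc_ex[OF assms]])
  have [measurable]: "D (G j) \<in> borel_measurable M" for j using G D_measurable by blast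
  have [measurable]: "(\<lambda>x. LEAST k. x \<in> Ek k) \<in> measurable M (count_space UNIV)"
    by (rule measurable_Least) measurable
  have "(\<lambda>x. D (G (LEAST k. x \<in> Ek k)) x) \<in> borel_measurable M"
    by (rule measurable_compose_countable[where g = "\<lambda>x. LEAST k. x \<in> Ek k"]) auto
  moreover have "grad f = (\<lambda>x. if x \<in> (\<Union>k. Ek k) then D (G (LEAST k. x \<in> Ek k)) x else 0)"
    by (auto simp: Dloc_grad_def Let_def G_def)
  ultimately show ?thesis by (simp only:) measurable
qed

text \<open>The local representatives may be chosen freely here, whereas \<open>D0\<close> refers to
  those fixed inside \<open>Dloc_grad\<close>.\<close>

lemma D0I:
  assumes m: "f \<in> borel_measurable M" and b: "AE x in M. \<bar>f x\<bar> \<le> C"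
    and loc: "\<And>k. \<exists>g\<in>Dom. (AE x in M. x \<in> Ek k \<longrightarrow> f x = g x) \<and> (AE x in M. x \<in> Ek k \<longrightarrow> norm (D g x) \<le> 1)"
  shows "f \<in> D_0"
proof -
  have f: "f \<in> Dloc M Dom Ek" using m loc unfolding Dloc_def by blast
  have "AE x in M. norm (grad f x) \<le> 1"
  proof (rule AE_nestI)
    fix k
    obtain g where g: "g \<in> Dom" "AE x in M. x \<in> Ek k \<longrightarrow> f x = g x" "AE x in M. x \<in> Ek k \<longrightarrow> norm (D g x) \<le> 1"
      using loc[of k] by blast
    show "AE x in M. x \<in> Ek k \<longrightarrow> norm (grad f x) \<le> 1"
      using grad_eq[OF f g(1,2)] g(3) by eventually_elim auto
  qed
  with f m b show ?thesis by (auto simp: D0_def Linfty_def)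
qed

lemma D0D:
  assumes "f \<in> D_0"
  shows "f \<in> Dloc M Dom Ek" "f \<in> borel_measurable M" "\<exists>C. AE x in M. \<bar>f x\<bar> \<le> C"
    "AE x in M. norm (grad f x) \<le> 1"
  using assms by (auto simp: D0_def Linfty_def)

lemma D0_local:
  assumes "f \<in> D_0"
  obtains g where "g \<in> Dom" "AE x in M. x \<in> Ek k \<longrightarrow> f x = g x"
    "AE x in M. x \<in> Ek k \<longrightarrow> grad f x = D g x" "AE x in M. x \<in> Ek k \<longrightarrow> norm (D g x) \<le> 1"
proof -
  obtain g where g: "g \<in> Dom" "AE x in M. x \<in> Ek k \<longrightarrow> f x = g x"
    using Dloc_ex[OF D0D(1)[OF assms]] by blast
  note e = grad_eq[OF D0D(1)[OF assms] g]
  have "AE x in M. x \<in> Ek k \<longrightarrow> norm (D g x) \<le> 1"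
    using e D0D(4)[OF assms] by eventually_elim auto
  with g e show thesis by (rule that)
qed

lemma D0_cong:
  assumes "f \<in> D_0" "f' \<in> borel_measurable M" "AE x in M. f' x = f x"
  shows "f' \<in> D_0"
proof -
  obtain C where "AE x in M. \<bar>f x\<bar> \<le> C" using D0D(3)[OF assms(1)] by blast
  with assms(3) have "AE x in M. \<bar>f' x\<bar> \<le> C" by eventually_elim simp
  then show ?thesis
  proof (rule D0I[OF assms(2)])
    fix k
    obtain g where g: "g \<in> Dom" "AE x in M. x \<in> Ek k \<longrightarrow> f x = g x" "AE x in M. x \<in> Ek k \<longrightarrow> norm (D g x) \<le> 1"
      using D0_local[OF assms(1), of k] by blast
    have "AE x in M. x \<in> Ek k \<longrightarrow> f' x = g x" using assms(3) g(2) by eventually_elim simp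
    then show "\<exists>g\<in>Dom. (AE x in M. x \<in> Ek k \<longrightarrow> f' x = g x) \<and> (AE x in M. x \<in> Ek k \<longrightarrow> norm (D g x) \<le> 1)"
      using g by blast
  qed
qed

end

section \<open>Multipliers\<close>

lemma partial_exp_sum_le: "\<bar>\<Sum>i<n. x ^ i / fact i\<bar> \<le> exp \<bar>x\<bar>" for x :: real
proof -
  have s: "(\<lambda>i. \<bar>x\<bar> ^ i / fact i) sums exp \<bar>x\<bar>"
    using exp_converges[of "\<bar>x\<bar>"] by (simp add: divide_inverse mult.commute)
  have "\<bar>\<Sum>i<n. x ^ i / fact i\<bar> \<le> (\<Sum>i<n. \<bar>x ^ i / fact i\<bar>)" by (rule sum_abs)
  also have "\<dots> = (\<Sum>i<n. \<bar>x\<bar> ^ i / fact i)" by (simp add: power_abs)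
  also have "\<dots> \<le> (\<Sum>i. \<bar>x\<bar> ^ i / fact i)"
    using s by (intro sum_le_suminf) (auto simp: sums_iff)
  also have "\<dots> = exp \<bar>x\<bar>" using s by (simp add: sums_iff)
  finally show ?thesis .
qed

lemma partial_exp_sum_tendsto: "(\<lambda>n. \<Sum>i<n. x ^ i / fact i) \<longlonglongrightarrow> exp x" for x :: real
  using exp_converges[of x] by (simp add: sums_def divide_inverse mult.commute)

text \<open>A C1 substitute for the positive part. It provides the cutoff that is constant on the
  sets of the nest.\<close>

lemma positive_part_square_derivative:
  "((\<lambda>y. (max 0 y)\<^sup>2) has_real_derivative 2 * max 0 y) (at y)"
proof -
  consider "y > 0" | "y < 0" | "y = 0" by linarith
  then show ?thesis
  proof cases
    case 1
    have "((\<lambda>y. y\<^sup>2) has_real_derivative 2 * y) (at y)" by (auto intro!: derivative_eq_intros)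
    then have "((\<lambda>y. (max 0 y)\<^sup>2) has_real_derivative 2 * y) (at y)"
      by (rule has_field_derivative_transform_within_open[of _ _ _ "{0<..}"]) (use 1 in \<open>auto simp: max_def\<close>)
    then show ?thesis using 1 by simp
  next
    case 2
    have "((\<lambda>y. 0) has_real_derivative 0) (at y)" by simp
    then have "((\<lambda>y. (max 0 y)\<^sup>2) has_real_derivative 0) (at y)"
      by (rule has_field_derivative_transform_within_open[of _ _ _ "{..<0}"]) (use 2 in \<open>auto simp: max_def\<close>)
    then show ?thesis using 2 by simp
  next
    case 3
    have "((\<lambda>h. (max 0 h)\<^sup>2 / h) \<longlongrightarrow> 0) (at (0::real))"
    proof (rule Lim_null_comparison)
      show "((\<lambda>h. \<bar>h\<bar>) \<longlongrightarrow> 0) (at (0::real))" by (rule tendsto_rabs_zero) simp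
      show "\<forall>\<^sub>F h::real in at 0. norm ((max 0 h)\<^sup>2 / h) \<le> \<bar>h\<bar>"
        by (intro always_eventually allI) (auto simp: max_def power2_eq_square)
    qed
    then show ?thesis using 3 by (simp add: DERIV_def)
  qed
qed

context dirichlet_nest
begin

text \<open>\<open>G\<close> plays the gradient of \<open>m\<close>, but \<open>m\<close> itself may
  lie outside \<open>Dom\<close>, as constants and \<open>exp (\<alpha> * \<psi>)\<close> do in
  general; all that is asked is that multiplication by \<open>m\<close> preserves \<open>Dom\<close>
  with the product rule.\<close>

definition multiplier :: "('a \<Rightarrow> real) \<Rightarrow> ('a \<Rightarrow> 'h) \<Rightarrow> bool" where
  "multiplier m G \<longleftrightarrow> m \<in> borel_measurable M \<and> G \<in> borel_measurable M
     \<and> (\<exists>C. AE x in M. \<bar>m x\<bar> \<le> C) \<and> (\<exists>C. AE x in M. norm (G x) \<le> C)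
     \<and> (\<forall>u\<in>Dom. (\<lambda>x. m x * u x) \<in> Dom
          \<and> (AE x in M. D (\<lambda>x. m x * u x) x = m x *\<^sub>R D u x + u x *\<^sub>R G x))"

lemma multiplierD:
  assumes "multiplier m G"
  shows "m \<in> borel_measurable M" "G \<in> borel_measurable M"
    "\<exists>C. AE x in M. \<bar>m x\<bar> \<le> C" "\<exists>C. AE x in M. norm (G x) \<le> C"
    "u \<in> Dom \<Longrightarrow> (\<lambda>x. m x * u x) \<in> Dom"
    "u \<in> Dom \<Longrightarrow> AE x in M. D (\<lambda>x. m x * u x) x = m x *\<^sub>R D u x + u x *\<^sub>R G x"
  using assms unfolding multiplier_def by blast+

lemma multiplier_conv1:
  assumes m: "multiplier m G" and u: "conv1 us u"
  shows "conv1 (\<lambda>n x. m x * us n x) (\<lambda>x. m x * u x)"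
proof -
  note mD = multiplierD[OF m]
  obtain C C' where C: "AE x in M. \<bar>m x\<bar> \<le> C" "AE x in M. norm (G x) \<le> C'" using mD by blast
  have uD: "us n \<in> Dom" "u \<in> Dom" for n using u by (auto simp: conv1_def)
  have P: "(\<lambda>n. \<integral>x. (us n x - u x)\<^sup>2 \<partial>M) \<longlonglongrightarrow> 0" "(\<lambda>n. \<integral>x. (norm (D (us n) x - D u x))\<^sup>2 \<partial>M) \<longlonglongrightarrow> 0"
    using u by (auto simp: conv1_def)
  have H: "AE x in M. D (\<lambda>x. m x * us n x) x - D (\<lambda>x. m x * u x) x
      = m x *\<^sub>R (D (us n) x - D u x) + (us n x - u x) *\<^sub>R G x" for n
    using mD(6)[OF uD(1)[of n]] mD(6)[OF uD(2)] by eventually_elim (simp add: algebra_simps)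
  have meas: "(\<lambda>x. D (\<lambda>x. m x * us n x) x - D (\<lambda>x. m x * u x) x) \<in> borel_measurable M" for n
    using D_measurable[OF mD(5)[OF uD(1)]] D_measurable[OF mD(5)[OF uD(2)]] by measurable
  note lim = L2H_product_null[OF mD(1) C(1) mD(2) C(2) L2H_diff[OF dom_L2[OF uD(1)] dom_L2[OF uD(2)]]
      L2H_diff[OF D_L2[OF uD(1)] D_L2[OF uD(2)]] P meas H]
  show ?thesis using lim uD mD(5) by (simp add: conv1_def right_diff_distrib)
qed

text \<open>The local representative \<open>g\<close> of \<open>\<psi>\<close> may be unbounded, so
  the product rule is first applied to its truncations. On \<open>Ek\<close> these are controlled by
  the bound of \<open>\<psi>\<close>; off \<open>Ek\<close> both \<open>u\<close> and
  \<open>D u\<close> vanish.\<close>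

lemma D0_mult_core:
  assumes \<psi>: "\<psi> \<in> D_0" and u: "u \<in> Core"
  shows "(\<lambda>x. \<psi> x * u x) \<in> Dom" "AE x in M. D (\<lambda>x. \<psi> x * u x) x = \<psi> x *\<^sub>R D u x + u x *\<^sub>R grad \<psi> x"
proof -
  obtain k C where uD: "u \<in> Dom" and u0: "AE x in M. x \<notin> Ek k \<longrightarrow> u x = 0" and uC: "AE x in M. \<bar>u x\<bar> \<le> C"
    using coreE[OF u] by blast
  obtain C' where \<psi>C: "AE x in M. \<bar>\<psi> x\<bar> \<le> C'" using D0D(3)[OF \<psi>] by blast
  obtain g where g: "g \<in> Dom" "AE x in M. x \<in> Ek k \<longrightarrow> \<psi> x = g x" "AE x in M. x \<in> Ek k \<longrightarrow> grad \<psi> x = D g x"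
    using D0_local[OF \<psi>, of k] by blast
  have Du0: "AE x in M. x \<notin> Ek k \<longrightarrow> D u x = 0"
    using u0 D_eq_0_on_zero_set[OF uD] by eventually_elim auto
  have [measurable]: "g \<in> borel_measurable M" "D g \<in> borel_measurable M" "u \<in> borel_measurable M" "D u \<in> borel_measurable M"
      "\<psi> \<in> borel_measurable M" "grad \<psi> \<in> borel_measurable M"
    using g uD \<psi> by (auto intro: dom_measurable D_measurable D0D grad_measurable)
  define a where "a n = inverse (real (Suc n))" for n
  have a: "a n > 0" for n by (simp add: a_def)
  define fs where "fs n x = cutoff (a n) (g x) * u x" for n x
  define Gs where "Gs n x = cutoff (a n) (g x) *\<^sub>R D u x + u x *\<^sub>R (cutoff' (a n) (g x) *\<^sub>R D g x)" for n x
  have cb: "AE x in M. \<bar>cutoff (a n) (g x)\<bar> \<le> 1 / sqrt (a n)" for n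
    by (intro AE_I2 cutoff_bounded a)
  note cd = cutoff_dom[OF g(1) less_imp_le[OF a]]
  have fsD: "fs n \<in> Dom" for n unfolding fs_def by (rule dom_mult(1)[OF cd(1) uD cb uC])
  have Gs: "AE x in M. D (fs n) x = Gs n x" for n
    using dom_mult(2)[OF cd(1)[of n] uD cb uC] cd(2)[of n]
    unfolding fs_def[symmetric] Gs_def by eventually_elim simp
  have lim: "AE x in M. (\<lambda>n. fs n x) \<longlonglongrightarrow> \<psi> x * u x"
    using u0 g(2)
  proof eventually_elim
    case (elim x)
    have "(\<lambda>n. fs n x) \<longlonglongrightarrow> g x * u x"
      unfolding fs_def a_def by (intro tendsto_intros cutoff_tendsto_id)
    then show ?case using elim by (cases "x \<in> Ek k") auto
  qed
  have lim': "AE x in M. (\<lambda>n. Gs n x) \<longlonglongrightarrow> \<psi> x *\<^sub>R D u x + u x *\<^sub>R grad \<psi> x"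
    using u0 Du0 g(2,3)
  proof eventually_elim
    case (elim x)
    have "(\<lambda>n. Gs n x) \<longlonglongrightarrow> g x *\<^sub>R D u x + u x *\<^sub>R (1 *\<^sub>R D g x)"
      unfolding Gs_def a_def by (intro tendsto_intros cutoff_tendsto_id cutoff'_tendsto_1)
    then show ?case using elim by (cases "x \<in> Ek k") auto
  qed
  have b1: "AE x in M. \<bar>fs n x\<bar> \<le> norm (C' * u x)" for n
    using u0 g(2) \<psi>C
  proof eventually_elim
    case (elim x)
    show ?case
    proof (cases "x \<in> Ek k")
      case True
      then have "\<bar>cutoff (a n) (g x)\<bar> \<le> \<bar>C'\<bar>"
        using abs_cutoff_le[OF less_imp_le[OF a[of n]], of "g x"] elim by simp
      then show ?thesis by (simp add: fs_def abs_mult mult_right_mono)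
    qed (use elim in \<open>simp add: fs_def\<close>)
  qed
  have b2: "AE x in M. norm (Gs n x) \<le> norm (C' *\<^sub>R D u x) + norm (C *\<^sub>R D g x)" for n
    using u0 Du0 uC g(2) \<psi>C
  proof eventually_elim
    case (elim x)
    show ?case
    proof (cases "x \<in> Ek k")
      case True
      then have "\<bar>cutoff (a n) (g x)\<bar> \<le> \<bar>C'\<bar>"
        using abs_cutoff_le[OF less_imp_le[OF a[of n]], of "g x"] elim by simp
      then have "norm (cutoff (a n) (g x) *\<^sub>R D u x) \<le> norm (C' *\<^sub>R D u x)"
        by (simp add: mult_right_mono)
      moreover have "\<bar>u x * cutoff' (a n) (g x)\<bar> \<le> \<bar>C\<bar> * 1"
        unfolding abs_mult using elim abs_cutoff'_le[OF less_imp_le[OF a[of n]], of "g x"] by (intro mult_mono) auto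
      then have "norm (u x *\<^sub>R (cutoff' (a n) (g x) *\<^sub>R D g x)) \<le> norm (C *\<^sub>R D g x)"
        by (simp add: mult_right_mono abs_mult flip: mult.assoc)
      ultimately show ?thesis unfolding Gs_def by (rule norm_triangle_mono)
    qed (use elim in \<open>simp add: Gs_def\<close>)
  qed
  have L: "L2H M (\<lambda>x. norm (C' * u x))" "L2H M (\<lambda>x. norm (C' *\<^sub>R D u x) + norm (C *\<^sub>R D g x))"
    by (rule L2_norm L2H_add L2_cmult L2H_scaleR dom_L2 D_L2 uD g)+
  show "(\<lambda>x. \<psi> x * u x) \<in> Dom" "AE x in M. D (\<lambda>x. \<psi> x * u x) x = \<psi> x *\<^sub>R D u x + u x *\<^sub>R grad \<psi> x"
    by (rule dom_dominated[OF fsD Gs _ _ lim b1 L(1) lim' b2 L(2)]; measurable)+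
qed

text \<open>Boundedness of \<open>\<psi>\<close> and of its gradient makes the product rule stable
  under form-norm limits; density of the core and closedness of \<open>D\<close> then extend it to
  all of \<open>Dom\<close>.\<close>

lemma D0_multiplier:
  assumes \<psi>: "\<psi> \<in> D_0" shows "multiplier \<psi> (grad \<psi>)"
proof -
  have [measurable]: "\<psi> \<in> borel_measurable M" "grad \<psi> \<in> borel_measurable M"
    using \<psi> by (auto intro: D0D grad_measurable)
  obtain C where \<psi>C: "AE x in M. \<bar>\<psi> x\<bar> \<le> C" using D0D(3)[OF \<psi>] by blast
  note g1 = D0D(4)[OF \<psi>]
  have "(\<lambda>x. \<psi> x * u x) \<in> Dom \<and> (AE x in M. D (\<lambda>x. \<psi> x * u x) x = \<psi> x *\<^sub>R D u x + u x *\<^sub>R grad \<psi> x)"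
    if u: "u \<in> Dom" for u
  proof -
    obtain us where us: "\<And>n. us n \<in> Core" "conv1 us u" using core_dense[OF u] by blast
    have usD: "us n \<in> Dom" for n using us(1) by (rule coreD)
    note m = D0_mult_core[OF \<psi> us(1)]
    have P: "(\<lambda>n. \<integral>x. (us n x - u x)\<^sup>2 \<partial>M) \<longlonglongrightarrow> 0" "(\<lambda>n. \<integral>x. (norm (D (us n) x - D u x))\<^sup>2 \<partial>M) \<longlonglongrightarrow> 0"
      using us(2) by (auto simp: conv1_def)
    have Lu: "L2H M (\<lambda>x. \<psi> x * u x)" "L2H M (\<lambda>x. \<psi> x *\<^sub>R D u x + u x *\<^sub>R grad \<psi> x)"
      using L2H_mult_bounded[OF dom_L2[OF u] _ \<psi>C]
        L2H_add[OF L2H_mult_bounded[OF D_L2[OF u] _ \<psi>C] L2H_bounded_scaleR[OF dom_L2[OF u] _ g1]] by auto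
    have H: "AE x in M. D (\<lambda>x. \<psi> x * us n x) x - (\<psi> x *\<^sub>R D u x + u x *\<^sub>R grad \<psi> x)
        = \<psi> x *\<^sub>R (D (us n) x - D u x) + (us n x - u x) *\<^sub>R grad \<psi> x" for n
      using m(2)[of n] by eventually_elim (simp add: algebra_simps)
    have meas: "(\<lambda>x. D (\<lambda>x. \<psi> x * us n x) x - (\<psi> x *\<^sub>R D u x + u x *\<^sub>R grad \<psi> x)) \<in> borel_measurable M" for n
      using D_measurable[OF m(1)] L2H_measurable[OF Lu(2)] by measurable
    note lim = L2H_product_null[OF _ \<psi>C _ g1 L2H_diff[OF dom_L2[OF usD] dom_L2[OF u]]
        L2H_diff[OF D_L2[OF usD] D_L2[OF u]] P meas H]
    have c1: "(\<lambda>n. \<integral>x. (\<psi> x * us n x - \<psi> x * u x)\<^sup>2 \<partial>M) \<longlonglongrightarrow> 0"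
      using lim(1) by (simp add: right_diff_distrib)
    have c2: "(\<lambda>n. \<integral>x. (norm (D (\<lambda>x. \<psi> x * us n x) x - (\<psi> x *\<^sub>R D u x + u x *\<^sub>R grad \<psi> x)))\<^sup>2 \<partial>M) \<longlonglongrightarrow> 0"
      by (rule lim(2)) measurable
    show ?thesis using dom_closed[OF m(1) Lu c1 c2] by blast
  qed
  then show ?thesis unfolding multiplier_def using \<psi>C g1 by (intro conjI) auto
qed

lemma multiplier_const: "multiplier (\<lambda>_. c) (\<lambda>_. 0)"
  unfolding multiplier_def using dom_cmult by auto

lemma multiplier_add:
  assumes "multiplier m G" "multiplier m' G'"
  shows "multiplier (\<lambda>x. m x + m' x) (\<lambda>x. G x + G' x)"
  unfolding multiplier_def
proof (intro conjI ballI)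
  note 1 = multiplierD[OF assms(1)] and 2 = multiplierD[OF assms(2)]
  show "(\<lambda>x. m x + m' x) \<in> borel_measurable M" "(\<lambda>x. G x + G' x) \<in> borel_measurable M"
    using 1(1,2) 2(1,2) by measurable
  obtain C0 C1 C2 C3 where C: "AE x in M. \<bar>m x\<bar> \<le> C0" "AE x in M. norm (G x) \<le> C1"
    "AE x in M. \<bar>m' x\<bar> \<le> C2" "AE x in M. norm (G' x) \<le> C3" using 1(3,4) 2(3,4) by blast
  have "AE x in M. \<bar>m x + m' x\<bar> \<le> C0 + C2" using C(1,3) by eventually_elim linarith
  then show "\<exists>C. AE x in M. \<bar>m x + m' x\<bar> \<le> C" ..
  have "AE x in M. norm (G x + G' x) \<le> C1 + C3" using C(2,4) by eventually_elim (rule norm_triangle_mono)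
  then show "\<exists>C. AE x in M. norm (G x + G' x) \<le> C" ..
  fix u assume u: "u \<in> Dom"
  note a = dom_add[OF 1(5)[OF u] 2(5)[OF u]]
  show "(\<lambda>x. (m x + m' x) * u x) \<in> Dom" using a(1) by (simp add: distrib_right)
  have "AE x in M. D (\<lambda>x. m x * u x + m' x * u x) x = (m x + m' x) *\<^sub>R D u x + u x *\<^sub>R (G x + G' x)"
    using a(2) 1(6)[OF u] 2(6)[OF u] by eventually_elim (simp add: algebra_simps)
  then show "AE x in M. D (\<lambda>x. (m x + m' x) * u x) x = (m x + m' x) *\<^sub>R D u x + u x *\<^sub>R (G x + G' x)"
    by (simp add: distrib_right)
qed

lemma multiplier_mult:
  assumes "multiplier m G" "multiplier m' G'"
  shows "multiplier (\<lambda>x. m x * m' x) (\<lambda>x. m x *\<^sub>R G' x + m' x *\<^sub>R G x)"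
  unfolding multiplier_def
proof (intro conjI ballI)
  note 1 = multiplierD[OF assms(1)] and 2 = multiplierD[OF assms(2)]
  show "(\<lambda>x. m x * m' x) \<in> borel_measurable M" "(\<lambda>x. m x *\<^sub>R G' x + m' x *\<^sub>R G x) \<in> borel_measurable M"
    using 1(1,2) 2(1,2) by measurable
  obtain C0 C1 C2 C3 where C: "AE x in M. \<bar>m x\<bar> \<le> C0" "AE x in M. norm (G x) \<le> C1"
    "AE x in M. \<bar>m' x\<bar> \<le> C2" "AE x in M. norm (G' x) \<le> C3" using 1(3,4) 2(3,4) by blast
  have "AE x in M. \<bar>m x * m' x\<bar> \<le> C0 * C2" using C(1,3)
    by eventually_elim (auto simp: abs_mult intro: mult_mono)
  then show "\<exists>C. AE x in M. \<bar>m x * m' x\<bar> \<le> C" ..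
  have "AE x in M. norm (m x *\<^sub>R G' x + m' x *\<^sub>R G x) \<le> C0 * C3 + C2 * C1" using C
    by eventually_elim (rule norm_triangle_mono, auto intro: mult_mono)
  then show "\<exists>C. AE x in M. norm (m x *\<^sub>R G' x + m' x *\<^sub>R G x) \<le> C" ..
  fix u assume u: "u \<in> Dom"
  note u' = 2(5)[OF u]
  show "(\<lambda>x. m x * m' x * u x) \<in> Dom" using 1(5)[OF u'] by (simp add: mult.assoc)
  have "AE x in M. D (\<lambda>x. m x * (m' x * u x)) x = (m x * m' x) *\<^sub>R D u x + u x *\<^sub>R (m x *\<^sub>R G' x + m' x *\<^sub>R G x)"
    using 1(6)[OF u'] 2(6)[OF u] by eventually_elim (simp add: algebra_simps)
  then show "AE x in M. D (\<lambda>x. m x * m' x * u x) x = (m x * m' x) *\<^sub>R D u x + u x *\<^sub>R (m x *\<^sub>R G' x + m' x *\<^sub>R G x)"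
    by (simp add: mult.assoc)
qed

text \<open>The chain rule does not apply to \<open>m\<close> outside \<open>Dom\<close>.
  Multipliers are closed under sums and products, so the partial sums of the exponential series are
  multipliers, and they converge with uniform bounds.\<close>

lemma multiplier_exp:
  assumes m: "multiplier m G"
  shows "multiplier (\<lambda>x. exp (m x)) (\<lambda>x. exp (m x) *\<^sub>R G x)"
proof -
  note mD = multiplierD[OF m]
  have [measurable]: "m \<in> borel_measurable M" "G \<in> borel_measurable M" using mD by auto
  have pow: "multiplier (\<lambda>x. m x ^ n) (\<lambda>x. (real n * m x ^ (n - 1)) *\<^sub>R G x)" for n
  proof (induction n)
    case 0 then show ?case using multiplier_const[of 1] by simp
  next
    case (Suc n)
    have "(\<lambda>x. m x *\<^sub>R (real n * m x ^ (n - 1)) *\<^sub>R G x + m x ^ n *\<^sub>R G x) = (\<lambda>x. (real (Suc n) * m x ^ (Suc n - 1)) *\<^sub>R G x)"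
    proof
      fix x
      have "m x * (real n * m x ^ (n - 1)) + m x ^ n = real (Suc n) * m x ^ (Suc n - 1)"
        by (cases n) (auto simp: algebra_simps)
      then show "m x *\<^sub>R (real n * m x ^ (n - 1)) *\<^sub>R G x + m x ^ n *\<^sub>R G x = (real (Suc n) * m x ^ (Suc n - 1)) *\<^sub>R G x"
        by (simp only: scaleR_scaleR flip: scaleR_add_left)
    qed
    with multiplier_mult[OF m Suc] show ?case by simp
  qed
  define S where "S n x = (\<Sum>i<n. m x ^ i / fact i)" for n x
  have S: "multiplier (S n) (\<lambda>x. (\<Sum>i<n. real i * m x ^ (i - 1) / fact i) *\<^sub>R G x)" for n
  proof (induction n)
    case 0 then show ?case using multiplier_const[of 0] by (simp add: S_def[abs_def])
  next
    case (Suc n)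
    from multiplier_add[OF Suc multiplier_mult[OF multiplier_const[of "1 / fact n"] pow[of n]]]
    show ?case by (simp add: S_def[abs_def] algebra_simps)
  qed
  \<comment> \<open>Differentiating a partial sum gives the preceding one, so the gradient factor of
    \<open>S (Suc n)\<close> is \<open>S n\<close>.\<close>
  have shift: "(\<Sum>i<Suc n. real i * m x ^ (i - 1) / fact i) = S n x" for n x
  proof -
    have "(\<Sum>i<Suc n. real i * m x ^ (i - 1) / fact i) = (\<Sum>i<n. real (Suc i) * m x ^ i / fact (Suc i))"
      by (simp add: sum.lessThan_Suc_shift del: sum.lessThan_Suc of_nat_Suc fact_Suc)
    also have "\<dots> = S n x" unfolding S_def by (intro sum.cong refl) (simp add: fact_Suc divide_simps del: of_nat_Suc)
    finally show ?thesis .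
  qed
  have SS: "multiplier (S (Suc n)) (\<lambda>x. S n x *\<^sub>R G x)" for n
    using S[of "Suc n"] by (simp only: shift)
  obtain C0 C1 where C: "AE x in M. \<bar>m x\<bar> \<le> C0" "AE x in M. norm (G x) \<le> C1" using mD by blast
  have Sb: "AE x in M. \<forall>n. \<bar>S n x\<bar> \<le> exp C0"
    using C(1)
  proof eventually_elim
    case (elim x)
    have "\<bar>S n x\<bar> \<le> exp C0" for n
      using partial_exp_sum_le[of "m x" n] elim unfolding S_def by (meson exp_le_cancel_iff order_trans)
    then show ?case by blast
  qed
  have Slim: "(\<lambda>n. S n x) \<longlonglongrightarrow> exp (m x)" for x unfolding S_def by (rule partial_exp_sum_tendsto)
  have eb: "AE x in M. \<bar>exp (m x)\<bar> \<le> exp C0" using C(1) by eventually_elim auto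
  have "(\<lambda>x. exp (m x) * u x) \<in> Dom \<and>
      (AE x in M. D (\<lambda>x. exp (m x) * u x) x = exp (m x) *\<^sub>R D u x + u x *\<^sub>R (exp (m x) *\<^sub>R G x))" if u: "u \<in> Dom" for u
  proof -
    have [measurable]: "u \<in> borel_measurable M" "D u \<in> borel_measurable M" using u by (auto intro: dom_measurable D_measurable)
    define Gs where "Gs n x = S (Suc n) x *\<^sub>R D u x + u x *\<^sub>R (S n x *\<^sub>R G x)" for n x
    have f: "(\<lambda>x. S (Suc n) x * u x) \<in> Dom" "AE x in M. D (\<lambda>x. S (Suc n) x * u x) x = Gs n x" for n
      unfolding Gs_def using multiplierD(5,6)[OF SS u] by blast+
    have l1: "AE x in M. (\<lambda>n. S (Suc n) x * u x) \<longlonglongrightarrow> exp (m x) * u x"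
      using Slim by (intro AE_I2 tendsto_intros LIMSEQ_Suc)
    have l2: "AE x in M. (\<lambda>n. Gs n x) \<longlonglongrightarrow> exp (m x) *\<^sub>R D u x + u x *\<^sub>R (exp (m x) *\<^sub>R G x)"
      unfolding Gs_def using Slim by (intro AE_I2 tendsto_intros LIMSEQ_Suc)
    have b1: "AE x in M. \<bar>S (Suc n) x * u x\<bar> \<le> norm (exp C0 * u x)" for n
      using Sb by eventually_elim (auto simp: abs_mult intro!: mult_right_mono)
    have b2: "AE x in M. norm (Gs n x) \<le> norm (exp C0 *\<^sub>R D u x) + norm ((exp C0 * C1) * u x)" for n
      using Sb C(2)
    proof eventually_elim
      case (elim x)
      have "norm (S (Suc n) x *\<^sub>R D u x) \<le> norm (exp C0 *\<^sub>R D u x)"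
        using elim by (auto intro: mult_right_mono)
      moreover have "\<bar>S n x\<bar> * norm (G x) \<le> \<bar>exp C0 * C1\<bar>"
        unfolding abs_mult using elim by (intro mult_mono) auto
      then have "norm (u x *\<^sub>R (S n x *\<^sub>R G x)) \<le> norm ((exp C0 * C1) * u x)"
        using mult_right_mono[of "\<bar>S n x\<bar> * norm (G x)" "\<bar>exp C0 * C1\<bar>" "\<bar>u x\<bar>"] by (simp add: mult_ac abs_mult)
      ultimately show ?case unfolding Gs_def by (rule norm_triangle_mono)
    qed
    have L: "L2H M (\<lambda>x. norm (exp C0 * u x))" "L2H M (\<lambda>x. norm (exp C0 *\<^sub>R D u x) + norm ((exp C0 * C1) * u x))"
      by (rule L2_norm L2H_add L2_cmult L2H_scaleR dom_L2 D_L2 u)+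
    show ?thesis
      by (intro conjI; rule dom_dominated[OF f _ _ l1 b1 L(1) l2 b2 L(2)]; measurable)
  qed
  moreover have "\<exists>C. AE x in M. norm (exp (m x) *\<^sub>R G x) \<le> C"
  proof
    show "AE x in M. norm (exp (m x) *\<^sub>R G x) \<le> exp C0 * C1"
      using eb C(2) by eventually_elim (auto intro: mult_mono)
  qed
  moreover have "\<exists>C. AE x in M. \<bar>exp (m x)\<bar> \<le> C" using eb by blast
  moreover have "(\<lambda>x. exp (m x)) \<in> borel_measurable M" "(\<lambda>x. exp (m x) *\<^sub>R G x) \<in> borel_measurable M"
    by measurable
  ultimately show ?thesis unfolding multiplier_def by blast
qed

end

section \<open>The intrinsic distance\<close>

context dirichlet_nest
begin

text \<open>A local unit: the function of the nest that is at least 1 on \<open>Ek\<close> is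
  composed with a C1 function vanishing at 0 and constantly 1 beyond 1. The vanishing derivative
  there gives gradient zero on \<open>Ek\<close>.\<close>

lemma nest_cutoff:
  obtains \<zeta> where "\<zeta> \<in> Dom" "\<And>x. 0 \<le> \<zeta> x \<and> \<zeta> x \<le> 1" "AE x in M. x \<in> Ek k \<longrightarrow> \<zeta> x = 1 \<and> D \<zeta> x = 0"
proof -
  obtain h where h: "h \<in> Dom" "AE x in M. x \<in> Ek k \<longrightarrow> 1 \<le> h x"
    using nest unfolding measurable_nest_def by blast
  define F where "F x = 1 - (max 0 (1 - x\<^sup>2))\<^sup>2" for x :: real
  define F' where "F' x = 4 * x * max 0 (1 - x\<^sup>2)" for x :: real
  have der: "(F has_real_derivative F' x) (at x)" for x
  proof -
    have "((\<lambda>x. 1 - x\<^sup>2) has_real_derivative - (2 * x)) (at x)" by (auto intro!: derivative_eq_intros)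
    from DERIV_chain2[OF positive_part_square_derivative this]
    have "((\<lambda>x. (max 0 (1 - x\<^sup>2))\<^sup>2) has_real_derivative 2 * max 0 (1 - x\<^sup>2) * - (2 * x)) (at x)" .
    from DERIV_diff[OF DERIV_const[of 1] this] show ?thesis
      unfolding F_def[abs_def] F'_def by (simp add: mult_ac)
  qed
  have bdd: "\<bar>F' x\<bar> \<le> 4" for x
  proof (cases "x\<^sup>2 \<le> 1")
    case True
    then have "\<bar>x\<bar> \<le> 1" by (simp add: abs_square_le_1)
    moreover have "\<bar>max 0 (1 - x\<^sup>2)\<bar> \<le> 1" by (simp add: max_def)
    ultimately have "\<bar>x\<bar> * \<bar>max 0 (1 - x\<^sup>2)\<bar> \<le> 1 * 1" by (intro mult_mono) auto
    then show ?thesis by (simp add: F'_def abs_mult)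
  next
    case False then show ?thesis by (simp add: F'_def max_def)
  qed
  have cont: "continuous_on UNIV F'" unfolding F'_def[abs_def] by (intro continuous_intros)
  have F0: "F 0 = 0" by (simp add: F_def)
  note ch = chain_rule[OF h(1) der cont bdd F0]
  have 1: "0 \<le> F x \<and> F x \<le> 1" for x
  proof -
    have "\<bar>max 0 (1 - x\<^sup>2)\<bar> \<le> 1" by (simp add: max_def)
    then show ?thesis by (simp add: F_def abs_square_le_1)
  qed
  have "AE x in M. x \<in> Ek k \<longrightarrow> F (h x) = 1 \<and> D (\<lambda>x. F (h x)) x = 0"
    using h(2) ch(2)
  proof eventually_elim
    case (elim x)
    have mx: "max 0 (1 - (h x)\<^sup>2) = 0" if "1 \<le> h x" using one_le_power[OF that, of 2] by simp
    show ?case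
    proof
      assume "x \<in> Ek k"
      then have "1 \<le> h x" using elim by simp
      then show "F (h x) = 1 \<and> D (\<lambda>x. F (h x)) x = 0" unfolding elim(2) unfolding F_def F'_def mx by simp
    qed
  qed
  with that[of "\<lambda>x. F (h x)"] ch(1) 1 show thesis by blast
qed

text \<open>The bounds make \<open>f\<^sub>n \<zeta>\<close> bounded in energy, so weak closedness of \<open>D\<close> applies.\<close>

lemma D0_closed:
  assumes fn: "\<And>n. fn n \<in> D_0" and f: "f \<in> borel_measurable M"
    and b: "\<And>n. AE x in M. \<bar>fn n x\<bar> \<le> C" and lim: "AE x in M. (\<lambda>n. fn n x) \<longlonglongrightarrow> f x"
  shows "f \<in> D_0"
proof -
  have ball: "AE x in M. \<forall>n. \<bar>fn n x\<bar> \<le> C" unfolding AE_all_countable using b by blast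
  with lim have fb: "AE x in M. \<bar>f x\<bar> \<le> C"
  proof eventually_elim
    case (elim x)
    from elim have "(\<lambda>n. \<bar>fn n x\<bar>) \<longlonglongrightarrow> \<bar>f x\<bar>" by (intro tendsto_intros)
    then show ?case by (rule LIMSEQ_le_const2) (use elim in auto)
  qed
  have [measurable]: "fn n \<in> borel_measurable M" "grad (fn n) \<in> borel_measurable M" for n
    using fn by (auto intro: D0D grad_measurable)
  note [measurable] = f
  show ?thesis
  proof (rule D0I[OF f fb])
    fix k
    obtain \<zeta> where \<zeta>: "\<zeta> \<in> Dom" "\<And>x. 0 \<le> \<zeta> x \<and> \<zeta> x \<le> 1" "AE x in M. x \<in> Ek k \<longrightarrow> \<zeta> x = 1 \<and> D \<zeta> x = 0"
      using nest_cutoff[of k] by blast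
    have [measurable]: "\<zeta> \<in> borel_measurable M" using \<zeta> by (auto intro: dom_measurable)
    note m = multiplierD(5,6)[OF D0_multiplier[OF fn] \<zeta>(1)]
    have L\<zeta>: "L2H M (\<lambda>x. norm (C * \<zeta> x))" by (rule L2_norm L2_cmult dom_L2 \<zeta>)+
    have l: "L2H M (\<lambda>x. f x * \<zeta> x)" "(\<lambda>n. \<integral>x. (norm (fn n x * \<zeta> x - f x * \<zeta> x))\<^sup>2 \<partial>M) \<longlonglongrightarrow> 0"
    proof -
      have p1: "AE x in M. (\<lambda>n. fn n x * \<zeta> x) \<longlonglongrightarrow> f x * \<zeta> x"
        using lim by eventually_elim (intro tendsto_intros)
      have p2: "AE x in M. norm (fn n x * \<zeta> x) \<le> norm (C * \<zeta> x)" for n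
        using ball by eventually_elim (auto simp: abs_mult \<zeta>(2) intro!: mult_right_mono order_trans[OF _ abs_ge_self])
      show "L2H M (\<lambda>x. f x * \<zeta> x)" "(\<lambda>n. \<integral>x. (norm (fn n x * \<zeta> x - f x * \<zeta> x))\<^sup>2 \<partial>M) \<longlonglongrightarrow> 0"
        by (rule L2H_dominated_convergence[OF _ _ p1 p2 L\<zeta>]; measurable)+
    qed
    define K where "K = 2 * (C\<^sup>2 * (\<integral>x. (norm (D \<zeta> x))\<^sup>2 \<partial>M)) + 2 * (\<integral>x. (\<zeta> x)\<^sup>2 \<partial>M)"
    have bK: "(\<integral>x. (norm (D (\<lambda>x. fn n x * \<zeta> x) x))\<^sup>2 \<partial>M) \<le> K" for n
    proof -
      have "(\<integral>x. (norm (D (\<lambda>x. fn n x * \<zeta> x) x))\<^sup>2 \<partial>M) \<le> (\<integral>x. 2 * (C\<^sup>2 * (norm (D \<zeta> x))\<^sup>2) + 2 * (\<zeta> x)\<^sup>2 \<partial>M)"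
      proof (rule integral_mono_AE)
        show "integrable M (\<lambda>x. (norm (D (\<lambda>x. fn n x * \<zeta> x) x))\<^sup>2)" by (rule L2H_integrable[OF D_L2[OF m(1)]])
        show "integrable M (\<lambda>x. 2 * (C\<^sup>2 * (norm (D \<zeta> x))\<^sup>2) + 2 * (\<zeta> x)\<^sup>2)"
          using L2H_integrable[OF D_L2[OF \<zeta>(1)]] L2_integrable[OF dom_L2[OF \<zeta>(1)]] by simp
        show "AE x in M. (norm (D (\<lambda>x. fn n x * \<zeta> x) x))\<^sup>2 \<le> 2 * (C\<^sup>2 * (norm (D \<zeta> x))\<^sup>2) + 2 * (\<zeta> x)\<^sup>2"
          using b[of n] m(2)[of n] D0D(4)[OF fn[of n]]
        proof eventually_elim
          case (elim x)
          have f2: "(fn n x)\<^sup>2 \<le> C\<^sup>2" using elim by (metis abs_ge_zero power2_abs power_mono)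
          have g2: "(norm (grad (fn n) x))\<^sup>2 \<le> 1" using elim by (simp add: power_le_one)
          have "(norm (D (\<lambda>x. fn n x * \<zeta> x) x))\<^sup>2 \<le> 2 * (norm (fn n x *\<^sub>R D \<zeta> x))\<^sup>2 + 2 * (norm (\<zeta> x *\<^sub>R grad (fn n) x))\<^sup>2"
            unfolding elim(2) by (rule norm_add_square_le)
          also have "\<dots> = 2 * ((fn n x)\<^sup>2 * (norm (D \<zeta> x))\<^sup>2) + 2 * ((norm (grad (fn n) x))\<^sup>2 * (\<zeta> x)\<^sup>2)"
            by (simp add: power_mult_distrib)
          also have "\<dots> \<le> 2 * (C\<^sup>2 * (norm (D \<zeta> x))\<^sup>2) + 2 * (1 * (\<zeta> x)\<^sup>2)"
            by (intro add_mono mult_left_mono mult_right_mono f2 g2) auto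
          finally show ?case by simp
        qed
      qed
      also have "\<dots> = K"
        using L2H_integrable[OF D_L2[OF \<zeta>(1)]] L2_integrable[OF dom_L2[OF \<zeta>(1)]] by (simp add: K_def)
      finally show ?thesis .
    qed
    have one: "AE x in M. x \<in> Ek k \<longrightarrow> norm (D (\<lambda>x. fn n x * \<zeta> x) x) \<le> 1" for n
      using m(2)[of n] \<zeta>(3) D0D(4)[OF fn[of n]] by eventually_elim auto
    have lim2: "(\<lambda>n. \<integral>x. (fn n x * \<zeta> x - f x * \<zeta> x)\<^sup>2 \<partial>M) \<longlonglongrightarrow> 0" using l(2) by simp
    note w = dom_weak_limit[OF m(1) l(1) lim2 bK one]
    have eq: "AE x in M. x \<in> Ek k \<longrightarrow> f x = f x * \<zeta> x" using \<zeta>(3) by eventually_elim simp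
    show "\<exists>g\<in>Dom. (AE x in M. x \<in> Ek k \<longrightarrow> f x = g x) \<and> (AE x in M. x \<in> Ek k \<longrightarrow> norm (D g x) \<le> 1)"
      by (intro bexI[of _ "\<lambda>x. f x * \<zeta> x"] conjI eq w)
  qed
qed

text \<open>A constant may fail to be in \<open>Dom\<close>; on \<open>Ek\<close> it is represented
  by a multiple of the local unit, whose gradient vanishes there.\<close>

lemma D0_add_const:
  assumes f: "f \<in> D_0" shows "(\<lambda>x. f x + c) \<in> D_0"
proof -
  obtain C where C: "AE x in M. \<bar>f x\<bar> \<le> C" using D0D(3)[OF f] by blast
  have [measurable]: "f \<in> borel_measurable M" by (rule D0D[OF f])
  show ?thesis
  proof (rule D0I[where C = "C + \<bar>c\<bar>"])
    show "AE x in M. \<bar>f x + c\<bar> \<le> C + \<bar>c\<bar>" using C by eventually_elim linarith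
    fix k
    obtain \<zeta> where \<zeta>: "\<zeta> \<in> Dom" "AE x in M. x \<in> Ek k \<longrightarrow> \<zeta> x = 1 \<and> D \<zeta> x = 0"
      using nest_cutoff[of k] by blast
    obtain g where g: "g \<in> Dom" "AE x in M. x \<in> Ek k \<longrightarrow> f x = g x" "AE x in M. x \<in> Ek k \<longrightarrow> norm (D g x) \<le> 1"
      using D0_local[OF f, of k] by blast
    note c = dom_cmult[OF \<zeta>(1), of c]
    note a = dom_add[OF g(1) c(1)]
    have "AE x in M. x \<in> Ek k \<longrightarrow> f x + c = g x + c * \<zeta> x" using g(2) \<zeta>(2) by eventually_elim auto
    moreover have "AE x in M. x \<in> Ek k \<longrightarrow> norm (D (\<lambda>x. g x + c * \<zeta> x) x) \<le> 1"
      using a(2) c(2) \<zeta>(2) g(3) by eventually_elim auto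
    ultimately show "\<exists>g\<in>Dom. (AE x in M. x \<in> Ek k \<longrightarrow> f x + c = g x) \<and> (AE x in M. x \<in> Ek k \<longrightarrow> norm (D g x) \<le> 1)"
      using a(1) by (intro bexI[of _ "\<lambda>x. g x + c * \<zeta> x"] conjI)
  qed measurable
qed

lemma D0_zero: "(\<lambda>_. 0) \<in> D_0"
proof (rule D0I[where C = 0])
  fix k
  have "AE x in M. x \<in> Ek k \<longrightarrow> norm (D (\<lambda>_. 0) x) \<le> 1" using D_zero by eventually_elim simp
  then show "\<exists>g\<in>Dom. (AE x in M. x \<in> Ek k \<longrightarrow> 0 = g x) \<and> (AE x in M. x \<in> Ek k \<longrightarrow> norm (D g x) \<le> 1)"
    using dom_zero by (intro bexI[of _ "\<lambda>_. 0"]) auto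
qed auto

lemma D0_const: "(\<lambda>_. c) \<in> D_0"
  using D0_add_const[OF D0_zero, of c] by simp

lemma D0_uminus:
  assumes f: "f \<in> D_0" shows "(\<lambda>x. - f x) \<in> D_0"
proof -
  obtain C where C: "AE x in M. \<bar>f x\<bar> \<le> C" using D0D(3)[OF f] by blast
  have [measurable]: "f \<in> borel_measurable M" by (rule D0D[OF f])
  show ?thesis
  proof (rule D0I)
    show "AE x in M. \<bar>- f x\<bar> \<le> C" using C by simp
    fix k
    obtain g where g: "g \<in> Dom" "AE x in M. x \<in> Ek k \<longrightarrow> f x = g x" "AE x in M. x \<in> Ek k \<longrightarrow> norm (D g x) \<le> 1"
      using D0_local[OF f, of k] by blast
    note c = dom_cmult[OF g(1), of "-1"]
    have "AE x in M. x \<in> Ek k \<longrightarrow> - f x = -1 * g x" using g(2) by eventually_elim auto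
    moreover have "AE x in M. x \<in> Ek k \<longrightarrow> norm (D (\<lambda>x. -1 * g x) x) \<le> 1"
      using c(2) g(3) by eventually_elim auto
    ultimately show "\<exists>g\<in>Dom. (AE x in M. x \<in> Ek k \<longrightarrow> - f x = g x) \<and> (AE x in M. x \<in> Ek k \<longrightarrow> norm (D g x) \<le> 1)"
      using c(1) by (intro bexI[of _ "\<lambda>x. - 1 * g x"] conjI)
  qed measurable
qed

text \<open>\<open>max f g = (f + g + \<bar>f - g\<bar>) / 2\<close>; smoothing the absolute value turns the gradient into a
  convex combination of the two gradients.\<close>

lemma D0_max:
  assumes f: "f \<in> D_0" and g: "g \<in> D_0" shows "(\<lambda>x. max (f x) (g x)) \<in> D_0"
proof -
  obtain C1 C2 where C: "AE x in M. \<bar>f x\<bar> \<le> C1" "AE x in M. \<bar>g x\<bar> \<le> C2" using D0D(3)[OF f] D0D(3)[OF g] by blast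
  have [measurable]: "f \<in> borel_measurable M" "g \<in> borel_measurable M" using f g by (auto intro: D0D)
  define e where "e n = inverse (real (Suc n))" for n
  have e: "e n > 0" for n by (simp add: e_def)
  have e0: "e \<longlonglongrightarrow> 0" unfolding e_def[abs_def] by (rule LIMSEQ_inverse_real_of_nat)
  \<comment> \<open>Subtracting \<open>e n\<close> gives \<open>A n 0 = 0\<close>, which the chain
    rule requires.\<close>
  define A where "A n x = sqrt (x\<^sup>2 + (e n)\<^sup>2) - e n" for n x
  define A' where "A' n x = x / sqrt (x\<^sup>2 + (e n)\<^sup>2)" for n x
  have pos: "x\<^sup>2 + (e n)\<^sup>2 > 0" for n x using e[of n] by (intro add_nonneg_pos) auto
  have der: "(A n has_real_derivative A' n x) (at x)" for n x
  proof -
    have "((\<lambda>x. x\<^sup>2 + (e n)\<^sup>2) has_real_derivative 2 * x) (at x)"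
      using DERIV_add[OF DERIV_pow[of 2 x] DERIV_const[of "(e n)\<^sup>2"]] by simp
    from DERIV_diff[OF DERIV_chain2[OF DERIV_real_sqrt[OF pos[of x n]] this] DERIV_const[of "e n"]]
    have "(A n has_real_derivative inverse (sqrt (x\<^sup>2 + (e n)\<^sup>2)) / 2 * (2 * x) - 0) (at x)"
      unfolding A_def[abs_def] .
    moreover have "inverse q / 2 * (2 * x) - 0 = x / q" for q by (cases "q = 0") (auto simp: field_simps)
    ultimately show ?thesis unfolding A'_def by (simp only:)
  qed
  have cont: "continuous_on UNIV (A' n)" for n
    unfolding A'_def[abs_def] using pos[of _ n] by (intro continuous_intros) (metis less_irrefl real_sqrt_gt_zero)
  have bdd: "\<bar>A' n x\<bar> \<le> 1" for n x
  proof -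
    have "\<bar>x\<bar> \<le> sqrt (x\<^sup>2 + (e n)\<^sup>2)" by (rule real_le_rsqrt) simp
    then show ?thesis using pos[of x n] by (simp add: A'_def abs_divide)
  qed
  have A0: "A n 0 = 0" for n using e[of n] by (simp add: A_def)
  have Ab: "0 \<le> A n x \<and> A n x \<le> \<bar>x\<bar>" for n x
  proof
    have "e n \<le> sqrt (x\<^sup>2 + (e n)\<^sup>2)" by (rule real_le_rsqrt) simp
    then show "0 \<le> A n x" by (simp add: A_def)
    have "sqrt (x\<^sup>2 + (e n)\<^sup>2) \<le> \<bar>x\<bar> + e n"
      using e[of n] by (intro real_le_lsqrt) (auto simp: power2_sum)
    then show "A n x \<le> \<bar>x\<bar>" by (simp add: A_def)
  qed
  have Alim: "(\<lambda>n. A n x) \<longlonglongrightarrow> \<bar>x\<bar>" for x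
  proof -
    have "(\<lambda>n. A n x) \<longlonglongrightarrow> sqrt (x\<^sup>2 + 0\<^sup>2) - 0" unfolding A_def by (intro tendsto_intros e0)
    then show ?thesis by simp
  qed
  have [measurable]: "A n \<in> borel_measurable borel" for n unfolding A_def[abs_def] by measurable
  define F where "F n x = (1/2) * (f x + g x) + (1/2) * A n (f x - g x)" for n x
  have [measurable]: "F n \<in> borel_measurable M" for n unfolding F_def[abs_def] by measurable
  have Fb: "AE x in M. \<bar>F n x\<bar> \<le> C1 + C2" for n
    using C
  proof eventually_elim
    case (elim x)
    have "\<bar>(1/2) * (p + q) + (1/2) * a\<bar> \<le> \<bar>p\<bar> + \<bar>q\<bar>" if "0 \<le> a \<and> a \<le> \<bar>p - q\<bar>" for p q a :: real
    proof -
      have "\<bar>p + q + a\<bar> \<le> 2 * \<bar>p\<bar> + 2 * \<bar>q\<bar>" using that by linarith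
      moreover have "\<bar>(1/2) * (p + q) + (1/2) * a\<bar> = \<bar>p + q + a\<bar> / 2" by (simp add: field_simps)
      ultimately show ?thesis by simp
    qed
    from this[OF Ab[of n "f x - g x"]] elim show ?case unfolding F_def by linarith
  qed
  have FD: "F n \<in> D_0" for n
  proof (rule D0I[OF _ Fb])
    fix k
    obtain f' where f': "f' \<in> Dom" "AE x in M. x \<in> Ek k \<longrightarrow> f x = f' x" "AE x in M. x \<in> Ek k \<longrightarrow> norm (D f' x) \<le> 1"
      using D0_local[OF f, of k] by blast
    obtain g' where g': "g' \<in> Dom" "AE x in M. x \<in> Ek k \<longrightarrow> g x = g' x" "AE x in M. x \<in> Ek k \<longrightarrow> norm (D g' x) \<le> 1"
      using D0_local[OF g, of k] by blast
    note s = dom_add[OF f'(1) g'(1)]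
    note s2 = dom_cmult[OF s(1), of "1/2"]
    note d = dom_diff[OF f'(1) g'(1)]
    note c = chain_rule[OF d(1) der cont bdd A0, of n]
    note c2 = dom_cmult[OF c(1), of "1/2"]
    note t = dom_add[OF s2(1) c2(1)]
    have "AE x in M. x \<in> Ek k \<longrightarrow> F n x = 1 / 2 * (f' x + g' x) + 1 / 2 * A n (f' x - g' x)"
      using f'(2) g'(2) by eventually_elim (auto simp: F_def)
    moreover have "AE x in M. x \<in> Ek k \<longrightarrow> norm (D (\<lambda>x. 1 / 2 * (f' x + g' x) + 1 / 2 * A n (f' x - g' x)) x) \<le> 1"
      using f'(3) g'(3) s(2) s2(2) d(2) c(2) c2(2) t(2)
    proof eventually_elim
      case (elim x)
      define a where "a = A' n (f' x - g' x)"
      have a: "\<bar>a\<bar> \<le> 1" unfolding a_def by (rule bdd)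
      have "D (\<lambda>x. 1 / 2 * (f' x + g' x) + 1 / 2 * A n (f' x - g' x)) x
          = (1/2) *\<^sub>R (D f' x + D g' x) + (1/2) *\<^sub>R (a *\<^sub>R (D f' x - D g' x))"
        using elim by (simp add: a_def)
      also have "\<dots> = ((1 + a) / 2) *\<^sub>R D f' x + ((1 - a) / 2) *\<^sub>R D g' x"
        by (simp add: algebra_simps add_divide_distrib diff_divide_distrib)
      finally have eq: "D (\<lambda>x. 1 / 2 * (f' x + g' x) + 1 / 2 * A n (f' x - g' x)) x
          = ((1 + a) / 2) *\<^sub>R D f' x + ((1 - a) / 2) *\<^sub>R D g' x" .
      show ?case
      proof
        assume "x \<in> Ek k"
        have "norm (((1 + a) / 2) *\<^sub>R D f' x) \<le> (1 + a) / 2"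
          using mult_left_mono[of "norm (D f' x)" 1 "(1 + a) / 2"] elim(1) \<open>x \<in> Ek k\<close> a by auto
        moreover have "norm (((1 - a) / 2) *\<^sub>R D g' x) \<le> (1 - a) / 2"
          using mult_left_mono[of "norm (D g' x)" 1 "(1 - a) / 2"] elim(2) \<open>x \<in> Ek k\<close> a by auto
        ultimately have "norm (((1 + a) / 2) *\<^sub>R D f' x + ((1 - a) / 2) *\<^sub>R D g' x) \<le> (1 + a) / 2 + (1 - a) / 2"
          by (rule norm_triangle_mono)
        also have "\<dots> = 1" by (simp add: field_simps)
        finally show "norm (D (\<lambda>x. 1 / 2 * (f' x + g' x) + 1 / 2 * A n (f' x - g' x)) x) \<le> 1" unfolding eq .
      qed
    qed
    ultimately show "\<exists>g\<in>Dom. (AE x in M. x \<in> Ek k \<longrightarrow> F n x = g x) \<and> (AE x in M. x \<in> Ek k \<longrightarrow> norm (D g x) \<le> 1)"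
      using t(1) by (intro bexI[of _ "\<lambda>x. 1 / 2 * (f' x + g' x) + 1 / 2 * A n (f' x - g' x)"] conjI)
  qed measurable
  have lim: "AE x in M. (\<lambda>n. F n x) \<longlonglongrightarrow> max (f x) (g x)"
  proof (rule AE_I2)
    fix x
    have "(\<lambda>n. F n x) \<longlonglongrightarrow> (1/2) * (f x + g x) + (1/2) * \<bar>f x - g x\<bar>"
      unfolding F_def by (intro tendsto_intros Alim)
    moreover have "(1/2) * (f x + g x) + (1/2) * \<bar>f x - g x\<bar> = max (f x) (g x)"
      by (cases "f x \<le> g x") (simp_all add: field_simps)
    ultimately show "(\<lambda>n. F n x) \<longlonglongrightarrow> max (f x) (g x)" by simp
  qed
  have "(\<lambda>x. max (f x) (g x)) \<in> borel_measurable M" by measurable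
  from D0_closed[OF FD this Fb lim] show ?thesis .
qed

lemma D0_min:
  assumes f: "f \<in> D_0" and g: "g \<in> D_0" shows "(\<lambda>x. min (f x) (g x)) \<in> D_0"
proof -
  have "(\<lambda>x. - max (- f x) (- g x)) \<in> D_0" by (intro D0_uminus D0_max f g)
  moreover have "(\<lambda>x. - max (- f x) (- g x)) = (\<lambda>x. min (f x) (g x))" by (auto simp: max_def min_def)
  ultimately show ?thesis by simp
qed

definition admissible :: "'a set \<Rightarrow> real \<Rightarrow> ('a \<Rightarrow> real) set" where
  "admissible B N = {f \<in> D_0. (AE x in M. x \<in> B \<longrightarrow> f x = 0) \<and> (AE x in M. 0 \<le> f x \<and> f x \<le> N)}"

text \<open>An almost everywhere greatest element is found by maximising one number, the integral
  against a strictly positive weight. A maximiser must dominate every competitor, since otherwise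
  their pointwise maximum would have a larger integral.\<close>

lemma admissible_greatest:
  assumes N: "N > 0"
  obtains V where "V \<in> admissible B N" "\<And>f. f \<in> admissible B N \<Longrightarrow> AE x in M. f x \<le> V x"
proof -
  obtain p :: "'a \<Rightarrow> real" where p: "integrable M p" "AE x in M. 0 < p x" "\<And>x. 0 \<le> p x"
    using positive_integrable_function by blast
  have [measurable]: "p \<in> borel_measurable M" using p(1) by auto
  have am: "f \<in> borel_measurable M" if "f \<in> admissible B N" for f using that by (auto simp: admissible_def intro: D0D)
  have ip: "integrable M (\<lambda>x. f x * p x)" if f: "f \<in> admissible B N" for f
  proof (rule Bochner_Integration.integrable_bound[of M "\<lambda>x. N * p x"])
    show "integrable M (\<lambda>x. N * p x)" using p by simp
    show "(\<lambda>x. f x * p x) \<in> borel_measurable M" using am[OF f] by measurable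
    have "AE x in M. 0 \<le> f x \<and> f x \<le> N" using f by (simp add: admissible_def)
    then show "AE x in M. norm (f x * p x) \<le> norm (N * p x)"
      by eventually_elim (use p(3) N in \<open>auto simp: abs_mult intro!: mult_right_mono\<close>)
  qed
  define J where "J f = (\<integral>x. f x * p x \<partial>M)" for f
  have Jmono: "J f \<le> J g" if "f \<in> admissible B N" "g \<in> admissible B N" "AE x in M. f x \<le> g x" for f g
    unfolding J_def using that(3)
    by (intro integral_mono_AE ip that) (use p(3) in \<open>auto elim!: eventually_mono intro: mult_right_mono\<close>)
  have z: "(\<lambda>_. 0) \<in> admissible B N" using D0_zero N by (simp add: admissible_def)
  have c: "J f \<le> N * (\<integral>x. p x \<partial>M)" if f: "f \<in> admissible B N" for f
  proof -
    have "AE x in M. 0 \<le> f x \<and> f x \<le> N" using f by (simp add: admissible_def)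
    then have "AE x in M. f x * p x \<le> N * p x" by eventually_elim (use p(3) in \<open>auto intro: mult_right_mono\<close>)
    then have "J f \<le> (\<integral>x. N * p x \<partial>M)" unfolding J_def using p(1) by (intro integral_mono_AE[OF ip[OF f]]) auto
    then show ?thesis by simp
  qed
  have bdd: "bdd_above (J ` admissible B N)" using c by (intro bdd_aboveI2)
  define s where "s = Sup (J ` admissible B N)"
  have Js: "J f \<le> s" if "f \<in> admissible B N" for f
    unfolding s_def using that bdd by (intro cSup_upper) auto
  have "\<exists>f\<in>admissible B N. s - inverse (real (Suc n)) < J f" for n
  proof -
    have "s - inverse (real (Suc n)) < Sup (J ` admissible B N)" by (simp add: s_def)
    then have "\<exists>y\<in>J ` admissible B N. s - inverse (real (Suc n)) < y" using z by (intro less_cSupD) auto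
    then show ?thesis by auto
  qed
  then obtain f where f: "\<And>n. f n \<in> admissible B N" "\<And>n. s - inverse (real (Suc n)) < J (f n)" by metis
  have amax: "(\<lambda>x. max (g x) (h x)) \<in> admissible B N" if "g \<in> admissible B N" "h \<in> admissible B N" for g h
  proof -
    have a: "AE x in M. x \<in> B \<longrightarrow> g x = 0" "AE x in M. x \<in> B \<longrightarrow> h x = 0" "AE x in M. 0 \<le> g x \<and> g x \<le> N"
       "AE x in M. 0 \<le> h x \<and> h x \<le> N" using that by (auto simp: admissible_def)
    have "AE x in M. x \<in> B \<longrightarrow> max (g x) (h x) = 0" using a(1,2) by eventually_elim auto
    moreover have "AE x in M. 0 \<le> max (g x) (h x) \<and> max (g x) (h x) \<le> N" using a(3,4) by eventually_elim auto
    ultimately show ?thesis using that D0_max by (simp add: admissible_def)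
  qed
  \<comment> \<open>Running maxima turn the maximising sequence into an increasing one, which
    converges pointwise and is still maximising.\<close>
  define F where "F = rec_nat (f 0) (\<lambda>n g x. max (g x) (f (Suc n) x))"
  have F0: "F 0 = f 0" and FS: "F (Suc n) = (\<lambda>x. max (F n x) (f (Suc n) x))" for n by (simp_all add: F_def)
  have Fa: "F n \<in> admissible B N" for n by (induction n) (auto simp: F0 FS f intro: amax)
  have Ff: "f n x \<le> F n x" for n x by (cases n) (auto simp: F0 FS)
  have inc: "incseq (\<lambda>n. F n x)" for x by (rule incseq_SucI) (simp add: FS)
  have [measurable]: "F n \<in> borel_measurable M" for n by (rule am[OF Fa])
  define V where "V x = lim (\<lambda>n. F n x)" for x
  have [measurable]: "V \<in> borel_measurable M" unfolding V_def[abs_def] by (rule borel_measurable_lim_metric) measurable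
  have FN: "AE x in M. \<forall>n. 0 \<le> F n x \<and> F n x \<le> N" and FB: "AE x in M. \<forall>n. x \<in> B \<longrightarrow> F n x = 0"
    unfolding AE_all_countable using Fa by (auto simp: admissible_def)
  have lim: "AE x in M. (\<lambda>n. F n x) \<longlonglongrightarrow> V x \<and> (\<forall>n. F n x \<le> V x)"
    using FN
  proof eventually_elim
    case (elim x)
    obtain L where L: "(\<lambda>n. F n x) \<longlonglongrightarrow> L" "\<forall>n. F n x \<le> L" using incseq_convergent[OF inc, of x N] elim by blast
    then have "V x = L" unfolding V_def by (intro limI)
    with L show ?case by simp
  qed
  have VD: "V \<in> D_0"
  proof (rule D0_closed)
    show "F n \<in> D_0" for n using Fa by (simp add: admissible_def)
    show "AE x in M. \<bar>F n x\<bar> \<le> N" for n using FN by eventually_elim auto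
    show "AE x in M. (\<lambda>n. F n x) \<longlonglongrightarrow> V x" using lim by eventually_elim auto
  qed measurable
  have "AE x in M. 0 \<le> V x \<and> V x \<le> N"
    using lim FN by eventually_elim (meson LIMSEQ_le_const2 order_trans)
  moreover have "AE x in M. x \<in> B \<longrightarrow> V x = 0"
    using lim FB
  proof eventually_elim
    case (elim x)
    show ?case
    proof
      assume "x \<in> B"
      then have "(\<lambda>n. 0) \<longlonglongrightarrow> V x" using elim by simp
      then show "V x = 0" using LIMSEQ_unique tendsto_const by blast
    qed
  qed
  ultimately have V: "V \<in> admissible B N" using VD by (simp add: admissible_def)
  have JV: "s \<le> J V"
  proof (rule LIMSEQ_le_const2)
    have "(\<lambda>n. s - inverse (real (Suc n))) \<longlonglongrightarrow> s - 0" by (intro tendsto_intros LIMSEQ_inverse_real_of_nat)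
    then show "(\<lambda>n. s - inverse (real (Suc n))) \<longlonglongrightarrow> s" by simp
    have "s - inverse (real (Suc n)) \<le> J V" for n
    proof -
      have "AE x in M. f n x \<le> V x" using lim by eventually_elim (use Ff in \<open>meson order_trans\<close>)
      then show ?thesis using Jmono[OF f(1) V] f(2)[of n] by force
    qed
    then show "\<exists>N. \<forall>n\<ge>N. s - inverse (real (Suc n)) \<le> J V" by blast
  qed
  have "AE x in M. g x \<le> V x" if g: "g \<in> admissible B N" for g
  proof -
    \<comment> \<open>The maximum with a competitor is again admissible, so its integral cannot
      exceed the supremum; positivity of the weight then forces \<open>m = V\<close> almost
      everywhere.\<close>
    define m where "m x = max (g x) (V x)" for x
    have ma: "m \<in> admissible B N" unfolding m_def[abs_def] by (rule amax[OF g V])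
    have "(\<integral>x. m x * p x - V x * p x \<partial>M) = J m - J V"
      unfolding J_def using ip[OF ma] ip[OF V] by simp
    also have "\<dots> \<le> 0" using Js[OF ma] JV by simp
    finally have "(\<integral>x. m x * p x - V x * p x \<partial>M) = 0"
      using p(3) by (intro antisym integral_nonneg_AE) (auto simp: m_def mult_right_mono)
    then have "AE x in M. m x * p x - V x * p x = 0"
      using ip[OF ma] ip[OF V] p(3)
      by (subst (asm) integral_nonneg_eq_0_iff_AE) (auto simp: m_def mult_right_mono)
    with p(2) show ?thesis
    proof eventually_elim
      case (elim x)
      then have "(m x - V x) * p x = 0" by (simp add: algebra_simps)
      then have "m x = V x" using elim by simp
      then show ?case by (simp add: m_def max_def split: if_splits)
    qed
  qed
  with V show thesis by (rule that)
qed

end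

section \<open>The distance function and the distance of sets\<close>

context dirichlet_nest
begin

abbreviation "dfun \<equiv> dist_fun M Dom D Ek"

lemma admissible_min:
  assumes f: "f \<in> admissible B N" and N': "N' \<ge> 0"
  shows "(\<lambda>x. min (f x) N') \<in> admissible B N'"
proof -
  have a: "f \<in> D_0" "AE x in M. x \<in> B \<longrightarrow> f x = 0" "AE x in M. 0 \<le> f x \<and> f x \<le> N"
    using f by (auto simp: admissible_def)
  have "AE x in M. x \<in> B \<longrightarrow> min (f x) N' = 0" using a(2) by eventually_elim (use N' in \<open>auto simp: min_def\<close>)
  moreover have "AE x in M. 0 \<le> min (f x) N' \<and> min (f x) N' \<le> N'" using a(3) by eventually_elim (use N' in auto)
  ultimately show ?thesis using D0_min[OF a(1) D0_const[of N']] by (simp add: admissible_def)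
qed

lemma admissible_mono: "f \<in> admissible B N \<Longrightarrow> N \<le> N' \<Longrightarrow> f \<in> admissible B N'"
proof -
  assume f: "f \<in> admissible B N" and "N \<le> N'"
  from f have "AE x in M. 0 \<le> f x \<and> f x \<le> N" by (simp add: admissible_def)
  then have "AE x in M. 0 \<le> f x \<and> f x \<le> N'" by eventually_elim (use \<open>N \<le> N'\<close> in auto)
  with f show ?thesis by (simp add: admissible_def)
qed

text \<open>The greatest competitors of different levels are consistent: truncating one at a lower
  level gives the greatest one there. Hence one supremum over the integer levels has all of them as
  truncations.\<close>

lemma ex_is_dist_fun: "\<exists>d. is_dist_fun M Dom D Ek B d"
proof -
  have "\<forall>N. \<exists>V. N > 0 \<longrightarrow> V \<in> admissible B N \<and> (\<forall>f\<in>admissible B N. AE x in M. f x \<le> V x)"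
    using admissible_greatest by metis
  then obtain V where V: "\<And>N. N > 0 \<Longrightarrow> V N \<in> admissible B N"
    "\<And>N f. N > 0 \<Longrightarrow> f \<in> admissible B N \<Longrightarrow> AE x in M. f x \<le> V N x" by metis
  have Vm: "V N \<in> borel_measurable M" if "N > 0" for N using V(1)[OF that] by (auto simp: admissible_def intro: D0D)
  \<comment> \<open>The maximum with 0 gives nonnegativity at every point, as
    \<open>is_dist_fun\<close> demands, and not only almost everywhere.\<close>
  define d where "d x = (SUP n::nat. ereal (max 0 (V (real (Suc n)) x)))" for x
  have [measurable]: "V (real (Suc n)) \<in> borel_measurable M" for n by (rule Vm) simp
  have [measurable]: "d \<in> borel_measurable M" unfolding d_def[abs_def] by measurable
  have d0: "0 \<le> d x" for x
    unfolding d_def by (rule SUP_upper2[of 0]) (auto simp: zero_ereal_def le_max_iff_disj)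
  have key: "AE x in M. min (d x) (ereal N) = ereal (V N x)" if N: "N > 0" for N
  proof -
    have "AE x in M. 0 \<le> V (real (Suc n)) x" for n using V(1)[of "real (Suc n)"] by (auto simp: admissible_def elim: eventually_mono)
    then have 1: "AE x in M. \<forall>n. 0 \<le> V (real (Suc n)) x" unfolding AE_all_countable by blast
    have 2: "AE x in M. 0 \<le> V N x \<and> V N x \<le> N" using V(1)[OF N] by (auto simp: admissible_def)
    have "AE x in M. min (V (real (Suc n)) x) N \<le> V N x" for n
      using V(1)[of "real (Suc n)"] N by (intro V(2)[OF N] admissible_min) auto
    then have 3: "AE x in M. \<forall>n. min (V (real (Suc n)) x) N \<le> V N x" unfolding AE_all_countable by blast
    obtain n where n: "N \<le> real n" using real_arch_simple by blast
    have 4: "AE x in M. V N x \<le> V (real (Suc n)) x"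
      by (rule V(2)) (use n in \<open>auto intro: admissible_mono[OF V(1)[OF N]]\<close>)
    show ?thesis using 1 2 3 4
    proof eventually_elim
      case (elim x)
      show ?case
      proof (rule antisym)
        show "min (d x) (ereal N) \<le> ereal (V N x)"
        proof (rule ccontr)
          assume "\<not> ?thesis"
          then have a: "ereal (V N x) < d x" "V N x < N" by (simp_all add: not_le)
          then obtain i where "ereal (V N x) < ereal (max 0 (V (real (Suc i)) x))"
            unfolding d_def less_SUP_iff by blast
          then have "V N x < V (real (Suc i)) x" using elim(1) by (simp add: max_def split: if_splits)
          then show False using elim(3) a(2) by (metis min_less_iff_conj not_le)
        qed
        have "ereal (V N x) \<le> ereal (max 0 (V (real (Suc n)) x))" using elim by simp
        also have "\<dots> \<le> d x" unfolding d_def by (rule SUP_upper) simp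
        finally show "ereal (V N x) \<le> min (d x) (ereal N)" using elim by simp
      qed
    qed
  qed
  have "is_dist_fun M Dom D Ek B d"
    unfolding is_dist_fun_def
  proof (intro conjI allI impI ballI)
    fix N :: real assume N: "N > 0"
    have VD: "V N \<in> D_0" "AE x in M. x \<in> B \<longrightarrow> V N x = 0" using V(1)[OF N] by (auto simp: admissible_def)
    show "(\<lambda>x. real_of_ereal (min (d x) (ereal N))) \<in> D_0"
    proof (rule D0_cong[OF VD(1)])
      show "AE x in M. real_of_ereal (min (d x) (ereal N)) = V N x" using key[OF N] by eventually_elim simp
    qed measurable
    show "AE x in M. x \<in> B \<longrightarrow> min (d x) (ereal N) = 0" using key[OF N] VD(2) by eventually_elim auto
    fix f assume f: "f \<in> D_0" "AE x in M. x \<in> B \<longrightarrow> f x = 0" "AE x in M. 0 \<le> f x \<and> f x \<le> N"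
    then have "AE x in M. f x \<le> V N x" by (intro V(2)[OF N]) (simp add: admissible_def)
    with key[OF N] show "AE x in M. ereal (f x) \<le> min (d x) (ereal N)" by eventually_elim simp
  qed (use d0 in auto)
  then show ?thesis by (rule exI[of _ d])
qed

lemma is_dist_fun_dist_fun: "is_dist_fun M Dom D Ek B (dfun B)"
  unfolding dist_fun_def by (rule someI_ex[OF ex_is_dist_fun])

lemma dist_fun_measurable [measurable]: "dfun B \<in> borel_measurable M"
  and dist_fun_nonneg: "0 \<le> dfun B x"
  and dist_fun_D0: "N > 0 \<Longrightarrow> (\<lambda>x. real_of_ereal (min (dfun B x) (ereal N))) \<in> D_0"
  and dist_fun_zero: "N > 0 \<Longrightarrow> AE x in M. x \<in> B \<longrightarrow> min (dfun B x) (ereal N) = 0"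
  and dist_fun_greatest: "N > 0 \<Longrightarrow> f \<in> D_0 \<Longrightarrow> AE x in M. x \<in> B \<longrightarrow> f x = 0 \<Longrightarrow>
      AE x in M. 0 \<le> f x \<and> f x \<le> N \<Longrightarrow> AE x in M. ereal (f x) \<le> min (dfun B x) (ereal N)"
  using is_dist_fun_dist_fun[of B] unfolding is_dist_fun_def by blast+

text \<open>The zero function competes. Positive measure of both sets excludes the infinite
  essential bounds that occur over null sets.\<close>

lemma dist_sets_nonneg:
  assumes "A \<in> sets M" "0 < emeasure M A" "B \<in> sets M" "0 < emeasure M B"
  shows "0 \<le> dist_sets M Dom D Ek A B"
proof -
  have inf: "ess_inf_on M A (\<lambda>_. 0) = 0" 
  proof -
    have "\<not> (AE x in M. x \<in> A \<longrightarrow> False)"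
      using assms(1,2) AE_iff_null_sets[OF assms(1)] by (auto simp: null_sets_def)
    then have "(AE x in M. x \<in> A \<longrightarrow> c \<le> ereal 0) \<longleftrightarrow> c \<le> 0" for c :: ereal
      by (cases "c \<le> 0") (simp_all add: frequently_def flip: zero_ereal_def)
    then have "{c::ereal. AE x in M. x \<in> A \<longrightarrow> c \<le> ereal 0} = {..0}"
      by blast
    then show ?thesis by (simp add: ess_inf_on_def)
  qed
  have sup: "ess_sup_on M B (\<lambda>_. 0) = 0" 
  proof -
    have "\<not> (AE x in M. x \<in> B \<longrightarrow> False)"
      using assms(3,4) AE_iff_null_sets[OF assms(3)] by (auto simp: null_sets_def)
    then have "(AE x in M. x \<in> B \<longrightarrow> ereal 0 \<le> c) \<longleftrightarrow> 0 \<le> c" for c :: ereal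
      by (cases "0 \<le> c") (simp_all add: frequently_def flip: zero_ereal_def)
    then have "{c::ereal. AE x in M. x \<in> B \<longrightarrow> ereal 0 \<le> c} = {0..}"
      by blast
    then show ?thesis by (simp add: ess_sup_on_def)
  qed
  have "ess_inf_on M A (\<lambda>_. 0) - ess_sup_on M B (\<lambda>_. 0) \<le> dist_sets M Dom D Ek A B"
    unfolding dist_sets_def using D0_zero by (intro Sup_upper) blast
  then show ?thesis by (simp add: inf sup)
qed

text \<open>A nearly optimal \<open>f\<close> for the distance of the sets separates
  \<open>A\<close> from \<open>B\<close> by more than \<open>c\<close>; shifted and clipped, it
  becomes a competitor for \<open>d_B\<close> at level \<open>c\<close>.\<close>

lemma dist_fun_ge:
  assumes c: "0 < c" "ereal c < dist_sets M Dom D Ek A B"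
  shows "AE x in M. x \<in> A \<longrightarrow> ereal c \<le> dfun B x"
proof -
  obtain f where f: "f \<in> D_0" and cf: "ereal c < ess_inf_on M A f - ess_sup_on M B f"
    using c(2) unfolding dist_sets_def less_Sup_iff by blast
  obtain C where C: "AE x in M. \<bar>f x\<bar> \<le> C" using D0D(3)[OF f] by blast
  \<comment> \<open>Boundedness of \<open>f\<close> keeps the essential supremum below infinity and
    the essential infimum above minus infinity, so the extended difference can be
    rearranged.\<close>
  have "ess_sup_on M B f \<le> ereal C"
    unfolding ess_sup_on_def by (rule Inf_lower) (use C in \<open>auto elim!: eventually_mono\<close>)
  then have supC: "ess_sup_on M B f \<noteq> \<infinity>" by auto
  have infC: "ereal (-C) \<le> ess_inf_on M A f"
    unfolding ess_inf_on_def by (rule Sup_upper) (use C in \<open>auto elim!: eventually_mono\<close>)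
  have "ess_sup_on M B f < ess_inf_on M A f - ereal c"
    using cf supC infC by (cases "ess_sup_on M B f"; cases "ess_inf_on M A f") auto
  then obtain q where q: "ess_sup_on M B f < ereal q" "ereal q < ess_inf_on M A f - ereal c"
    using ereal_dense2 by blast
  have qc: "ereal (q + c) < ess_inf_on M A f" using q(2) by (cases "ess_inf_on M A f") auto
  obtain s where s: "AE x in M. x \<in> B \<longrightarrow> ereal (f x) \<le> s" "s < ereal q"
    using q(1) unfolding ess_sup_on_def Inf_less_iff by blast
  obtain r where r: "AE x in M. x \<in> A \<longrightarrow> r \<le> ereal (f x)" "ereal (q + c) < r"
    using qc unfolding ess_inf_on_def less_Sup_iff by blast
  have fB: "AE x in M. x \<in> B \<longrightarrow> f x \<le> q" using s(1)
  proof eventually_elim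
    case (elim x)
    show ?case
    proof
      assume "x \<in> B"
      then have "ereal (f x) < ereal q" using elim s(2) by (meson le_less_trans)
      then show "f x \<le> q" by simp
    qed
  qed
  have fA: "AE x in M. x \<in> A \<longrightarrow> q + c \<le> f x" using r(1)
  proof eventually_elim
    case (elim x)
    show ?case
    proof
      assume "x \<in> A"
      then have "ereal (q + c) < ereal (f x)" using elim r(2) by (meson less_le_trans)
      then show "q + c \<le> f x" by simp
    qed
  qed
  \<comment> \<open>The level \<open>q\<close> lies above \<open>f\<close> on \<open>B\<close> and
    at least \<open>c\<close> below \<open>f\<close> on \<open>A\<close>, so clipping to
    \<open>[0, c]\<close> leaves 0 on \<open>B\<close> and \<open>c\<close> on
    \<open>A\<close>.\<close>
  define g where "g x = max 0 (min c (f x + (-q)))" for x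
  have g: "g \<in> D_0" unfolding g_def[abs_def] by (intro D0_max D0_min D0_const D0_add_const f)
  have "AE x in M. ereal (g x) \<le> min (dfun B x) (ereal c)"
  proof (rule dist_fun_greatest[OF c(1) g])
    show "AE x in M. x \<in> B \<longrightarrow> g x = 0" using fB by eventually_elim (auto simp: g_def)
    show "AE x in M. 0 \<le> g x \<and> g x \<le> c" using c(1) by (auto simp: g_def)
  qed
  with fA show ?thesis
  proof eventually_elim
    case (elim x)
    show ?case
    proof
      assume "x \<in> A"
      then have "g x = c" using elim c(1) by (auto simp: g_def)
      then show "ereal c \<le> dfun B x" using elim by simp
    qed
  qed
qed

text \<open>Consequently the truncation of \<open>d_B\<close> at \<open>d\<close> is constant on
  \<open>A\<close>, where the exponential weight is divided out at the end.\<close>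

lemma dist_fun_ge_dist_sets:
  assumes d: "dist_sets M Dom D Ek A B = ereal d" "0 < d"
  shows "AE x in M. x \<in> A \<longrightarrow> ereal d \<le> dfun B x"
proof -
  \<comment> \<open>The index is shifted by two so that already the first level is positive.\<close>
  define c where "c n = d * (1 - inverse (real (Suc (Suc n))))" for n
  have c: "0 < c n" "c n < d" for n
  proof -
    have "inverse (real (Suc (Suc n))) < 1" "0 < inverse (real (Suc (Suc n)))" by (simp_all add: inverse_less_1_iff)
    then show "0 < c n" "c n < d" using d(2) by (simp_all add: c_def)
  qed
  have "AE x in M. \<forall>n. x \<in> A \<longrightarrow> ereal (c n) \<le> dfun B x"
    unfolding AE_all_countable using c dist_fun_ge d(1) by simp
  moreover have "(\<lambda>n. ereal (c n)) \<longlonglongrightarrow> ereal d"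
  proof -
    have "c \<longlonglongrightarrow> d * (1 - 0)" unfolding c_def
      by (intro tendsto_intros LIMSEQ_Suc[OF LIMSEQ_inverse_real_of_nat])
    then show ?thesis by simp
  qed
  ultimately show ?thesis
    by (elim eventually_mono) (meson LIMSEQ_le_const2)
qed

text \<open>\<open>d\<^sub>B \<and> d\<close> has the gradient of \<open>d\<^sub>B\<close> where \<open>0 < d\<^sub>B < d\<close>, and gradient zero elsewhere by locality.\<close>

lemma grad_truncated_dist_fun:
  fixes B :: "'a set"
  assumes d: "0 < d"
  defines "\<psi> \<equiv> \<lambda>x. real_of_ereal (min (dfun B x) (ereal d))"
  shows "AE x in M. grad \<psi> x = indicator {y. 0 < dfun B y \<and> dfun B y < ereal d} x
      *\<^sub>R dist_fun_grad M Dom D Ek B x"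
proof -
  let ?d = "dfun B"
  have \<psi>: "\<psi> \<in> D_0" unfolding \<psi>_def by (rule dist_fun_D0[OF d])
  define P where "P N x = real_of_ereal (min (?d x) (ereal (real (Suc N))))" for N x
  have P: "P N \<in> D_0" for N unfolding P_def by (rule dist_fun_D0) simp
  have g0: "AE x in M. grad (\<lambda>_. c) x = 0" for c
  proof (rule AE_nestI)
    fix k
    obtain \<zeta> where \<zeta>: "\<zeta> \<in> Dom" "AE x in M. x \<in> Ek k \<longrightarrow> \<zeta> x = 1 \<and> D \<zeta> x = 0"
      using nest_cutoff[of k] by blast
    note c = dom_cmult[OF \<zeta>(1), of c]
    have "AE x in M. x \<in> Ek k \<longrightarrow> c = c * \<zeta> x" using \<zeta>(2) by eventually_elim auto
    from grad_eq[OF D0D(1)[OF D0_const] c(1) this] c(2) \<zeta>(2)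
    show "AE x in M. x \<in> Ek k \<longrightarrow> grad (\<lambda>_. c) x = 0" by eventually_elim auto
  qed
  \<comment> \<open>The level at which \<open>dist_fun_grad\<close> truncates varies with the point,
    so all levels are compared at once.\<close>
  have "AE x in M. \<forall>N. \<psi> x = P N x \<longrightarrow> grad \<psi> x = grad (P N) x"
    unfolding AE_all_countable using grad_eq_on_equal_set[OF D0D(1)[OF \<psi>] D0D(1)[OF P]] by blast
  moreover note grad_eq_on_equal_set[OF D0D(1)[OF \<psi>] D0D(1)[OF D0_const[of 0]]]
    grad_eq_on_equal_set[OF D0D(1)[OF \<psi>] D0D(1)[OF D0_const[of d]]] g0[of 0] g0[of d]
  ultimately show ?thesis
  proof eventually_elim
    case (elim x)
    consider "?d x = 0" | "ereal d \<le> ?d x" | "0 < ?d x" "?d x < ereal d"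
      using dist_fun_nonneg[of B x] by (metis antisym_conv2 not_le order.strict_iff_order)
    then show ?case
    proof cases
      case 1
      then have "\<psi> x = 0" using d by (simp add: \<psi>_def min_def)
      then show ?thesis using elim 1 by simp
    next
      case 2
      then have "\<psi> x = d" by (simp add: \<psi>_def min_def)
      then show ?thesis using elim 2 by (simp add: not_less)
    next
      case 3
      \<comment> \<open>With the \<open>Suc\<close> in the definition of \<open>P\<close>, this is
        the truncation level chosen by \<open>dist_fun_grad\<close>.\<close>
      define N where "N = nat \<lceil>real_of_ereal (?d x)\<rceil>"
      obtain r where r: "?d x = ereal r" "0 < r" "r < d" using 3 by (cases "?d x") auto
      have "r \<le> real (Suc N)" unfolding N_def r by simp linarith
      then have "\<psi> x = P N x" using r by (simp add: \<psi>_def P_def min_def)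
      then have "grad \<psi> x = grad (P N) x" using elim by blast
      also have "\<dots> = dist_fun_grad M Dom D Ek B x"
        unfolding dist_fun_grad_def Let_def using r by (simp add: P_def[abs_def] N_def add.commute)
      finally show ?thesis using 3 by simp
    qed
  qed
qed

end

section \<open>A family of convex functions of almost quadratic growth\<close>

text \<open>The weight common to all estimates: \<open>Phi2\<close> and the squares of
  \<open>phiF1\<close> and \<open>phiG1\<close> are bounded by multiples of it, so every energy is
  compared with the integral of \<open>phiJ s v\<close> times the squared norm of
  \<open>D v\<close>.\<close>

definition phiJ :: "real \<Rightarrow> real \<Rightarrow> real" where
  "phiJ s x = (1 + x\<^sup>2) powr (- s)"

definition Phi :: "real \<Rightarrow> real \<Rightarrow> real" where
  "Phi s x = x\<^sup>2 * phiJ s x"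

definition Phi1 :: "real \<Rightarrow> real \<Rightarrow> real" where
  "Phi1 s x = 2 * x * (1 + (1 - s) * x\<^sup>2) / (1 + x\<^sup>2) * phiJ s x"

definition Phi2 :: "real \<Rightarrow> real \<Rightarrow> real" where
  "Phi2 s x = 2 * (1 + (2 - 5 * s) * x\<^sup>2 + (1 - s) * (1 - 2 * s) * (x\<^sup>2)\<^sup>2) / (1 + x\<^sup>2)\<^sup>2 * phiJ s x"

text \<open>\<open>phiF\<close> and \<open>phiG\<close> are the square roots of \<open>x \<Phi>'(x)\<close> and \<open>(2 \<Phi>(x) - x \<Phi>'(x)) / (2 s)\<close>.\<close>

definition phiF :: "real \<Rightarrow> real \<Rightarrow> real" where
  "phiF s x = sqrt 2 * x * sqrt (1 + (1 - s) * x\<^sup>2) * (1 + x\<^sup>2) powr (- (s + 1) / 2)"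

definition phiF1 :: "real \<Rightarrow> real \<Rightarrow> real" where
  "phiF1 s x = sqrt 2 * (1 + (2 - 3 * s) * x\<^sup>2 + (1 - s)\<^sup>2 * (x\<^sup>2)\<^sup>2)
     / ((1 + x\<^sup>2) * sqrt (1 + (1 - s) * x\<^sup>2)) * (1 + x\<^sup>2) powr (- (s + 1) / 2)"

definition phiG :: "real \<Rightarrow> real \<Rightarrow> real" where
  "phiG s x = x\<^sup>2 * (1 + x\<^sup>2) powr (- (s + 1) / 2)"

definition phiG1 :: "real \<Rightarrow> real \<Rightarrow> real" where
  "phiG1 s x = x * (2 + (1 - s) * x\<^sup>2) / (1 + x\<^sup>2) * (1 + x\<^sup>2) powr (- (s + 1) / 2)"

text \<open>Minus the derivative of \<open>Phi\<close> in \<open>s\<close>, and at the same time the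
  entropy density to which the logarithmic term of (B.2) is reduced.\<close>

definition PhiL :: "real \<Rightarrow> real \<Rightarrow> real" where
  "PhiL s x = Phi s x * ln (1 + x\<^sup>2)"

lemma one_plus_square_pos: "0 < 1 + x\<^sup>2" for x :: real
  by (simp add: add_pos_nonneg)

lemma one_plus_square_neq_0: "1 + x\<^sup>2 \<noteq> 0" for x :: real
  using one_plus_square_pos[of x] by simp

lemma derivative_one_plus_square: "((\<lambda>x. 1 + a * x\<^sup>2) has_real_derivative 2 * a * x) (at x)"
  for a x :: real
proof -
  have "((\<lambda>x. 1 + a * x\<^sup>2) has_real_derivative 0 + a * (real 2 * x ^ (2 - Suc 0))) (at x)"
    by (intro DERIV_add DERIV_const DERIV_cmult DERIV_pow)
  moreover have "0 + a * (real 2 * x ^ (2 - Suc 0)) = 2 * a * x" by simp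
  ultimately show ?thesis by (simp only:)
qed

lemma derivative_powr:
  "((\<lambda>x. (1 + x\<^sup>2) powr a) has_real_derivative (2 * a * x / (1 + x\<^sup>2) * (1 + x\<^sup>2) powr a)) (at x)"
proof -
  have d: "((\<lambda>x. 1 + x\<^sup>2) has_real_derivative 2 * x) (at x)" using derivative_one_plus_square[of 1 x] by simp
  have "((\<lambda>z. z powr a) has_real_derivative a * (1 + x\<^sup>2) powr (a - 1)) (at (1 + x\<^sup>2))"
    by (rule has_real_derivative_powr[OF one_plus_square_pos])
  from DERIV_chain2[OF this d]
  have "((\<lambda>x. (1 + x\<^sup>2) powr a) has_real_derivative a * (1 + x\<^sup>2) powr (a - 1) * (2 * x)) (at x)" .
  moreover have "(1 + x\<^sup>2) powr (a - 1) = (1 + x\<^sup>2) powr a / (1 + x\<^sup>2)"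
    using one_plus_square_pos[of x] by (simp add: powr_diff)
  ultimately show ?thesis by (simp add: mult_ac)
qed

lemma powr_half_square: "((1 + x\<^sup>2) powr (- (s + 1) / 2))\<^sup>2 = phiJ s x / (1 + x\<^sup>2)"
proof -
  have "((1 + x\<^sup>2) powr (- (s + 1) / 2))\<^sup>2 = (1 + x\<^sup>2) powr (- (s + 1) / 2 + - (s + 1) / 2)"
    unfolding power2_eq_square by (rule powr_add[symmetric])
  also have "- (s + 1) / 2 + - (s + 1) / 2 = - s - 1" by (simp add: field_simps)
  also have "(1 + x\<^sup>2) powr (- s - 1) = phiJ s x / (1 + x\<^sup>2)"
    using one_plus_square_pos[of x] by (simp add: powr_diff phiJ_def)
  finally show ?thesis .
qed

lemma phiJ_pos: "0 < phiJ s x"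
  unfolding phiJ_def using one_plus_square_pos[of x] by (simp add: powr_gt_zero)

lemma phiJ_le_1: "0 \<le> s \<Longrightarrow> phiJ s x \<le> 1"
  unfolding phiJ_def using powr_mono[of "-s" 0 "1 + x\<^sup>2"] one_plus_square_neq_0[of x] by simp

lemma Phi_nonneg: "0 \<le> Phi s x"
  using phiJ_pos[of s x] by (simp add: Phi_def)

lemma Phi_le: "0 \<le> s \<Longrightarrow> Phi s x \<le> x\<^sup>2"
  unfolding Phi_def using phiJ_le_1[of s x] phiJ_pos[of s x] by (intro mult_left_le) auto

lemma Phi_0: "Phi s 0 = 0" "Phi1 s 0 = 0" "phiF s 0 = 0" "phiG s 0 = 0"
  by (simp_all add: Phi_def Phi1_def phiF_def phiG_def)

lemma derivative_Phi: "(Phi s has_real_derivative Phi1 s x) (at x)"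
proof -
  have "(Phi s has_real_derivative (real 2 * x ^ (2 - Suc 0)) * phiJ s x + (2 * (- s) * x / (1 + x\<^sup>2) * phiJ s x) * x\<^sup>2) (at x)"
    unfolding Phi_def[abs_def] phiJ_def by (rule DERIV_mult[OF DERIV_pow derivative_powr])
  moreover have "(real 2 * x ^ (2 - Suc 0)) * phiJ + (2 * (- s) * x / (1 + x\<^sup>2) * phiJ) * x\<^sup>2
      = 2 * x * (1 + (1 - s) * x\<^sup>2) / (1 + x\<^sup>2) * phiJ" for phiJ
    using one_plus_square_neq_0[of x] by (simp add: field_simps power2_eq_square)
  ultimately show ?thesis unfolding Phi1_def by (simp only:)
qed

lemma derivative_Phi1: "(Phi1 s has_real_derivative Phi2 s x) (at x)"
proof -
  have n: "((\<lambda>x. 2 * x * (1 + (1 - s) * x\<^sup>2)) has_real_derivative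
      (2 * 1) * (1 + (1 - s) * x\<^sup>2) + (2 * (1 - s) * x) * (2 * x)) (at x)"
    by (rule DERIV_mult[OF DERIV_cmult[OF DERIV_ident] derivative_one_plus_square])
  have d: "((\<lambda>x. 1 + x\<^sup>2) has_real_derivative 2 * x) (at x)" using derivative_one_plus_square[of 1 x] by simp
  note q = DERIV_divide[OF n d one_plus_square_neq_0]
  have "(Phi1 s has_real_derivative (((2 * 1) * (1 + (1 - s) * x\<^sup>2) + (2 * (1 - s) * x) * (2 * x)) * (1 + x\<^sup>2)
      - (2 * x * (1 + (1 - s) * x\<^sup>2)) * (2 * x)) / ((1 + x\<^sup>2) * (1 + x\<^sup>2)) * phiJ s x
      + (2 * (- s) * x / (1 + x\<^sup>2) * phiJ s x) * (2 * x * (1 + (1 - s) * x\<^sup>2) / (1 + x\<^sup>2))) (at x)"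
    unfolding Phi1_def[abs_def] phiJ_def by (rule DERIV_mult[OF q derivative_powr])
  moreover have "(((2 * 1) * (1 + (1 - s) * x\<^sup>2) + (2 * (1 - s) * x) * (2 * x)) * (1 + x\<^sup>2)
      - (2 * x * (1 + (1 - s) * x\<^sup>2)) * (2 * x)) / ((1 + x\<^sup>2) * (1 + x\<^sup>2)) * phiJ
      + (2 * (- s) * x / (1 + x\<^sup>2) * phiJ) * (2 * x * (1 + (1 - s) * x\<^sup>2) / (1 + x\<^sup>2))
      = 2 * (1 + (2 - 5 * s) * x\<^sup>2 + (1 - s) * (1 - 2 * s) * (x\<^sup>2)\<^sup>2) / (1 + x\<^sup>2)\<^sup>2 * phiJ" for phiJ
  proof -
    have "(2 * (- s) * x / y * phiJ) * (2 * x * z / y) = (2 * (- s) * x * (2 * x * z)) / (y * y) * phiJ" for y z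
      by simp
    then have "(((2 * 1) * (1 + (1 - s) * x\<^sup>2) + (2 * (1 - s) * x) * (2 * x)) * (1 + x\<^sup>2)
      - (2 * x * (1 + (1 - s) * x\<^sup>2)) * (2 * x)) / ((1 + x\<^sup>2) * (1 + x\<^sup>2)) * phiJ
      + (2 * (- s) * x / (1 + x\<^sup>2) * phiJ) * (2 * x * (1 + (1 - s) * x\<^sup>2) / (1 + x\<^sup>2))
      = ((((2 * 1) * (1 + (1 - s) * x\<^sup>2) + (2 * (1 - s) * x) * (2 * x)) * (1 + x\<^sup>2)
      - (2 * x * (1 + (1 - s) * x\<^sup>2)) * (2 * x)) + 2 * (- s) * x * (2 * x * (1 + (1 - s) * x\<^sup>2))) / ((1 + x\<^sup>2) * (1 + x\<^sup>2)) * phiJ"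
      by (simp only: add_divide_distrib distrib_right)
    also have "(((2 * 1) * (1 + (1 - s) * x\<^sup>2) + (2 * (1 - s) * x) * (2 * x)) * (1 + x\<^sup>2)
      - (2 * x * (1 + (1 - s) * x\<^sup>2)) * (2 * x)) + 2 * (- s) * x * (2 * x * (1 + (1 - s) * x\<^sup>2))
      = 2 * (1 + (2 - 5 * s) * x\<^sup>2 + (1 - s) * (1 - 2 * s) * (x\<^sup>2)\<^sup>2)"
      by (simp add: power2_eq_square algebra_simps)
    finally show ?thesis by (simp only: power2_eq_square)
  qed
  ultimately show ?thesis unfolding Phi2_def by (simp only:)
qed

lemma derivative_phiG: "(phiG s has_real_derivative phiG1 s x) (at x)"
proof -
  have "(phiG s has_real_derivative (real 2 * x ^ (2 - Suc 0)) * (1 + x\<^sup>2) powr (- (s + 1) / 2)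
      + (2 * (- (s + 1) / 2) * x / (1 + x\<^sup>2) * (1 + x\<^sup>2) powr (- (s + 1) / 2)) * x\<^sup>2) (at x)"
    unfolding phiG_def[abs_def] by (rule DERIV_mult[OF DERIV_pow derivative_powr])
  moreover have "(real 2 * x ^ (2 - Suc 0)) * R + (2 * (- (s + 1) / 2) * x / (1 + x\<^sup>2) * R) * x\<^sup>2
      = x * (2 + (1 - s) * x\<^sup>2) / (1 + x\<^sup>2) * R" for R
    using one_plus_square_neq_0[of x] by (simp add: field_simps power2_eq_square)
  ultimately show ?thesis unfolding phiG1_def by (simp only:)
qed

lemma derivative_phiF:
  assumes s: "0 \<le> s" "s \<le> 1"
  shows "(phiF s has_real_derivative phiF1 s x) (at x)"
proof -
  define q where "q = sqrt (1 + (1 - s) * x\<^sup>2)"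
  have p: "0 < 1 + (1 - s) * x\<^sup>2" using s by (simp add: add_pos_nonneg)
  have q: "q > 0" "q * q = 1 + (1 - s) * x\<^sup>2" using p by (simp_all add: q_def)
  have dq: "((\<lambda>x. sqrt (1 + (1 - s) * x\<^sup>2)) has_real_derivative inverse q / 2 * (2 * (1 - s) * x)) (at x)"
    unfolding q_def by (rule DERIV_chain2[OF DERIV_real_sqrt[OF p] derivative_one_plus_square])
  have "((\<lambda>x. sqrt 2 * x * sqrt (1 + (1 - s) * x\<^sup>2)) has_real_derivative
      (sqrt 2 * 1) * q + (inverse q / 2 * (2 * (1 - s) * x)) * (sqrt 2 * x)) (at x)"
    using DERIV_mult[OF DERIV_cmult[OF DERIV_ident] dq] unfolding q_def .
  from DERIV_mult[OF this derivative_powr]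
  have "(phiF s has_real_derivative ((sqrt 2 * 1) * q + (inverse q / 2 * (2 * (1 - s) * x)) * (sqrt 2 * x)) * (1 + x\<^sup>2) powr (- (s + 1) / 2)
     + (2 * (- (s + 1) / 2) * x / (1 + x\<^sup>2) * (1 + x\<^sup>2) powr (- (s + 1) / 2)) * (sqrt 2 * x * q)) (at x)"
    unfolding phiF_def[abs_def] q_def .
  moreover have "((sqrt 2 * 1) * q + (inverse q / 2 * (2 * (1 - s) * x)) * (sqrt 2 * x)) * R
     + (2 * (- (s + 1) / 2) * x / (1 + x\<^sup>2) * R) * (sqrt 2 * x * q)
     = sqrt 2 * (1 + (2 - 3 * s) * x\<^sup>2 + (1 - s)\<^sup>2 * (x\<^sup>2)\<^sup>2) / ((1 + x\<^sup>2) * q) * R" for R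
  proof -
    define y where "y = 1 + x\<^sup>2"
    have y: "y > 0" unfolding y_def by (rule one_plus_square_pos)
    have "(((sqrt 2 * 1) * q + (inverse q / 2 * (2 * (1 - s) * x)) * (sqrt 2 * x)) * R
       + (2 * (- (s + 1) / 2) * x / y * R) * (sqrt 2 * x * q)) * (y * q)
       = sqrt 2 * R * ((q * q) * y + (1 - s) * x\<^sup>2 * y - (s + 1) * x\<^sup>2 * (q * q))"
      using q y by (simp add: field_simps power2_eq_square)
    also have "(q * q) * y + (1 - s) * x\<^sup>2 * y - (s + 1) * x\<^sup>2 * (q * q) = 1 + (2 - 3 * s) * x\<^sup>2 + (1 - s)\<^sup>2 * (x\<^sup>2)\<^sup>2"
      unfolding q(2) y_def by (simp add: power2_eq_square algebra_simps)
    finally show ?thesis using q y unfolding y_def[symmetric] by (simp add: eq_divide_eq mult_ac)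
  qed
  ultimately show ?thesis unfolding phiF1_def q_def[symmetric] by (simp only:)
qed

lemma phiF_square:
  assumes s: "0 \<le> s" "s \<le> 1" shows "phiF s x * phiF s x = x * Phi1 s x"
proof -
  have p: "0 \<le> 1 + (1 - s) * x\<^sup>2" using s by simp
  have "phiF s x * phiF s x = (sqrt 2)\<^sup>2 * x\<^sup>2 * (sqrt (1 + (1 - s) * x\<^sup>2))\<^sup>2 * ((1 + x\<^sup>2) powr (- (s + 1) / 2))\<^sup>2"
    by (simp add: phiF_def power2_eq_square mult_ac)
  also have "\<dots> = x * Phi1 s x"
    unfolding powr_half_square using p by (simp add: Phi1_def power2_eq_square)
  finally show ?thesis .
qed

lemma phiG_square: "2 * s * (phiG s x * phiG s x) = 2 * Phi s x - x * Phi1 s x"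
proof -
  have "2 * s * (phiG s x * phiG s x) = 2 * s * (x\<^sup>2)\<^sup>2 * ((1 + x\<^sup>2) powr (- (s + 1) / 2))\<^sup>2"
    by (simp add: phiG_def power2_eq_square mult_ac)
  also have "\<dots> = 2 * Phi s x - x * Phi1 s x"
    unfolding powr_half_square Phi_def Phi1_def using one_plus_square_neq_0[of x]
    by (simp add: field_simps power2_eq_square)
  finally show ?thesis .
qed

text \<open>Both sides are derivatives of the two expressions in \<open>phiF_square\<close>, so
  uniqueness of derivatives replaces a computation with the explicit formulas. The same is done for
  \<open>phiG\<close>.\<close>

lemma phiF_phiF1:
  assumes s: "0 \<le> s" "s \<le> 1"
  shows "2 * (phiF s x * phiF1 s x) = Phi1 s x + x * Phi2 s x"
proof -
  have "((\<lambda>x. phiF s x * phiF s x) has_real_derivative phiF1 s x * phiF s x + phiF1 s x * phiF s x) (at x)"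
    by (rule DERIV_mult[OF derivative_phiF[OF s] derivative_phiF[OF s]])
  moreover have "((\<lambda>x. x * Phi1 s x) has_real_derivative 1 * Phi1 s x + Phi2 s x * x) (at x)"
    by (rule DERIV_mult[OF DERIV_ident derivative_Phi1])
  ultimately have "phiF1 s x * phiF s x + phiF1 s x * phiF s x = 1 * Phi1 s x + Phi2 s x * x"
    unfolding phiF_square[OF s] by (rule DERIV_unique)
  then show ?thesis by (simp add: mult_ac)
qed

lemma phiG_phiG1: "4 * s * (phiG s x * phiG1 s x) = Phi1 s x - x * Phi2 s x"
proof -
  have "((\<lambda>x. 2 * s * (phiG s x * phiG s x)) has_real_derivative 2 * s * (phiG1 s x * phiG s x + phiG1 s x * phiG s x)) (at x)"
    by (rule DERIV_cmult[OF DERIV_mult[OF derivative_phiG derivative_phiG]])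
  moreover have "((\<lambda>x. 2 * Phi s x - x * Phi1 s x) has_real_derivative 2 * Phi1 s x - (1 * Phi1 s x + Phi2 s x * x)) (at x)"
    by (rule DERIV_diff[OF DERIV_cmult[OF derivative_Phi] DERIV_mult[OF DERIV_ident derivative_Phi1]])
  ultimately have "2 * s * (phiG1 s x * phiG s x + phiG1 s x * phiG s x) = 2 * Phi1 s x - (1 * Phi1 s x + Phi2 s x * x)"
    unfolding phiG_square by (rule DERIV_unique)
  then show ?thesis by (simp add: algebra_simps)
qed

lemma square_expand: "(1 + X)\<^sup>2 = 1 + 2 * X + X\<^sup>2" for X :: real
  by (simp add: power2_eq_square algebra_simps)

lemma Phi2_eq:
  "Phi2 s x = 2 * ((1 + (2 - 5 * s) * x\<^sup>2 + (1 - s) * (1 - 2 * s) * (x\<^sup>2)\<^sup>2) / (1 + x\<^sup>2)\<^sup>2) * phiJ s x"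
  unfolding Phi2_def by (simp only: times_divide_eq_right)

text \<open>Relative to the weight, the loss against the exact square is of order \<open>s\<close>:
  after clearing denominators, the difference of the two sides has the nonnegative coefficients
  \<open>5 * s\<close>, \<open>5 * s\<close> and \<open>2 * s + 2 * s^2\<close> in powers of
  \<open>x^2\<close>.\<close>

lemma Phi2_lower:
  assumes s: "0 \<le> s" shows "2 * (1 - 5 * s) * phiJ s x \<le> Phi2 s x"
proof -
  have "(1 - 5 * s) * (1 + x\<^sup>2)\<^sup>2 \<le> 1 + (2 - 5 * s) * x\<^sup>2 + (1 - s) * (1 - 2 * s) * (x\<^sup>2)\<^sup>2"
  proof -
    have "1 + (2 - 5 * s) * X + (1 - s) * (1 - 2 * s) * X\<^sup>2 - (1 - 5 * s) * (1 + X)\<^sup>2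
      = 5 * s + 5 * s * X + (2 * s + 2 * s\<^sup>2) * X\<^sup>2" for X
      by (simp add: power2_eq_square algebra_simps)
    moreover have "0 \<le> 5 * s + 5 * s * x\<^sup>2 + (2 * s + 2 * s\<^sup>2) * (x\<^sup>2)\<^sup>2" using s by simp
    ultimately show ?thesis by (metis diff_ge_0_iff_ge)
  qed
  then have "1 - 5 * s \<le> (1 + (2 - 5 * s) * x\<^sup>2 + (1 - s) * (1 - 2 * s) * (x\<^sup>2)\<^sup>2) / (1 + x\<^sup>2)\<^sup>2"
    using one_plus_square_pos[of x] by (simp add: pos_le_divide_eq)
  then show ?thesis unfolding Phi2_eq using phiJ_pos[of s x]
    by (intro mult_right_mono mult_left_mono) auto
qed

lemma Phi2_upper:
  assumes s: "0 \<le> s" "s \<le> 1/2" shows "Phi2 s x \<le> 2 * phiJ s x"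
proof -
  have "1 + (2 - 5 * s) * x\<^sup>2 + (1 - s) * (1 - 2 * s) * (x\<^sup>2)\<^sup>2 \<le> (1 + x\<^sup>2)\<^sup>2"
  proof -
    have "(1 - s) * (1 - 2 * s) \<le> 1 * 1" using s by (intro mult_mono) auto
    then have "(1 - s) * (1 - 2 * s) * (x\<^sup>2)\<^sup>2 \<le> 1 * (x\<^sup>2)\<^sup>2" by (intro mult_right_mono) auto
    moreover have "(2 - 5 * s) * x\<^sup>2 \<le> 2 * x\<^sup>2" using s by (intro mult_right_mono) auto
    ultimately show ?thesis unfolding square_expand by linarith
  qed
  then have "(1 + (2 - 5 * s) * x\<^sup>2 + (1 - s) * (1 - 2 * s) * (x\<^sup>2)\<^sup>2) / (1 + x\<^sup>2)\<^sup>2 \<le> 1"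
    using one_plus_square_pos[of x] by (simp add: pos_divide_le_eq)
  then have "2 * ((1 + (2 - 5 * s) * x\<^sup>2 + (1 - s) * (1 - 2 * s) * (x\<^sup>2)\<^sup>2) / (1 + x\<^sup>2)\<^sup>2) * phiJ s x \<le> 2 * 1 * phiJ s x"
    using phiJ_pos[of s x] by (intro mult_right_mono mult_left_mono) auto
  then show ?thesis unfolding Phi2_eq by simp
qed

text \<open>The range \<open>s \<le> 1/10\<close>, used from here on, keeps \<open>1 - 5 * s\<close>
  positive, so \<open>Phi s\<close> is convex. Boundedness of \<open>Phi2\<close> lets the chain
  rule apply to \<open>Phi1\<close>.\<close>

lemma Phi2_bounds:
  assumes s: "0 \<le> s" "s \<le> 1/10" shows "0 \<le> Phi2 s x" "\<bar>Phi2 s x\<bar> \<le> 2"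
proof -
  have "0 \<le> 2 * (1 - 5 * s) * phiJ s x" using s phiJ_pos[of s x] by simp
  then show *: "0 \<le> Phi2 s x" using Phi2_lower[OF s(1), of x] by linarith
  show "\<bar>Phi2 s x\<bar> \<le> 2" using * Phi2_upper[of s x] phiJ_le_1[of s x] s by simp
qed

text \<open>With \<open>y = 1 + x^2\<close> and \<open>w\<close> the expression under the root, the
  numerator is at most \<open>y * w\<close>, and \<open>w \<le> y\<close>; everything but the weight
  cancels.\<close>

lemma phiF1_square_le:
  assumes s: "0 \<le> s" "s \<le> 1/2" shows "(phiF1 s x)\<^sup>2 \<le> 2 * phiJ s x"
proof -
  define N where "N = 1 + (2 - 3 * s) * x\<^sup>2 + (1 - s)\<^sup>2 * (x\<^sup>2)\<^sup>2"
  define w where "w = 1 + (1 - s) * x\<^sup>2"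
  define y where "y = 1 + x\<^sup>2"
  have w: "0 < w" unfolding w_def using s by (simp add: add_pos_nonneg)
  have y: "0 < y" unfolding y_def by (rule one_plus_square_pos)
  have N0: "0 \<le> N" unfolding N_def using s by simp
  have Ny: "N \<le> y * w"
  proof -
    have "y * w - N = 2 * s * x\<^sup>2 + s * (1 - s) * (x\<^sup>2)\<^sup>2"
      by (simp add: N_def w_def y_def power2_eq_square algebra_simps)
    moreover have "0 \<le> 2 * s * x\<^sup>2 + s * (1 - s) * (x\<^sup>2)\<^sup>2" using s by simp
    ultimately show ?thesis by linarith
  qed
  have wy: "w \<le> y" unfolding w_def y_def using s by (simp add: mult_left_le_one_le)
  have "(phiF1 s x)\<^sup>2 = 2 * (N\<^sup>2 / (y\<^sup>2 * w) / y) * phiJ s x"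
  proof -
    have "(phiF1 s x)\<^sup>2 = (sqrt 2)\<^sup>2 * N\<^sup>2 / (y\<^sup>2 * (sqrt w)\<^sup>2) * ((1 + x\<^sup>2) powr (- (s + 1) / 2))\<^sup>2"
      unfolding phiF1_def N_def w_def y_def by (simp only: power_mult_distrib power_divide)
    then show ?thesis unfolding powr_half_square using w by (simp add: y_def)
  qed
  moreover have "N\<^sup>2 / (y\<^sup>2 * w) / y \<le> 1"
  proof -
    have "N\<^sup>2 \<le> (y * w)\<^sup>2" using N0 Ny by (intro power_mono) auto
    also have "\<dots> = y\<^sup>2 * w * w" by (simp add: power2_eq_square mult_ac)
    also have "\<dots> \<le> y\<^sup>2 * w * y" using w wy by (intro mult_left_mono) auto
    finally show ?thesis using w y by (simp add: pos_divide_le_eq mult_ac)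
  qed
  then have "2 * (N\<^sup>2 / (y\<^sup>2 * w) / y) * phiJ s x \<le> 2 * 1 * phiJ s x"
    using phiJ_pos[of s x] by (intro mult_right_mono mult_left_mono) auto
  ultimately show ?thesis by simp
qed

lemma phiG1_square_le:
  assumes s: "0 \<le> s" "s \<le> 1/2" shows "(phiG1 s x)\<^sup>2 \<le> 4 * phiJ s x"
proof -
  define y where "y = 1 + x\<^sup>2"
  have y: "0 < y" unfolding y_def by (rule one_plus_square_pos)
  have "(phiG1 s x)\<^sup>2 = x\<^sup>2 * (2 + (1 - s) * x\<^sup>2)\<^sup>2 / y\<^sup>2 / y * phiJ s x"
    unfolding phiG1_def power_mult_distrib power_divide powr_half_square y_def by simp
  moreover have le: "x\<^sup>2 * (2 + (1 - s) * x\<^sup>2)\<^sup>2 / y\<^sup>2 / y \<le> 4"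
  proof -
    have "(1 - s) * x\<^sup>2 \<le> 1 * x\<^sup>2" using s by (intro mult_right_mono) auto
    then have "2 + (1 - s) * x\<^sup>2 \<le> 2 + 2 * x\<^sup>2" using zero_le_power2[of x] by linarith
    then have "2 + (1 - s) * x\<^sup>2 \<le> 2 * y" unfolding y_def by simp
    then have "(2 + (1 - s) * x\<^sup>2)\<^sup>2 \<le> (2 * y)\<^sup>2" using s by (intro power_mono) auto
    then have "x\<^sup>2 * (2 + (1 - s) * x\<^sup>2)\<^sup>2 \<le> y * (2 * y)\<^sup>2" using y by (intro mult_mono) (auto simp: y_def)
    then show ?thesis using y by (simp add: pos_divide_le_eq power2_eq_square mult_ac)
  qed
  ultimately show ?thesis using mult_right_mono[OF le less_imp_le[OF phiJ_pos[of s x]]] by simp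
qed

text \<open>For an exact square \<open>Phi1 = x * Phi2\<close>, so the difference is of order
  \<open>s\<close>. It is the coefficient of the cross term between \<open>D v\<close> and
  \<open>grad \<psi>\<close>, which is small for this reason.\<close>

lemma Phi1_diff_le:
  assumes s: "0 \<le> s" "s \<le> 1/2" shows "\<bar>Phi1 s x - x * Phi2 s x\<bar> \<le> 4 * s * \<bar>x\<bar> * phiJ s x"
proof -
  define y where "y = 1 + x\<^sup>2"
  have y: "0 < y" unfolding y_def by (rule one_plus_square_pos)
  have "Phi1 s x - x * Phi2 s x = 4 * s * x * (x\<^sup>2 * (2 + (1 - s) * x\<^sup>2) / y\<^sup>2) * phiJ s x"
  proof -
    have "Phi1 s x - x * Phi2 s x = 4 * s * (phiG s x * phiG1 s x)" by (simp add: phiG_phiG1)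
    also have "phiG s x * phiG1 s x = x\<^sup>2 * (x * (2 + (1 - s) * x\<^sup>2) / y) * ((1 + x\<^sup>2) powr (- (s + 1) / 2))\<^sup>2"
      by (simp add: phiG_def phiG1_def y_def power2_eq_square mult_ac)
    also have "4 * s * (x\<^sup>2 * (x * (2 + (1 - s) * x\<^sup>2) / y) * ((1 + x\<^sup>2) powr (- (s + 1) / 2))\<^sup>2)
       = 4 * s * x * (x\<^sup>2 * (2 + (1 - s) * x\<^sup>2) / y\<^sup>2) * phiJ s x"
      unfolding powr_half_square y_def by (simp add: power2_eq_square mult_ac)
    finally show ?thesis .
  qed
  then have "\<bar>Phi1 s x - x * Phi2 s x\<bar> = 4 * s * \<bar>x\<bar> * (x\<^sup>2 * (2 + (1 - s) * x\<^sup>2) / y\<^sup>2) * phiJ s x"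
    using s phiJ_pos[of s x] by (simp add: abs_mult)
  also have "\<dots> \<le> 4 * s * \<bar>x\<bar> * 1 * phiJ s x"
  proof (intro mult_right_mono mult_left_mono)
    have "x\<^sup>2 * (2 + (1 - s) * x\<^sup>2) \<le> x\<^sup>2 * (2 + 1 * x\<^sup>2)"
      using s by (intro mult_left_mono add_mono mult_right_mono) auto
    also have "\<dots> \<le> y\<^sup>2" unfolding y_def square_expand by (simp add: power2_eq_square algebra_simps)
    finally show "x\<^sup>2 * (2 + (1 - s) * x\<^sup>2) / y\<^sup>2 \<le> 1" using y by (simp add: pos_divide_le_eq)
  qed (use s phiJ_pos[of s x] in auto)
  finally show ?thesis by simp
qed

lemma phiF_square_bounds:
  assumes s: "0 \<le> s" "s \<le> 1/2"
  shows "2 * (1 - s) * Phi s x \<le> (phiF s x)\<^sup>2" "(phiF s x)\<^sup>2 \<le> 2 * Phi s x"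
proof -
  have eq: "(phiF s x)\<^sup>2 = 2 * ((1 + (1 - s) * x\<^sup>2) / (1 + x\<^sup>2)) * Phi s x"
    using phiF_square[of s x] s by (simp add: power2_eq_square Phi_def Phi1_def)
  have "1 - s \<le> (1 + (1 - s) * x\<^sup>2) / (1 + x\<^sup>2)"
  proof -
    have "(1 - s) * (1 + x\<^sup>2) \<le> 1 + (1 - s) * x\<^sup>2" unfolding distrib_left using s by simp
    then show ?thesis using one_plus_square_pos[of x] by (simp only: pos_le_divide_eq)
  qed
  then show "2 * (1 - s) * Phi s x \<le> (phiF s x)\<^sup>2"
    unfolding eq using Phi_nonneg[of s x] by (intro mult_right_mono mult_left_mono) auto
  have "(1 - s) * x\<^sup>2 \<le> 1 * x\<^sup>2" using s by (intro mult_right_mono) auto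
  then have "(1 + (1 - s) * x\<^sup>2) / (1 + x\<^sup>2) \<le> 1"
    using one_plus_square_pos[of x] by (simp add: pos_divide_le_eq)
  then have "2 * ((1 + (1 - s) * x\<^sup>2) / (1 + x\<^sup>2)) * Phi s x \<le> 2 * 1 * Phi s x"
    using Phi_nonneg[of s x] by (intro mult_right_mono mult_left_mono) auto
  then show "(phiF s x)\<^sup>2 \<le> 2 * Phi s x" unfolding eq by simp
qed

lemma phiG_square_le: "(phiG s x)\<^sup>2 \<le> Phi s x"
proof -
  have "(phiG s x)\<^sup>2 = x\<^sup>2 / (1 + x\<^sup>2) * Phi s x"
    unfolding phiG_def power_mult_distrib powr_half_square by (simp add: Phi_def power2_eq_square)
  also have "\<dots> \<le> 1 * Phi s x"
    using one_plus_square_pos[of x] Phi_nonneg[of s x] by (intro mult_right_mono) (auto simp: pos_divide_le_eq)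
  finally show ?thesis by simp
qed

lemma Phi1_abs_le:
  assumes s: "0 \<le> s" "s \<le> 1" shows "\<bar>Phi1 s x\<bar> \<le> 2 * \<bar>x\<bar> * phiJ s x" "\<bar>Phi1 s x\<bar> \<le> 2 * \<bar>x\<bar>"
proof -
  have "(1 - s) * x\<^sup>2 \<le> 1 * x\<^sup>2" using s by (intro mult_right_mono) auto
  then have l: "(1 + (1 - s) * x\<^sup>2) / (1 + x\<^sup>2) \<le> 1" and g: "0 \<le> (1 + (1 - s) * x\<^sup>2) / (1 + x\<^sup>2)"
    using one_plus_square_pos[of x] s by (auto simp: pos_divide_le_eq)
  have "\<bar>Phi1 s x\<bar> = 2 * \<bar>x\<bar> * ((1 + (1 - s) * x\<^sup>2) / (1 + x\<^sup>2)) * phiJ s x"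
  proof -
    have "Phi1 s x = 2 * x * ((1 + (1 - s) * x\<^sup>2) / (1 + x\<^sup>2)) * phiJ s x"
      unfolding Phi1_def by (simp only: times_divide_eq_right)
    then show ?thesis by (simp only: abs_mult abs_of_nonneg[OF g] abs_of_pos[OF phiJ_pos] abs_numeral)
  qed
  also have "\<dots> \<le> 2 * \<bar>x\<bar> * 1 * phiJ s x" using l phiJ_pos[of s x] by (intro mult_right_mono mult_left_mono) auto
  finally show *: "\<bar>Phi1 s x\<bar> \<le> 2 * \<bar>x\<bar> * phiJ s x" by simp
  have "2 * \<bar>x\<bar> * phiJ s x \<le> 2 * \<bar>x\<bar> * 1" using phiJ_le_1[OF s(1)] by (intro mult_left_mono) auto
  with * show "\<bar>Phi1 s x\<bar> \<le> 2 * \<bar>x\<bar>" by simp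
qed

lemma continuous_phiJ: "continuous_on UNIV (phiJ s)"
  unfolding phiJ_def[abs_def] by (intro continuous_intros) (simp add: one_plus_square_neq_0)

lemma continuous_Phi2: "continuous_on UNIV (Phi2 s)"
  unfolding Phi2_def[abs_def] by (intro continuous_intros continuous_phiJ) (simp add: one_plus_square_neq_0)

lemma continuous_phiF1:
  assumes "0 \<le> s" "s \<le> 1" shows "continuous_on UNIV (phiF1 s)"
proof -
  have "sqrt (1 + (1 - s) * x\<^sup>2) \<noteq> 0" for x
    using assms add_pos_nonneg[of 1 "(1 - s) * x\<^sup>2"] by simp
  then show ?thesis unfolding phiF1_def[abs_def]
    by (intro continuous_intros) (auto simp: one_plus_square_neq_0)
qed

lemma continuous_phiG1: "continuous_on UNIV (phiG1 s)"
  unfolding phiG1_def[abs_def] by (intro continuous_intros) (auto simp: one_plus_square_neq_0)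

lemma phi_measurable [measurable]:
  "phiJ s \<in> borel_measurable borel" "Phi s \<in> borel_measurable borel" "Phi1 s \<in> borel_measurable borel"
  "Phi2 s \<in> borel_measurable borel" "PhiL s \<in> borel_measurable borel" "phiF s \<in> borel_measurable borel"
  "phiG s \<in> borel_measurable borel"
  unfolding phiJ_def[abs_def] Phi_def[abs_def] Phi1_def[abs_def] Phi2_def[abs_def] PhiL_def[abs_def]
    phiF_def[abs_def] phiG_def[abs_def] by measurable

text \<open>The tangent at \<open>a\<close>, later the value at the current time, bounds increments
  from earlier times; it replaces differentiation under the integral.\<close>

lemma Phi_convex:
  assumes s: "0 \<le> s" "s \<le> 1/10"
  shows "Phi s a - Phi s b \<le> Phi1 s a * (a - b)"
proof -
  have "convex_on UNIV (Phi s)"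
    by (rule f''_ge0_imp_convex[where f' = "Phi1 s" and f'' = "Phi2 s"])
      (auto intro: derivative_Phi derivative_Phi1 Phi2_bounds(1)[OF s])
  then have "Phi1 s a * (b - a) \<le> Phi s b - Phi s a"
    using derivative_Phi[of s a] by (intro convex_on_imp_above_tangent[of UNIV]) auto
  then show ?thesis by (simp add: algebra_simps)
qed

lemma Phi_antimono: "s \<le> s' \<Longrightarrow> Phi s' x \<le> Phi s x"
  unfolding Phi_def phiJ_def by (intro mult_left_mono powr_mono) auto

text \<open>Convexity in the exponent, with the tangent at the larger value \<open>s'\<close>: this
  produces the negative entropy term.\<close>

lemma Phi_parameter_diff:
  assumes "s \<le> s'" shows "Phi s' x - Phi s x \<le> - (s' - s) * PhiL s' x"
proof -
  have "phiJ s x = phiJ s' x * exp ((s' - s) * ln (1 + x\<^sup>2))"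
    using one_plus_square_pos[of x] by (simp add: phiJ_def powr_def algebra_simps flip: exp_add)
  moreover have "1 + (s' - s) * ln (1 + x\<^sup>2) \<le> exp ((s' - s) * ln (1 + x\<^sup>2))" by (rule exp_ge_add_one_self)
  ultimately have "phiJ s' x * (1 + (s' - s) * ln (1 + x\<^sup>2)) \<le> phiJ s x" using phiJ_pos[of s' x] by simp
  then have "x\<^sup>2 * (phiJ s' x * (1 + (s' - s) * ln (1 + x\<^sup>2))) \<le> x\<^sup>2 * phiJ s x" by (rule mult_left_mono) simp
  then show ?thesis by (simp add: Phi_def PhiL_def algebra_simps)
qed

text \<open>Mean value theorem. A Lipschitz constant of linear growth is what makes the integral of
  \<open>f (v x)\<close> continuous in \<open>v\<close> with respect to the L2-norm.\<close>

lemma quadratic_lipschitz: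
  fixes f :: "real \<Rightarrow> real"
  assumes der: "\<And>x. (f has_real_derivative f' x) (at x)" and b: "\<And>x. \<bar>f' x\<bar> \<le> C * \<bar>x\<bar>" and C: "0 \<le> C"
  shows "\<bar>f x - f y\<bar> \<le> C * (\<bar>x\<bar> + \<bar>y\<bar>) * \<bar>x - y\<bar>"
proof -
  have main: "\<bar>f x - f y\<bar> \<le> C * (\<bar>x\<bar> + \<bar>y\<bar>) * \<bar>x - y\<bar>" if xy: "x < y" for x y
  proof -
    obtain z where z: "x < z" "z < y" "f y - f x = (y - x) * f' z" using MVT2[OF xy, of f f'] der by blast
    have "\<bar>f' z\<bar> \<le> C * (\<bar>x\<bar> + \<bar>y\<bar>)"
      using b[of z] mult_left_mono[of "\<bar>z\<bar>" "\<bar>x\<bar> + \<bar>y\<bar>" C] C z by linarith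
    then have "\<bar>f' z\<bar> * \<bar>y - x\<bar> \<le> C * (\<bar>x\<bar> + \<bar>y\<bar>) * \<bar>y - x\<bar>" by (rule mult_right_mono) simp
    moreover have "\<bar>f x - f y\<bar> = \<bar>f' z\<bar> * \<bar>y - x\<bar>" using z(3) by (metis abs_minus_commute abs_mult mult.commute)
    ultimately show ?thesis by (simp add: abs_minus_commute)
  qed
  consider "x < y" | "y < x" | "x = y" by linarith
  then show ?thesis
    by cases (use main[of x y] main[of y x] in \<open>auto simp: abs_minus_commute add.commute\<close>)
qed

lemma Phi_lipschitz:
  assumes "0 \<le> s" "s \<le> 1" shows "\<bar>Phi s x - Phi s y\<bar> \<le> 2 * (\<bar>x\<bar> + \<bar>y\<bar>) * \<bar>x - y\<bar>"
  by (rule quadratic_lipschitz[OF derivative_Phi]) (use Phi1_abs_le(2)[OF assms] in auto)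

text \<open>A logarithm is dominated by a power \<open>s\<close> at the cost of
  \<open>1 / s\<close>. The entropy density is thus bounded by a multiple of the square for each
  fixed positive \<open>s\<close>, but not uniformly as \<open>s\<close> tends to 0.\<close>

lemma ln_phiJ_le: "0 < s \<Longrightarrow> ln (1 + x\<^sup>2) * phiJ s x \<le> 1 / s"
proof -
  assume s: "0 < s"
  have "ln (1 + x\<^sup>2) \<le> (1 + x\<^sup>2) powr s / s" by (rule ln_powr_bound) (use s in auto)
  then have "ln (1 + x\<^sup>2) * phiJ s x \<le> (1 + x\<^sup>2) powr s / s * phiJ s x"
    using phiJ_pos[of s x] by (intro mult_right_mono) auto
  also have "\<dots> = 1 / s"
    using one_plus_square_pos[of x] by (simp add: phiJ_def powr_minus)
  finally show ?thesis .
qed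

lemma PhiL_nonneg: "0 \<le> PhiL s x"
  unfolding PhiL_def using Phi_nonneg by (intro mult_nonneg_nonneg ln_ge_zero) auto

lemma PhiL_le: "0 < s \<Longrightarrow> PhiL s x \<le> (1 / s) * x\<^sup>2"
  using mult_left_mono[OF ln_phiJ_le[of s x], of "x\<^sup>2"] by (simp add: PhiL_def Phi_def mult_ac)

lemma PhiL_lipschitz:
  assumes s: "0 < s" "s \<le> 1" shows "\<bar>PhiL s x - PhiL s y\<bar> \<le> (2 / s + 2) * (\<bar>x\<bar> + \<bar>y\<bar>) * \<bar>x - y\<bar>"
proof (rule quadratic_lipschitz)
  fix x
  have d: "((\<lambda>x. ln (1 + x\<^sup>2)) has_real_derivative inverse (1 + x\<^sup>2) * (2 * x)) (at x)"
    using DERIV_chain2[OF DERIV_ln[OF one_plus_square_pos] derivative_one_plus_square[of 1 x, simplified]] by simp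
  show "(PhiL s has_real_derivative Phi1 s x * ln (1 + x\<^sup>2) + inverse (1 + x\<^sup>2) * (2 * x) * Phi s x) (at x)"
    unfolding PhiL_def[abs_def] by (rule DERIV_mult[OF derivative_Phi d])
  have l0: "0 \<le> ln (1 + x\<^sup>2)" by (intro ln_ge_zero) simp
  have "\<bar>Phi1 s x * ln (1 + x\<^sup>2)\<bar> \<le> 2 * \<bar>x\<bar> * phiJ s x * ln (1 + x\<^sup>2)"
    using Phi1_abs_le(1)[of s x] s l0 by (simp add: abs_mult mult_right_mono)
  also have "\<dots> = 2 * \<bar>x\<bar> * (ln (1 + x\<^sup>2) * phiJ s x)" by simp
  also have "\<dots> \<le> 2 * \<bar>x\<bar> * (1 / s)" by (intro mult_left_mono ln_phiJ_le s) auto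
  finally have 1: "\<bar>Phi1 s x * ln (1 + x\<^sup>2)\<bar> \<le> 2 / s * \<bar>x\<bar>" by simp
  have "Phi s x \<le> 1 + x\<^sup>2" using Phi_le[of s x] s by linarith
  then have "inverse (1 + x\<^sup>2) * Phi s x \<le> 1"
    using one_plus_square_pos[of x] by (simp add: inverse_eq_divide pos_divide_le_eq)
  then have "2 * \<bar>x\<bar> * (inverse (1 + x\<^sup>2) * Phi s x) \<le> 2 * \<bar>x\<bar> * 1" by (intro mult_left_mono) auto
  then have 2: "\<bar>inverse (1 + x\<^sup>2) * (2 * x) * Phi s x\<bar> \<le> 2 * \<bar>x\<bar>"
    using one_plus_square_pos[of x] Phi_nonneg[of s x] by (simp add: abs_mult mult_ac)
  show "\<bar>Phi1 s x * ln (1 + x\<^sup>2) + inverse (1 + x\<^sup>2) * (2 * x) * Phi s x\<bar> \<le> (2 / s + 2) * \<bar>x\<bar>"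
    using 1 2 abs_triangle_ineq[of "Phi1 s x * ln (1 + x\<^sup>2)" "inverse (1 + x\<^sup>2) * (2 * x) * Phi s x"]
    unfolding distrib_right by linarith
qed (use s in auto)

text \<open>Above the level \<open>S\<close>, \<open>Phi s x\<close> grows like the power
  \<open>2 - 2 * s\<close> of \<open>\<bar>x\<bar>\<close>, and the remaining factor
  \<open>\<bar>x\<bar> powr (2 * s - 1)\<close> is decreasing. On a set of finite measure this
  converts a bound on the integral of \<open>Phi\<close> into one on the integral of
  \<open>\<bar>x\<bar>\<close>, with \<open>S\<close> free to be optimised.\<close>

lemma abs_le_Phi:
  assumes s: "0 \<le> s" "s \<le> 1/2" and S: "1 \<le> S"
  shows "\<bar>x\<bar> \<le> S + 2 * S powr (2 * s - 1) * Phi s x"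
proof (cases "\<bar>x\<bar> \<le> S")
  case True then show ?thesis using Phi_nonneg[of s x] by (simp add: add_increasing2)
next
  case False
  then have x: "S < \<bar>x\<bar>" "1 \<le> \<bar>x\<bar>" using S by auto
  have "1 \<le> x\<^sup>2" using x(2) by (metis one_le_power power2_abs)
  \<comment> \<open>For \<open>\<bar>x\<bar> \<ge> 1\<close> the added 1 costs at most
    \<open>2 powr s \<le> 2\<close>; this is the factor 2 of the statement.\<close>
  then have "(1 + x\<^sup>2) powr s \<le> (2 * x\<^sup>2) powr s" using s by (intro powr_mono2) auto
  also have "\<dots> = 2 powr s * (x\<^sup>2) powr s" by (simp add: powr_mult)
  also have "\<dots> \<le> 2 powr 1 * (x\<^sup>2) powr s" using s by (intro mult_right_mono powr_mono) auto
  also have "(x\<^sup>2) powr s = \<bar>x\<bar> powr (2 * s)" 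
  proof -
    have "x\<^sup>2 = \<bar>x\<bar> powr 2" using x(2) by (simp add: powr_numeral)
    then show ?thesis by (simp only: powr_powr)
  qed
  finally have a: "(1 + x\<^sup>2) powr s \<le> 2 * \<bar>x\<bar> powr (2 * s)" by simp
  have "x\<^sup>2 = (1 + x\<^sup>2) powr s * Phi s x"
    using one_plus_square_pos[of x] by (simp add: Phi_def phiJ_def powr_minus)
  also have "\<dots> \<le> 2 * \<bar>x\<bar> powr (2 * s) * Phi s x" using a Phi_nonneg[of s x] by (rule mult_right_mono)
  also have "\<bar>x\<bar> powr (2 * s) = \<bar>x\<bar> * \<bar>x\<bar> powr (2 * s - 1)"
    using x(2) by (simp add: powr_diff)
  finally have "\<bar>x\<bar> * \<bar>x\<bar> \<le> \<bar>x\<bar> * (2 * \<bar>x\<bar> powr (2 * s - 1) * Phi s x)" by (simp add: power2_eq_square mult_ac)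
  then have "\<bar>x\<bar> \<le> 2 * \<bar>x\<bar> powr (2 * s - 1) * Phi s x"
    by (rule mult_left_le_imp_le) (use x(2) in linarith)
  also have "\<dots> \<le> 2 * S powr (2 * s - 1) * Phi s x"
    using x S s Phi_nonneg[of s x] by (intro mult_right_mono mult_left_mono powr_mono2') auto
  finally show ?thesis using S by simp
qed

text \<open>Dividing by \<open>y \<ge> 1\<close> can only lower the logarithm, and the additive 1
  absorbs \<open>ln 2\<close>. This is why the growth estimate is claimed only while the functional
  exceeds 1.\<close>

lemma logplus_phiF_le:
  assumes s: "0 \<le> s" "s \<le> 1/2" and y: "1 \<le> y"
  shows "logplus ((phiF s x)\<^sup>2 / y) \<le> 1 + ln (1 + x\<^sup>2)"
proof (cases "phiF s x = 0")
  case True then show ?thesis by (simp add: logplus_def)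
next
  case False
  have l0: "0 \<le> ln (1 + x\<^sup>2)" by (intro ln_ge_zero) simp
  have "(phiF s x)\<^sup>2 / y \<le> (phiF s x)\<^sup>2 / 1" using y by (intro divide_left_mono) auto
  also have "\<dots> \<le> 2 * (1 + x\<^sup>2)" using phiF_square_bounds(2)[OF s, of x] Phi_le[OF s(1), of x] by simp
  finally have "ln ((phiF s x)\<^sup>2 / y) \<le> ln (2 * (1 + x\<^sup>2))" using False y by (subst ln_le_cancel_iff) (auto intro: add_pos_nonneg)
  also have "\<dots> = ln 2 + ln (1 + x\<^sup>2)" by (rule ln_mult_pos) (simp_all add: one_plus_square_pos)
  also have "\<dots> \<le> 1 + ln (1 + x\<^sup>2)" using ln_le_minus_one[of 2] by simp
  finally show ?thesis using l0 by (simp add: logplus_def)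
qed

section \<open>The perturbed form\<close>

context dirichlet
begin

text \<open>The gradient difference splits into \<open>F' (vs n)\<close> times
  \<open>D (vs n) - D v\<close> and \<open>F' (vs n) - F' (v)\<close> times \<open>D v\<close>. The
  second part is treated by dominated convergence, since \<open>F'\<close> is only continuous and
  bounded; hence the pointwise hypothesis, met by passing to a subsequence.\<close>

lemma chain_conv1:
  assumes vs: "conv1 vs v" and lim: "AE x in M. (\<lambda>n. vs n x) \<longlonglongrightarrow> v x"
    and der: "\<And>x. (F has_real_derivative F' x) (at x)"
    and cont: "continuous_on UNIV F'" and bdd: "\<And>x. \<bar>F' x\<bar> \<le> C" and F0: "F 0 = 0"
  shows "conv1 (\<lambda>n x. F (vs n x)) (\<lambda>x. F (v x))"
proof -
  have vD: "vs n \<in> Dom" "v \<in> Dom" for n using vs by (auto simp: conv1_def)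
  have [measurable]: "vs n \<in> borel_measurable M" "D (vs n) \<in> borel_measurable M" "v \<in> borel_measurable M" "D v \<in> borel_measurable M" for n
    using vD by (auto intro: dom_measurable D_measurable)
  have [measurable]: "F' \<in> borel_measurable borel" using cont by (rule borel_measurable_continuous_onI)
  note ch = chain_rule[OF _ der cont bdd F0]
  have C0: "0 \<le> C" using bdd[of 0] by linarith
  have lip: "\<bar>F x - F y\<bar> \<le> C * \<bar>x - y\<bar>" for x y
  proof -
    have "norm (F x - F y) \<le> C * norm (x - y)"
      by (rule field_differentiable_bound[of UNIV F F']) (auto simp: der bdd)
    then show ?thesis by simp
  qed
  have L: "L2H M (\<lambda>x. vs n x - v x)" "L2H M (\<lambda>x. D (vs n) x - D v x)" for n
    using vD by (auto intro: L2H_diff dom_L2 D_L2)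
  have P: "(\<lambda>n. \<integral>x. (norm (vs n x - v x))\<^sup>2 \<partial>M) \<longlonglongrightarrow> 0" "(\<lambda>n. \<integral>x. (norm (D (vs n) x - D v x))\<^sup>2 \<partial>M) \<longlonglongrightarrow> 0"
    using vs by (auto simp: conv1_def)
  have "(\<lambda>n. \<integral>x. (norm (F (vs n x) - F (v x)))\<^sup>2 \<partial>M) \<longlonglongrightarrow> 0"
    by (rule L2H_null_mono_sequentially[where C = C, OF L(1) L2H_measurable[OF L2H_diff[OF dom_L2[OF ch(1)[OF vD(1)]] dom_L2[OF ch(1)[OF vD(2)]]]] _ P(1)])
      (simp add: lip)
  then have c1: "(\<lambda>n. \<integral>x. (F (vs n x) - F (v x))\<^sup>2 \<partial>M) \<longlonglongrightarrow> 0" by simp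
  have Lb: "L2H M (\<lambda>x. F' (vs n x) *\<^sub>R D v x)" for n
    by (rule L2H_mult_bounded[OF D_L2[OF vD(2)], where C = C]) (use bdd in auto)
  have L0: "L2H M (\<lambda>x. F' (v x) *\<^sub>R D v x)"
    by (rule L2H_mult_bounded[OF D_L2[OF vD(2)], where C = C]) (use bdd in auto)
  have c3: "(\<lambda>n. \<integral>x. (norm (F' (vs n x) *\<^sub>R D v x - F' (v x) *\<^sub>R D v x))\<^sup>2 \<partial>M) \<longlonglongrightarrow> 0"
  proof -
    have p1: "AE x in M. (\<lambda>n. F' (vs n x) *\<^sub>R D v x) \<longlonglongrightarrow> F' (v x) *\<^sub>R D v x"
      using lim
    proof eventually_elim
      case (elim x)
      have "isCont F' (v x)" using cont by (simp add: continuous_on_eq_continuous_at)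
      then have "(\<lambda>n. F' (vs n x)) \<longlonglongrightarrow> F' (v x)" using elim by (rule isCont_tendsto_compose)
      then show ?case by (intro tendsto_intros)
    qed
    have p2: "AE x in M. norm (F' (vs n x) *\<^sub>R D v x) \<le> norm (C *\<^sub>R D v x)" for n
      using bdd C0 by (auto intro!: mult_right_mono)
    have p3: "L2H M (\<lambda>x. norm (C *\<^sub>R D v x))" by (rule L2_norm L2H_scaleR D_L2 vD)+
    show ?thesis by (rule L2H_dominated_convergence(2)[OF _ _ p1 p2 p3]; measurable)
  qed
  have Lc: "L2H M (\<lambda>x. F' (vs n x) *\<^sub>R (D (vs n) x - D v x))" for n
    by (rule L2H_mult_bounded[OF L(2), where C = C]) (use bdd in auto)
  have c4: "(\<lambda>n. \<integral>x. (norm (F' (vs n x) *\<^sub>R (D (vs n) x - D v x)))\<^sup>2 \<partial>M) \<longlonglongrightarrow> 0"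
    by (rule L2H_null_mono_sequentially[where C = C, OF L(2) L2H_measurable[OF Lc] _ P(2)])
      (use bdd in \<open>auto intro!: AE_I2 mult_right_mono\<close>)
  have c2: "(\<lambda>n. \<integral>x. (norm (D (\<lambda>x. F (vs n x)) x - D (\<lambda>x. F (v x)) x))\<^sup>2 \<partial>M) \<longlonglongrightarrow> 0"
  proof (rule L2H_null_add[OF Lc L2H_diff[OF Lb L0] c4 c3])
    show "(\<lambda>x. D (\<lambda>x. F (vs n x)) x - D (\<lambda>x. F (v x)) x) \<in> borel_measurable M" for n
      by (rule L2H_measurable[OF L2H_diff[OF D_L2[OF ch(1)[OF vD(1)]] D_L2[OF ch(1)[OF vD(2)]]]])
    show "AE x in M. D (\<lambda>x. F (vs n x)) x - D (\<lambda>x. F (v x)) x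
        = F' (vs n x) *\<^sub>R (D (vs n) x - D v x) + (F' (vs n x) *\<^sub>R D v x - F' (v x) *\<^sub>R D v x)" for n
      using ch(2)[OF vD(1)[of n]] ch(2)[OF vD(2)] by eventually_elim (simp add: algebra_simps)
  qed
  show ?thesis unfolding conv1_def using ch(1)[OF vD(1)] ch(1)[OF vD(2)] c1 c2 by blast
qed

abbreviation "e1 f \<equiv> sqrt (E0l M D 1 f f)"

text \<open>A triangle inequality up to a factor 2, which is harmless because \<open>e1\<close> only
  measures errors that tend to zero and bounded quantities.\<close>

lemma e1_diff_le:
  assumes "f \<in> Dom" "g \<in> Dom" "h \<in> Dom"
  shows "e1 (\<lambda>x. f x - g x) \<le> 2 * (e1 (\<lambda>x. f x - h x) + e1 (\<lambda>x. g x - h x))"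
proof -
  define a where "a = E0l M D 1 (\<lambda>x. f x - h x) (\<lambda>x. f x - h x)"
  define b where "b = E0l M D 1 (\<lambda>x. g x - h x) (\<lambda>x. g x - h x)"
  have ab: "0 \<le> a" "0 \<le> b" by (simp_all add: a_def b_def E0l_nonneg)
  have sym: "E0l M D 1 (\<lambda>x. h x - g x) (\<lambda>x. h x - g x) = b"
    unfolding b_def using assms by (simp add: E0l_self integral_norm_D_diff power2_commute norm_minus_commute)
  have "E0l M D 1 (\<lambda>x. f x - g x) (\<lambda>x. f x - g x) \<le> 2 * a + 2 * b"
    using E0l_diff_triangle[OF assms(1,3,2)] sym by (simp add: a_def)
  also have "\<dots> \<le> (2 * (sqrt a + sqrt b))\<^sup>2"
  proof -
    have "(2 * (sqrt a + sqrt b))\<^sup>2 = 4 * (a + b + 2 * sqrt a * sqrt b)"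
      using ab by (simp only: power_mult_distrib power2_sum real_sqrt_pow2) simp
    moreover have "0 \<le> sqrt a * sqrt b" using ab by simp
    ultimately show ?thesis using ab by simp
  qed
  finally show ?thesis unfolding a_def[symmetric] b_def[symmetric]
    using ab by (intro real_le_lsqrt) auto
qed

end

context dirichlet_nest
begin

lemma core_diff:
  assumes "f \<in> Core" "g \<in> Core"
  shows "(\<lambda>x. f x - g x) \<in> Core"
proof -
  obtain k C where f: "f \<in> Dom" "AE x in M. x \<notin> Ek k \<longrightarrow> f x = 0" "AE x in M. \<bar>f x\<bar> \<le> C" using coreE[OF assms(1)] by blast
  obtain k' C' where g: "g \<in> Dom" "AE x in M. x \<notin> Ek k' \<longrightarrow> g x = 0" "AE x in M. \<bar>g x\<bar> \<le> C'" using coreE[OF assms(2)] by blast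
  have inc: "Ek i \<subseteq> Ek j" if "i \<le> j" for i j using nest that by (auto simp: measurable_nest_def incseq_def)
  show ?thesis
  proof (rule coreI[where k = "max k k'" and C = "C + C'"])
    show "(\<lambda>x. f x - g x) \<in> Dom" by (rule dom_diff[OF f(1) g(1)])
    show "AE x in M. x \<notin> Ek (max k k') \<longrightarrow> f x - g x = 0"
      using f(2) g(2) by eventually_elim (use inc[of k "max k k'"] inc[of k' "max k k'"] in auto)
    show "AE x in M. \<bar>f x - g x\<bar> \<le> C + C'" using f(3) g(3) by eventually_elim linarith
  qed
qed

lemma core_chain:
  assumes f: "f \<in> Core" and F: "(\<lambda>x. F (f x)) \<in> Dom" and b: "\<And>x. \<bar>F x\<bar> \<le> C * \<bar>x\<bar>" and C: "0 \<le> C"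
  shows "(\<lambda>x. F (f x)) \<in> Core"
proof -
  obtain k K where f: "f \<in> Dom" "AE x in M. x \<notin> Ek k \<longrightarrow> f x = 0" "AE x in M. \<bar>f x\<bar> \<le> K" using coreE[OF assms(1)] by blast
  show ?thesis
  proof (rule coreI[OF F, where k = k and C = "C * K"])
    show "AE x in M. x \<notin> Ek k \<longrightarrow> F (f x) = 0" using f(2) by eventually_elim (use b[of 0] in auto)
    show "AE x in M. \<bar>F (f x)\<bar> \<le> C * K" using f(3)
    proof eventually_elim
      case (elim x)
      then show ?case using b[of "f x"] mult_left_mono[OF elim C] by linarith
    qed
  qed
qed

lemma core_multiplier:
  assumes f: "f \<in> Core" and m: "multiplier m G"
  shows "(\<lambda>x. m x * f x) \<in> Core"
proof -
  obtain k K where f: "f \<in> Dom" "AE x in M. x \<notin> Ek k \<longrightarrow> f x = 0" "AE x in M. \<bar>f x\<bar> \<le> K" using coreE[OF assms(1)] by blast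
  obtain C where C: "AE x in M. \<bar>m x\<bar> \<le> C" using multiplierD(3)[OF m] by blast
  show ?thesis
  proof (rule coreI[where k = k and C = "C * K"])
    show "(\<lambda>x. m x * f x) \<in> Dom" by (rule multiplierD(5)[OF m f(1)])
    show "AE x in M. x \<notin> Ek k \<longrightarrow> m x * f x = 0" using f(2) by eventually_elim auto
    show "AE x in M. \<bar>m x * f x\<bar> \<le> C * K" using f(3) C by eventually_elim (auto simp: abs_mult intro: mult_mono)
  qed
qed

text \<open>Local integrability of (A.1), rephrased through restrictions in \<open>L2H\<close> so
  that the Cauchy-Schwarz estimates for \<open>L2H\<close> apply.\<close>

definition loc_L2 :: "('a \<Rightarrow> 'h) \<Rightarrow> bool" where
  "loc_L2 X \<longleftrightarrow> X \<in> borel_measurable M \<and> (\<forall>k. L2H M (\<lambda>x. indicator (Ek k) x *\<^sub>R X x))"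

lemma loc_L2I:
  assumes [measurable]: "X \<in> borel_measurable M" and "Lp_loc M 2 Ek (\<lambda>x. norm (X x))"
  shows "loc_L2 X"
proof -
  have "L2H M (\<lambda>x. indicator (Ek k) x *\<^sub>R X x)" for k
    unfolding L2H_def
  proof
    show "(\<lambda>x. indicat_real (Ek k) x *\<^sub>R X x) \<in> borel_measurable M" by measurable
    have "integrable M (\<lambda>x. indicator (Ek k) x * \<bar>norm (X x)\<bar> powr 2)" using assms(2) by (simp add: Lp_loc_def)
    moreover have "(\<lambda>x. indicator (Ek k) x * \<bar>norm (X x)\<bar> powr 2) = (\<lambda>x. (norm (indicat_real (Ek k) x *\<^sub>R X x))\<^sup>2)"
      by (auto simp: indicator_def powr_numeral fun_eq_iff)
    ultimately show "integrable M (\<lambda>x. (norm (indicat_real (Ek k) x *\<^sub>R X x))\<^sup>2)" by simp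
  qed
  then show ?thesis by (simp add: loc_L2_def assms)
qed

lemma loc_L2_add: "loc_L2 X \<Longrightarrow> loc_L2 Y \<Longrightarrow> loc_L2 (\<lambda>x. X x + Y x)"
  unfolding loc_L2_def by (auto simp: scaleR_add_right intro: L2H_add)

lemma loc_L2_diff: "loc_L2 X \<Longrightarrow> loc_L2 Y \<Longrightarrow> loc_L2 (\<lambda>x. X x - Y x)"
  unfolding loc_L2_def by (auto simp: scaleR_diff_right intro: L2H_diff)

text \<open>A core function is bounded and lives on one \<open>Ek\<close>, where \<open>X\<close> is
  square-integrable. This is what makes the lower-order integrals meaningful on the core.\<close>

lemma drift_integrable:
  assumes X: "loc_L2 X" and G: "L2H M G" and g: "g \<in> Core"
  shows "integrable M (\<lambda>x. inner (X x) (G x) * g x)"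
proof -
  obtain k C where g: "g \<in> Dom" "AE x in M. x \<notin> Ek k \<longrightarrow> g x = 0" "AE x in M. \<bar>g x\<bar> \<le> C" using coreE[OF g] by blast
  have Xk: "L2H M (\<lambda>x. indicator (Ek k) x *\<^sub>R X x)" using X by (simp add: loc_L2_def)
  have [measurable]: "X \<in> borel_measurable M" "G \<in> borel_measurable M" "g \<in> borel_measurable M"
    using X G g by (auto simp: loc_L2_def intro: L2H_measurable dom_measurable)
  have i: "integrable M (\<lambda>x. C * (norm (indicat_real (Ek k) x *\<^sub>R X x) * norm (G x)))"
    using L2H_norm_mult_integrable[OF Xk G] by simp
  show ?thesis
  proof (rule Bochner_Integration.integrable_bound[OF i])
    show "AE x in M. norm (inner (X x) (G x) * g x) \<le> norm (C * (norm (indicat_real (Ek k) x *\<^sub>R X x) * norm (G x)))"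
      using g(2,3)
    proof eventually_elim
      case (elim x)
      show ?case
      proof (cases "x \<in> Ek k")
        case True
        have "\<bar>inner (X x) (G x)\<bar> * \<bar>g x\<bar> \<le> (norm (X x) * norm (G x)) * \<bar>C\<bar>"
          using elim by (intro mult_mono Cauchy_Schwarz_ineq2) auto
        then show ?thesis using True by (simp add: abs_mult mult_ac)
      next
        case False then show ?thesis using elim by simp
      qed
    qed
  qed measurable
qed

end

section \<open>The bilinear form and its continuous extension\<close>

locale lower_order = dirichlet_nest M Dom D Ek
  for M :: "'a measure" and Dom :: "('a \<Rightarrow> real) set"
    and D :: "('a \<Rightarrow> real) \<Rightarrow> 'a \<Rightarrow> 'h::{real_inner,banach,second_countable_topology}"
    and Ek :: "nat \<Rightarrow> 'a set" +
  fixes b c :: "'a \<Rightarrow> 'h" and V :: "'a \<Rightarrow> real" and \<eta> \<theta> \<omega> l :: real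
  assumes bm: "b \<in> borel_measurable M" and cm: "c \<in> borel_measurable M" and Vm [measurable]: "V \<in> borel_measurable M"
    and bloc: "Lp_loc M 2 Ek (\<lambda>x. norm (b x))" and cloc: "Lp_loc M 2 Ek (\<lambda>x. norm (c x))" and Vloc: "Lp_loc M 1 Ek V"
    and coeff_bounds: "0 \<le> \<eta>" "\<eta> < 1" "0 \<le> \<theta>" "0 \<le> \<omega>" "0 \<le> l"
    and lower: "\<And>f. f \<in> Core \<Longrightarrow>
           - (\<integral>x. inner (b x + c x) (D f x) * f x + V x * (f x)\<^sup>2 \<partial>M) \<le> \<eta> * E0 M D f f + \<theta> * (norm2 M f)\<^sup>2"
    and upper: "\<And>f g. f \<in> Core \<Longrightarrow> g \<in> Core \<Longrightarrow>
           \<bar>\<integral>x. inner (b x) (D f x) * g x + inner (c x) (D g x) * f x + V x * f x * g x \<partial>M\<bar>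
             \<le> \<omega> * sqrt (E0l M D l f f) * sqrt (E0l M D l g g)"
begin

lemmas b_loc = loc_L2I[OF bm bloc] and c_loc = loc_L2I[OF cm cloc]

lemma V_integrable:
  assumes "f \<in> Core" "g \<in> Core"
  shows "integrable M (\<lambda>x. V x * f x * g x)"
proof -
  obtain k C where f: "f \<in> Dom" "AE x in M. x \<notin> Ek k \<longrightarrow> f x = 0" "AE x in M. \<bar>f x\<bar> \<le> C" using coreE[OF assms(1)] by blast
  obtain k' C' where g: "g \<in> Dom" "AE x in M. x \<notin> Ek k' \<longrightarrow> g x = 0" "AE x in M. \<bar>g x\<bar> \<le> C'" using coreE[OF assms(2)] by blast
  have [measurable]: "f \<in> borel_measurable M" "g \<in> borel_measurable M" using f g by (auto intro: dom_measurable)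
  have "integrable M (\<lambda>x. indicator (Ek k) x * \<bar>V x\<bar> powr 1)" using Vloc by (simp add: Lp_loc_def)
  then have i: "integrable M (\<lambda>x. (C * C') * (indicator (Ek k) x * \<bar>V x\<bar>))" by simp
  show ?thesis
  proof (rule Bochner_Integration.integrable_bound[OF i])
    show "AE x in M. norm (V x * f x * g x) \<le> norm ((C * C') * (indicator (Ek k) x * \<bar>V x\<bar>))"
      using f(2,3) g(3)
    proof eventually_elim
      case (elim x)
      show ?case
      proof (cases "x \<in> Ek k")
        case True
        have "\<bar>f x\<bar> * \<bar>g x\<bar> \<le> \<bar>C\<bar> * \<bar>C'\<bar>" using elim by (intro mult_mono) auto
        then have "\<bar>V x\<bar> * (\<bar>f x\<bar> * \<bar>g x\<bar>) \<le> \<bar>V x\<bar> * (\<bar>C\<bar> * \<bar>C'\<bar>)" by (intro mult_left_mono) auto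
        then show ?thesis using True by (simp add: abs_mult mult_ac)
      next
        case False then show ?thesis using elim by simp
      qed
    qed
  qed measurable
qed

definition pert :: "('a \<Rightarrow> real) \<Rightarrow> ('a \<Rightarrow> real) \<Rightarrow> 'a \<Rightarrow> real" where
  "pert f g x = inner (b x) (D f x) * g x + inner (c x) (D g x) * f x + V x * f x * g x"

lemma pert_integrable:
  assumes "f \<in> Core" "g \<in> Core" shows "integrable M (pert f g)"
  unfolding pert_def[abs_def]
  using assms drift_integrable[OF b_loc D_L2[OF coreD[OF assms(1)]] assms(2)]
    drift_integrable[OF c_loc D_L2[OF coreD[OF assms(2)]] assms(1)] V_integrable[OF assms]
  by (intro Bochner_Integration.integrable_add)

abbreviation "E \<equiv> pform M D b c V"
abbreviation "Eext \<equiv> pform_ext M Dom D Ek b c V"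

lemma pform_eq: "E f g = (1/2) * (\<integral>x. inner (D f x) (D g x) \<partial>M) + (\<integral>x. pert f g x \<partial>M)"
  by (simp add: pform_def E0_def pert_def)

lemma pform_diff_left:
  assumes f: "f \<in> Core" and f': "f' \<in> Core" and g: "g \<in> Core"
  shows "E (\<lambda>x. f x - f' x) g = E f g - E f' g"
proof -
  note D = coreD[OF f] coreD[OF f'] coreD[OF g]
  note d = core_diff[OF f f']
  note dD = dom_diff(2)[OF D(1,2)]
  have "(\<integral>x. inner (D (\<lambda>x. f x - f' x) x) (D g x) \<partial>M) = (\<integral>x. inner (D f x) (D g x) - inner (D f' x) (D g x) \<partial>M)"
    using dD D_measurable[OF coreD[OF d]] D_measurable[OF D(1)] D_measurable[OF D(2)] D_measurable[OF D(3)]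
    by (intro integral_cong_AE) (auto simp: inner_diff_left)
  also have "\<dots> = (\<integral>x. inner (D f x) (D g x) \<partial>M) - (\<integral>x. inner (D f' x) (D g x) \<partial>M)"
    using D by (intro Bochner_Integration.integral_diff L2H_inner_integrable D_L2)
  finally have 1: "(\<integral>x. inner (D (\<lambda>x. f x - f' x) x) (D g x) \<partial>M) = (\<integral>x. inner (D f x) (D g x) \<partial>M) - (\<integral>x. inner (D f' x) (D g x) \<partial>M)" .
  have "(\<integral>x. pert (\<lambda>x. f x - f' x) g x \<partial>M) = (\<integral>x. pert f g x - pert f' g x \<partial>M)"
  proof (rule integral_cong_AE)
    show "AE x in M. pert (\<lambda>x. f x - f' x) g x = pert f g x - pert f' g x"
      using dD
    proof eventually_elim
      case (elim x)
      show ?case unfolding pert_def elim by (simp add: inner_diff_right algebra_simps)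
    qed
  qed (use pert_integrable[OF d g] pert_integrable[OF f g] pert_integrable[OF f' g] in auto)
  also have "\<dots> = (\<integral>x. pert f g x \<partial>M) - (\<integral>x. pert f' g x \<partial>M)"
    by (intro Bochner_Integration.integral_diff pert_integrable f f' g)
  finally show ?thesis unfolding pform_eq 1 by (simp add: algebra_simps)
qed

lemma pform_diff_right:
  assumes f: "f \<in> Core" and f': "f' \<in> Core" and g: "g \<in> Core"
  shows "E g (\<lambda>x. f x - f' x) = E g f - E g f'"
proof -
  note D = coreD[OF f] coreD[OF f'] coreD[OF g]
  note d = core_diff[OF f f']
  note dD = dom_diff(2)[OF D(1,2)]
  have "(\<integral>x. inner (D g x) (D (\<lambda>x. f x - f' x) x) \<partial>M) = (\<integral>x. inner (D g x) (D f x) - inner (D g x) (D f' x) \<partial>M)"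
    using dD D_measurable[OF coreD[OF d]] D_measurable[OF D(1)] D_measurable[OF D(2)] D_measurable[OF D(3)]
    by (intro integral_cong_AE) (auto simp: inner_diff_right)
  also have "\<dots> = (\<integral>x. inner (D g x) (D f x) \<partial>M) - (\<integral>x. inner (D g x) (D f' x) \<partial>M)"
    using D by (intro Bochner_Integration.integral_diff L2H_inner_integrable D_L2)
  finally have 1: "(\<integral>x. inner (D g x) (D (\<lambda>x. f x - f' x) x) \<partial>M) = (\<integral>x. inner (D g x) (D f x) \<partial>M) - (\<integral>x. inner (D g x) (D f' x) \<partial>M)" .
  have "(\<integral>x. pert g (\<lambda>x. f x - f' x) x \<partial>M) = (\<integral>x. pert g f x - pert g f' x \<partial>M)"
  proof (rule integral_cong_AE)
    show "AE x in M. pert g (\<lambda>x. f x - f' x) x = pert g f x - pert g f' x"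
      using dD
    proof eventually_elim
      case (elim x)
      show ?case unfolding pert_def elim by (simp add: inner_diff_right algebra_simps)
    qed
  qed (use pert_integrable[OF g d] pert_integrable[OF g f] pert_integrable[OF g f'] in auto)
  also have "\<dots> = (\<integral>x. pert g f x \<partial>M) - (\<integral>x. pert g f' x \<partial>M)"
    by (intro Bochner_Integration.integral_diff pert_integrable f f' g)
  finally show ?thesis unfolding pform_eq 1 by (simp add: algebra_simps)
qed

lemma pform_bound:
  obtains K where "0 \<le> K" "\<And>f g. f \<in> Core \<Longrightarrow> g \<in> Core \<Longrightarrow> \<bar>E f g\<bar> \<le> K * (e1 f * e1 g)"
proof
  \<comment> \<open>The norm with constant \<open>l\<close> is compared with \<open>e1\<close>; the
    maximum with 1 covers the gradient part when \<open>l < 1\<close>.\<close>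
  define L where "L = max 1 l"
  show "0 \<le> 1 + \<omega> * L" using coeff_bounds by (simp add: L_def)
  fix f g assume f: "f \<in> Core" and g: "g \<in> Core"
  have el: "sqrt (E0l M D l h h) \<le> sqrt L * e1 h" for h
  proof -
    have "E0l M D l h h \<le> L * E0l M D 1 h h"
    proof -
      have "l * (\<integral>x. (h x)\<^sup>2 \<partial>M) \<le> L * (\<integral>x. (h x)\<^sup>2 \<partial>M)" by (intro mult_right_mono) (auto simp: L_def)
      moreover have "1 * (\<integral>x. (norm (D h x))\<^sup>2 \<partial>M) \<le> L * (\<integral>x. (norm (D h x))\<^sup>2 \<partial>M)" by (intro mult_right_mono) (auto simp: L_def)
      ultimately show ?thesis unfolding E0l_self by (simp add: distrib_left)
    qed
    then show ?thesis by (simp flip: real_sqrt_mult)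
  qed
  have n: "norm2H M (D h) \<le> sqrt 2 * e1 h" for h
    unfolding norm2H_def real_sqrt_mult[symmetric] E0l_self by simp
  have "\<bar>(1/2) * (\<integral>x. inner (D f x) (D g x) \<partial>M)\<bar> \<le> (1/2) * (norm2H M (D f) * norm2H M (D g))"
    using integral_inner_le[OF D_L2[OF coreD[OF f]] D_L2[OF coreD[OF g]]] by simp
  also have "\<dots> \<le> (1/2) * ((sqrt 2 * e1 f) * (sqrt 2 * e1 g))"
    by (intro mult_left_mono mult_mono n) (auto simp: norm2H_def E0l_nonneg)
  also have "\<dots> = e1 f * e1 g" by simp
  finally have 1: "\<bar>(1/2) * (\<integral>x. inner (D f x) (D g x) \<partial>M)\<bar> \<le> e1 f * e1 g" .
  have "\<bar>\<integral>x. pert f g x \<partial>M\<bar> \<le> \<omega> * sqrt (E0l M D l f f) * sqrt (E0l M D l g g)"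
    unfolding pert_def by (rule upper[OF f g])
  also have "\<dots> \<le> \<omega> * (sqrt L * e1 f) * (sqrt L * e1 g)"
    using coeff_bounds by (intro mult_mono el mult_left_mono) (auto simp: E0l_nonneg L_def)
  also have "\<dots> = \<omega> * L * (e1 f * e1 g)" by (simp add: L_def)
  finally have 2: "\<bar>\<integral>x. pert f g x \<partial>M\<bar> \<le> \<omega> * L * (e1 f * e1 g)" .
  have "\<bar>E f g\<bar> \<le> \<bar>(1/2) * (\<integral>x. inner (D f x) (D g x) \<partial>M)\<bar> + \<bar>\<integral>x. pert f g x \<partial>M\<bar>"
    unfolding pform_eq by (rule abs_triangle_ineq)
  also have "\<dots> \<le> e1 f * e1 g + \<omega> * L * (e1 f * e1 g)" by (rule add_mono[OF 1 2])
  finally show "\<bar>E f g\<bar> \<le> (1 + \<omega> * L) * (e1 f * e1 g)" by (simp add: distrib_right)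
qed

text \<open>Joint continuity, with all approximants measured against fixed targets in
  \<open>Dom\<close>. It yields both the Cauchy property of the form values and their independence
  of the approximating sequences.\<close>

lemma pform_diff_bound:
  obtains K where "\<And>f g f1 f2 g1 g2. \<lbrakk>f \<in> Dom; g \<in> Dom; f1 \<in> Core; f2 \<in> Core; g1 \<in> Core; g2 \<in> Core\<rbrakk>
    \<Longrightarrow> \<bar>E f1 g1 - E f2 g2\<bar> \<le> K * ((e1 (\<lambda>x. f1 x - f x) + e1 (\<lambda>x. f2 x - f x)) * (e1 (\<lambda>x. g1 x - g x) + e1 g)
       + (e1 (\<lambda>x. f2 x - f x) + e1 f) * (e1 (\<lambda>x. g1 x - g x) + e1 (\<lambda>x. g2 x - g x)))"
proof -
  obtain K where K: "0 \<le> K" "\<And>f g. f \<in> Core \<Longrightarrow> g \<in> Core \<Longrightarrow> \<bar>E f g\<bar> \<le> K * (e1 f * e1 g)"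
    using pform_bound by blast
  have z: "e1 g1 \<le> 2 * (e1 (\<lambda>x. g1 x - g x) + e1 g)" if "g1 \<in> Dom" "g \<in> Dom" for g1 g
  proof -
    have "(\<integral>x. (norm (D (\<lambda>_. 0) x - D g x))\<^sup>2 \<partial>M) = (\<integral>x. (norm (D g x))\<^sup>2 \<partial>M)"
      using D_zero D_measurable[OF dom_zero] D_measurable[OF that(2)]
      by (intro integral_cong_AE) (auto elim!: eventually_mono)
    then have "e1 (\<lambda>x. 0 - g x) = e1 g"
      unfolding E0l_self integral_norm_D_diff[OF dom_zero that(2)] by simp
    then show ?thesis using e1_diff_le[OF that(1) dom_zero that(2)] by simp
  qed
  show thesis
  proof (rule that[of "4 * K"])
    fix f g f1 f2 g1 g2
    assume D: "f \<in> Dom" "g \<in> Dom" and c: "f1 \<in> Core" "f2 \<in> Core" "g1 \<in> Core" "g2 \<in> Core"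
    note cD = c[THEN coreD]
    have "E f1 g1 - E f2 g2 = E (\<lambda>x. f1 x - f2 x) g1 + E f2 (\<lambda>x. g1 x - g2 x)"
      unfolding pform_diff_left[OF c(1,2,3)] pform_diff_right[OF c(3,4,2)] by simp
    then have "\<bar>E f1 g1 - E f2 g2\<bar> \<le> \<bar>E (\<lambda>x. f1 x - f2 x) g1\<bar> + \<bar>E f2 (\<lambda>x. g1 x - g2 x)\<bar>" by (simp add: abs_triangle_ineq)
    also have "\<dots> \<le> K * (e1 (\<lambda>x. f1 x - f2 x) * e1 g1) + K * (e1 f2 * e1 (\<lambda>x. g1 x - g2 x))"
      using c by (intro add_mono K core_diff)
    also have "\<dots> \<le> K * ((2 * (e1 (\<lambda>x. f1 x - f x) + e1 (\<lambda>x. f2 x - f x))) * (2 * (e1 (\<lambda>x. g1 x - g x) + e1 g)))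
       + K * ((2 * (e1 (\<lambda>x. f2 x - f x) + e1 f)) * (2 * (e1 (\<lambda>x. g1 x - g x) + e1 (\<lambda>x. g2 x - g x))))"
      using D cD by (intro add_mono mult_left_mono mult_mono K e1_diff_le z) (auto simp: E0l_nonneg)
    also have "\<dots> = 4 * K * ((e1 (\<lambda>x. f1 x - f x) + e1 (\<lambda>x. f2 x - f x)) * (e1 (\<lambda>x. g1 x - g x) + e1 g)
       + (e1 (\<lambda>x. f2 x - f x) + e1 f) * (e1 (\<lambda>x. g1 x - g x) + e1 (\<lambda>x. g2 x - g x)))" by (simp add: algebra_simps)
    finally show "\<bar>E f1 g1 - E f2 g2\<bar> \<le> 4 * K * ((e1 (\<lambda>x. f1 x - f x) + e1 (\<lambda>x. f2 x - f x)) * (e1 (\<lambda>x. g1 x - g x) + e1 g)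
       + (e1 (\<lambda>x. f2 x - f x) + e1 f) * (e1 (\<lambda>x. g1 x - g x) + e1 (\<lambda>x. g2 x - g x)))" .
  qed
qed

text \<open>\<open>pform_ext\<close> is a definite description. This shows that it denotes, and it
  is the only property of the extension that the sequel relies on.\<close>

lemma pform_ext_tendsto:
  assumes fs: "\<And>n. fs n \<in> Core" "conv1 fs f" and gs: "\<And>n. gs n \<in> Core" "conv1 gs g"
  shows "(\<lambda>n. E (fs n) (gs n)) \<longlonglongrightarrow> Eext f g"
proof -
  have D: "f \<in> Dom" "g \<in> Dom" using fs(2) gs(2) by (auto simp: conv1_def)
  obtain K where "\<And>f g f1 f2 g1 g2. \<lbrakk>f \<in> Dom; g \<in> Dom; f1 \<in> Core; f2 \<in> Core; g1 \<in> Core; g2 \<in> Core\<rbrakk>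
    \<Longrightarrow> \<bar>E f1 g1 - E f2 g2\<bar> \<le> K * ((e1 (\<lambda>x. f1 x - f x) + e1 (\<lambda>x. f2 x - f x)) * (e1 (\<lambda>x. g1 x - g x) + e1 g)
       + (e1 (\<lambda>x. f2 x - f x) + e1 f) * (e1 (\<lambda>x. g1 x - g x) + e1 (\<lambda>x. g2 x - g x)))"
    by (fact pform_diff_bound)
  note K = this[OF D]
  have e0: "(\<lambda>n. e1 (\<lambda>x. hs n x - h x)) \<longlonglongrightarrow> 0" if "conv1 hs h" for hs h
  proof -
    have "(\<lambda>n. E0l M D 1 (\<lambda>x. hs n x - h x) (\<lambda>x. hs n x - h x)) \<longlonglongrightarrow> 0"
      using that conv1_iff_E0l[of hs h] by (simp add: conv1_def)
    then have "(\<lambda>n. e1 (\<lambda>x. hs n x - h x)) \<longlonglongrightarrow> sqrt 0" by (intro tendsto_intros)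
    then show ?thesis by simp
  qed
  define \<delta> where "\<delta> n = e1 (\<lambda>x. fs n x - f x)" for n
  define \<delta>' where "\<delta>' n = e1 (\<lambda>x. gs n x - g x)" for n
  have d0: "\<delta> \<longlonglongrightarrow> 0" "\<delta>' \<longlonglongrightarrow> 0" unfolding \<delta>_def \<delta>'_def by (rule e0, fact)+
  have "Cauchy (\<lambda>n. E (fs n) (gs n))"
  proof (rule metric_CauchyI)
    fix r :: real assume r: "r > 0"
    \<comment> \<open>The bound depends on two independent indices; along the product filter it is
      an ordinary limit, from which the Cauchy property is read off.\<close>
    have "((\<lambda>(m,n). K * ((\<delta> m + \<delta> n) * (\<delta>' m + e1 g) + (\<delta> n + e1 f) * (\<delta>' m + \<delta>' n)))
        \<longlongrightarrow> K * ((0 + 0) * (0 + e1 g) + (0 + e1 f) * (0 + 0))) (sequentially \<times>\<^sub>F sequentially)"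
      unfolding case_prod_beta
      by (intro tendsto_intros filterlim_compose[OF d0(1) filterlim_fst] filterlim_compose[OF d0(1) filterlim_snd]
          filterlim_compose[OF d0(2) filterlim_fst] filterlim_compose[OF d0(2) filterlim_snd])
    then have "\<forall>\<^sub>F p in sequentially \<times>\<^sub>F sequentially. (case p of (m,n) \<Rightarrow> K * ((\<delta> m + \<delta> n) * (\<delta>' m + e1 g) + (\<delta> n + e1 f) * (\<delta>' m + \<delta>' n))) < r"
      using r by (intro order_tendstoD) auto
    then obtain N where N: "\<And>m n. m \<ge> N \<Longrightarrow> n \<ge> N \<Longrightarrow> K * ((\<delta> m + \<delta> n) * (\<delta>' m + e1 g) + (\<delta> n + e1 f) * (\<delta>' m + \<delta>' n)) < r"
      unfolding eventually_prod_sequentially by auto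
    show "\<exists>N. \<forall>m\<ge>N. \<forall>n\<ge>N. dist (E (fs m) (gs m)) (E (fs n) (gs n)) < r"
    proof (intro exI allI impI)
      fix m n assume "m \<ge> N" "n \<ge> N"
      from K[OF fs(1)[of m] fs(1)[of n] gs(1)[of m] gs(1)[of n]] N[OF this]
      show "dist (E (fs m) (gs m)) (E (fs n) (gs n)) < r"
        unfolding dist_real_def \<delta>_def[symmetric] \<delta>'_def[symmetric] by linarith
    qed
  qed
  then obtain e where e: "(\<lambda>n. E (fs n) (gs n)) \<longlonglongrightarrow> e" by (auto simp: Cauchy_convergent_iff convergent_def)
  have all: "(\<lambda>n. E (fs' n) (gs' n)) \<longlonglongrightarrow> e"
    if fs': "\<And>n. fs' n \<in> Core" "conv1 fs' f" and gs': "\<And>n. gs' n \<in> Core" "conv1 gs' g" for fs' gs'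
  proof -
    have "(\<lambda>n. E (fs' n) (gs' n) - E (fs n) (gs n)) \<longlonglongrightarrow> 0"
    proof (rule Lim_null_comparison)
      let ?B = "\<lambda>n. K * ((e1 (\<lambda>x. fs' n x - f x) + \<delta> n) * (e1 (\<lambda>x. gs' n x - g x) + e1 g) + (\<delta> n + e1 f) * (e1 (\<lambda>x. gs' n x - g x) + \<delta>' n))"
      have "?B \<longlonglongrightarrow> K * ((0 + 0) * (0 + e1 g) + (0 + e1 f) * (0 + 0))"
        by (intro tendsto_intros d0 e0[OF fs'(2)] e0[OF gs'(2)])
      then show "?B \<longlonglongrightarrow> 0" by simp
      show "\<forall>\<^sub>F n in sequentially. norm (E (fs' n) (gs' n) - E (fs n) (gs n)) \<le> ?B n"
        unfolding \<delta>_def \<delta>'_def real_norm_def by (intro always_eventually allI K fs gs fs' gs')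
    qed
    from tendsto_add[OF this e] show ?thesis by simp
  qed
  have "Eext f g = e"
    unfolding pform_ext_def
  proof (rule the_equality)
    show "\<forall>fs gs. (\<forall>n. fs n \<in> Core \<and> gs n \<in> Core)
        \<longrightarrow> (\<lambda>n. E0l M D 1 (\<lambda>x. fs n x - f x) (\<lambda>x. fs n x - f x)) \<longlonglongrightarrow> 0
        \<longrightarrow> (\<lambda>n. E0l M D 1 (\<lambda>x. gs n x - g x) (\<lambda>x. gs n x - g x)) \<longlonglongrightarrow> 0
        \<longrightarrow> (\<lambda>n. E (fs n) (gs n)) \<longlonglongrightarrow> e"
      using all D coreD conv1_iff_E0l by blast
  next
    fix e' assume *: "\<forall>fs gs. (\<forall>n. fs n \<in> Core \<and> gs n \<in> Core)
        \<longrightarrow> (\<lambda>n. E0l M D 1 (\<lambda>x. fs n x - f x) (\<lambda>x. fs n x - f x)) \<longlonglongrightarrow> 0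
        \<longrightarrow> (\<lambda>n. E0l M D 1 (\<lambda>x. gs n x - g x) (\<lambda>x. gs n x - g x)) \<longlonglongrightarrow> 0
        \<longrightarrow> (\<lambda>n. E (fs n) (gs n)) \<longlonglongrightarrow> e'"
    have "(\<lambda>n. E (fs n) (gs n)) \<longlonglongrightarrow> e'"
      using *[rule_format, of fs gs] fs gs D conv1_iff_E0l[of fs f] conv1_iff_E0l[of gs g] coreD by blast
    then show "e' = e" using e by (rule LIMSEQ_unique)
  qed
  with e show ?thesis by simp
qed

end

text \<open>The Lipschitz bound is expanded around \<open>v\<close>, and the mixed term is estimated
  by Cauchy-Schwarz.\<close>

lemma quadratic_integral_diff:
  fixes v v' :: "'a \<Rightarrow> real"
  assumes [measurable]: "\<Psi> \<in> borel_measurable borel" and lip: "\<And>x y. \<bar>\<Psi> x - \<Psi> y\<bar> \<le> C * (\<bar>x\<bar> + \<bar>y\<bar>) * \<bar>x - y\<bar>"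
    and C: "0 \<le> C" and \<Psi>0: "\<Psi> 0 = 0" and v: "L2H M v" and v': "L2H M v'"
  shows "\<bar>(\<integral>x. \<Psi> (v' x) \<partial>M) - (\<integral>x. \<Psi> (v x) \<partial>M)\<bar>
     \<le> C * ((norm2H M (\<lambda>x. v' x - v x))\<^sup>2 + 2 * (norm2H M v * norm2H M (\<lambda>x. v' x - v x)))"
proof -
  have [measurable]: "v \<in> borel_measurable M" "v' \<in> borel_measurable M" using v v' by (auto intro: L2H_measurable)
  have i: "integrable M (\<lambda>x. \<Psi> (w x))" if w: "L2H M w" for w
  proof (rule Bochner_Integration.integrable_bound)
    show "integrable M (\<lambda>x. C * (w x)\<^sup>2)" using L2_integrable[OF w] by simp
    show "(\<lambda>x. \<Psi> (w x)) \<in> borel_measurable M" using L2H_measurable[OF w] by measurable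
    show "AE x in M. norm (\<Psi> (w x)) \<le> norm (C * (w x)\<^sup>2)"
    proof (rule AE_I2)
      fix x
      have "\<bar>\<Psi> (w x)\<bar> \<le> C * (w x)\<^sup>2" using lip[of "w x" 0] \<Psi>0 by (simp add: power2_eq_square mult.assoc)
      then show "norm (\<Psi> (w x)) \<le> norm (C * (w x)\<^sup>2)" using C by simp
    qed
  qed
  define d where "d x = v' x - v x" for x
  have d: "L2H M d" unfolding d_def[abs_def] by (rule L2H_diff[OF v' v])
  have i2: "integrable M (\<lambda>x. \<bar>v x\<bar> * \<bar>d x\<bar>)" using L2H_norm_mult_integrable[OF v d] by simp
  have "\<bar>(\<integral>x. \<Psi> (v' x) \<partial>M) - (\<integral>x. \<Psi> (v x) \<partial>M)\<bar> = \<bar>\<integral>x. \<Psi> (v' x) - \<Psi> (v x) \<partial>M\<bar>"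
    using i[OF v] i[OF v'] by simp
  also have "\<dots> \<le> (\<integral>x. \<bar>\<Psi> (v' x) - \<Psi> (v x)\<bar> \<partial>M)" by (rule integral_abs_bound)
  also have "\<dots> \<le> (\<integral>x. C * ((d x)\<^sup>2 + 2 * (\<bar>v x\<bar> * \<bar>d x\<bar>)) \<partial>M)"
  proof (rule integral_mono)
    show "integrable M (\<lambda>x. \<bar>\<Psi> (v' x) - \<Psi> (v x)\<bar>)" using i[OF v] i[OF v'] by simp
    show "integrable M (\<lambda>x. C * ((d x)\<^sup>2 + 2 * (\<bar>v x\<bar> * \<bar>d x\<bar>)))" using L2_integrable[OF d] i2 by simp
    fix x
    have "\<bar>\<Psi> (v' x) - \<Psi> (v x)\<bar> \<le> C * (\<bar>v' x\<bar> + \<bar>v x\<bar>) * \<bar>d x\<bar>" using lip[of "v' x" "v x"] by (simp add: d_def)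
    also have "\<dots> \<le> C * (\<bar>d x\<bar> + 2 * \<bar>v x\<bar>) * \<bar>d x\<bar>"
      using C by (intro mult_right_mono mult_left_mono) (auto simp: d_def)
    also have "\<dots> = C * ((d x)\<^sup>2 + 2 * (\<bar>v x\<bar> * \<bar>d x\<bar>))"
      by (simp add: algebra_simps power2_eq_square)
    finally show "\<bar>\<Psi> (v' x) - \<Psi> (v x)\<bar> \<le> C * ((d x)\<^sup>2 + 2 * (\<bar>v x\<bar> * \<bar>d x\<bar>))" .
  qed
  also have "\<dots> = C * ((\<integral>x. (d x)\<^sup>2 \<partial>M) + 2 * (\<integral>x. \<bar>v x\<bar> * \<bar>d x\<bar> \<partial>M))"
    using L2_integrable[OF d] i2 by simp
  also have "\<dots> \<le> C * ((norm2H M d)\<^sup>2 + 2 * (norm2H M v * norm2H M d))"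
  proof (intro mult_left_mono add_mono C)
    show "(\<integral>x. (d x)\<^sup>2 \<partial>M) \<le> (norm2H M d)\<^sup>2" by (simp add: norm2H_def)
    have "L2H M (\<lambda>x. \<bar>v x\<bar>)" "L2H M (\<lambda>x. \<bar>d x\<bar>)"
      by (rule L2H_bound[OF v, where C = 1] L2H_bound[OF d, where C = 1]; use L2H_measurable[OF d] in auto)+
    from integral_inner_le[OF this] show "(\<integral>x. \<bar>v x\<bar> * \<bar>d x\<bar> \<partial>M) \<le> norm2H M v * norm2H M d"
      by (simp add: norm2H_def)
  qed auto
  finally show ?thesis unfolding d_def .
qed

lemma quadratic_integral_tendsto:
  fixes v :: "'a \<Rightarrow> real"
  assumes "\<Psi> \<in> borel_measurable borel" "\<And>x y. \<bar>\<Psi> x - \<Psi> y\<bar> \<le> C * (\<bar>x\<bar> + \<bar>y\<bar>) * \<bar>x - y\<bar>" "0 \<le> C" "\<Psi> 0 = 0"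
    and "L2H M v" and L: "\<forall>\<^sub>F s in F. L2H M (vs s)"
    and lim: "((\<lambda>s. norm2H M (\<lambda>x. vs s x - v x)) \<longlongrightarrow> 0) F"
  shows "((\<lambda>s. \<integral>x. \<Psi> (vs s x) \<partial>M) \<longlongrightarrow> (\<integral>x. \<Psi> (v x) \<partial>M)) F"
proof -
  have "((\<lambda>s. (\<integral>x. \<Psi> (vs s x) \<partial>M) - (\<integral>x. \<Psi> (v x) \<partial>M)) \<longlongrightarrow> 0) F"
  proof (rule Lim_null_comparison)
    have "((\<lambda>s. C * ((norm2H M (\<lambda>x. vs s x - v x))\<^sup>2 + 2 * (norm2H M v * norm2H M (\<lambda>x. vs s x - v x)))) \<longlongrightarrow> C * (0\<^sup>2 + 2 * (norm2H M v * 0))) F"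
      by (intro tendsto_intros lim)
    then show "((\<lambda>s. C * ((norm2H M (\<lambda>x. vs s x - v x))\<^sup>2 + 2 * (norm2H M v * norm2H M (\<lambda>x. vs s x - v x)))) \<longlongrightarrow> 0) F" by simp
    show "\<forall>\<^sub>F s in F. norm ((\<integral>x. \<Psi> (vs s x) \<partial>M) - (\<integral>x. \<Psi> (v x) \<partial>M))
       \<le> C * ((norm2H M (\<lambda>x. vs s x - v x))\<^sup>2 + 2 * (norm2H M v * norm2H M (\<lambda>x. vs s x - v x)))"
      using L unfolding real_norm_def by eventually_elim (intro quadratic_integral_diff assms)
  qed
  then show ?thesis by (simp add: LIM_zero_iff)
qed

lemma square_lipschitz: "\<bar>x\<^sup>2 - y\<^sup>2\<bar> \<le> 1 * (\<bar>x\<bar> + \<bar>y\<bar>) * \<bar>x - y\<bar>" for x y :: real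
proof -
  have "\<bar>x\<^sup>2 - y\<^sup>2\<bar> = \<bar>x + y\<bar> * \<bar>x - y\<bar>" by (simp add: power2_eq_square square_diff_square_factored abs_mult)
  also have "\<dots> \<le> (\<bar>x\<bar> + \<bar>y\<bar>) * \<bar>x - y\<bar>" by (intro mult_right_mono) auto
  finally show ?thesis by simp
qed

section \<open>The exponential twist and the basic energy inequality\<close>

context lower_order
begin

definition wt :: "real \<Rightarrow> ('a \<Rightarrow> real) \<Rightarrow> 'a \<Rightarrow> real" where
  "wt \<alpha> \<psi> x = exp (\<alpha> * \<psi> x)"

definition twist :: "real \<Rightarrow> ('a \<Rightarrow> real) \<Rightarrow> ('a \<Rightarrow> real) \<Rightarrow> 'a \<Rightarrow> real" where
  "twist \<alpha> \<psi> u x = wt \<alpha> \<psi> x * u x"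

text \<open>The L2-gradient at \<open>u\<close> of the functional that integrates
  \<open>Phi s (exp (\<alpha> * \<psi>) * u)\<close>. Paired with the time derivative of
  \<open>u\<close> it gives the rate of change of that functional, so the form is tested against
  it.\<close>

definition dual :: "real \<Rightarrow> real \<Rightarrow> ('a \<Rightarrow> real) \<Rightarrow> ('a \<Rightarrow> real) \<Rightarrow> 'a \<Rightarrow> real" where
  "dual s \<alpha> \<psi> u x = wt \<alpha> \<psi> x * Phi1 s (twist \<alpha> \<psi> u x)"

lemma wt_multiplier:
  assumes "\<psi> \<in> D_0" shows "multiplier (wt \<alpha> \<psi>) (\<lambda>x. (\<alpha> * wt \<alpha> \<psi> x) *\<^sub>R grad \<psi> x)"
proof -
  have "multiplier (\<lambda>x. \<alpha> * \<psi> x) (\<lambda>x. \<alpha> *\<^sub>R grad \<psi> x + \<psi> x *\<^sub>R 0)"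
    by (rule multiplier_mult[OF multiplier_const D0_multiplier[OF assms]])
  from multiplier_exp[OF this] show ?thesis by (simp add: wt_def[abs_def] mult.commute)
qed

lemma Phi1_chain:
  assumes "0 \<le> s" "s \<le> 1/10" "v \<in> Dom"
  shows "(\<lambda>x. Phi1 s (v x)) \<in> Dom" "AE x in M. D (\<lambda>x. Phi1 s (v x)) x = Phi2 s (v x) *\<^sub>R D v x"
  using chain_rule[OF assms(3) derivative_Phi1 continuous_Phi2 Phi2_bounds(2)[OF assms(1,2)]] Phi_0 by auto

lemma twist_dom:
  assumes "\<psi> \<in> D_0" "u \<in> Dom"
  shows "twist \<alpha> \<psi> u \<in> Dom"
    "AE x in M. D (twist \<alpha> \<psi> u) x = wt \<alpha> \<psi> x *\<^sub>R D u x + (\<alpha> * twist \<alpha> \<psi> u x) *\<^sub>R grad \<psi> x"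
  using multiplierD(5,6)[OF wt_multiplier[OF assms(1)] assms(2), of \<alpha>]
  unfolding twist_def[abs_def] by (auto simp: mult_ac)

lemma dual_dom:
  assumes "\<psi> \<in> D_0" "u \<in> Dom" "0 \<le> s" "s \<le> 1/10"
  shows "dual s \<alpha> \<psi> u \<in> Dom"
    "AE x in M. D (dual s \<alpha> \<psi> u) x = wt \<alpha> \<psi> x *\<^sub>R (Phi2 s (twist \<alpha> \<psi> u x) *\<^sub>R D (twist \<alpha> \<psi> u) x
        + (\<alpha> * Phi1 s (twist \<alpha> \<psi> u x)) *\<^sub>R grad \<psi> x)"
proof -
  note t = twist_dom(1)[OF assms(1,2), of \<alpha>]
  note p = Phi1_chain[OF assms(3,4) t]
  note m = multiplierD(5,6)[OF wt_multiplier[OF assms(1)] p(1), of \<alpha>]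
  show "dual s \<alpha> \<psi> u \<in> Dom" using m(1) unfolding dual_def[abs_def] .
  show "AE x in M. D (dual s \<alpha> \<psi> u) x = wt \<alpha> \<psi> x *\<^sub>R (Phi2 s (twist \<alpha> \<psi> u x) *\<^sub>R D (twist \<alpha> \<psi> u) x
        + (\<alpha> * Phi1 s (twist \<alpha> \<psi> u x)) *\<^sub>R grad \<psi> x)"
    using m(2) p(2) unfolding dual_def[abs_def] by eventually_elim (simp add: scaleR_add_right mult_ac)
qed

lemma twist_core: "\<psi> \<in> D_0 \<Longrightarrow> u \<in> Core \<Longrightarrow> twist \<alpha> \<psi> u \<in> Core"
  using core_multiplier[OF _ wt_multiplier] unfolding twist_def[abs_def] by blast

lemma Phi1_core:
  assumes "0 \<le> s" "s \<le> 1/10" "v \<in> Core" shows "(\<lambda>x. Phi1 s (v x)) \<in> Core"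
  by (rule core_chain[OF assms(3) Phi1_chain(1)[OF assms(1,2) coreD[OF assms(3)]], where C = 2])
    (use Phi1_abs_le(2)[of s] assms in auto)

lemma dual_core:
  "\<psi> \<in> D_0 \<Longrightarrow> u \<in> Core \<Longrightarrow> 0 \<le> s \<Longrightarrow> s \<le> 1/10 \<Longrightarrow> dual s \<alpha> \<psi> u \<in> Core"
  using core_multiplier[OF Phi1_core[OF _ _ twist_core] wt_multiplier] unfolding dual_def[abs_def] by blast

lemma phiF_chain:
  assumes s: "0 \<le> s" "s \<le> 1/10" and v: "v \<in> Dom"
  shows "(\<lambda>x. phiF s (v x)) \<in> Dom" "AE x in M. D (\<lambda>x. phiF s (v x)) x = phiF1 s (v x) *\<^sub>R D v x"
proof -
  have "\<bar>phiF1 s x\<bar> \<le> 2" for x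
  proof (rule abs_le_square_iff[THEN iffD2, of _ 2, simplified])
    show "(phiF1 s x)\<^sup>2 \<le> 4" using phiF1_square_le[of s x] phiJ_le_1[of s x] s by simp
  qed
  then show "(\<lambda>x. phiF s (v x)) \<in> Dom" "AE x in M. D (\<lambda>x. phiF s (v x)) x = phiF1 s (v x) *\<^sub>R D v x"
    using chain_rule[OF v derivative_phiF continuous_phiF1, of s] Phi_0 s by auto
qed

lemma phiG_chain:
  assumes s: "0 \<le> s" "s \<le> 1/10" and v: "v \<in> Dom"
  shows "(\<lambda>x. phiG s (v x)) \<in> Dom" "AE x in M. D (\<lambda>x. phiG s (v x)) x = phiG1 s (v x) *\<^sub>R D v x"
proof -
  have "\<bar>phiG1 s x\<bar> \<le> 2" for x
  proof (rule abs_le_square_iff[THEN iffD2, of _ 2, simplified])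
    show "(phiG1 s x)\<^sup>2 \<le> 4" using phiG1_square_le[of s x] phiJ_le_1[of s x] s by simp
  qed
  then show "(\<lambda>x. phiG s (v x)) \<in> Dom" "AE x in M. D (\<lambda>x. phiG s (v x)) x = phiG1 s (v x) *\<^sub>R D v x"
    using chain_rule[OF v derivative_phiG continuous_phiG1, of s] Phi_0 by auto
qed

lemma phiF_core:
  assumes s: "0 \<le> s" "s \<le> 1/10" and v: "v \<in> Core" shows "(\<lambda>x. phiF s (v x)) \<in> Core"
proof (rule core_chain[OF v phiF_chain(1)[OF s coreD[OF v]], where C = 2])
  fix x
  have "(phiF s x)\<^sup>2 \<le> 2 * x\<^sup>2" using phiF_square_bounds(2)[of s x] Phi_le[of s x] s by simp
  also have "\<dots> \<le> (2 * x)\<^sup>2" by (simp add: power_mult_distrib)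
  finally have "(phiF s x)\<^sup>2 \<le> (2 * x)\<^sup>2" .
  then have "\<bar>phiF s x\<bar> \<le> \<bar>2 * x\<bar>" by (simp only: abs_le_square_iff)
  then show "\<bar>phiF s x\<bar> \<le> 2 * \<bar>x\<bar>" by (simp add: abs_mult)
qed simp

lemma phiG_core:
  assumes s: "0 \<le> s" "s \<le> 1/10" and v: "v \<in> Core" shows "(\<lambda>x. phiG s (v x)) \<in> Core"
proof (rule core_chain[OF v phiG_chain(1)[OF s coreD[OF v]], where C = 1])
  fix x
  have "(phiG s x)\<^sup>2 \<le> x\<^sup>2" using phiG_square_le[of s x] Phi_le[of s x] s by simp
  then show "\<bar>phiG s x\<bar> \<le> 1 * \<bar>x\<bar>" by (simp add: abs_le_square_iff[symmetric])
qed simp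

text \<open>Since \<open>u \<cdot> dual u = phiF\<^sup>2\<close> and \<open>2 \<Phi> - x \<Phi>' = 2 s phiG\<^sup>2\<close>, the lower-order part splits into
  exactly those terms that the hypotheses control.\<close>

lemma pert_dual:
  fixes \<alpha> :: real
  assumes \<psi>: "\<psi> \<in> D_0" and u: "u \<in> Dom" and s: "0 \<le> s" "s \<le> 1/10"
  defines "v \<equiv> twist \<alpha> \<psi> u"
  shows "AE x in M. pert u (dual s \<alpha> \<psi> u) x
     = (inner (b x + c x) (D (\<lambda>x. phiF s (v x)) x) * phiF s (v x) + V x * (phiF s (v x))\<^sup>2)
       + 2 * s * (inner (b x - c x) (D (\<lambda>x. phiG s (v x)) x) * phiG s (v x))
       - \<alpha> * (inner (b x - c x) (grad \<psi> x) * (phiF s (v x))\<^sup>2)"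
proof -
  have vD: "v \<in> Dom" unfolding v_def by (rule twist_dom[OF \<psi> u])
  show ?thesis
    using twist_dom(2)[OF \<psi> u, of \<alpha>, folded v_def] dual_dom(2)[OF \<psi> u s, of \<alpha>, folded v_def]
      phiF_chain(2)[OF s vD] phiG_chain(2)[OF s vD]
  proof eventually_elim
    case (elim x)
    define w where "w = wt \<alpha> \<psi> x"
    define P1 where "P1 = Phi1 s (v x)"
    define P2 where "P2 = Phi2 s (v x)"
    define X where "X = inner (b x) (D v x)"
    define X' where "X' = inner (c x) (D v x)"
    define Y where "Y = inner (b x) (grad \<psi> x)"
    define Y' where "Y' = inner (c x) (grad \<psi> x)"
    have vx: "v x = w * u x" by (simp add: v_def twist_def w_def)
    have kx: "dual s \<alpha> \<psi> u x = w * P1" by (simp add: dual_def w_def P1_def v_def)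
    have 1: "w * inner (b x) (D u x) = X - \<alpha> * v x * Y"
      unfolding X_def Y_def elim(1) w_def by (simp add: inner_add_right)
    have 2: "inner (c x) (D (dual s \<alpha> \<psi> u) x) = w * (P2 * X' + \<alpha> * P1 * Y')"
      unfolding elim(2) P1_def P2_def X'_def Y'_def w_def by (simp add: inner_add_right)
    have 3: "phiF s (v x) * phiF1 s (v x) = (P1 + v x * P2) / 2"
      using phiF_phiF1[of s "v x"] s by (simp add: P1_def P2_def)
    have 4: "s * (phiG s (v x) * phiG1 s (v x)) = (P1 - v x * P2) / 4"
      using phiG_phiG1[of s "v x"] by (simp add: P1_def P2_def)
    have 5: "(phiF s (v x))\<^sup>2 = v x * P1"
      using phiF_square[of s "v x"] s by (simp add: P1_def power2_eq_square)
    have "pert u (dual s \<alpha> \<psi> u) x = (w * inner (b x) (D u x)) * P1 + inner (c x) (D (dual s \<alpha> \<psi> u) x) * u x + V x * u x * (w * P1)"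
      unfolding pert_def kx by simp
    also have "\<dots> = (X - \<alpha> * v x * Y) * P1 + v x * (P2 * X' + \<alpha> * P1 * Y') + V x * (v x * P1)"
      unfolding 1 2 unfolding vx by (simp add: algebra_simps)
    \<comment> \<open>The terms \<open>X * P1\<close> and \<open>X' * (v x * P2)\<close> are
      rewritten through the sum and the difference of \<open>b\<close> and \<open>c\<close>: (A.2)
      controls the sum, (B.1) the difference, whose factor \<open>P1 - v x * P2\<close> is of order
      \<open>s\<close>.\<close>
    also have "\<dots> = ((X + X') * ((P1 + v x * P2) / 2) + V x * (v x * P1)) + 2 * ((X - X') * ((P1 - v x * P2) / 4)) - \<alpha> * ((Y - Y') * (v x * P1))"
      by (simp add: field_simps)
    also have "\<dots> = ((X + X') * (phiF s (v x) * phiF1 s (v x)) + V x * (phiF s (v x))\<^sup>2)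
         + 2 * ((X - X') * (s * (phiG s (v x) * phiG1 s (v x)))) - \<alpha> * ((Y - Y') * (phiF s (v x))\<^sup>2)"
      unfolding 3 4 5 ..
    also have "\<dots> = (inner (b x + c x) (D (\<lambda>x. phiF s (v x)) x) * phiF s (v x) + V x * (phiF s (v x))\<^sup>2)
       + 2 * s * (inner (b x - c x) (D (\<lambda>x. phiG s (v x)) x) * phiG s (v x))
       - \<alpha> * (inner (b x - c x) (grad \<psi> x) * (phiF s (v x))\<^sup>2)"
      unfolding elim(3,4) X_def X'_def Y_def Y'_def by (simp add: inner_add_left inner_diff_left mult_ac)
    finally show ?case .
  qed
qed

text \<open>Both gradients are expressed by \<open>D v\<close> and \<open>grad \<psi>\<close>; the
  cross term carries \<open>Phi1 - v * Phi2\<close>, which is of order \<open>s\<close>. Of the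
  \<open>12 * s\<close>, ten come from \<open>Phi2_lower\<close> and two from the cross term, which
  also adds \<open>2 * s\<close> to the coefficient of \<open>\<alpha>\<^sup>2\<close>.\<close>

lemma inner_D_dual:
  assumes \<psi>: "\<psi> \<in> D_0" and u: "u \<in> Dom" and s: "0 \<le> s" "s \<le> 1/10" and \<alpha>: "0 \<le> \<alpha>"
  defines "v \<equiv> twist \<alpha> \<psi> u"
  shows "AE x in M. (2 - 12 * s) * (phiJ s (v x) * (norm (D v x))\<^sup>2) - (2 + 2 * s) * \<alpha>\<^sup>2 * Phi s (v x)
      \<le> inner (D u x) (D (dual s \<alpha> \<psi> u) x)"
  using twist_dom(2)[OF \<psi> u, of \<alpha>, folded v_def] dual_dom(2)[OF \<psi> u s, of \<alpha>, folded v_def] D0D(4)[OF \<psi>]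
proof eventually_elim
  case (elim x)
  define P1 where "P1 = Phi1 s (v x)"
  define P2 where "P2 = Phi2 s (v x)"
  define n where "n = norm (D v x)"
  define i where "i = inner (D v x) (grad \<psi> x)"
  define g where "g = (norm (grad \<psi> x))\<^sup>2"
  define Jx where "Jx = phiJ s (v x)"
  have J0: "0 < Jx" unfolding Jx_def by (rule phiJ_pos)
  have g: "0 \<le> g" "g \<le> 1" using elim(3) by (simp_all add: g_def power_le_one)
  have n0: "0 \<le> n" by (simp add: n_def)
  have i: "\<bar>i\<bar> \<le> n"
  proof -
    have "\<bar>i\<bar> \<le> n * norm (grad \<psi> x)" unfolding i_def n_def by (rule Cauchy_Schwarz_ineq2)
    also have "\<dots> \<le> n * 1" using elim(3) n0 by (intro mult_left_mono) auto
    finally show ?thesis by simp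
  qed
  have "inner (D u x) (D (dual s \<alpha> \<psi> u) x) = inner (wt \<alpha> \<psi> x *\<^sub>R D u x) (P2 *\<^sub>R D v x + (\<alpha> * P1) *\<^sub>R grad \<psi> x)"
    unfolding elim(2) P1_def P2_def by (simp add: inner_add_right distrib_left mult_ac)
  also have "wt \<alpha> \<psi> x *\<^sub>R D u x = D v x - (\<alpha> * v x) *\<^sub>R grad \<psi> x" using elim(1) by simp
  also have "inner (D v x - (\<alpha> * v x) *\<^sub>R grad \<psi> x) (P2 *\<^sub>R D v x + (\<alpha> * P1) *\<^sub>R grad \<psi> x)
      = P2 * n\<^sup>2 + \<alpha> * (P1 - v x * P2) * i - \<alpha>\<^sup>2 * (v x * P1) * g"
    unfolding n_def i_def g_def power2_norm_eq_inner
    by (simp add: inner_add_right inner_diff_left inner_commute power2_eq_square algebra_simps)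
  finally have eq: "inner (D u x) (D (dual s \<alpha> \<psi> u) x) = P2 * n\<^sup>2 + \<alpha> * (P1 - v x * P2) * i - \<alpha>\<^sup>2 * (v x * P1) * g" .
  have 1: "(2 * (1 - 5 * s) * Jx) * n\<^sup>2 \<le> P2 * n\<^sup>2"
    unfolding P2_def Jx_def using Phi2_lower[of s "v x"] s by (intro mult_right_mono) auto
  have "\<bar>\<alpha> * (P1 - v x * P2) * i\<bar> \<le> \<alpha> * (4 * s * \<bar>v x\<bar> * Jx) * n"
    unfolding abs_mult using \<alpha> s Phi1_diff_le[of s "v x"] i n0 J0
    by (intro mult_mono) (auto simp: P1_def P2_def Jx_def)
  also have "\<dots> = 2 * s * Jx * (2 * (\<alpha> * \<bar>v x\<bar>) * n)" by simp
  also have "\<dots> \<le> 2 * s * Jx * ((\<alpha> * \<bar>v x\<bar>)\<^sup>2 + n\<^sup>2)"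
    using s J0 by (intro mult_left_mono sum_squares_bound) auto
  also have "\<dots> = 2 * s * (\<alpha>\<^sup>2 * Phi s (v x)) + 2 * s * (Jx * n\<^sup>2)"
    by (simp add: Phi_def Jx_def power_mult_distrib algebra_simps)
  finally have 2: "- (2 * s * (\<alpha>\<^sup>2 * Phi s (v x)) + 2 * s * (Jx * n\<^sup>2)) \<le> \<alpha> * (P1 - v x * P2) * i" by linarith
  have f2: "(phiF s (v x))\<^sup>2 = v x * P1"
    using phiF_square[of s "v x"] s by (simp add: P1_def power2_eq_square)
  have "\<alpha>\<^sup>2 * (v x * P1) * g \<le> \<alpha>\<^sup>2 * (2 * Phi s (v x)) * 1"
    unfolding f2[symmetric] using phiF_square_bounds(2)[of s "v x"] s g
    by (intro mult_mono mult_left_mono) (auto simp: Phi_nonneg)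
  then have 3: "\<alpha>\<^sup>2 * (v x * P1) * g \<le> 2 * (\<alpha>\<^sup>2 * Phi s (v x))" by simp
  have "(2 - 12 * s) * (Jx * n\<^sup>2) - (2 + 2 * s) * \<alpha>\<^sup>2 * Phi s (v x)
      = (2 * (1 - 5 * s) * Jx) * n\<^sup>2 - (2 * s * (\<alpha>\<^sup>2 * Phi s (v x)) + 2 * s * (Jx * n\<^sup>2)) - 2 * (\<alpha>\<^sup>2 * Phi s (v x))"
    by (simp add: algebra_simps)
  also have "\<dots> \<le> P2 * n\<^sup>2 + \<alpha> * (P1 - v x * P2) * i - \<alpha>\<^sup>2 * (v x * P1) * g"
    using 1 2 3 by linarith
  finally show ?case unfolding eq Jx_def n_def .
qed

lemma Phi_integrable:
  assumes "0 \<le> s" "L2H M v" shows "integrable M (\<lambda>x. Phi s (v x))"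
proof (rule Bochner_Integration.integrable_bound[OF L2_integrable[OF assms(2)]])
  show "(\<lambda>x. Phi s (v x)) \<in> borel_measurable M" using L2H_measurable[OF assms(2)] by measurable
qed (use Phi_le[OF assms(1)] Phi_nonneg in auto)

lemma PhiL_integrable:
  assumes s: "0 < s" and v: "L2H M v" shows "integrable M (\<lambda>x. PhiL s (v x))"
proof (rule Bochner_Integration.integrable_bound)
  show "integrable M (\<lambda>x. (1 / s) * (v x)\<^sup>2)" using L2_integrable[OF v] by simp
  show "(\<lambda>x. PhiL s (v x)) \<in> borel_measurable M" using L2H_measurable[OF v] by measurable
  show "AE x in M. norm (PhiL s (v x)) \<le> norm ((1 / s) * (v x)\<^sup>2)"
    using PhiL_le[OF s] PhiL_nonneg s by (intro AE_I2) auto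
qed

lemma weighted_energy_integrable:
  assumes "0 \<le> s" "v \<in> Dom" shows "integrable M (\<lambda>x. phiJ s (v x) * (norm (D v x))\<^sup>2)"
proof (rule Bochner_Integration.integrable_bound[OF L2H_integrable[OF D_L2[OF assms(2)]]])
  show "(\<lambda>x. phiJ s (v x) * (norm (D v x))\<^sup>2) \<in> borel_measurable M"
    using dom_measurable[OF assms(2)] D_measurable[OF assms(2)] by measurable
qed (use phiJ_le_1[OF assms(1)] phiJ_pos in \<open>auto simp: abs_mult less_imp_le intro!: mult_left_le_one_le\<close>)

lemma phiF_energy_le:
  assumes s: "0 \<le> s" "s \<le> 1/10" and v: "v \<in> Dom"
  shows "(\<integral>x. (norm (D (\<lambda>x. phiF s (v x)) x))\<^sup>2 \<partial>M) \<le> 2 * (\<integral>x. phiJ s (v x) * (norm (D v x))\<^sup>2 \<partial>M)"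
proof -
  note c = phiF_chain[OF s v] and iI = weighted_energy_integrable[OF s(1) v]
  have "(\<integral>x. (norm (D (\<lambda>x. phiF s (v x)) x))\<^sup>2 \<partial>M) \<le> (\<integral>x. 2 * (phiJ s (v x) * (norm (D v x))\<^sup>2) \<partial>M)"
  proof (rule integral_mono_AE)
    show "integrable M (\<lambda>x. (norm (D (\<lambda>x. phiF s (v x)) x))\<^sup>2)" by (rule L2H_integrable[OF D_L2[OF c(1)]])
    show "integrable M (\<lambda>x. 2 * (phiJ s (v x) * (norm (D v x))\<^sup>2))" using iI by simp
    show "AE x in M. (norm (D (\<lambda>x. phiF s (v x)) x))\<^sup>2 \<le> 2 * (phiJ s (v x) * (norm (D v x))\<^sup>2)"
      using c(2)
    proof eventually_elim
      case (elim x)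
      have "(phiF1 s (v x))\<^sup>2 * (norm (D v x))\<^sup>2 \<le> (2 * phiJ s (v x)) * (norm (D v x))\<^sup>2"
        using phiF1_square_le[of s "v x"] s by (intro mult_right_mono) auto
      then show ?case unfolding elim by (simp add: power_mult_distrib)
    qed
  qed
  then show ?thesis using iI by simp
qed

lemma phiF_integral_bounds:
  assumes s: "0 \<le> s" "s \<le> 1/10" and v: "v \<in> Dom"
  shows "(\<integral>x. (phiF s (v x))\<^sup>2 \<partial>M) \<le> 2 * (\<integral>x. Phi s (v x) \<partial>M)"
    "(\<integral>x. Phi s (v x) \<partial>M) \<le> (\<integral>x. (phiF s (v x))\<^sup>2 \<partial>M)"
proof -
  note i = L2_integrable[OF dom_L2[OF phiF_chain(1)[OF s v]]] and iK = Phi_integrable[OF s(1) dom_L2[OF v]]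
  have "(\<integral>x. (phiF s (v x))\<^sup>2 \<partial>M) \<le> (\<integral>x. 2 * Phi s (v x) \<partial>M)"
    using i iK phiF_square_bounds(2)[of s] s by (intro integral_mono) auto
  then show "(\<integral>x. (phiF s (v x))\<^sup>2 \<partial>M) \<le> 2 * (\<integral>x. Phi s (v x) \<partial>M)" by simp
  have "Phi s x \<le> (phiF s x)\<^sup>2" for x
  proof -
    have "1 * Phi s x \<le> 2 * (1 - s) * Phi s x" using s Phi_nonneg[of s x] by (intro mult_right_mono) auto
    then show ?thesis using phiF_square_bounds(1)[of s x] s by simp
  qed
  then show "(\<integral>x. Phi s (v x) \<partial>M) \<le> (\<integral>x. (phiF s (v x))\<^sup>2 \<partial>M)"
    using i iK by (intro integral_mono) auto
qed

text \<open>The energy is handled by \<open>inner_D_dual\<close>, (A.2) is applied to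
  \<open>phiF s v\<close> and (B.1) to \<open>phiG s v\<close>; the drift along
  \<open>grad \<psi>\<close> is left for (B.2). The energies of these two functions are at most
  \<open>I\<close> and \<open>2 * I\<close>, which gives \<open>\<eta> * I\<close> and
  \<open>4 * s * \<kappa> * I\<close>; the \<open>6 * s\<close> is half of the 12 in
  \<open>inner_D_dual\<close>.\<close>

lemma core_inequality:
  assumes \<psi>: "\<psi> \<in> D_0" and u: "u \<in> Core" and s: "0 \<le> s" "s \<le> 1/10" and \<alpha>: "0 \<le> \<alpha>"
    and B1: "\<And>f. f \<in> Core \<Longrightarrow> \<bar>\<integral>x. inner (b x - c x) (D f x) * f x \<partial>M\<bar> \<le> \<kappa> * E0l M D 1 f f"
    and \<kappa>: "0 \<le> \<kappa>"
  defines "v \<equiv> twist \<alpha> \<psi> u"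
  defines "I \<equiv> \<integral>x. phiJ s (v x) * (norm (D v x))\<^sup>2 \<partial>M" and "K \<equiv> \<integral>x. Phi s (v x) \<partial>M"
  shows "- E u (dual s \<alpha> \<psi> u) \<le> - (1 - \<eta> - 6 * s - 4 * s * \<kappa>) * I + ((1 + s) * \<alpha>\<^sup>2 + 2 * \<theta> + 2 * s * \<kappa>) * K
     + \<alpha> * (\<integral>x. inner (b x - c x) (grad \<psi> x) * (phiF s (v x))\<^sup>2 \<partial>M)"
proof -
  have uD: "u \<in> Dom" by (rule coreD[OF u])
  have vc: "v \<in> Core" unfolding v_def by (rule twist_core[OF \<psi> u])
  have vD: "v \<in> Dom" by (rule coreD[OF vc])
  define k where "k = dual s \<alpha> \<psi> u"
  have kc: "k \<in> Core" unfolding k_def by (rule dual_core[OF \<psi> u s])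
  have kD: "k \<in> Dom" by (rule coreD[OF kc])
  define f where "f x = phiF s (v x)" for x
  define g where "g x = phiG s (v x)" for x
  have fc: "f \<in> Core" unfolding f_def[abs_def] by (rule phiF_core[OF s vc])
  have gc: "g \<in> Core" unfolding g_def[abs_def] by (rule phiG_core[OF s vc])
  have iI: "integrable M (\<lambda>x. phiJ s (v x) * (norm (D v x))\<^sup>2)" by (rule weighted_energy_integrable[OF s(1) vD])
  have iK: "integrable M (\<lambda>x. Phi s (v x))" by (rule Phi_integrable[OF s(1) dom_L2[OF vD]])
  have "(2 - 12 * s) * I - (2 + 2 * s) * \<alpha>\<^sup>2 * K
      = (\<integral>x. (2 - 12 * s) * (phiJ s (v x) * (norm (D v x))\<^sup>2) - (2 + 2 * s) * \<alpha>\<^sup>2 * Phi s (v x) \<partial>M)"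
    unfolding I_def K_def using iI iK by simp
  also have "\<dots> \<le> (\<integral>x. inner (D u x) (D k x) \<partial>M)"
    using iI iK inner_D_dual[OF \<psi> uD s \<alpha>] L2H_inner_integrable[OF D_L2[OF uD] D_L2[OF kD]]
    unfolding v_def[symmetric] k_def[symmetric] by (intro integral_mono_AE) auto
  finally have e0: "(2 - 12 * s) * I - (2 + 2 * s) * \<alpha>\<^sup>2 * K \<le> (\<integral>x. inner (D u x) (D k x) \<partial>M)" .
  have bc: "loc_L2 (\<lambda>x. b x + c x)" "loc_L2 (\<lambda>x. b x - c x)" using b_loc c_loc by (auto intro: loc_L2_add loc_L2_diff)
  have i1: "integrable M (\<lambda>x. inner (b x + c x) (D f x) * f x + V x * (f x)\<^sup>2)"
    using drift_integrable[OF bc(1) D_L2[OF coreD[OF fc]] fc] V_integrable[OF fc fc]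
    by (simp add: power2_eq_square mult.assoc)
  have i2: "integrable M (\<lambda>x. inner (b x - c x) (D g x) * g x)"
    by (rule drift_integrable[OF bc(2) D_L2[OF coreD[OF gc]] gc])
  have Lfg: "L2H M (\<lambda>x. f x *\<^sub>R grad \<psi> x)"
    by (rule L2H_bounded_scaleR[OF dom_L2[OF coreD[OF fc]] grad_measurable[OF D0D(1)[OF \<psi>]] D0D(4)[OF \<psi>]])
  have i3: "integrable M (\<lambda>x. inner (b x - c x) (grad \<psi> x) * (f x)\<^sup>2)"
    using drift_integrable[OF bc(2) Lfg fc] by (simp add: power2_eq_square mult_ac)
  have "(\<integral>x. pert u k x \<partial>M) = (\<integral>x. (inner (b x + c x) (D f x) * f x + V x * (f x)\<^sup>2)
       + 2 * s * (inner (b x - c x) (D g x) * g x) - \<alpha> * (inner (b x - c x) (grad \<psi> x) * (f x)\<^sup>2) \<partial>M)"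
  proof (rule integral_cong_AE)
    show "pert u k \<in> borel_measurable M" using pert_integrable[OF u kc] by auto
    show "(\<lambda>x. inner (b x + c x) (D f x) * f x + V x * (f x)\<^sup>2 + 2 * s * (inner (b x - c x) (D g x) * g x) - \<alpha> * (inner (b x - c x) (grad \<psi> x) * (f x)\<^sup>2)) \<in> borel_measurable M"
      using borel_measurable_integrable[OF i1] borel_measurable_integrable[OF i2] borel_measurable_integrable[OF i3] by measurable
    show "AE x in M. pert u k x = (inner (b x + c x) (D f x) * f x + V x * (f x)\<^sup>2)
       + 2 * s * (inner (b x - c x) (D g x) * g x) - \<alpha> * (inner (b x - c x) (grad \<psi> x) * (f x)\<^sup>2)"
      using pert_dual[OF \<psi> uD s, of \<alpha>] unfolding k_def v_def f_def[abs_def] g_def[abs_def] .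
  qed
  also have "\<dots> = (\<integral>x. inner (b x + c x) (D f x) * f x + V x * (f x)\<^sup>2 \<partial>M)
       + 2 * s * (\<integral>x. inner (b x - c x) (D g x) * g x \<partial>M) - \<alpha> * (\<integral>x. inner (b x - c x) (grad \<psi> x) * (f x)\<^sup>2 \<partial>M)"
    using i1 i2 i3 by (simp only: Bochner_Integration.integral_diff Bochner_Integration.integral_add
        Bochner_Integration.integrable_add integrable_mult_right integral_mult_right_zero)
  finally have e1: "(\<integral>x. pert u k x \<partial>M) = (\<integral>x. inner (b x + c x) (D f x) * f x + V x * (f x)\<^sup>2 \<partial>M)
       + 2 * s * (\<integral>x. inner (b x - c x) (D g x) * g x \<partial>M) - \<alpha> * (\<integral>x. inner (b x - c x) (grad \<psi> x) * (f x)\<^sup>2 \<partial>M)" .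
  have Df: "(\<integral>x. (norm (D f x))\<^sup>2 \<partial>M) \<le> 2 * I"
    unfolding f_def[abs_def] I_def by (rule phiF_energy_le[OF s vD])
  have Dg: "(\<integral>x. (norm (D g x))\<^sup>2 \<partial>M) \<le> 4 * I"
  proof -
    have "(\<integral>x. (norm (D g x))\<^sup>2 \<partial>M) \<le> (\<integral>x. 4 * (phiJ s (v x) * (norm (D v x))\<^sup>2) \<partial>M)"
    proof (rule integral_mono_AE)
      show "integrable M (\<lambda>x. (norm (D g x))\<^sup>2)" by (rule L2H_integrable[OF D_L2[OF coreD[OF gc]]])
      show "integrable M (\<lambda>x. 4 * (phiJ s (v x) * (norm (D v x))\<^sup>2))" using iI by simp
      show "AE x in M. (norm (D g x))\<^sup>2 \<le> 4 * (phiJ s (v x) * (norm (D v x))\<^sup>2)"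
        using phiG_chain(2)[OF s vD]
      proof eventually_elim
        case (elim x)
        have "(phiG1 s (v x))\<^sup>2 * (norm (D v x))\<^sup>2 \<le> (4 * phiJ s (v x)) * (norm (D v x))\<^sup>2"
          using phiG1_square_le[of s "v x"] s by (intro mult_right_mono) auto
        then show ?case unfolding g_def elim by (simp add: power_mult_distrib)
      qed
    qed
    then show ?thesis using iI by (simp add: I_def)
  qed
  have f2: "(\<integral>x. (f x)\<^sup>2 \<partial>M) \<le> 2 * K"
    unfolding f_def[abs_def] K_def by (rule phiF_integral_bounds[OF s vD])
  have g2: "(\<integral>x. (g x)\<^sup>2 \<partial>M) \<le> K"
    unfolding K_def using L2_integrable[OF dom_L2[OF coreD[OF gc]]] iK phiG_square_le[of s]
    by (intro integral_mono) (auto simp: g_def)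
  have "- (\<integral>x. inner (b x + c x) (D f x) * f x + V x * (f x)\<^sup>2 \<partial>M) \<le> \<eta> * E0 M D f f + \<theta> * (norm2 M f)\<^sup>2"
    by (rule lower[OF fc])
  also have "\<dots> \<le> \<eta> * I + \<theta> * (2 * K)"
  proof (intro add_mono mult_left_mono)
    show "E0 M D f f \<le> I" using Df by (simp add: E0_self)
    show "(norm2 M f)\<^sup>2 \<le> 2 * K" using f2 by (simp add: norm2_def)
  qed (use coeff_bounds in auto)
  finally have e2: "- (\<integral>x. inner (b x + c x) (D f x) * f x + V x * (f x)\<^sup>2 \<partial>M) \<le> \<eta> * I + \<theta> * (2 * K)" .
  have "E0l M D 1 g g \<le> 2 * I + K" using Dg g2 by (simp add: E0l_self)
  then have "\<kappa> * E0l M D 1 g g \<le> \<kappa> * (2 * I + K)" using \<kappa> by (rule mult_left_mono)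
  then have "- (\<integral>x. inner (b x - c x) (D g x) * g x \<partial>M) \<le> \<kappa> * (2 * I + K)" using B1[OF gc] by linarith
  then have e3: "2 * s * - (\<integral>x. inner (b x - c x) (D g x) * g x \<partial>M) \<le> 2 * s * (\<kappa> * (2 * I + K))"
    using s by (intro mult_left_mono) auto
  have "- E u k = - (1/2) * (\<integral>x. inner (D u x) (D k x) \<partial>M) - (\<integral>x. inner (b x + c x) (D f x) * f x + V x * (f x)\<^sup>2 \<partial>M)
      + 2 * s * - (\<integral>x. inner (b x - c x) (D g x) * g x \<partial>M) + \<alpha> * (\<integral>x. inner (b x - c x) (grad \<psi> x) * (f x)\<^sup>2 \<partial>M)"
    unfolding pform_eq e1 by simp
  also have "\<dots> \<le> - (1/2) * ((2 - 12 * s) * I - (2 + 2 * s) * \<alpha>\<^sup>2 * K) + (\<eta> * I + \<theta> * (2 * K)) + 2 * s * (\<kappa> * (2 * I + K))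
      + \<alpha> * (\<integral>x. inner (b x - c x) (grad \<psi> x) * (f x)\<^sup>2 \<partial>M)"
  proof -
    have "p - q + r + t \<le> p' + q' + r' + t" if "p \<le> p'" "- q \<le> q'" "r \<le> r'" for p q r t p' q' r' :: real
      using that by linarith
    moreover have "- (1/2) * p \<le> - (1/2) * q" if "q \<le> p" for p q :: real using that by simp
    ultimately show ?thesis using e0 e2 e3 by blast
  qed
  also have "\<dots> = - (1 - \<eta> - 6 * s - 4 * s * \<kappa>) * I + ((1 + s) * \<alpha>\<^sup>2 + 2 * \<theta> + 2 * s * \<kappa>) * K
     + \<alpha> * (\<integral>x. inner (b x - c x) (grad \<psi> x) * (f x)\<^sup>2 \<partial>M)"
    by (simp add: algebra_simps)
  finally show ?thesis unfolding k_def f_def .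
qed

end

section \<open>Entropy absorption and passage to the form domain\<close>

context lower_order
begin

text \<open>(B.2) speaks of normalised functions, so it is applied to \<open>phiF s v\<close>
  divided by its norm and scaled back. Since \<open>K > 1\<close> the norm exceeds 1, and the
  entropy of the quotient is bounded through \<open>logplus_phiF_le\<close> by \<open>K\<close> and
  \<open>H\<close>.\<close>

lemma drift_entropy_bound:
  assumes \<psi>: "\<psi> \<in> D_0" and v: "v \<in> Core" and s: "0 < s" "s \<le> 1/10" and \<rho>: "0 < \<rho>" and \<gamma>: "0 \<le> \<gamma>"
    and \<epsilon>: "0 \<le> \<epsilon>" and L: "0 \<le> L"
    and B2: "\<And>f. f \<in> Core \<Longrightarrow> norm2 M f = 1 \<Longrightarrow>
        (\<integral>x. inner (b x - c x) (grad \<psi> x) * (f x)\<^sup>2 \<partial>M)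
          \<le> \<epsilon> * E0 M D f f + L + \<gamma> * sqrt (\<integral>x. (f x)\<^sup>2 * logplus ((f x)\<^sup>2) \<partial>M)"
  defines "I \<equiv> \<integral>x. phiJ s (v x) * (norm (D v x))\<^sup>2 \<partial>M" and "K \<equiv> \<integral>x. Phi s (v x) \<partial>M"
    and "H \<equiv> \<integral>x. PhiL s (v x) \<partial>M"
  assumes K: "1 < K"
  shows "(\<integral>x. inner (b x - c x) (grad \<psi> x) * (phiF s (v x))\<^sup>2 \<partial>M) \<le> \<epsilon> * I + 2 * L * K + \<gamma> * ((1 / \<rho> + \<rho>) * K + \<rho> * H)"
proof -
  have s0: "0 \<le> s" using s by simp
  have vD: "v \<in> Dom" by (rule coreD[OF v])
  define F where "F x = phiF s (v x)" for x
  have Fc: "F \<in> Core" unfolding F_def[abs_def] by (rule phiF_core[OF s0 s(2) v])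
  define y where "y = (\<integral>x. (F x)\<^sup>2 \<partial>M)"
  have y: "y \<le> 2 * K" "K \<le> y" unfolding y_def F_def K_def using phiF_integral_bounds[OF s0 s(2) vD] by auto
  have y1: "1 < y" using K y by simp
  define a where "a = 1 / sqrt y"
  have a2: "a\<^sup>2 = 1 / y" using y1 by (simp add: a_def power_divide)
  define f where "f x = a * F x" for x
  have fc: "f \<in> Core" unfolding f_def[abs_def] by (rule core_multiplier[OF Fc multiplier_const])
  have f2: "(f x)\<^sup>2 = (F x)\<^sup>2 / y" for x by (simp add: f_def power_mult_distrib a2)
  have nf: "norm2 M f = 1" unfolding norm2_def f2 using y1 by (simp add: y_def)
  have EF: "E0 M D F F \<le> I"
    using phiF_energy_le[OF s0 s(2) vD] by (simp add: E0_self F_def[abs_def] I_def)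
  have Ef: "E0 M D f f = E0 M D F F / y"
  proof -
    have "(\<integral>x. (norm (D f x))\<^sup>2 \<partial>M) = (\<integral>x. (1 / y) * (norm (D F x))\<^sup>2 \<partial>M)"
    proof (rule integral_cong_AE)
      show "AE x in M. (norm (D f x))\<^sup>2 = (1 / y) * (norm (D F x))\<^sup>2"
        using dom_cmult(2)[OF coreD[OF Fc], of a] unfolding f_def[abs_def]
        by eventually_elim (simp add: power_mult_distrib a2)
    qed (use D_measurable[OF coreD[OF Fc]] D_measurable[OF coreD[OF fc]] in measurable)
    then show ?thesis by (simp add: E0_self)
  qed
  have iK: "integrable M (\<lambda>x. Phi s (v x))" by (rule Phi_integrable[OF s0 dom_L2[OF vD]])
  have iH: "integrable M (\<lambda>x. PhiL s (v x))" by (rule PhiL_integrable[OF s(1) dom_L2[OF vD]])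
  have H0: "0 \<le> H" unfolding H_def using PhiL_nonneg by simp
  have ent: "(\<integral>x. (f x)\<^sup>2 * logplus ((f x)\<^sup>2) \<partial>M) \<le> (2 * K + 2 * H) / y"
  proof -
    have "(\<integral>x. (f x)\<^sup>2 * logplus ((f x)\<^sup>2) \<partial>M) \<le> (\<integral>x. (2 / y) * (Phi s (v x) + PhiL s (v x)) \<partial>M)"
    proof (rule integral_mono')
      show "integrable M (\<lambda>x. (2 / y) * (Phi s (v x) + PhiL s (v x)))" using iK iH by simp
      fix x
      show "0 \<le> (2 / y) * (Phi s (v x) + PhiL s (v x))" using y1 Phi_nonneg PhiL_nonneg by simp
      have "(f x)\<^sup>2 * logplus ((f x)\<^sup>2) \<le> (2 * Phi s (v x) / y) * (1 + ln (1 + (v x)\<^sup>2))"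
      proof (rule mult_mono)
        show "(f x)\<^sup>2 \<le> 2 * Phi s (v x) / y"
          unfolding f2 F_def using phiF_square_bounds(2)[of s "v x"] s y1 by (intro divide_right_mono) auto
        show "logplus ((f x)\<^sup>2) \<le> 1 + ln (1 + (v x)\<^sup>2)"
          unfolding f2 F_def using s y1 by (intro logplus_phiF_le) auto
      qed (use y1 Phi_nonneg in \<open>auto simp: logplus_def\<close>)
      also have "\<dots> = (2 / y) * (Phi s (v x) + PhiL s (v x))" by (simp add: PhiL_def algebra_simps)
      finally show "(f x)\<^sup>2 * logplus ((f x)\<^sup>2) \<le> (2 / y) * (Phi s (v x) + PhiL s (v x))" .
    qed
    also have "\<dots> = (2 * K + 2 * H) / y" using iK iH by (simp add: K_def H_def field_simps)
    finally show ?thesis .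
  qed
  have rt: "y * sqrt (\<integral>x. (f x)\<^sup>2 * logplus ((f x)\<^sup>2) \<partial>M) \<le> (1 / \<rho> + \<rho>) * K + \<rho> * H"
  proof -
    have "y * sqrt (\<integral>x. (f x)\<^sup>2 * logplus ((f x)\<^sup>2) \<partial>M) \<le> y * sqrt ((2 * K + 2 * H) / y)"
      using ent y1 by (intro mult_left_mono real_sqrt_le_mono) auto
    also have "\<dots> = sqrt (y * (2 * K + 2 * H))"
    proof -
      have "y * sqrt ((2 * K + 2 * H) / y) = sqrt (y\<^sup>2) * sqrt ((2 * K + 2 * H) / y)" using y1 by simp
      also have "\<dots> = sqrt (y\<^sup>2 * ((2 * K + 2 * H) / y))" by (simp only: real_sqrt_mult)
      also have "y\<^sup>2 * ((2 * K + 2 * H) / y) = y * (2 * K + 2 * H)" using y1 by (simp add: power2_eq_square)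
      finally show ?thesis .
    qed
    also have "\<dots> \<le> sqrt ((2 * K) * (2 * K + 2 * H))"
      using y H0 K by (intro real_sqrt_le_mono mult_right_mono) auto
    also have "\<dots> \<le> K / \<rho> + \<rho> * (K + H)"
    proof (rule real_le_lsqrt)
      show "0 \<le> K / \<rho> + \<rho> * (K + H)" using K H0 \<rho> by simp
      \<comment> \<open>Young's inequality. The parameter \<open>\<rho>\<close> stays free so that
        the share of \<open>H\<close> can later be matched with \<open>\<beta>\<close>.\<close>
      have "0 \<le> (K / \<rho> - \<rho> * (K + H))\<^sup>2" by simp
      also have "\<dots> = (K / \<rho> + \<rho> * (K + H))\<^sup>2 - 4 * ((K / \<rho>) * (\<rho> * (K + H)))" by (simp add: power2_eq_square algebra_simps)
      also have "(K / \<rho>) * (\<rho> * (K + H)) = K * (K + H)" using \<rho> by simp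
      finally show "(2 * K) * (2 * K + 2 * H) \<le> (K / \<rho> + \<rho> * (K + H))\<^sup>2" by (simp add: algebra_simps)
    qed
    also have "\<dots> = (1 / \<rho> + \<rho>) * K + \<rho> * H" by (simp add: algebra_simps)
    finally show ?thesis .
  qed
  have "(\<integral>x. inner (b x - c x) (grad \<psi> x) * (F x)\<^sup>2 \<partial>M) = y * (\<integral>x. inner (b x - c x) (grad \<psi> x) * (f x)\<^sup>2 \<partial>M)"
    unfolding f2 using y1 by simp
  also have "\<dots> \<le> y * (\<epsilon> * E0 M D f f + L + \<gamma> * sqrt (\<integral>x. (f x)\<^sup>2 * logplus ((f x)\<^sup>2) \<partial>M))"
    using y1 B2[OF fc nf] by (intro mult_left_mono) auto
  also have "\<dots> = \<epsilon> * E0 M D F F + L * y + \<gamma> * (y * sqrt (\<integral>x. (f x)\<^sup>2 * logplus ((f x)\<^sup>2) \<partial>M))"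
    unfolding Ef using y1 by (simp add: field_simps)
  also have "\<dots> \<le> \<epsilon> * I + L * (2 * K) + \<gamma> * ((1 / \<rho> + \<rho>) * K + \<rho> * H)"
    by (intro add_mono mult_left_mono EF rt y \<gamma> \<epsilon> L)
  finally show ?thesis unfolding F_def by (simp add: mult_ac)
qed

text \<open>The hypothesis \<open>small\<close> says that the coercivity gap pays for every energy
  term of order \<open>s\<close> and for the \<open>\<epsilon>\<close> of (B.2); the energy
  \<open>I\<close> then has a nonpositive coefficient and is dropped.\<close>

lemma core_growth:
  assumes \<psi>: "\<psi> \<in> D_0" and u: "u \<in> Core" and s: "0 < s" "s \<le> 1/10" and \<rho>: "0 < \<rho>" and \<gamma>: "0 \<le> \<gamma>"
    and \<epsilon>: "0 \<le> \<epsilon>" and L: "0 \<le> L" and \<alpha>: "0 \<le> \<alpha>" and \<kappa>: "0 \<le> \<kappa>"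
    and B1: "\<And>f. f \<in> Core \<Longrightarrow> \<bar>\<integral>x. inner (b x - c x) (D f x) * f x \<partial>M\<bar> \<le> \<kappa> * E0l M D 1 f f"
    and B2: "\<And>f. f \<in> Core \<Longrightarrow> norm2 M f = 1 \<Longrightarrow>
        (\<integral>x. inner (b x - c x) (grad \<psi> x) * (f x)\<^sup>2 \<partial>M)
          \<le> \<epsilon> * E0 M D f f + L + \<gamma> * sqrt (\<integral>x. (f x)\<^sup>2 * logplus ((f x)\<^sup>2) \<partial>M)"
    and small: "(6 + 4 * \<kappa>) * s + \<alpha> * \<epsilon> \<le> 1 - \<eta>"
  defines "K \<equiv> \<integral>x. Phi s (twist \<alpha> \<psi> u x) \<partial>M" and "H \<equiv> \<integral>x. PhiL s (twist \<alpha> \<psi> u x) \<partial>M"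
  assumes K: "1 < K"
  shows "- E u (dual s \<alpha> \<psi> u) \<le> ((1 + s) * \<alpha>\<^sup>2 + 2 * \<theta> + 2 * s * \<kappa> + 2 * \<alpha> * L + \<alpha> * \<gamma> * (1 / \<rho> + \<rho>)) * K + \<alpha> * \<gamma> * \<rho> * H"
proof -
  define v where "v = twist \<alpha> \<psi> u"
  define I where "I = (\<integral>x. phiJ s (v x) * (norm (D v x))\<^sup>2 \<partial>M)"
  have I0: "0 \<le> I" unfolding I_def using phiJ_pos by (intro integral_nonneg_AE) (auto simp: less_imp_le)
  have vc: "v \<in> Core" unfolding v_def by (rule twist_core[OF \<psi> u])
  have 1: "- E u (dual s \<alpha> \<psi> u) \<le> - (1 - \<eta> - 6 * s - 4 * s * \<kappa>) * I + ((1 + s) * \<alpha>\<^sup>2 + 2 * \<theta> + 2 * s * \<kappa>) * K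
     + \<alpha> * (\<integral>x. inner (b x - c x) (grad \<psi> x) * (phiF s (v x))\<^sup>2 \<partial>M)"
    unfolding I_def K_def v_def by (rule core_inequality[OF \<psi> u _ s(2) \<alpha> B1 \<kappa>]) (use s in auto)
  have "(\<integral>x. inner (b x - c x) (grad \<psi> x) * (phiF s (v x))\<^sup>2 \<partial>M) \<le> \<epsilon> * I + 2 * L * K + \<gamma> * ((1 / \<rho> + \<rho>) * K + \<rho> * H)"
    using drift_entropy_bound[OF \<psi> vc s \<rho> \<gamma> \<epsilon> L B2] K unfolding I_def K_def H_def v_def by blast
  then have 2: "\<alpha> * (\<integral>x. inner (b x - c x) (grad \<psi> x) * (phiF s (v x))\<^sup>2 \<partial>M) \<le> \<alpha> * (\<epsilon> * I + 2 * L * K + \<gamma> * ((1 / \<rho> + \<rho>) * K + \<rho> * H))"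
    using \<alpha> by (rule mult_left_mono)
  have 3: "0 \<le> (1 - \<eta> - 6 * s - 4 * s * \<kappa> - \<alpha> * \<epsilon>) * I"
    using small I0 by (intro mult_nonneg_nonneg) (auto simp: algebra_simps)
  have "- E u (dual s \<alpha> \<psi> u) \<le> - (1 - \<eta> - 6 * s - 4 * s * \<kappa>) * I + ((1 + s) * \<alpha>\<^sup>2 + 2 * \<theta> + 2 * s * \<kappa>) * K
     + \<alpha> * (\<epsilon> * I + 2 * L * K + \<gamma> * ((1 / \<rho> + \<rho>) * K + \<rho> * H))" using 1 2 by linarith
  also have "\<dots> = ((1 + s) * \<alpha>\<^sup>2 + 2 * \<theta> + 2 * s * \<kappa> + 2 * \<alpha> * L + \<alpha> * \<gamma> * (1 / \<rho> + \<rho>)) * K + \<alpha> * \<gamma> * \<rho> * H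
     - (1 - \<eta> - 6 * s - 4 * s * \<kappa> - \<alpha> * \<epsilon>) * I" by (simp add: algebra_simps)
  finally show ?thesis using 3 by linarith
qed

lemma twist_conv1:
  assumes "\<psi> \<in> D_0" "conv1 us u" shows "conv1 (\<lambda>n. twist \<alpha> \<psi> (us n)) (twist \<alpha> \<psi> u)"
  unfolding twist_def[abs_def] by (rule multiplier_conv1[OF wt_multiplier[OF assms(1)] assms(2)])

lemma dual_conv1:
  assumes \<psi>: "\<psi> \<in> D_0" and us: "conv1 us u" "AE x in M. (\<lambda>n. us n x) \<longlonglongrightarrow> u x" and s: "0 \<le> s" "s \<le> 1/10"
  shows "conv1 (\<lambda>n. dual s \<alpha> \<psi> (us n)) (dual s \<alpha> \<psi> u)"
proof -
  have lim: "AE x in M. (\<lambda>n. twist \<alpha> \<psi> (us n) x) \<longlonglongrightarrow> twist \<alpha> \<psi> u x"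
    using us(2) unfolding twist_def by eventually_elim (intro tendsto_intros)
  have "conv1 (\<lambda>n x. Phi1 s (twist \<alpha> \<psi> (us n) x)) (\<lambda>x. Phi1 s (twist \<alpha> \<psi> u x))"
    by (rule chain_conv1[OF twist_conv1[OF \<psi> us(1)] lim derivative_Phi1 continuous_Phi2 Phi2_bounds(2)[OF s]]) (simp add: Phi_0)
  from multiplier_conv1[OF wt_multiplier[OF \<psi>] this, of \<alpha>] show ?thesis unfolding dual_def[abs_def] .
qed

text \<open>All terms are continuous along form-norm approximation, so the inequality passes from
  the core to \<open>Dom\<close>. The approximants are also made to converge almost everywhere,
  because the gradient of \<open>dual\<close> contains \<open>Phi2\<close> of them.\<close>

lemma dom_growth:
  assumes \<psi>: "\<psi> \<in> D_0" and u: "u \<in> Dom" and s: "0 < s" "s \<le> 1/10"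
    and core: "\<And>u'. u' \<in> Core \<Longrightarrow> 1 < (\<integral>x. Phi s (twist \<alpha> \<psi> u' x) \<partial>M) \<Longrightarrow>
       - E u' (dual s \<alpha> \<psi> u') \<le> C * (\<integral>x. Phi s (twist \<alpha> \<psi> u' x) \<partial>M) + C' * (\<integral>x. PhiL s (twist \<alpha> \<psi> u' x) \<partial>M)"
    and K: "1 < (\<integral>x. Phi s (twist \<alpha> \<psi> u x) \<partial>M)"
  shows "- Eext u (dual s \<alpha> \<psi> u) \<le> C * (\<integral>x. Phi s (twist \<alpha> \<psi> u x) \<partial>M) + C' * (\<integral>x. PhiL s (twist \<alpha> \<psi> u x) \<partial>M)"
proof -
  obtain us0 where us0: "\<And>n. us0 n \<in> Core" "conv1 us0 u" using core_dense[OF u] by blast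
  obtain r :: "nat \<Rightarrow> nat" where r: "AE x in M. (\<lambda>n. us0 (r n) x) \<longlonglongrightarrow> u x" "conv1 (\<lambda>n. us0 (r n)) u"
    using conv1_AE_subseq[OF us0(2)] by blast
  define us where "us n = us0 (r n)" for n
  have us: "us n \<in> Core" "conv1 us u" "AE x in M. (\<lambda>n. us n x) \<longlonglongrightarrow> u x" for n
    unfolding us_def using us0(1) r by auto
  have s0: "0 \<le> s" "s \<le> 1" using s by auto
  define v where "v n = twist \<alpha> \<psi> (us n)" for n
  define w where "w = twist \<alpha> \<psi> u"
  have vw: "conv1 v w" unfolding v_def w_def by (rule twist_conv1[OF \<psi> us(2)])
  have E: "(\<lambda>n. E (us n) (dual s \<alpha> \<psi> (us n))) \<longlonglongrightarrow> Eext u (dual s \<alpha> \<psi> u)"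
    by (rule pform_ext_tendsto[OF us(1,2) dual_core[OF \<psi> us(1) s0(1) s(2)] dual_conv1[OF \<psi> us(2,3) s0(1) s(2)]])
  have n0: "(\<lambda>n. norm2H M (\<lambda>x. v n x - w x)) \<longlonglongrightarrow> 0"
    using vw by (simp add: conv1_def norm2H_tendsto_0_iff)
  have L: "L2H M w" "\<forall>\<^sub>F n in sequentially. L2H M (v n)"
    using vw by (auto simp: conv1_def intro!: dom_L2 always_eventually)
  have tK: "(\<lambda>n. \<integral>x. Phi s (v n x) \<partial>M) \<longlonglongrightarrow> (\<integral>x. Phi s (w x) \<partial>M)"
    by (rule quadratic_integral_tendsto[where C = 2, OF _ Phi_lipschitz[OF s0] _ _ L n0]) (use Phi_0 in auto)
  have tH: "(\<lambda>n. \<integral>x. PhiL s (v n x) \<partial>M) \<longlonglongrightarrow> (\<integral>x. PhiL s (w x) \<partial>M)"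
    by (rule quadratic_integral_tendsto[where C = "2 / s + 2", OF _ PhiL_lipschitz[OF s(1) s0(2)] _ _ L n0])
      (use s in \<open>auto simp: PhiL_def Phi_0\<close>)
  \<comment> \<open>Strict inequality is an open condition, hence inherited by late approximants;
    only for these is the core estimate available.\<close>
  have "\<forall>\<^sub>F n in sequentially. 1 < (\<integral>x. Phi s (v n x) \<partial>M)"
    using order_tendstoD(1)[OF tK] K by (simp add: w_def)
  then have ev: "\<forall>\<^sub>F n in sequentially. - E (us n) (dual s \<alpha> \<psi> (us n)) \<le> C * (\<integral>x. Phi s (v n x) \<partial>M) + C' * (\<integral>x. PhiL s (v n x) \<partial>M)"
    by eventually_elim (use core[OF us(1)] in \<open>simp add: v_def\<close>)
  have "(\<lambda>n. C * (\<integral>x. Phi s (v n x) \<partial>M) + C' * (\<integral>x. PhiL s (v n x) \<partial>M)) \<longlonglongrightarrow> C * (\<integral>x. Phi s (w x) \<partial>M) + C' * (\<integral>x. PhiL s (w x) \<partial>M)"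
    by (intro tendsto_intros tK tH)
  from tendsto_le[OF sequentially_bot this tendsto_minus[OF E] ev] show ?thesis unfolding w_def .
qed

end

text \<open>The first time at which the discounted value \<open>exp (- c t) K t\<close> reaches its final value would
  violate the hypothesis on left neighbours.\<close>

lemma growth_crossing:
  fixes K :: "real \<Rightarrow> real"
  assumes t: "t0 \<le> t1" and start: "K t0 \<le> m" and c: "0 \<le> c"
    and usc: "\<And>t e. t0 \<le> t \<Longrightarrow> e > 0 \<Longrightarrow> \<forall>\<^sub>F s in at_right t. K s < K t + e"
    and left: "\<And>t. t0 < t \<Longrightarrow> t \<le> t1 \<Longrightarrow> m < K t \<Longrightarrow> \<exists>s. t0 \<le> s \<and> s < t \<and> K t \<le> exp (c * (t - s)) * K s"
    and m: "0 \<le> m"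
  shows "K t1 \<le> m * exp (c * (t1 - t0))"
proof (rule ccontr)
  assume neg: "\<not> ?thesis"
  define Z where "Z t = exp (- c * (t - t0)) * K t" for t
  define S where "S = {t \<in> {t0..t1}. Z t1 \<le> Z t}"
  define \<tau> where "\<tau> = Inf S"
  have mexp: "m * exp (c * (t1 - t0)) < K t1" using neg by simp
  have Z1: "m < Z t1"
  proof -
    have "exp (- c * (t1 - t0)) * exp (c * (t1 - t0)) = 1" by (simp flip: exp_add)
    then have "m = exp (- c * (t1 - t0)) * (m * exp (c * (t1 - t0)))"
      by (metis mult.left_commute mult.right_neutral)
    also have "\<dots> < exp (- c * (t1 - t0)) * K t1"
      using mexp by (intro mult_strict_left_mono) auto
    finally show ?thesis unfolding Z_def .
  qed
  have S: "t1 \<in> S" "S \<noteq> {}" "bdd_below S" "S \<subseteq> {t0..t1}" unfolding S_def using t by (auto intro: bdd_belowI)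
  have \<tau>: "t0 \<le> \<tau>" "\<tau> \<le> t1"
    unfolding \<tau>_def by (rule cInf_greatest[OF S(2)], use S(4) in force) (rule cInf_lower[OF S(1,3)])
  \<comment> \<open>The infimum is attained: otherwise points of \<open>S\<close> would accumulate
    at \<open>\<tau>\<close> from the right with values of \<open>Z\<close> at least
    \<open>Z t1 > Z \<tau>\<close>, against \<open>usc\<close>.\<close>
  have Z\<tau>: "Z t1 \<le> Z \<tau>"
  proof (rule ccontr)
    assume "\<not> Z t1 \<le> Z \<tau>"
    then have lt: "Z \<tau> < Z t1" by simp
    define e where "e = (Z t1 - Z \<tau>) * exp (c * (\<tau> - t0))"
    have e: "e > 0" using lt by (simp add: e_def)
    have "\<forall>\<^sub>F s in at_right \<tau>. K s < K \<tau> + e" by (rule usc[OF \<tau>(1) e])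
    then obtain b where b: "\<tau> < b" "\<And>s. \<tau> < s \<Longrightarrow> s < b \<Longrightarrow> K s < K \<tau> + e"
      unfolding eventually_at_right_field by blast
    have "\<tau> \<notin> S" using lt by (simp add: S_def)
    obtain s where s: "s \<in> S" "s < b" using cInf_lessD[OF S(2), of b] b(1) unfolding \<tau>_def by blast
    have "\<tau> \<le> s" unfolding \<tau>_def using s S by (intro cInf_lower) auto
    then have \<tau>s: "\<tau> < s" using s(1) \<open>\<tau> \<notin> S\<close> by (cases "s = \<tau>") auto
    have Zs: "Z t1 \<le> Z s" using s(1) by (simp add: S_def)
    have "0 < K s"
    proof -
      have "0 < Z s" using Zs Z1 m by linarith
      then show ?thesis by (simp add: Z_def zero_less_mult_iff)
    qed
    have "Z s \<le> exp (- c * (\<tau> - t0)) * K s"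
      unfolding Z_def using \<open>0 < K s\<close> c \<tau>s by (intro mult_right_mono) (auto intro: mult_left_mono)
    also have "\<dots> < exp (- c * (\<tau> - t0)) * (K \<tau> + e)" using b(2)[OF \<tau>s s(2)] by (intro mult_strict_left_mono) auto
    also have "\<dots> = Z \<tau> + (Z t1 - Z \<tau>) * (exp (- c * (\<tau> - t0)) * exp (c * (\<tau> - t0)))"
      by (simp add: Z_def e_def algebra_simps)
    also have "exp (- c * (\<tau> - t0)) * exp (c * (\<tau> - t0)) = 1" by (simp flip: exp_add)
    finally show False using Zs by simp
  qed
  \<comment> \<open>This transfers the threshold \<open>m\<close> from \<open>Z\<close> to
    \<open>K\<close>, so that \<open>left\<close> can be applied at \<open>\<tau>\<close>.\<close>
  have "Z \<tau> \<le> K \<tau>"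
  proof -
    have "0 < Z \<tau>" using Z\<tau> Z1 m by linarith
    then have "0 < K \<tau>" by (simp add: Z_def zero_less_mult_iff)
    moreover have "exp (- c * (\<tau> - t0)) \<le> 1" using c \<tau>(1) by simp
    ultimately show ?thesis unfolding Z_def by (intro mult_left_le_one_le) auto
  qed
  then have mK: "m < K \<tau>" using Z\<tau> Z1 by linarith
  have "\<tau> \<noteq> t0" using mK start by auto
  then have "t0 < \<tau>" using \<tau> by simp
  from left[OF this \<tau>(2) mK] obtain s where s: "t0 \<le> s" "s < \<tau>" "K \<tau> \<le> exp (c * (\<tau> - s)) * K s" by blast
  have "Z \<tau> \<le> exp (- c * (\<tau> - t0)) * (exp (c * (\<tau> - s)) * K s)" unfolding Z_def using s(3) by (intro mult_left_mono) auto
  also have "\<dots> = (exp (- c * (\<tau> - t0)) * exp (c * (\<tau> - s))) * K s" by simp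
  also have "exp (- c * (\<tau> - t0)) * exp (c * (\<tau> - s)) = exp (- c * (s - t0))"
    unfolding exp_add[symmetric] by (simp add: algebra_simps)
  finally have "Z t1 \<le> Z s" using Z\<tau> by (simp add: Z_def)
  then have "s \<in> S" using s \<tau> by (simp add: S_def)
  then have "\<tau> \<le> s" unfolding \<tau>_def using S by (intro cInf_lower) auto
  with s show False by simp
qed

section \<open>Evolution under the semigroup\<close>

locale semigroup_form = lower_order M Dom D Ek b c V \<eta> \<theta> \<omega> l
  for M :: "'a measure" and Dom :: "('a \<Rightarrow> real) set"
    and D :: "('a \<Rightarrow> real) \<Rightarrow> 'a \<Rightarrow> 'h::{real_inner,banach,second_countable_topology}"
    and Ek :: "nat \<Rightarrow> 'a set" and b c :: "'a \<Rightarrow> 'h" and V :: "'a \<Rightarrow> real" and \<eta> \<theta> \<omega> l :: real +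
  fixes T :: "real \<Rightarrow> ('a \<Rightarrow> real) \<Rightarrow> 'a \<Rightarrow> real" and f0 :: "'a \<Rightarrow> real"
  assumes semigroup: "associated_semigroup M Dom D Ek b c V T" and f0: "L2H M f0"
begin

abbreviation "u t \<equiv> T t f0"

lemma u_dom: "0 < t \<Longrightarrow> u t \<in> Dom"
  using semigroup f0 unfolding associated_semigroup_def L2_iff_L2H by blast

lemma u_generator:
  assumes "0 < t"
  obtains w where "L2H M w" "((\<lambda>s. norm2H M (\<lambda>x. (u s x - u t x) / (s - t) - w x)) \<longlongrightarrow> 0) (at t)"
    "\<And>g. g \<in> Dom \<Longrightarrow> (\<integral>x. w x * g x \<partial>M) = - Eext (u t) g"
  using semigroup f0 assms unfolding associated_semigroup_def L2_iff_L2H norm2_eq_norm2H by blast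

lemma u_initial: "((\<lambda>t. norm2H M (\<lambda>x. u t x - f0 x)) \<longlongrightarrow> 0) (at_right 0)"
  using semigroup f0 unfolding associated_semigroup_def L2_iff_L2H norm2_eq_norm2H by blast

lemma u_continuous:
  assumes t: "0 < t" shows "((\<lambda>s. norm2H M (\<lambda>x. u s x - u t x)) \<longlongrightarrow> 0) (at t)"
proof -
  obtain w where w: "L2H M w" "((\<lambda>s. norm2H M (\<lambda>x. (u s x - u t x) / (s - t) - w x)) \<longlongrightarrow> 0) (at t)"
    using u_generator[OF t] by blast
  let ?q = "\<lambda>s. \<integral>x. ((u s x - u t x) / (s - t) - w x)\<^sup>2 \<partial>M"
  have q: "(?q \<longlongrightarrow> 0) (at t)" using w(2) by (simp add: norm2H_tendsto_0_iff)
  have "((\<lambda>s. \<integral>x. (u s x - u t x)\<^sup>2 \<partial>M) \<longlongrightarrow> 0) (at t)"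
  proof (rule Lim_null_comparison)
    have "((\<lambda>s. (s - t)\<^sup>2 * (2 * ?q s + 2 * (\<integral>x. (w x)\<^sup>2 \<partial>M))) \<longlongrightarrow> (t - t)\<^sup>2 * (2 * 0 + 2 * (\<integral>x. (w x)\<^sup>2 \<partial>M))) (at t)"
      by (intro tendsto_intros q)
    then show "((\<lambda>s. (s - t)\<^sup>2 * (2 * ?q s + 2 * (\<integral>x. (w x)\<^sup>2 \<partial>M))) \<longlongrightarrow> 0) (at t)" by simp
    have "\<forall>\<^sub>F s in at t. 0 < s"
      using t by (auto intro!: order_tendstoD(1)[OF tendsto_ident_at])
    moreover have "\<forall>\<^sub>F s in at t. s \<noteq> t" by (simp add: eventually_at_filter)
    ultimately show "\<forall>\<^sub>F s in at t. norm (\<integral>x. (u s x - u t x)\<^sup>2 \<partial>M) \<le> (s - t)\<^sup>2 * (2 * ?q s + 2 * (\<integral>x. (w x)\<^sup>2 \<partial>M))"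
    proof eventually_elim
      case (elim s)
      have L: "L2H M (\<lambda>x. (u s x - u t x) / (s - t) - w x)"
        using L2H_diff[OF L2_cmult[OF L2H_diff[OF dom_L2[OF u_dom[OF elim(1)]] dom_L2[OF u_dom[OF t]]], of "1 / (s - t)"] w(1)]
        by simp
      have "(\<integral>x. (u s x - u t x)\<^sup>2 \<partial>M) = (\<integral>x. (s - t)\<^sup>2 * (norm (((u s x - u t x) / (s - t) - w x) + w x))\<^sup>2 \<partial>M)"
        using elim(2) by (intro Bochner_Integration.integral_cong) (auto simp: power_divide)
      also have "\<dots> = (s - t)\<^sup>2 * (\<integral>x. (norm (((u s x - u t x) / (s - t) - w x) + w x))\<^sup>2 \<partial>M)" by simp
      also have "\<dots> \<le> (s - t)\<^sup>2 * (2 * (\<integral>x. (norm ((u s x - u t x) / (s - t) - w x))\<^sup>2 \<partial>M) + 2 * (\<integral>x. (norm (w x))\<^sup>2 \<partial>M))"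
        by (intro mult_left_mono integral_norm_add_square_le L w) auto
      finally show ?case by simp
    qed
  qed
  then show ?thesis by (simp add: norm2H_tendsto_0_iff)
qed

lemma twist_L2:
  assumes "\<psi> \<in> D_0" "L2H M f" shows "L2H M (twist \<alpha> \<psi> f)"
proof -
  obtain C where "AE x in M. \<bar>wt \<alpha> \<psi> x\<bar> \<le> C" using multiplierD(3)[OF wt_multiplier[OF assms(1)]] by blast
  from L2H_mult_bounded[OF assms(2) multiplierD(1)[OF wt_multiplier[OF assms(1)]] this]
  show ?thesis unfolding twist_def[abs_def] by simp
qed

lemma twist_tendsto:
  assumes \<psi>: "\<psi> \<in> D_0" and L: "\<forall>\<^sub>F s in F. L2H M (fs s)" "L2H M f"
    and lim: "((\<lambda>s. norm2H M (\<lambda>x. fs s x - f x)) \<longlongrightarrow> 0) F"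
  shows "((\<lambda>s. norm2H M (\<lambda>x. twist \<alpha> \<psi> (fs s) x - twist \<alpha> \<psi> f x)) \<longlongrightarrow> 0) F"
proof -
  obtain C where C: "AE x in M. \<bar>wt \<alpha> \<psi> x\<bar> \<le> C" using multiplierD(3)[OF wt_multiplier[OF \<psi>]] by blast
  have "((\<lambda>s. \<integral>x. (norm (twist \<alpha> \<psi> (fs s) x - twist \<alpha> \<psi> f x))\<^sup>2 \<partial>M) \<longlongrightarrow> 0) F"
  proof (rule L2H_null_mono[where C = C])
    show "((\<lambda>s. \<integral>x. (norm (fs s x - f x))\<^sup>2 \<partial>M) \<longlongrightarrow> 0) F" using lim by (simp add: norm2H_tendsto_0_iff)
    show "\<forall>\<^sub>F s in F. L2H M (\<lambda>x. fs s x - f x) \<and> (\<lambda>x. twist \<alpha> \<psi> (fs s) x - twist \<alpha> \<psi> f x) \<in> borel_measurable M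
        \<and> (AE x in M. norm (twist \<alpha> \<psi> (fs s) x - twist \<alpha> \<psi> f x) \<le> C * norm (fs s x - f x))"
      using L(1)
    proof eventually_elim
      case (elim s)
      have "AE x in M. norm (twist \<alpha> \<psi> (fs s) x - twist \<alpha> \<psi> f x) \<le> C * norm (fs s x - f x)"
        using C
      proof eventually_elim
        case (elim x)
        have "twist \<alpha> \<psi> (fs s) x - twist \<alpha> \<psi> f x = wt \<alpha> \<psi> x * (fs s x - f x)"
          by (simp add: twist_def right_diff_distrib)
        with elim show ?case by (simp add: abs_mult mult_right_mono)
      qed
      then show ?case
        using L2H_diff[OF elim L(2)] L2H_measurable[OF L2H_diff[OF twist_L2[OF \<psi> elim] twist_L2[OF \<psi> L(2)]]] by blast
    qed
  qed
  then show ?thesis by (simp add: norm2H_tendsto_0_iff)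
qed

text \<open>The functional is not differentiated; its value at \<open>t\<close> is compared with
  slightly earlier ones by convexity, and \<open>growth_crossing\<close> integrates the outcome. The
  1 added to the initial value keeps \<open>K\<close> above 1 wherever \<open>growth\<close> is
  invoked and leaves room for the limit at time 0; the 1 added to \<open>C\<close> absorbs the error
  of the difference quotient.\<close>

lemma Phi_evolution:
  assumes \<psi>: "\<psi> \<in> D_0" and t1: "0 < t1" and \<beta>: "0 < \<beta>" "\<beta> * t1 \<le> 1/10" and C: "0 \<le> C"
    and growth: "\<And>t. 0 < t \<Longrightarrow> t \<le> t1 \<Longrightarrow> 1 < (\<integral>x. Phi (\<beta> * t) (twist \<alpha> \<psi> (u t) x) \<partial>M) \<Longrightarrow>
       - Eext (u t) (dual (\<beta> * t) \<alpha> \<psi> (u t)) \<le> C * (\<integral>x. Phi (\<beta> * t) (twist \<alpha> \<psi> (u t) x) \<partial>M) + \<beta> * (\<integral>x. PhiL (\<beta> * t) (twist \<alpha> \<psi> (u t) x) \<partial>M)"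
  shows "(\<integral>x. Phi (\<beta> * t1) (twist \<alpha> \<psi> (u t1) x) \<partial>M) \<le> ((\<integral>x. (twist \<alpha> \<psi> f0 x)\<^sup>2 \<partial>M) + 1) * exp ((C + 1) * t1)"
proof -
  define v where "v t = twist \<alpha> \<psi> (u t)" for t
  define K where "K t = (\<integral>x. Phi (\<beta> * t) (v t x) \<partial>M)" for t
  define m where "m = (\<integral>x. (twist \<alpha> \<psi> f0 x)\<^sup>2 \<partial>M) + 1"
  have m1: "1 \<le> m" by (simp add: m_def)
  have vD: "v t \<in> Dom" if "0 < t" for t unfolding v_def by (rule twist_dom[OF \<psi> u_dom[OF that]])
  have vL: "L2H M (v t)" if "0 < t" for t by (rule dom_L2[OF vD[OF that]])
  have evpos: "\<forall>\<^sub>F s in at t. 0 < s" if "0 < t" for t :: real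
    using that by (auto intro!: order_tendstoD(1)[OF tendsto_ident_at])
  have evL: "\<forall>\<^sub>F s in at t. L2H M (u s)" if t: "0 < t" for t
    using evpos[OF t] by eventually_elim (rule dom_L2[OF u_dom])
  have vlim: "((\<lambda>s. norm2H M (\<lambda>x. v s x - v t x)) \<longlongrightarrow> 0) (at t)" if t: "0 < t" for t
    unfolding v_def by (rule twist_tendsto[OF \<psi> evL[OF t] dom_L2[OF u_dom[OF t]] u_continuous[OF t]])
  have evLv: "\<forall>\<^sub>F s in at t. L2H M (v s)" if t: "0 < t" for t
    using evpos[OF t] by eventually_elim (rule vL)
  have usc: "\<forall>\<^sub>F s in at_right t. K s < K t + e" if t: "0 < t" and t': "t \<le> t1" and e: "e > 0" for t e
  proof -
    have "\<beta> * t \<le> \<beta> * t1" using t' \<beta> by (intro mult_left_mono) auto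
    then have s: "0 \<le> \<beta> * t" "\<beta> * t \<le> 1" using t \<beta> by (simp, linarith)
    have "((\<lambda>s. \<integral>x. Phi (\<beta> * t) (v s x) \<partial>M) \<longlongrightarrow> (\<integral>x. Phi (\<beta> * t) (v t x) \<partial>M)) (at t)"
      by (rule quadratic_integral_tendsto[where C = 2, OF _ Phi_lipschitz[OF s] _ _ vL[OF t] evLv[OF t] vlim[OF t]])
        (auto simp: Phi_0)
    then have "((\<lambda>s. \<integral>x. Phi (\<beta> * t) (v s x) \<partial>M) \<longlongrightarrow> K t) (at_right t)"
      unfolding K_def by (rule tendsto_within_subset) simp
    then have "\<forall>\<^sub>F s in at_right t. (\<integral>x. Phi (\<beta> * t) (v s x) \<partial>M) < K t + e" using e by (intro order_tendstoD) auto
    moreover have "\<forall>\<^sub>F s in at_right t. t < s" by (simp add: eventually_at_right_less)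
    ultimately show ?thesis
    proof eventually_elim
      case (elim s')
      have p: "0 < s'" using elim t by simp
      \<comment> \<open>The exponent grows with time and \<open>Phi\<close> decreases in it, so the
        exponent may be frozen at time \<open>t\<close>, where continuity in L2 applies.\<close>
      have "K s' \<le> (\<integral>x. Phi (\<beta> * t) (v s' x) \<partial>M)"
        unfolding K_def using elim \<beta> t by (intro integral_mono Phi_integrable vL p Phi_antimono) auto
      with elim show ?case by simp
    qed
  qed
  have left: "\<exists>r. t0 \<le> r \<and> r < t \<and> K t \<le> exp ((C + 1) * (t - r)) * K r"
    if t0: "0 < t0" and t: "t0 < t" "t \<le> t1" and Kt: "m < K t" for t0 t
  proof -
    have tp: "0 < t" using t0 t by simp
    define s where "s = \<beta> * t"
    have "\<beta> * t \<le> \<beta> * t1" using t(2) \<beta> by (intro mult_left_mono) auto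
    then have s: "0 < s" "s \<le> 1/10" unfolding s_def using tp \<beta> by (simp, linarith)
    obtain w where w: "L2H M w" "((\<lambda>r. norm2H M (\<lambda>x. (u r x - u t x) / (r - t) - w x)) \<longlongrightarrow> 0) (at t)"
      "\<And>g. g \<in> Dom \<Longrightarrow> (\<integral>x. w x * g x \<partial>M) = - Eext (u t) g" using u_generator[OF tp] by blast
    \<comment> \<open>The test function is frozen at time \<open>t\<close>; the tangent inequality
      compares all earlier times with it.\<close>
    define k where "k = dual s \<alpha> \<psi> (u t)"
    have kD: "k \<in> Dom" unfolding k_def by (rule dual_dom[OF \<psi> u_dom[OF tp]]) (use s in auto)
    define q where "q r = (\<integral>x. k x * ((u r x - u t x) / (r - t)) \<partial>M)" for r
    \<comment> \<open>An upper bound for the backward difference quotient of \<open>K\<close> at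
      \<open>t\<close>: its first part tends to minus the extended form, its second part is the
      entropy gained from the moving exponent.\<close>
    define X where "X r = q r - \<beta> * (\<integral>x. PhiL s (v r x) \<partial>M)" for r
    have Lq: "L2H M (\<lambda>x. (u r x - u t x) / (r - t))" if "0 < r" for r
      using L2_cmult[OF L2H_diff[OF dom_L2[OF u_dom[OF that]] dom_L2[OF u_dom[OF tp]]], of "1 / (r - t)"] by simp
    have "((\<lambda>r. q r - (\<integral>x. k x * w x \<partial>M)) \<longlongrightarrow> 0) (at t)"
    proof (rule Lim_null_comparison)
      have "((\<lambda>r. norm2H M k * norm2H M (\<lambda>x. (u r x - u t x) / (r - t) - w x)) \<longlongrightarrow> norm2H M k * 0) (at t)"
        by (intro tendsto_intros w)
      then show "((\<lambda>r. norm2H M k * norm2H M (\<lambda>x. (u r x - u t x) / (r - t) - w x)) \<longlongrightarrow> 0) (at t)" by simp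
      show "\<forall>\<^sub>F r in at t. norm (q r - (\<integral>x. k x * w x \<partial>M)) \<le> norm2H M k * norm2H M (\<lambda>x. (u r x - u t x) / (r - t) - w x)"
        using evpos[OF tp]
      proof eventually_elim
        case (elim r)
        have "q r - (\<integral>x. k x * w x \<partial>M) = (\<integral>x. inner (k x) ((u r x - u t x) / (r - t) - w x) \<partial>M)"
          unfolding q_def using L2_mult_integrable[OF dom_L2[OF kD] Lq[OF elim]] L2_mult_integrable[OF dom_L2[OF kD] w(1)]
          by (simp add: right_diff_distrib)
        then show ?case using integral_inner_le[OF dom_L2[OF kD] L2H_diff[OF Lq[OF elim] w(1)]] by simp
      qed
    qed
    then have qlim: "(q \<longlongrightarrow> (\<integral>x. k x * w x \<partial>M)) (at t)" by (simp add: LIM_zero_iff)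
    have Hlim: "((\<lambda>r. \<integral>x. PhiL s (v r x) \<partial>M) \<longlongrightarrow> (\<integral>x. PhiL s (v t x) \<partial>M)) (at t)"
      by (rule quadratic_integral_tendsto[where C = "2 / s + 2", OF _ PhiL_lipschitz _ _ vL[OF tp] evLv[OF tp] vlim[OF tp]])
        (use s in \<open>auto simp: PhiL_def Phi_0\<close>)
    have "(\<integral>x. k x * w x \<partial>M) = - Eext (u t) k" using w(3)[OF kD] by (simp add: mult.commute)
    then have Xlim: "(X \<longlongrightarrow> - Eext (u t) k - \<beta> * (\<integral>x. PhiL s (v t x) \<partial>M)) (at t)"
      unfolding X_def using qlim Hlim by (intro tendsto_intros) auto
    have "- Eext (u t) k - \<beta> * (\<integral>x. PhiL s (v t x) \<partial>M) \<le> C * K t"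
      using growth[OF tp t(2)] Kt m1 unfolding k_def s_def K_def v_def by simp
    also have "C * K t < (C + 1/2) * K t" using Kt m1 by (simp add: algebra_simps)
    finally have "\<forall>\<^sub>F r in at t. X r < (C + 1/2) * K t" by (rule order_tendstoD(2)[OF Xlim])
    then have X: "\<forall>\<^sub>F r in at_left t. X r < (C + 1/2) * K t" by (simp add: eventually_at_split)
    \<comment> \<open>Half of the extra 1 in \<open>C + 1\<close> pays for passing from the limit of
      \<open>X\<close> to a nearby value; for steps this short the other half pays for bounding the
      reciprocal of \<open>1 - (C + 1/2) * y\<close> by \<open>exp ((C + 1) * y)\<close>.\<close>
    define h where "h = min (t - t0) (1 / (2 * (C + 1) * (C + 1)))"
    have h: "0 < h" using t C by (simp add: h_def)
    have "\<forall>\<^sub>F r in at_left t. t - h < r" by (rule order_tendstoD(1)[OF tendsto_ident_at]) (use h in simp)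
    moreover have "\<forall>\<^sub>F r in at_left t. r < t" by (simp add: eventually_at_filter)
    ultimately have "\<forall>\<^sub>F r in at_left t. X r < (C + 1/2) * K t \<and> t - h < r \<and> r < t"
      using X by eventually_elim auto
    then obtain r where r: "X r < (C + 1/2) * K t" "t - h < r" "r < t"
      using eventually_happens'[OF trivial_limit_at_left_real] by blast
    have r0: "t0 \<le> r" using r(2) by (simp add: h_def min_def split: if_splits)
    have rp: "0 < r" using r0 t0 by simp
    have "K t - K r \<le> (t - r) * X r"
    proof -
      have i1: "integrable M (\<lambda>x. Phi s (v t x))" "integrable M (\<lambda>x. Phi (\<beta> * r) (v r x))" "integrable M (\<lambda>x. PhiL s (v r x))"
        using s rp \<beta> by (auto intro!: Phi_integrable PhiL_integrable vL tp)
      have i2: "integrable M (\<lambda>x. k x * ((u r x - u t x) / (r - t)))" by (rule L2_mult_integrable[OF dom_L2[OF kD] Lq[OF rp]])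
      have "K t - K r = (\<integral>x. Phi s (v t x) - Phi (\<beta> * r) (v r x) \<partial>M)" unfolding K_def s_def[symmetric] using i1 by simp
      also have "\<dots> \<le> (\<integral>x. (t - r) * (k x * ((u r x - u t x) / (r - t)) - \<beta> * PhiL s (v r x)) \<partial>M)"
      proof (rule integral_mono)
        show "integrable M (\<lambda>x. Phi s (v t x) - Phi (\<beta> * r) (v r x))" using i1 by simp
        show "integrable M (\<lambda>x. (t - r) * (k x * ((u r x - u t x) / (r - t)) - \<beta> * PhiL s (v r x)))" using i1 i2 by simp
        fix x
        \<comment> \<open>Two tangent inequalities follow: in the value with the exponent frozen at
          \<open>s\<close>, then in the exponent with the function frozen at
          \<open>v r\<close>.\<close>
        have "Phi s (v t x) - Phi s (v r x) \<le> Phi1 s (v t x) * (v t x - v r x)" by (rule Phi_convex) (use s in auto)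
        also have "\<dots> = k x * (u t x - u r x)" by (simp add: k_def dual_def v_def twist_def algebra_simps)
        also have "\<dots> = (t - r) * (k x * ((u r x - u t x) / (r - t)))" using r(3) by (simp add: field_simps)
        finally have 1: "Phi s (v t x) - Phi s (v r x) \<le> (t - r) * (k x * ((u r x - u t x) / (r - t)))" .
        have 2: "Phi s (v r x) - Phi (\<beta> * r) (v r x) \<le> - (s - \<beta> * r) * PhiL s (v r x)"
          by (rule Phi_parameter_diff) (use r \<beta> in \<open>auto simp: s_def\<close>)
        have "- (s - \<beta> * r) * PhiL s (v r x) = - ((t - r) * (\<beta> * PhiL s (v r x)))" by (simp add: s_def algebra_simps)
        then show "Phi s (v t x) - Phi (\<beta> * r) (v r x) \<le> (t - r) * (k x * ((u r x - u t x) / (r - t)) - \<beta> * PhiL s (v r x))"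
          using 1 2 unfolding right_diff_distrib by linarith
      qed
      also have "\<dots> = (t - r) * X r" unfolding X_def q_def using i1 i2 by simp
      finally show ?thesis .
    qed
    also have "\<dots> \<le> (t - r) * ((C + 1/2) * K t)" using r by (intro mult_left_mono) auto
    finally have Kr: "K t * (1 - (C + 1/2) * (t - r)) \<le> K r" by (simp add: algebra_simps)
    define y where "y = t - r"
    have y: "0 < y" "y \<le> 1 / (2 * (C + 1) * (C + 1))" using r by (auto simp: y_def h_def)
    have Kt0: "0 < K t" using Kt m1 by simp
    have yC: "(C + 1) * (C + 1/2) * y \<le> 1/2"
    proof -
      have "(C + 1) * (C + 1/2) * y \<le> (C + 1) * (C + 1) * (1 / (2 * (C + 1) * (C + 1)))"
        using C y by (intro mult_mono) auto
      also have "\<dots> = 1/2"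
      proof -
        have "z * z * (1 / (2 * z * z)) = 1/2" if "0 < z" for z :: real using that by (simp add: field_simps)
        from this[of "C + 1"] C show ?thesis by simp
      qed
      finally show ?thesis .
    qed
    have "1 \<le> (1 + (C + 1) * y) * (1 - (C + 1/2) * y)"
    proof -
      have "(1 + (C + 1) * y) * (1 - (C + 1/2) * y) = 1 + y * (1/2 - (C + 1) * (C + 1/2) * y)" by (simp add: algebra_simps)
      moreover have "0 \<le> y * (1/2 - (C + 1) * (C + 1/2) * y)" using y yC by simp
      ultimately show ?thesis by linarith
    qed
    also have "\<dots> \<le> exp ((C + 1) * y) * (1 - (C + 1/2) * y)"
    proof (rule mult_right_mono)
      show "1 + (C + 1) * y \<le> exp ((C + 1) * y)" by (rule exp_ge_add_one_self)
      have "1 * ((C + 1/2) * y) \<le> (C + 1) * ((C + 1/2) * y)" using C y by (intro mult_right_mono) auto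
      then show "0 \<le> 1 - (C + 1/2) * y" using yC by simp
    qed
    finally have "K t * 1 \<le> K t * (exp ((C + 1) * y) * (1 - (C + 1/2) * y))" using Kt0 by (intro mult_left_mono) auto
    also have "\<dots> = exp ((C + 1) * y) * (K t * (1 - (C + 1/2) * y))" by simp
    also have "\<dots> \<le> exp ((C + 1) * y) * K r" using Kr by (intro mult_left_mono) (auto simp: y_def)
    finally show ?thesis using r0 r(3) by (auto simp: y_def)
  qed
  have "\<forall>\<^sub>F t in at_right 0. K t \<le> m \<and> 0 < t \<and> t < t1"
  proof -
    have "\<forall>\<^sub>F s in at_right 0. L2H M (u s)" using eventually_at_right_less[of 0]
      by eventually_elim (rule dom_L2[OF u_dom])
    from twist_tendsto[OF \<psi> this f0 u_initial]
    have vl: "((\<lambda>s. norm2H M (\<lambda>x. v s x - twist \<alpha> \<psi> f0 x)) \<longlongrightarrow> 0) (at_right 0)" unfolding v_def .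
    have evv: "\<forall>\<^sub>F s in at_right 0. L2H M (v s)" using eventually_at_right_less[of 0] by eventually_elim (rule vL)
    have "((\<lambda>s. \<integral>x. (v s x)\<^sup>2 \<partial>M) \<longlongrightarrow> (\<integral>x. (twist \<alpha> \<psi> f0 x)\<^sup>2 \<partial>M)) (at_right 0)"
      by (rule quadratic_integral_tendsto[where C = 1 and \<Psi> = "\<lambda>x. x\<^sup>2", OF _ square_lipschitz _ _ twist_L2[OF \<psi> f0] evv vl]) auto
    then have "\<forall>\<^sub>F s in at_right 0. (\<integral>x. (v s x)\<^sup>2 \<partial>M) < m" unfolding m_def by (intro order_tendstoD(2)) auto
    moreover have "\<forall>\<^sub>F s in at_right 0. s < t1" using t1 by (auto intro!: order_tendstoD(2)[OF tendsto_ident_at])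
    ultimately show ?thesis using eventually_at_right_less[of 0]
    proof eventually_elim
      case (elim t)
      have "K t \<le> (\<integral>x. (v t x)\<^sup>2 \<partial>M)"
        unfolding K_def using elim \<beta> by (intro integral_mono Phi_integrable L2_integrable vL Phi_le) auto
      with elim show ?case by simp
    qed
  qed
  then obtain t0 where t0: "K t0 \<le> m" "0 < t0" "t0 < t1"
    using eventually_happens'[OF trivial_limit_at_right_real] by blast
  \<comment> \<open>\<open>growth_crossing\<close> asks for right upper semicontinuity at all later
    times, but the exponent is kept in its admissible range only up to \<open>t1\<close>; beyond
    \<open>t1\<close> the functional is frozen.\<close>
  define K' where "K' t = K (min t t1)" for t
  have "K' t1 \<le> m * exp ((C + 1) * (t1 - t0))"
  proof (rule growth_crossing[OF less_imp_le[OF t0(3)]])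
    show "K' t0 \<le> m" using t0 by (simp add: K'_def)
    show "0 \<le> C + 1" using C by simp
    show "0 \<le> m" using m1 by simp
    show "\<forall>\<^sub>F s in at_right t. K' s < K' t + e" if t: "t0 \<le> t" and e: "e > 0" for t e
    proof (cases "t < t1")
      case True
      have "\<forall>\<^sub>F s in at_right t. s < t1" using True by (auto intro!: order_tendstoD(2)[OF tendsto_ident_at])
      moreover have "\<forall>\<^sub>F s in at_right t. K s < K t + e" by (rule usc) (use t t0 True e in auto)
      ultimately show ?thesis by eventually_elim (use True in \<open>simp add: K'_def\<close>)
    next
      case False
      have "\<forall>\<^sub>F s in at_right t. t < s" by (simp add: eventually_at_right_less)
      then show ?thesis by eventually_elim (use False e in \<open>simp add: K'_def\<close>)
    qed
    show "\<exists>s. t0 \<le> s \<and> s < t \<and> K' t \<le> exp ((C + 1) * (t - s)) * K' s" if "t0 < t" "t \<le> t1" "m < K' t" for t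
      using left[OF t0(2) that(1,2)] that by (force simp: K'_def min_def)
  qed
  also have "\<dots> \<le> m * exp ((C + 1) * t1)" using m1 C t0 by (intro mult_left_mono) auto
  finally show ?thesis unfolding K'_def K_def v_def m_def by simp
qed

end

section \<open>Small-time estimate and conclusion\<close>

context dirichlet_nest
begin

text \<open>Measurability allows the gradient of the truncated distance to be exchanged with
  \<open>dist_fun_grad\<close> inside the integral of (B.2).\<close>

lemma dist_fun_grad_measurable: "dist_fun_grad M Dom D Ek B \<in> borel_measurable M"
proof -
  define P where "P n x = real_of_ereal (min (dfun B x) (ereal (real (n + 1))))" for n x
  have "P n \<in> D_0" for n unfolding P_def by (rule dist_fun_D0) simp
  then have [measurable]: "grad (P n) \<in> borel_measurable M" for n by (intro grad_measurable D0D(1))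
  have [measurable]: "(\<lambda>x. nat \<lceil>real_of_ereal (dfun B x)\<rceil>) \<in> measurable M (count_space UNIV)"
    by measurable
  have "(\<lambda>x. grad (P (nat \<lceil>real_of_ereal (dfun B x)\<rceil>)) x) \<in> borel_measurable M"
    by (rule measurable_compose_countable[where g = "\<lambda>x. nat \<lceil>real_of_ereal (dfun B x)\<rceil>"]) auto
  moreover have "dist_fun_grad M Dom D Ek B = (\<lambda>x. if dfun B x = \<infinity> then 0
      else grad (P (nat \<lceil>real_of_ereal (dfun B x)\<rceil>)) x)"
    by (auto simp: dist_fun_grad_def P_def[abs_def] Let_def)
  ultimately show ?thesis by (simp only:) measurable
qed

end

context semigroup_form
begin

text \<open>The weight is 1 on \<open>B\<close>, so the functional starts from
  \<open>measure M B\<close>; it is \<open>exp (\<alpha> * d)\<close> on \<open>A\<close>, where it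
  can be divided out after the evolution estimate.\<close>

lemma small_time_bound:
  assumes f0B: "f0 = indicator B" and A: "A \<in> sets M" "emeasure M A < \<infinity>" and B: "B \<in> sets M" "emeasure M B < \<infinity>"
    and \<psi>: "\<psi> \<in> D_0" and \<psi>B: "AE x in M. x \<in> B \<longrightarrow> \<psi> x = 0" and \<psi>A: "AE x in M. x \<in> A \<longrightarrow> \<psi> x = d" and d: "0 < d"
    and \<kappa>: "0 \<le> \<kappa>" and B1: "\<And>f. f \<in> Core \<Longrightarrow> \<bar>\<integral>x. inner (b x - c x) (D f x) * f x \<partial>M\<bar> \<le> \<kappa> * E0l M D 1 f f"
    and \<gamma>: "0 < \<gamma>" and lam: "\<And>\<epsilon>. 0 < \<epsilon> \<Longrightarrow> 0 \<le> lam \<epsilon>"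
    and B2: "\<And>\<epsilon> f. 0 < \<epsilon> \<Longrightarrow> f \<in> Core \<Longrightarrow> norm2 M f = 1 \<Longrightarrow>
        (\<integral>x. inner (b x - c x) (grad \<psi> x) * (f x)\<^sup>2 \<partial>M)
          \<le> \<epsilon> * E0 M D f f + lam \<epsilon> + \<gamma> * sqrt (\<integral>x. (f x)\<^sup>2 * logplus ((f x)\<^sup>2) \<partial>M)"
    and s0: "0 < s0" "s0 \<le> 1/10" "(6 + 4 * \<kappa>) * s0 \<le> (1 - \<eta>) / 2" and t: "0 < t"
  defines "C \<equiv> (1 + s0) * (d / t)\<^sup>2 + 2 * \<theta> + 2 * s0 * \<kappa> + 2 * (d / t) * lam ((1 - \<eta>) * t / (2 * d))
      + (d / t) * \<gamma> * (d * \<gamma> / s0 + s0 / (d * \<gamma>))"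
  shows "Pt M T t A B \<le> (measure M A + 2 * (measure M B + 1)) * exp (- (d\<^sup>2 / t) + (1 + 2 * s0) * ((C + 1) * t / 2))"
proof -
  \<comment> \<open>This value minimises \<open>- \<alpha> * d + \<alpha>\<^sup>2 * t / 2\<close>,
    the leading part of the exponent.\<close>
  define \<alpha> where "\<alpha> = d / t"
  \<comment> \<open>Chosen so that \<open>\<alpha> * \<gamma> * \<rho> = \<beta>\<close>: the
    entropy produced by (B.2) equals the one released by the moving exponent.\<close>
  define \<rho> where "\<rho> = s0 / (d * \<gamma>)"
  \<comment> \<open>The exponent \<open>\<beta> * r\<close> then reaches exactly \<open>s0\<close>
    at the final time \<open>t\<close>.\<close>
  define \<beta> where "\<beta> = s0 / t"
  \<comment> \<open>Half of the gap \<open>1 - \<eta>\<close> is spent on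
    \<open>\<alpha> * \<epsilon>\<close>; the bound on \<open>s0\<close> reserves the other half for
    the terms of order \<open>s\<close>.\<close>
  define \<epsilon> where "\<epsilon> = (1 - \<eta>) * t / (2 * d)"
  have pos: "0 < \<alpha>" "0 < \<rho>" "0 < \<beta>" "0 < \<epsilon>" using d t s0 \<gamma> coeff_bounds by (simp_all add: \<alpha>_def \<rho>_def \<beta>_def \<epsilon>_def)
  have \<beta>t: "\<beta> * t = s0" using t by (simp add: \<beta>_def)
  have \<alpha>\<gamma>\<rho>: "\<alpha> * \<gamma> * \<rho> = \<beta>" using d t \<gamma> by (simp add: \<alpha>_def \<rho>_def \<beta>_def)
  have \<alpha>\<epsilon>: "\<alpha> * \<epsilon> = (1 - \<eta>) / 2" using d t by (simp add: \<alpha>_def \<epsilon>_def)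
  have Ceq: "C = (1 + s0) * \<alpha>\<^sup>2 + 2 * \<theta> + 2 * s0 * \<kappa> + 2 * \<alpha> * lam \<epsilon> + \<alpha> * \<gamma> * (1 / \<rho> + \<rho>)"
    by (simp add: C_def \<alpha>_def \<rho>_def \<epsilon>_def)
  have C0: "0 \<le> C" unfolding Ceq using pos s0 coeff_bounds \<kappa> \<gamma> lam[OF pos(4)] by (intro add_nonneg_nonneg) auto
  define v where "v = twist \<alpha> \<psi> (u t)"
  define K where "K = (\<integral>x. Phi s0 (v x) \<partial>M)"
  have growth: "- Eext (u r) (dual (\<beta> * r) \<alpha> \<psi> (u r)) \<le> C * (\<integral>x. Phi (\<beta> * r) (twist \<alpha> \<psi> (u r) x) \<partial>M) + \<beta> * (\<integral>x. PhiL (\<beta> * r) (twist \<alpha> \<psi> (u r) x) \<partial>M)"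
    if r: "0 < r" "r \<le> t" and K1: "1 < (\<integral>x. Phi (\<beta> * r) (twist \<alpha> \<psi> (u r) x) \<partial>M)" for r
  proof -
    define s where "s = \<beta> * r"
    have sle: "s \<le> s0" unfolding s_def \<beta>t[symmetric] using r pos by (intro mult_left_mono) auto
    have s: "0 < s" "s \<le> 1/10" using sle r pos s0 by (auto simp: s_def)
    have small: "(6 + 4 * \<kappa>) * s + \<alpha> * \<epsilon> \<le> 1 - \<eta>"
    proof -
      have "(6 + 4 * \<kappa>) * s \<le> (6 + 4 * \<kappa>) * s0" using sle \<kappa> by (intro mult_left_mono) auto
      then show ?thesis using s0(3) \<alpha>\<epsilon> by simp
    qed
    show ?thesis unfolding s_def[symmetric]
    proof (rule dom_growth[OF \<psi> u_dom[OF r(1)] s _ K1[folded s_def]])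
      fix u' assume u': "u' \<in> Core" and K': "1 < (\<integral>x. Phi s (twist \<alpha> \<psi> u' x) \<partial>M)"
      have "- E u' (dual s \<alpha> \<psi> u') \<le> ((1 + s) * \<alpha>\<^sup>2 + 2 * \<theta> + 2 * s * \<kappa> + 2 * \<alpha> * lam \<epsilon> + \<alpha> * \<gamma> * (1 / \<rho> + \<rho>)) * (\<integral>x. Phi s (twist \<alpha> \<psi> u' x) \<partial>M)
          + \<alpha> * \<gamma> * \<rho> * (\<integral>x. PhiL s (twist \<alpha> \<psi> u' x) \<partial>M)"
        by (rule core_growth[where \<epsilon> = \<epsilon>, OF \<psi> u' s pos(2) _ _ lam[OF pos(4)] _ \<kappa> B1 B2[OF pos(4)] small K'])
          (use pos \<gamma> in auto)
      also have "\<dots> \<le> C * (\<integral>x. Phi s (twist \<alpha> \<psi> u' x) \<partial>M) + \<beta> * (\<integral>x. PhiL s (twist \<alpha> \<psi> u' x) \<partial>M)"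
        unfolding \<alpha>\<gamma>\<rho> Ceq using K' sle \<kappa>
        by (intro add_mono mult_right_mono order_refl) (auto intro!: mult_right_mono)
      finally show "- E u' (dual s \<alpha> \<psi> u') \<le> C * (\<integral>x. Phi s (twist \<alpha> \<psi> u' x) \<partial>M) + \<beta> * (\<integral>x. PhiL s (twist \<alpha> \<psi> u' x) \<partial>M)" .
    qed
  qed
  have mB: "(\<integral>x. (twist \<alpha> \<psi> f0 x)\<^sup>2 \<partial>M) = measure M B"
  proof -
    have m: "twist \<alpha> \<psi> f0 \<in> borel_measurable M" by (rule L2H_measurable[OF twist_L2[OF \<psi> f0]])
    have "(\<integral>x. (twist \<alpha> \<psi> f0 x)\<^sup>2 \<partial>M) = (\<integral>x. indicator B x \<partial>M)"
    proof (rule integral_cong_AE)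
      show "AE x in M. (twist \<alpha> \<psi> f0 x)\<^sup>2 = indicator B x"
        using \<psi>B by eventually_elim (auto simp: twist_def wt_def f0B indicator_def)
    qed (use m B in measurable)
    then show ?thesis using B by simp
  qed
  have Kb: "K \<le> (measure M B + 1) * exp ((C + 1) * t)"
    using Phi_evolution[OF \<psi> t pos(3) _ C0 growth] s0 unfolding \<beta>t mB K_def v_def by simp
  \<comment> \<open>\<open>S\<close> squared is the exponential in the bound \<open>Kb\<close>. This
    choice bounds both terms of \<open>abs_le_Phi\<close> by multiples of
    \<open>S powr (1 + 2 * s0)\<close>.\<close>
  define S where "S = exp ((C + 1) * t / 2)"
  have S1: "1 \<le> S" unfolding S_def using C0 t by simp
  have S2: "S powr 2 = exp ((C + 1) * t)" by (simp add: S_def powr_def)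
  have vL: "L2H M v" unfolding v_def by (rule twist_L2[OF \<psi> dom_L2[OF u_dom[OF t]]])
  have [measurable]: "u t \<in> borel_measurable M" "v \<in> borel_measurable M"
    using dom_measurable[OF u_dom[OF t]] L2H_measurable[OF vL] by auto
  have iK: "integrable M (\<lambda>x. Phi s0 (v x))" by (rule Phi_integrable[OF _ vL]) (use s0 in simp)
  define Y where "Y = 2 * S powr (2 * s0 - 1)"
  have Y0: "0 \<le> Y" by (simp add: Y_def)
  have "Pt M T t A B \<le> (\<integral>x. exp (- (\<alpha> * d)) * (S * indicator A x + Y * Phi s0 (v x)) \<partial>M)"
    unfolding Pt_def f0B[symmetric]
  proof (rule integral_mono_AE')
    show "integrable M (\<lambda>x. exp (- (\<alpha> * d)) * (S * indicator A x + Y * Phi s0 (v x)))"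
      using iK A by (simp add: integrable_indicator_iff)
    show "AE x in M. 0 \<le> exp (- (\<alpha> * d)) * (S * indicator A x + Y * Phi s0 (v x))"
      using S1 Y0 Phi_nonneg by (intro AE_I2) (auto intro!: mult_nonneg_nonneg add_nonneg_nonneg)
    show "AE x in M. indicator A x * u t x \<le> exp (- (\<alpha> * d)) * (S * indicator A x + Y * Phi s0 (v x))"
      using \<psi>A
    proof eventually_elim
      case (elim x)
      show ?case
      proof (cases "x \<in> A")
        case True
        then have "v x = exp (\<alpha> * d) * u t x" using elim by (simp add: v_def twist_def wt_def)
        then have "u t x = exp (- (\<alpha> * d)) * v x" by (simp add: exp_minus)
        also have "\<dots> \<le> exp (- (\<alpha> * d)) * (S + Y * Phi s0 (v x))"
        proof (rule mult_left_mono)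
          have "\<bar>v x\<bar> \<le> S + Y * Phi s0 (v x)" unfolding Y_def by (rule abs_le_Phi) (use s0 S1 in auto)
          then show "v x \<le> S + Y * Phi s0 (v x)" by simp
        qed simp
        finally show ?thesis using True by simp
      next
        case False then show ?thesis using Y0 Phi_nonneg by simp
      qed
    qed
  qed
  also have "\<dots> = exp (- (\<alpha> * d)) * (S * measure M A + Y * K)"
    using iK A by (simp add: K_def integrable_indicator_iff)
  also have "\<dots> \<le> exp (- (\<alpha> * d)) * (S powr (1 + 2 * s0) * (measure M A + 2 * (measure M B + 1)))"
  proof (rule mult_left_mono)
    have "S powr 1 \<le> S powr (1 + 2 * s0)" using S1 s0 by (intro powr_mono) auto
    then have "S * measure M A \<le> S powr (1 + 2 * s0) * measure M A" using S1 by (intro mult_right_mono) auto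
    moreover have "Y * K \<le> Y * ((measure M B + 1) * S powr 2)" unfolding S2 using Kb Y0 by (rule mult_left_mono)
    moreover have "Y * ((measure M B + 1) * S powr 2) = S powr (1 + 2 * s0) * (2 * (measure M B + 1))"
    proof -
      have "S powr (2 * s0 - 1) * S powr 2 = S powr (1 + 2 * s0)" by (simp add: algebra_simps flip: powr_add)
      then show ?thesis unfolding Y_def by (metis (no_types, lifting) mult.assoc mult.commute)
    qed
    ultimately show "S * measure M A + Y * K \<le> S powr (1 + 2 * s0) * (measure M A + 2 * (measure M B + 1))"
      by (simp add: distrib_left)
  qed simp
  also have "S powr (1 + 2 * s0) = exp ((1 + 2 * s0) * ((C + 1) * t / 2))" by (simp add: S_def powr_def)
  also have "\<alpha> * d = d\<^sup>2 / t" by (simp add: \<alpha>_def power2_eq_square)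
  finally show ?thesis unfolding exp_add by (simp only: mult_ac)
qed

text \<open>Serves the degenerate case of distance zero, where the claim is that the upper limit is
  at most 0 and any bound independent of \<open>t\<close> suffices. It follows from L2 continuity at
  time 0.\<close>

lemma bounded_Pt:
  assumes f0B: "f0 = indicator B" and A: "A \<in> sets M" "emeasure M A < \<infinity>"
  obtains Q where "1 \<le> Q" "\<forall>\<^sub>F t in at_right 0. Pt M T t A B \<le> Q"
proof -
  have ev: "\<forall>\<^sub>F t in at_right 0. L2H M (u t)" using eventually_at_right_less[of 0]
    by eventually_elim (rule dom_L2[OF u_dom])
  have "((\<lambda>t. \<integral>x. (u t x)\<^sup>2 \<partial>M) \<longlongrightarrow> (\<integral>x. (f0 x)\<^sup>2 \<partial>M)) (at_right 0)"
    by (rule quadratic_integral_tendsto[where C = 1 and \<Psi> = "\<lambda>x. x\<^sup>2", OF _ square_lipschitz _ _ f0 ev u_initial]) auto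
  then have "\<forall>\<^sub>F t in at_right 0. (\<integral>x. (u t x)\<^sup>2 \<partial>M) < (\<integral>x. (f0 x)\<^sup>2 \<partial>M) + 1" by (rule order_tendstoD(2)) simp
  with ev have "\<forall>\<^sub>F t in at_right 0. Pt M T t A B \<le> measure M A + ((\<integral>x. (f0 x)\<^sup>2 \<partial>M) + 1)"
  proof eventually_elim
    case (elim t)
    have "Pt M T t A B \<le> (\<integral>x. indicator A x + (u t x)\<^sup>2 \<partial>M)"
      unfolding Pt_def f0B[symmetric]
    proof (rule integral_mono')
      show "integrable M (\<lambda>x. indicator A x + (u t x)\<^sup>2)" using L2_integrable[OF elim(1)] A by (simp add: integrable_indicator_iff)
      fix x
      have "u t x \<le> 1 + (u t x)\<^sup>2"
      proof -
        have "2 * u t x \<le> (u t x)\<^sup>2 + 1" using sum_squares_bound[of "u t x" 1] by simp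
        then show ?thesis using zero_le_power2[of "u t x"] by linarith
      qed
      then show "indicator A x * u t x \<le> indicator A x + (u t x)\<^sup>2" by (auto simp: indicator_def)
    qed auto
    also have "\<dots> = measure M A + (\<integral>x. (u t x)\<^sup>2 \<partial>M)" using L2_integrable[OF elim(1)] A by (simp add: integrable_indicator_iff)
    finally show ?case using elim(2) by simp
  qed
  then show thesis by (intro that[of "measure M A + ((\<integral>x. (f0 x)\<^sup>2 \<partial>M) + 1)"]) auto
qed

end

text \<open>For \<open>p \<le> 0\<close> the value is minus infinity, so an upper bound for
  \<open>Pt\<close> is enough, whatever its sign.\<close>

lemma tlog_le:
  assumes "0 \<le> t" "p \<le> q" "0 < q" shows "tlog t p \<le> ereal (t * ln q)"
  using assms by (auto simp: tlog_def intro!: mult_left_mono)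

theorem mainTheorem1:
  fixes M :: "'a measure"
    and Dom :: "('a \<Rightarrow> real) set"
    and D :: "('a \<Rightarrow> real) \<Rightarrow> 'a \<Rightarrow> 'h::{real_inner,banach,second_countable_topology}"
    and Ek :: "nat \<Rightarrow> 'a set"
    and b c :: "'a \<Rightarrow> 'h"
    and V :: "'a \<Rightarrow> real"
    and T :: "real \<Rightarrow> ('a \<Rightarrow> real) \<Rightarrow> 'a \<Rightarrow> real"
    and A B :: "'a set"
  assumes frame: "dirichlet_framework M Dom D"
    and assmA: "assumption_A M Dom D Ek b c V"
    and semigroup: "associated_semigroup M Dom D Ek b c V T"
    and A_B0: "A \<in> sets M" "0 < emeasure M A" "emeasure M A < \<infinity>"
    and B_B0: "B \<in> sets M" "0 < emeasure M B" "emeasure M B < \<infinity>"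
    and dfin: "dist_sets M Dom D Ek A B < \<infinity>"
    and B1: "\<exists>\<kappa>>0. \<forall>f\<in>core M Dom Ek.
               \<bar>\<integral>x. inner (b x - c x) (D f x) * f x \<partial>M\<bar> \<le> \<kappa> * E0l M D 1 f f"
    and B2: "\<exists>\<gamma>\<ge>0. \<exists>lam::real \<Rightarrow> real. (\<forall>\<epsilon>>0. 0 \<le> lam \<epsilon>) \<and>
               ((\<lambda>\<epsilon>. \<epsilon> * lam \<epsilon>) \<longlongrightarrow> 0) (at_right 0) \<and>
               (\<forall>\<epsilon>>0. \<forall>f\<in>core M Dom Ek. norm2 M f = 1 \<longrightarrow>
                  (\<integral>x. indicator {y. 0 < dist_fun M Dom D Ek B y
                                      \<and> dist_fun M Dom D Ek B y < dist_sets M Dom D Ek A B} x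
                        * inner (b x - c x) (dist_fun_grad M Dom D Ek B x) * (f x)\<^sup>2 \<partial>M)
                  \<le> \<epsilon> * E0 M D f f + lam \<epsilon>
                     + \<gamma> * sqrt (\<integral>x. (f x)\<^sup>2 * logplus ((f x)\<^sup>2) \<partial>M))"
  shows "Limsup (at_right 0) (\<lambda>t. tlog t (Pt M T t A B))
           \<le> ereal (- ((real_of_ereal (dist_sets M Dom D Ek A B))\<^sup>2 / 2))"
proof -
  obtain \<eta> \<theta> \<omega> l :: real where co: "0 \<le> \<eta>" "\<eta> < 1" "0 \<le> \<theta>" "0 \<le> \<omega>" "0 \<le> l"
    and lo: "\<And>f. f \<in> core M Dom Ek \<Longrightarrow> - (\<integral>x. inner (b x + c x) (D f x) * f x + V x * (f x)\<^sup>2 \<partial>M)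
             \<le> \<eta> * E0 M D f f + \<theta> * (norm2 M f)\<^sup>2"
    and up: "\<And>f g. f \<in> core M Dom Ek \<Longrightarrow> g \<in> core M Dom Ek \<Longrightarrow>
           \<bar>\<integral>x. inner (b x) (D f x) * g x + inner (c x) (D g x) * f x + V x * f x * g x \<partial>M\<bar>
             \<le> \<omega> * sqrt (E0l M D l f f) * sqrt (E0l M D l g g)"
    using assmA unfolding assumption_A_def by blast
  have sq: "(\<lambda>x. (norm (indicat_real B x))\<^sup>2) = indicat_real B" by (auto simp: indicator_def fun_eq_iff)
  have fB: "L2H M (indicat_real B)"
    unfolding L2H_def sq using B_B0 by (simp add: integrable_indicator_iff)
  interpret semigroup_form M Dom D Ek b c V \<eta> \<theta> \<omega> l T "indicat_real B"
    by unfold_locales (use frame assmA semigroup fB co lo up in \<open>auto simp: assumption_A_def\<close>)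
  define d where "d = real_of_ereal (dist_sets M Dom D Ek A B)"
  have dnn: "0 \<le> dist_sets M Dom D Ek A B"
    by (rule dist_sets_nonneg[OF A_B0(1,2) B_B0(1,2)])
  have dS: "dist_sets M Dom D Ek A B = ereal d" and d0: "0 \<le> d"
    using dnn dfin by (cases "dist_sets M Dom D Ek A B"; simp add: d_def)+
  have rpos: "\<forall>\<^sub>F t in at_right (0::real). 0 < t" by (rule eventually_at_right_less)
  have "Limsup (at_right 0) (\<lambda>t. tlog t (Pt M T t A B)) \<le> ereal (- (d\<^sup>2 / 2))"
  proof (cases "d = 0")
    case True
    obtain Q where Q: "1 \<le> Q" "\<forall>\<^sub>F t in at_right 0. Pt M T t A B \<le> Q"
      using bounded_Pt[OF refl A_B0(1,3)] by blast
    have "Limsup (at_right 0) (\<lambda>t. tlog t (Pt M T t A B)) \<le> Limsup (at_right 0) (\<lambda>t. ereal (t * ln Q))"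
    proof (rule Limsup_mono)
      show "\<forall>\<^sub>F t in at_right 0. tlog t (Pt M T t A B) \<le> ereal (t * ln Q)"
        using Q(2) rpos by eventually_elim (rule tlog_le, use Q(1) in auto)
    qed
    also have "((\<lambda>t. t * ln Q) \<longlongrightarrow> 0 * ln Q) (at_right 0)" by (intro tendsto_intros)
    then have "Limsup (at_right 0) (\<lambda>t. ereal (t * ln Q)) = ereal (0 * ln Q)"
      by (intro lim_imp_Limsup tendsto_ereal) auto
    finally show ?thesis using True by simp
  next
    case False
    then have d: "0 < d" using d0 by simp
    define \<psi> where "\<psi> x = real_of_ereal (min (dist_fun M Dom D Ek B x) (ereal d))" for x
    have \<psi>: "\<psi> \<in> D0 M Dom D Ek" unfolding \<psi>_def[abs_def] by (rule dist_fun_D0[OF d])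
    have \<psi>B: "AE x in M. x \<in> B \<longrightarrow> \<psi> x = 0"
      using dist_fun_zero[OF d, of B] by eventually_elim (auto simp: \<psi>_def)
    have \<psi>A: "AE x in M. x \<in> A \<longrightarrow> \<psi> x = d"
      using dist_fun_ge_dist_sets[OF dS d] by eventually_elim (auto simp: \<psi>_def min_def)
    have g\<psi>: "AE x in M. grad \<psi> x = indicator {y. 0 < dist_fun M Dom D Ek B y \<and> dist_fun M Dom D Ek B y < ereal d} x
        *\<^sub>R dist_fun_grad M Dom D Ek B x"
      unfolding \<psi>_def[abs_def] by (rule grad_truncated_dist_fun[OF d])
    obtain \<kappa> where \<kappa>: "0 < \<kappa>" and B1': "\<And>f. f \<in> core M Dom Ek \<Longrightarrow>
        \<bar>\<integral>x. inner (b x - c x) (D f x) * f x \<partial>M\<bar> \<le> \<kappa> * E0l M D 1 f f"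
      using B1 by blast
    obtain \<gamma> lam where \<gamma>: "0 \<le> \<gamma>" and lam: "\<And>\<epsilon>. 0 < \<epsilon> \<Longrightarrow> 0 \<le> lam \<epsilon>"
      and lam0: "((\<lambda>\<epsilon>. \<epsilon> * lam \<epsilon>) \<longlongrightarrow> 0) (at_right 0)"
      and B2': "\<And>\<epsilon> f. 0 < \<epsilon> \<Longrightarrow> f \<in> core M Dom Ek \<Longrightarrow> norm2 M f = 1 \<Longrightarrow>
         (\<integral>x. indicator {y. 0 < dist_fun M Dom D Ek B y \<and> dist_fun M Dom D Ek B y < ereal d} x
             * inner (b x - c x) (dist_fun_grad M Dom D Ek B x) * (f x)\<^sup>2 \<partial>M)
           \<le> \<epsilon> * E0 M D f f + lam \<epsilon> + \<gamma> * sqrt (\<integral>x. (f x)\<^sup>2 * logplus ((f x)\<^sup>2) \<partial>M)"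
      using B2 unfolding dS by blast
    \<comment> \<open>The constant is raised to \<open>\<gamma> + 1\<close> because (B.2) permits
      \<open>\<gamma> = 0\<close>, while the choice of \<open>\<rho>\<close> divides by it.\<close>
    have B2'': "(\<integral>x. inner (b x - c x) (grad \<psi> x) * (f x)\<^sup>2 \<partial>M)
          \<le> \<epsilon> * E0 M D f f + lam \<epsilon> + (\<gamma> + 1) * sqrt (\<integral>x. (f x)\<^sup>2 * logplus ((f x)\<^sup>2) \<partial>M)"
      if "0 < \<epsilon>" and f: "f \<in> core M Dom Ek" and "norm2 M f = 1" for \<epsilon> f
    proof -
      have [measurable]: "f \<in> borel_measurable M" "b \<in> borel_measurable M" "c \<in> borel_measurable M"
        "grad \<psi> \<in> borel_measurable M" "dist_fun_grad M Dom D Ek B \<in> borel_measurable M"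
        by (rule dom_measurable[OF coreD[OF f]] bm cm grad_measurable[OF D0D(1)[OF \<psi>]] dist_fun_grad_measurable)+
      have "(\<integral>x. inner (b x - c x) (grad \<psi> x) * (f x)\<^sup>2 \<partial>M)
          = (\<integral>x. indicator {y. 0 < dist_fun M Dom D Ek B y \<and> dist_fun M Dom D Ek B y < ereal d} x
             * inner (b x - c x) (dist_fun_grad M Dom D Ek B x) * (f x)\<^sup>2 \<partial>M)"
      proof (rule integral_cong_AE)
        show "(\<lambda>x. indicator {y. 0 < dist_fun M Dom D Ek B y \<and> dist_fun M Dom D Ek B y < ereal d} x
             * inner (b x - c x) (dist_fun_grad M Dom D Ek B x) * (f x)\<^sup>2) \<in> borel_measurable M"
          unfolding indicator_def by measurable
        show "AE x in M. inner (b x - c x) (grad \<psi> x) * (f x)\<^sup>2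
           = indicator {y. 0 < dist_fun M Dom D Ek B y \<and> dist_fun M Dom D Ek B y < ereal d} x
             * inner (b x - c x) (dist_fun_grad M Dom D Ek B x) * (f x)\<^sup>2"
          using g\<psi> by eventually_elim simp
      qed measurable
      also have "\<dots> \<le> \<epsilon> * E0 M D f f + lam \<epsilon> + \<gamma> * sqrt (\<integral>x. (f x)\<^sup>2 * logplus ((f x)\<^sup>2) \<partial>M)"
        by (rule B2'[OF that])
      also have "\<dots> \<le> \<epsilon> * E0 M D f f + lam \<epsilon> + (\<gamma> + 1) * sqrt (\<integral>x. (f x)\<^sup>2 * logplus ((f x)\<^sup>2) \<partial>M)"
        by (intro add_left_mono mult_right_mono real_sqrt_ge_zero integral_nonneg_AE) (auto simp: logplus_def)
      finally show ?thesis .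
    qed
    define Q where "Q = measure M A + 2 * (measure M B + 1)"
    have Q: "0 < Q" by (simp add: Q_def add_nonneg_pos)
    \<comment> \<open>\<open>t\<close> times the logarithm of the bound from
      \<open>small_time_bound\<close>, arranged so that \<open>lam\<close> occurs only in the
      product \<open>\<epsilon> * lam \<epsilon>\<close>.\<close>
    define X where "X s t = t * ln Q - d\<^sup>2 + (1 + 2 * s) / 2 * ((1 + s) * d\<^sup>2
       + (2 * \<theta> + 2 * s * \<kappa> + 1) * t\<^sup>2 + (4 * d\<^sup>2 / (1 - \<eta>)) * ((1 - \<eta>) * t / (2 * d) * lam ((1 - \<eta>) * t / (2 * d)))
       + d * (\<gamma> + 1) * (d * (\<gamma> + 1) / s + s / (d * (\<gamma> + 1))) * t)" for s t
    have bound: "Limsup (at_right 0) (\<lambda>t. tlog t (Pt M T t A B)) \<le> ereal (- d\<^sup>2 + (1 + 2 * s) / 2 * ((1 + s) * d\<^sup>2))"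
      if s: "0 < s" "s \<le> 1/10" "(6 + 4 * \<kappa>) * s \<le> (1 - \<eta>) / 2" for s
    proof -
      have "Limsup (at_right 0) (\<lambda>t. tlog t (Pt M T t A B)) \<le> Limsup (at_right 0) (\<lambda>t. ereal (X s t))"
      proof (rule Limsup_mono)
        show "\<forall>\<^sub>F t in at_right 0. tlog t (Pt M T t A B) \<le> ereal (X s t)"
          using rpos
        proof eventually_elim
          case (elim t)
          define C where "C = (1 + s) * (d / t)\<^sup>2 + 2 * \<theta> + 2 * s * \<kappa> + 2 * (d / t) * lam ((1 - \<eta>) * t / (2 * d))
            + (d / t) * (\<gamma> + 1) * (d * (\<gamma> + 1) / s + s / (d * (\<gamma> + 1)))"
          have "Pt M T t A B \<le> Q * exp (- (d\<^sup>2 / t) + (1 + 2 * s) * ((C + 1) * t / 2))"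
            unfolding Q_def C_def
            by (rule small_time_bound[OF refl A_B0(1,3) B_B0(1,3) \<psi> \<psi>B \<psi>A d _ B1' _ lam B2'' s elim]) (use \<kappa> \<gamma> in auto)
          then have "tlog t (Pt M T t A B) \<le> ereal (t * ln (Q * exp (- (d\<^sup>2 / t) + (1 + 2 * s) * ((C + 1) * t / 2))))"
            using elim Q by (intro tlog_le) auto
          also have "t * ln (Q * exp (- (d\<^sup>2 / t) + (1 + 2 * s) * ((C + 1) * t / 2)))
              = t * (ln Q + (- (d\<^sup>2 / t) + (1 + 2 * s) * ((C + 1) * t / 2)))"
            using Q by (simp add: ln_mult_pos)
          also have "\<dots> = t * ln Q - d\<^sup>2 + (1 + 2 * s) / 2 * ((C + 1) * t\<^sup>2)"
            using elim by (simp add: field_simps power2_eq_square)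
          also have "(C + 1) * t\<^sup>2 = (1 + s) * d\<^sup>2
             + (2 * \<theta> + 2 * s * \<kappa> + 1) * t\<^sup>2 + (4 * d\<^sup>2 / (1 - \<eta>)) * ((1 - \<eta>) * t / (2 * d) * lam ((1 - \<eta>) * t / (2 * d)))
             + d * (\<gamma> + 1) * (d * (\<gamma> + 1) / s + s / (d * (\<gamma> + 1))) * t"
          proof -
            define \<Lambda> where "\<Lambda> = lam ((1 - \<eta>) * t / (2 * d))"
            define G where "G = (\<gamma> + 1) * (d * (\<gamma> + 1) / s + s / (d * (\<gamma> + 1)))"
            \<comment> \<open>Here \<open>2 * d * t\<close> is written as a constant times
              \<open>\<epsilon> = (1 - \<eta>) * t / (2 * d)\<close>, the form in which the
              hypothesis on \<open>lam\<close> applies.\<close>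
            have "(4 * d\<^sup>2 / (1 - \<eta>)) * ((1 - \<eta>) * t / (2 * d) * \<Lambda>) = 2 * d * t * \<Lambda>"
              using co d by (simp add: field_simps power2_eq_square)
            moreover have "C = (1 + s) * (d / t)\<^sup>2 + 2 * \<theta> + 2 * s * \<kappa> + 2 * (d / t) * \<Lambda> + (d / t) * G"
              by (simp add: C_def \<Lambda>_def G_def)
            moreover have "((1 + s) * (d / t)\<^sup>2 + 2 * \<theta> + 2 * s * \<kappa> + 2 * (d / t) * \<Lambda> + (d / t) * G + 1) * t\<^sup>2
              = (1 + s) * d\<^sup>2 + (2 * \<theta> + 2 * s * \<kappa> + 1) * t\<^sup>2 + 2 * d * t * \<Lambda> + d * G * t"
              using elim by (simp add: field_simps power2_eq_square)
            ultimately show ?thesis unfolding \<Lambda>_def[symmetric] by (simp add: G_def mult_ac)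
          qed
          finally show ?case unfolding X_def .
        qed
      qed
      also have "Limsup (at_right 0) (\<lambda>t. ereal (X s t)) = ereal (- d\<^sup>2 + (1 + 2 * s) / 2 * ((1 + s) * d\<^sup>2))"
      proof (rule lim_imp_Limsup)
        have k: "0 < (1 - \<eta>) / (2 * d)" using co d by simp
        have "filterlim (\<lambda>t. (1 - \<eta>) * t / (2 * d)) (at_right 0) (at_right 0)"
          unfolding filterlim_at
        proof
          show "\<forall>\<^sub>F t in at_right 0. (1 - \<eta>) * t / (2 * d) \<in> {0<..} \<and> (1 - \<eta>) * t / (2 * d) \<noteq> 0"
            using rpos by eventually_elim (use co d in auto)
          have "((\<lambda>t. (1 - \<eta>) * t / (2 * d)) \<longlongrightarrow> (1 - \<eta>) * 0 / (2 * d)) (at_right 0)"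
            by (intro tendsto_intros) (use d in auto)
          then show "((\<lambda>t. (1 - \<eta>) * t / (2 * d)) \<longlongrightarrow> 0) (at_right 0)" by simp
        qed
        from filterlim_compose[OF lam0 this]
        have L: "((\<lambda>t. (1 - \<eta>) * t / (2 * d) * lam ((1 - \<eta>) * t / (2 * d))) \<longlongrightarrow> 0) (at_right 0)" .
        have "((\<lambda>t. X s t) \<longlongrightarrow> 0 * ln Q - d\<^sup>2 + (1 + 2 * s) / 2 * ((1 + s) * d\<^sup>2
           + (2 * \<theta> + 2 * s * \<kappa> + 1) * 0\<^sup>2 + (4 * d\<^sup>2 / (1 - \<eta>)) * 0
           + d * (\<gamma> + 1) * (d * (\<gamma> + 1) / s + s / (d * (\<gamma> + 1))) * 0)) (at_right 0)"
          unfolding X_def by (intro tendsto_intros L)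
        then show "((\<lambda>t. ereal (X s t)) \<longlongrightarrow> ereal (- d\<^sup>2 + (1 + 2 * s) / 2 * ((1 + s) * d\<^sup>2))) (at_right 0)"
          by (intro tendsto_ereal) simp
      qed simp
      finally show ?thesis .
    qed
    \<comment> \<open>The limit in the final exponent \<open>s\<close> is taken after the one in
      \<open>t\<close>; at \<open>s = 0\<close> the bound becomes
      \<open>- d\<^sup>2 + d\<^sup>2 / 2\<close>.\<close>
    have "((\<lambda>s. ereal (- d\<^sup>2 + (1 + 2 * s) / 2 * ((1 + s) * d\<^sup>2))) \<longlongrightarrow> ereal (- d\<^sup>2 + (1 + 2 * 0) / 2 * ((1 + 0) * d\<^sup>2))) (at_right 0)"
      by (intro tendsto_ereal tendsto_intros) auto
    moreover have "\<forall>\<^sub>F s in at_right 0. Limsup (at_right 0) (\<lambda>t. tlog t (Pt M T t A B)) \<le> ereal (- d\<^sup>2 + (1 + 2 * s) / 2 * ((1 + s) * d\<^sup>2))"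
    proof -
      have "((\<lambda>s. (6 + 4 * \<kappa>) * s) \<longlongrightarrow> (6 + 4 * \<kappa>) * 0) (at_right 0)" by (intro tendsto_intros)
      then have "\<forall>\<^sub>F s in at_right 0. (6 + 4 * \<kappa>) * s < (1 - \<eta>) / 2" by (rule order_tendstoD(2)) (use co in simp)
      moreover have "\<forall>\<^sub>F s in at_right (0::real). s < 1/10" by (rule order_tendstoD(2)[OF tendsto_ident_at]) simp
      ultimately show ?thesis using rpos by eventually_elim (rule bound, auto)
    qed
    ultimately have "Limsup (at_right 0) (\<lambda>t. tlog t (Pt M T t A B)) \<le> ereal (- d\<^sup>2 + (1 + 2 * 0) / 2 * ((1 + 0) * d\<^sup>2))"
      by (rule tendsto_lowerbound) simp
    then show ?thesis by simp
  qed
  then show ?thesis by (simp add: d_def)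
qed

end
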